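(* Let $M^5\subset\mathbb{C}^3$, $0\in M$, be a $\mathfrak{C}_{2,1}$ hypersurface in Poincaré–Moser normal form $u=F(z,\zeta,\overline z,\overline\zeta,v)=\mathsf{m}(z,\zeta,\overline z,\overline\zeta)+G(z,\zeta,\overline z,\overline\zeta,v)$. Assume $F_{3,0,0,2,0}=0=F_{5,0,0,1,0}$. If $M$ is (locally) homogeneous, then all $G_{h,p,j,k,l}=0$, and $M$ coincides with the Gaussier–Merker representation of the flat model: $$u=\mathsf{m}+0=\frac{z\overline z+\frac12\overline z^2\zeta+\frac12z^2\overline\zeta}{1-\zeta\overline\zeta}.$$
   Context: Here $i=\sqrt{-1}$ and $\mathbb{C}^3$ has coordinates $(z,\zeta,w)$, $w=u+iv$. Everything is local near $0$ and real-analytic. A $\mathfrak{C}_{2,1}$ hypersurface is a real hypersurface $M^5\subset\mathbb{C}^3$ which is $2$-nondegenerate and whose Levi form has constant rank $1$. Let $\mathfrak{hol}(M)$ be the real Lie algebra of (germs at $0$ of) holomorphic vector fields $L=A(z,\zeta,w)\partial_z+B(z,\zeta,w)\partial_\zeta+C(z,\zeta,w)\partial_w$ such that $(L+\overline L)|_M$ is tangent to $M$. $M$ is (locally) homogeneous if $T_0M=\operatorname{Span}\{(L+\overline L)|_0: L\in\mathfrak{hol}(M)\}$. Set $$\mathsf{m}(z,\zeta,\overline z,\overline\zeta):=\frac{z\overline z+\frac12\overline z^2\zeta+\frac12z^2\overline\zeta}{1-\zeta\overline\zeta}.$$ Write $M$ as a graph $u=F(z,\zeta,\overline z,\overline\zeta,v)=\mathsf{m}+G$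 with $$F=\sum_{h,p,j,k,l}F_{h,p,j,k,l}\,z^h\zeta^p\overline z^j\overline\zeta^kv^l=\sum_{h,p,j,k}F_{h,p,j,k}(v)\,z^h\zeta^p\overline z^j\overline\zeta^k,\qquad \overline{F_{h,p,j,k,l}}=F_{j,k,h,p,l},\quad F_{0,0,0,0,0}=0,$$ and similarly $G=\sum G_{h,p,j,k,l}\,z^h\zeta^p\overline z^j\overline\zeta^kv^l$. Poincaré–Moser normal form (to which every $\mathfrak{C}_{2,1}$ hypersurface can be brought by a local biholomorphism fixing $0$) means that for all $h,p$: $0\equiv F_{h,p,0,0}(v)\equiv F_{h,p,1,0}(v)\equiv F_{h,p,2,0}(v)$, and $0\equiv F_{3,0,0,1}(v)\equiv F_{4,0,0,1}(v)\equiv F_{3,0,1,1}(v)\equiv F_{4,0,1,1}(v)\equiv F_{3,0,3,0}(v)$, with the exceptions $F_{1,0,1,0}(v)\equiv1$ and $F_{2,0,0,1}(v)\equiv\frac12$ (hence also $F_{0,1,2,0}(v)\equiv\frac12$). *)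

theory Defs
  imports "HOL-Analysis.Analysis"
begin

text \<open>
  Points of complex 3-space are \<open>p :: complex ^ 3\<close> with \<open>p $ 1 = z\<close>, \<open>p $ 2 = \<zeta>\<close>,
  \<open>p $ 3 = w = u + i v\<close>. Germs at the origin are expressed by \<open>eventually \<dots> (nhds 0)\<close>.
\<close>

type_synonym coeffs = "nat \<Rightarrow> nat \<Rightarrow> nat \<Rightarrow> nat \<Rightarrow> nat \<Rightarrow> complex"

definition convergent_series :: "coeffs \<Rightarrow> bool" where
  "convergent_series c \<longleftrightarrow>
     (\<exists>r>0. (\<lambda>(h, p, j, k, l). norm (c h p j k l) * r ^ (h + p + j + k + l)) summable_on UNIV)"

definition eval_series ::
    "coeffs \<Rightarrow> complex \<Rightarrow> complex \<Rightarrow> complex \<Rightarrow> complex \<Rightarrow> complex \<Rightarrow> complex" where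
  "eval_series c z \<zeta> zb \<zeta>b v =
     (\<Sum>\<^sub>\<infinity>(h, p, j, k, l). c h p j k l * z ^ h * \<zeta> ^ p * zb ^ j * \<zeta>b ^ k * v ^ l)"

definition graph_value :: "coeffs \<Rightarrow> complex ^ 3 \<Rightarrow> complex" where
  "graph_value c p =
     eval_series c (p $ 1) (p $ 2) (cnj (p $ 1)) (cnj (p $ 2)) (of_real (Im (p $ 3)))"

definition hermitian_coeffs :: "coeffs \<Rightarrow> bool" where
  "hermitian_coeffs c \<longleftrightarrow> (\<forall>h p j k l. cnj (c h p j k l) = c j k h p l)"

definition v_coeff :: "coeffs \<Rightarrow> nat \<Rightarrow> nat \<Rightarrow> nat \<Rightarrow> nat \<Rightarrow> complex fps" where
  "v_coeff c h p j k = Abs_fps (c h p j k)"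

definition gaussier_merker :: "complex \<Rightarrow> complex \<Rightarrow> complex \<Rightarrow> complex \<Rightarrow> complex" where
  "gaussier_merker z \<zeta> zb \<zeta>b =
     (z * zb + 1/2 * zb ^ 2 * \<zeta> + 1/2 * z ^ 2 * \<zeta>b) / (1 - \<zeta> * \<zeta>b)"

definition gaussier_merker_value :: "complex ^ 3 \<Rightarrow> complex" where
  "gaussier_merker_value p = gaussier_merker (p $ 1) (p $ 2) (cnj (p $ 1)) (cnj (p $ 2))"

definition poincare_moser_normal_form :: "coeffs \<Rightarrow> bool" where
  "poincare_moser_normal_form F \<longleftrightarrow>
     (\<forall>h p. v_coeff F h p 0 0 = 0) \<and>
     (\<forall>h p. v_coeff F h p 1 0 = (if (h, p) = (1, 0) then 1 else 0)) \<and>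
     (\<forall>h p. v_coeff F h p 2 0 = (if (h, p) = (0, 1) then fps_const (1/2) else 0)) \<and>
     v_coeff F 2 0 0 1 = fps_const (1/2) \<and>
     v_coeff F 3 0 0 1 = 0 \<and>
     v_coeff F 4 0 0 1 = 0 \<and>
     v_coeff F 3 0 1 1 = 0 \<and>
     v_coeff F 4 0 1 1 = 0 \<and>
     v_coeff F 3 0 3 0 = 0"

definition dZ :: "3 \<Rightarrow> (complex ^ 3 \<Rightarrow> complex) \<Rightarrow> complex ^ 3 \<Rightarrow> complex" where
  "dZ j f p = (frechet_derivative f (at p) (axis j 1)
               - \<i> * frechet_derivative f (at p) (axis j \<i>)) / 2"

definition dZbar :: "3 \<Rightarrow> (complex ^ 3 \<Rightarrow> complex) \<Rightarrow> complex ^ 3 \<Rightarrow> complex" where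
  "dZbar j f p = (frechet_derivative f (at p) (axis j 1)
                  + \<i> * frechet_derivative f (at p) (axis j \<i>)) / 2"

text \<open>
  Below, \<open>\<rho>\<close> is a real-valued local defining function of the hypersurface \<open>\<rho> = 0\<close>. A vector
  \<open>X :: complex ^ 3\<close> stands for the (1,0)-vector with components \<open>X $ j\<close> along \<open>dZ j\<close>.
\<close>

definition T10 :: "(complex ^ 3 \<Rightarrow> real) \<Rightarrow> complex ^ 3 \<Rightarrow> (complex ^ 3) set" where
  "T10 \<rho> p = {X. (\<Sum>j\<in>UNIV. dZ j (\<lambda>q. of_real (\<rho> q)) p * X $ j) = 0}"

definition levi_form ::
    "(complex ^ 3 \<Rightarrow> real) \<Rightarrow> complex ^ 3 \<Rightarrow> complex ^ 3 \<Rightarrow> complex ^ 3 \<Rightarrow> complex" where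
  "levi_form \<rho> p X Y =
     (\<Sum>j\<in>UNIV. \<Sum>k\<in>UNIV. dZbar k (dZ j (\<lambda>q. of_real (\<rho> q))) p * X $ j * cnj (Y $ k))"

definition levi_kernel :: "(complex ^ 3 \<Rightarrow> real) \<Rightarrow> complex ^ 3 \<Rightarrow> (complex ^ 3) set" where
  "levi_kernel \<rho> p = {X \<in> T10 \<rho> p. \<forall>Y \<in> T10 \<rho> p. levi_form \<rho> p X Y = 0}"

definition levi_rank :: "(complex ^ 3 \<Rightarrow> real) \<Rightarrow> complex ^ 3 \<Rightarrow> nat" where
  "levi_rank \<rho> p = vec.dim (T10 \<rho> p) - vec.dim (levi_kernel \<rho> p)"

text \<open>
  For \<open>j = 1, 2\<close> these operators form a local frame of the (0,1)-vector fields tangent to the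
  level sets of \<open>\<rho>\<close>, provided that the derivative of \<open>\<rho>\<close> along \<open>dZbar 3\<close> does not vanish; this
  is always the case for a graph \<open>u = F(z, \<zeta>, v)\<close>, since \<open>F\<close> is real-valued.
\<close>

definition cr_field ::
    "(complex ^ 3 \<Rightarrow> real) \<Rightarrow> 3 \<Rightarrow> (complex ^ 3 \<Rightarrow> complex) \<Rightarrow> complex ^ 3 \<Rightarrow> complex" where
  "cr_field \<rho> j f p = dZbar j f p
     - dZbar j (\<lambda>q. of_real (\<rho> q)) p / dZbar 3 (\<lambda>q. of_real (\<rho> q)) p * dZbar 3 f p"

text \<open>
  Finite nondegeneracy in the sense of Baouendi, Ebenfelt and Rothschild: the CR derivatives of
  length at most \<open>k\<close> of the complex gradient of \<open>\<rho>\<close> span the whole space, with \<open>k\<close> minimal.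
\<close>

definition cr_gradient_span ::
    "(complex ^ 3 \<Rightarrow> real) \<Rightarrow> nat \<Rightarrow> complex ^ 3 \<Rightarrow> (complex ^ 3) set" where
  "cr_gradient_span \<rho> k p =
     vec.span {\<chi> m. foldr (cr_field \<rho>) js (dZ m (\<lambda>q. of_real (\<rho> q))) p | js.
                 set js \<subseteq> {1, 2} \<and> length js \<le> k}"

definition k_nondegenerate :: "(complex ^ 3 \<Rightarrow> real) \<Rightarrow> nat \<Rightarrow> complex ^ 3 \<Rightarrow> bool" where
  "k_nondegenerate \<rho> k p \<longleftrightarrow>
     cr_gradient_span \<rho> k p = UNIV \<and> (\<forall>l<k. cr_gradient_span \<rho> l p \<noteq> UNIV)"

definition C21_hypersurface :: "(complex ^ 3) set \<Rightarrow> (complex ^ 3 \<Rightarrow> real) \<Rightarrow> bool" where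
  "C21_hypersurface M \<rho> \<longleftrightarrow>
     (\<forall>\<^sub>F p in nhds 0. p \<in> M \<longrightarrow> k_nondegenerate \<rho> 2 p \<and> levi_rank \<rho> p = 1)"

definition tangent_space :: "(complex ^ 3 \<Rightarrow> real) \<Rightarrow> complex ^ 3 \<Rightarrow> (complex ^ 3) set" where
  "tangent_space \<rho> p = {V. frechet_derivative \<rho> (at p) V = 0}"

text \<open>
  The holomorphic vector field \<open>L\<close> with coefficients \<open>X = (A, B, C)\<close> has real part
  \<open>L + cnj L\<close> whose value at \<open>p\<close>, as a real tangent vector of \<open>complex ^ 3\<close>, is \<open>X p\<close>
  (no factor 2: it maps the coordinate \<open>z\<close> to \<open>A\<close>).
\<close>

definition hol :: "(complex ^ 3) set \<Rightarrow> (complex ^ 3 \<Rightarrow> real) \<Rightarrow> (complex ^ 3 \<Rightarrow> complex ^ 3) set" where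
  "hol M \<rho> = {X.
     (\<forall>\<^sub>F p in nhds 0. \<exists>D. (X has_derivative D) (at p) \<and> Vector_Spaces.linear (*s) (*s) D) \<and>
     (\<forall>\<^sub>F p in nhds 0. p \<in> M \<longrightarrow> X p \<in> tangent_space \<rho> p)}"

text \<open>The \<open>span\<close> is taken over the reals.\<close>

definition locally_homogeneous :: "(complex ^ 3) set \<Rightarrow> (complex ^ 3 \<Rightarrow> real) \<Rightarrow> bool" where
  "locally_homogeneous M \<rho> \<longleftrightarrow> tangent_space \<rho> 0 = span {X 0 | X. X \<in> hol M \<rho>}"

text \<open>
  Levi rank, nondegeneracy and tangency do not depend on the choice of a local defining function;
  for a graph the canonical one is used. For Hermitian coefficients the series is real-valued
  at points of \<open>complex ^ 3\<close>, so \<open>Re\<close> only changes its type.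
\<close>

definition graph_defining_function :: "coeffs \<Rightarrow> complex ^ 3 \<Rightarrow> real" where
  "graph_defining_function F p = Re (graph_value F p) - Re (p $ 3)"

definition is_graph_of :: "(complex ^ 3) set \<Rightarrow> (complex ^ 3 \<Rightarrow> complex) \<Rightarrow> bool" where
  "is_graph_of M f \<longleftrightarrow> (\<forall>\<^sub>F p in nhds 0. p \<in> M \<longleftrightarrow> of_real (Re (p $ 3)) = f p)"

end

theory Submission
  imports Defs "HOL-Complex_Analysis.Complex_Analysis"
begin

text \<open>
  Give \<open>z\<close> the weight 1, \<open>\<zeta>\<close> the weight 0 and \<open>w\<close>, \<open>v\<close> the weight 2. Since the Levi form has rank 1,
  the Levi determinant of the graph vanishes; comparing it with that of the model in a term of
  minimal degree in \<open>\<zeta>\<close> and its conjugate shows that \<open>G\<close> has only terms of weight at least 3.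

  Suppose that \<open>G\<close> is not zero and let \<open>\<nu>\<close> be its lowest weight. Infinitesimal automorphisms with
  the values \<open>\<partial>\<^sub>v\<close>, \<open>\<partial>\<^sub>z\<close> (real and imaginary) and \<open>\<partial>\<^sub>\<zeta>\<close> at the origin exist by homogeneity; expanding
  their tangency condition at the points \<open>(s z, \<zeta>, s\<^sup>2 v)\<close>, the orders \<open>\<nu> - 2\<close>, \<open>\<nu> - 1\<close> and \<open>\<nu>\<close> in \<open>s\<close>
  determine the derivatives of the lowest part \<open>G\<^sub>\<nu>\<close> up to the real part of a polynomial in \<open>z\<close>, \<open>w\<close>
  and \<open>X\<close> of degree at most two in \<open>X\<close>, where \<open>z = cnj X - \<zeta> X\<close> straightens the Levi foliation of the
  model. In the coordinates \<open>(X, cnj X, t)\<close> these polynomials are the kernel of \<open>(V + \<zeta> U)\<^sup>3\<close>, with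
  \<open>V = \<partial>\<^sub>X + \<i> Y \<partial>\<^sub>t\<close> and \<open>U = \<partial>\<^sub>Y - \<i> X \<partial>\<^sub>t\<close> spanning a Heisenberg algebra. Expanding in powers of \<open>\<zeta>\<close>,
  the commutation relations and the normalization of \<open>G\<close> force \<open>G\<^sub>\<nu> = 0\<close>.
\<close>

subsection \<open>Three-variable series and the model operators\<close>

unbundle no vec_syntax

text \<open>The coordinate \<open>X\<close> is the \<open>z\<close>-derivative of the model, and
  X^2/2 is its \<open>\<zeta>\<close>-derivative. So tangency of a field \<open>(A, B, C)\<close> to
  the model involves only the real part of C - 2 X A - X^2 B; this is where degree two in
  \<open>X\<close>, and hence a cube of an operator, comes from. For fixed \<open>X\<close> and
  \<open>t\<close> the leaf is the complex line z = conj X - \<zeta> X, w = i t + X conj X - \<zeta>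
  X^2. The obstacle is that \<open>X\<close> is not a holomorphic function of the point.
  \<open>X\<close>, its conjugate, \<open>\<zeta>\<close> and its conjugate are therefore treated as
  five independent variables together with \<open>t\<close>, in formal series, and every analytic
  identity is first turned into a formal one. A real part K + conj K, with \<open>K\<close> free of
  the conjugate of \<open>\<zeta>\<close>, mixes the two summands only in the coefficient free of
  both; the coefficient of a positive power of \<open>\<zeta>\<close> alone sees \<open>K\<close>
  alone. The two numerical hypotheses close the last gaps: \<open>F 5 0 0 1 0\<close> the terms X^5
  in the coefficients of \<zeta> and \<zeta>^2, \<open>F 3 0 0 2 0\<close> a surviving X^3 when
  \<nu> = 3.\<close>

definition fps_map :: "('a::zero \<Rightarrow> 'b::zero) \<Rightarrow> 'a fps \<Rightarrow> 'b fps" where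
  "fps_map d f = Abs_fps (\<lambda>n. d (f $ n))"

lemma fps_map_nth [simp]: "fps_map d f $ n = d (f $ n)"
  by (simp add: fps_map_def)

text \<open>The coefficient of \<open>X ^ i * Y ^ j * t ^ k\<close> is \<open>f $ i $ j $ k\<close>; \<open>Y\<close> stands for the conjugate of \<open>X\<close>.\<close>

type_synonym ser3 = "complex fps fps fps"

definition xyt_coeff :: "ser3 \<Rightarrow> nat \<Rightarrow> nat \<Rightarrow> nat \<Rightarrow> complex" where
  "xyt_coeff f i j k = f $ i $ j $ k"

lemma ser3_eqI: "(\<And>i j k. xyt_coeff f i j k = xyt_coeff g i j k) \<Longrightarrow> f = g"
  by (simp add: fps_eq_iff xyt_coeff_def)

section \<open>The Heisenberg operators of the model and conjugation\<close>

definition dX :: "ser3 \<Rightarrow> ser3" where "dX = fps_deriv"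
definition dY :: "ser3 \<Rightarrow> ser3" where "dY = fps_map fps_deriv"
definition dT :: "ser3 \<Rightarrow> ser3" where "dT = fps_map (fps_map fps_deriv)"

abbreviation iota3 :: ser3 where
  "iota3 \<equiv> fps_const (fps_const (fps_const \<i>))"

definition opV :: "ser3 \<Rightarrow> ser3" where
  "opV f = dX f + iota3 * fps_const fps_X * dT f"
definition opU :: "ser3 \<Rightarrow> ser3" where
  "opU f = dY f - iota3 * fps_X * dT f"
definition opC :: "ser3 \<Rightarrow> ser3" where
  "opC f = - 2 * iota3 * dT f"

text \<open>Complex conjugation of a function of \<open>X\<close> and \<open>t\<close>: since
  \<open>Y\<close> stands for the conjugate of \<open>X\<close>, the first two exponents change
  places.\<close>

definition bar3 :: "ser3 \<Rightarrow> ser3" where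
  "bar3 f = Abs_fps (\<lambda>i. Abs_fps (\<lambda>j. Abs_fps (\<lambda>k. cnj (f $ j $ i $ k))))"

lemma coeff_add [simp]: "xyt_coeff (f + g) i j k = xyt_coeff f i j k + xyt_coeff g i j k"
  and coeff_diff [simp]: "xyt_coeff (f - g) i j k = xyt_coeff f i j k - xyt_coeff g i j k"
  and coeff_uminus [simp]: "xyt_coeff (- f) i j k = - xyt_coeff f i j k"
  and coeff_zero [simp]: "xyt_coeff 0 i j k = 0"
  by (simp_all add: xyt_coeff_def)

definition smul :: "complex \<Rightarrow> ser3 \<Rightarrow> ser3" where
  "smul a f = fps_const (fps_const (fps_const a)) * f"

lemma coeff_smul [simp]: "xyt_coeff (smul a f) i j k = a * xyt_coeff f i j k"
  by (simp add: xyt_coeff_def smul_def)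

lemma of_nat_fps_const: "(of_nat n :: 'a::comm_ring_1 fps) = fps_const (of_nat n)"
  by (rule fps_of_nat [symmetric])

lemma coeff_dX [simp]: "xyt_coeff (dX f) i j k = of_nat (i + 1) * xyt_coeff f (i + 1) j k"
proof -
  have "dX f $ i = fps_const (fps_const (of_nat (i + 1))) * f $ (i + 1)"
    by (simp add: dX_def of_nat_fps_const flip: fps_of_nat)
  thus ?thesis by (simp add: xyt_coeff_def)
qed

lemma coeff_dY [simp]: "xyt_coeff (dY f) i j k = of_nat (j + 1) * xyt_coeff f i (j + 1) k"
proof -
  have "dY f $ i $ j = fps_const (of_nat (j + 1)) * f $ i $ (j + 1)"
    by (simp add: dY_def of_nat_fps_const flip: fps_of_nat)
  thus ?thesis by (simp add: xyt_coeff_def)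
qed

lemma coeff_dT [simp]: "xyt_coeff (dT f) i j k = of_nat (k + 1) * xyt_coeff f i j (k + 1)"
  by (simp add: dT_def xyt_coeff_def)

lemma coeff_opV: "xyt_coeff (opV f) i j k = of_nat (Suc i) * xyt_coeff f (Suc i) j k
    + \<i> * of_nat (Suc k) * (if j = 0 then 0 else xyt_coeff f i (j - 1) (Suc k))"
proof -
  have *: "xyt_coeff (iota3 * fps_const fps_X * g) i j k = \<i> * (if j = 0 then 0 else xyt_coeff g i (j - 1) k)" for g :: ser3
    by (cases j) (simp_all add: mult.assoc xyt_coeff_def)
  show ?thesis
    unfolding opV_def coeff_add * by (simp add: algebra_simps)
qed

lemma coeff_opU: "xyt_coeff (opU f) i j k = of_nat (Suc j) * xyt_coeff f i (Suc j) k
    - \<i> * of_nat (Suc k) * (if i = 0 then 0 else xyt_coeff f (i - 1) j (Suc k))"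
proof -
  have *: "xyt_coeff (iota3 * fps_X * g) i j k = \<i> * (if i = 0 then 0 else xyt_coeff g (i - 1) j k)" for g :: ser3
    by (cases i) (simp_all add: mult.assoc xyt_coeff_def)
  show ?thesis
    unfolding opU_def coeff_diff * by (simp add: algebra_simps)
qed

lemma coeff_opC [simp]: "xyt_coeff (opC f) i j k = - 2 * \<i> * of_nat (k + 1) * xyt_coeff f i j (k + 1)"
proof -
  have "xyt_coeff (2 * g) i j k = 2 * xyt_coeff g i j k" for g
    by (metis coeff_add mult_2)
  moreover have "xyt_coeff (iota3 * g) i j k = \<i> * xyt_coeff g i j k" for g
    using coeff_smul[of \<i> g] by (simp add: smul_def)
  ultimately show ?thesis by (simp add: opC_def mult.assoc)
qed

lemma coeff_bar3 [simp]: "xyt_coeff (bar3 f) i j k = cnj (xyt_coeff f j i k)"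
  by (simp add: bar3_def xyt_coeff_def)

lemma opV_opU: "opV (opU f) = opU (opV f) + opC f"
  by (rule ser3_eqI) (simp add: coeff_opV coeff_opU algebra_simps)

lemma opV_opC: "opV (opC f) = opC (opV f)"
  by (rule ser3_eqI) (simp add: coeff_opV algebra_simps)

lemma opU_opC: "opU (opC f) = opC (opU f)"
  by (rule ser3_eqI) (simp add: coeff_opU algebra_simps)

lemma op_add [simp]: "opV (f + g) = opV f + opV g" "opU (f + g) = opU f + opU g"
    "opC (f + g) = opC f + opC g" "bar3 (f + g) = bar3 f + bar3 g" "smul a (f + g) = smul a f + smul a g"
  and op_smul [simp]: "opV (smul a f) = smul a (opV f)" "opU (smul a f) = smul a (opU f)"
    "opC (smul a f) = smul a (opC f)"
  by (rule ser3_eqI; simp add: coeff_opV coeff_opU algebra_simps)+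

lemma op_zero [simp]: "opV 0 = 0" "opU 0 = 0" "opC 0 = 0" "bar3 0 = 0"
  by (rule ser3_eqI; simp add: coeff_opV coeff_opU)+

lemma smul_0 [simp]: "smul a 0 = 0"
  by (simp add: smul_def)

lemma smul_eq_0_iff: "smul a f = 0 \<longleftrightarrow> a = 0 \<or> f = 0"
  by (simp add: smul_def)

lemma op_minus [simp]: "opV (- f) = - opV f" "opU (- f) = - opU f" "opC (- f) = - opC f" "bar3 (- f) = - bar3 f"
  by (rule ser3_eqI; simp add: coeff_opV coeff_opU algebra_simps)+

lemma op_diff [simp]: "opV (f - g) = opV f - opV g" "opU (f - g) = opU f - opU g"
    "opC (f - g) = opC f - opC g" "bar3 (f - g) = bar3 f - bar3 g"
  by (rule ser3_eqI; simp add: coeff_opV coeff_opU algebra_simps)+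

lemma bar3_bar3 [simp]: "bar3 (bar3 f) = f"
  by (rule ser3_eqI) simp

lemma bar3_opV: "bar3 (opV f) = opU (bar3 f)"
  and bar3_opU: "bar3 (opU f) = opV (bar3 f)"
  and bar3_opC: "bar3 (opC f) = - opC (bar3 f)"
  by (rule ser3_eqI; simp add: coeff_opV coeff_opU algebra_simps)+

text \<open>With \<open>V\<close>, \<open>U\<close>, \<open>C\<close> for the three operators, (V +
  \<zeta> U)^3 equals V^3 + 3 \<zeta> \<open>phi21\<close> + 3 \<zeta>^2 \<open>phi12\<close> +
  \<zeta>^3 \<open>phi03\<close>. The terms with \<open>opC\<close> come from bringing the three
  words with two equal letters into one common order.\<close>

definition phi21 :: "ser3 \<Rightarrow> ser3" where "phi21 p = opU (opV (opV p)) + opC (opV p)"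
definition phi12 :: "ser3 \<Rightarrow> ser3" where "phi12 p = opU (opU (opV p)) + opC (opU p)"
definition phi03 :: "ser3 \<Rightarrow> ser3" where "phi03 p = opU (opU (opU p))"

lemma bar3_phi12: "bar3 (phi12 p) = phi21 (bar3 p)"
  by (simp add: phi12_def phi21_def bar3_opV bar3_opU bar3_opC opV_opU opV_opC opU_opC)

lemma bar3_phi21: "bar3 (phi21 p) = phi12 (bar3 p)"
  by (metis bar3_bar3 bar3_phi12)

lemma phi_diff: "phi21 (p - q) = phi21 p - phi21 q" "phi12 (p - q) = phi12 p - phi12 q"
   "phi03 (p - q) = phi03 p - phi03 q"
  by (simp_all add: phi21_def phi12_def phi03_def)

context
  fixes p :: ser3
  assumes p: "opV (opV (opV p)) = 0"
begin

text \<open>Normal ordering: \<open>opC\<close> moves to the left and \<open>opV\<close> to the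
  right, next to \<open>p\<close>, where three of them give zero. The numbers 8, 7 and 2 in the four
  relations below count the commutators produced on the way. The relations are compatibility
  conditions between the three coefficients of the cube applied to one \<open>p\<close>.\<close>

lemmas op_normal = phi21_def phi12_def phi03_def op_add op_diff op_smul opV_opU opV_opC opU_opC p op_zero
  add_0 add_0_right

lemma phi_rel1: "opV (opV (phi21 p)) = 0"
  by (simp only: op_normal)

lemma phi_rel2: "smul 2 (opV (opV (phi12 p))) = opU (opV (phi21 p)) + smul 8 (opC (phi21 p))"
  by (simp only: op_normal) (rule ser3_eqI, simp only: coeff_add coeff_diff coeff_smul, simp del: coeff_opC)

lemma phi_rel3: "opU (opV (phi12 p)) - smul 7 (opC (phi12 p)) = smul 2 (opU (opU (phi21 p))) - opV (opV (phi03 p))"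
  by (simp only: op_normal) (rule ser3_eqI, simp only: coeff_add coeff_diff coeff_smul, simp del: coeff_opC)

lemma phi_rel4: "opU (opU (phi12 p)) = opU (opV (phi03 p)) - smul 2 (opC (phi03 p))"
  by (simp only: op_normal) (rule ser3_eqI, simp only: coeff_add coeff_diff coeff_smul, simp del: coeff_opC)

end

section \<open>Divisibility by powers of X and Y, and uniqueness for powers of V\<close>

definition xdiv :: "nat \<Rightarrow> ser3 \<Rightarrow> bool" where
  "xdiv m f \<longleftrightarrow> (\<forall>i j k. i < m \<longrightarrow> xyt_coeff f i j k = 0)"
definition ydiv :: "nat \<Rightarrow> ser3 \<Rightarrow> bool" where
  "ydiv m f \<longleftrightarrow> (\<forall>i j k. j < m \<longrightarrow> xyt_coeff f i j k = 0)"

lemma xdiv_op: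
  "xdiv m f \<Longrightarrow> xdiv m (opU f)" "xdiv m f \<Longrightarrow> xdiv m (opC f)" "xdiv (Suc m) f \<Longrightarrow> xdiv m (opV f)"
  by (auto simp: xdiv_def coeff_opU coeff_opV)

lemma ydiv_op:
  "ydiv m f \<Longrightarrow> ydiv m (opV f)" "ydiv m f \<Longrightarrow> ydiv m (opC f)" "ydiv (Suc m) f \<Longrightarrow> ydiv m (opU f)"
  by (auto simp: ydiv_def coeff_opU coeff_opV)

lemma xdiv_lin: "xdiv m f \<Longrightarrow> xdiv m g \<Longrightarrow> xdiv m (f + g)" "xdiv m f \<Longrightarrow> xdiv m g \<Longrightarrow> xdiv m (f - g)"
  by (auto simp: xdiv_def)

lemma ydiv_lin: "ydiv m f \<Longrightarrow> ydiv m g \<Longrightarrow> ydiv m (f + g)" "ydiv m f \<Longrightarrow> ydiv m g \<Longrightarrow> ydiv m (f - g)"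
  by (auto simp: ydiv_def)

lemma xdiv_bar3: "xdiv m (bar3 f) \<longleftrightarrow> ydiv m f" and ydiv_bar3: "ydiv m (bar3 f) \<longleftrightarrow> xdiv m f"
  by (auto simp: xdiv_def ydiv_def)

lemma xdiv_mono: "xdiv m f \<Longrightarrow> n \<le> m \<Longrightarrow> xdiv n f"
  by (auto simp: xdiv_def)

text \<open>The equation is an evolution equation in \<open>X\<close>: it expresses the coefficient
  of X^(i+1) by that of X^i, so a solution is determined by its value at X = 0.\<close>

lemma opV_eq_0D:
  assumes "opV f = 0" "xdiv 1 f"
  shows "f = 0"
proof -
  have "xyt_coeff f i j k = 0" for i j k
  proof (induction i arbitrary: j k)
    case 0
    then show ?case using assms(2) by (simp add: xdiv_def)
  next
    case (Suc i)
    have "xyt_coeff (opV f) i j k = 0" using assms(1) by simp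
    then show ?case using Suc by (simp add: coeff_opV del: of_nat_Suc split: if_splits)
  qed
  thus ?thesis by (intro ser3_eqI) simp
qed

lemma opV2_eq_0D: "opV (opV f) = 0 \<Longrightarrow> xdiv 2 f \<Longrightarrow> f = 0"
  using opV_eq_0D xdiv_op(3)[of 1 f] xdiv_mono[of 2 f 1] by (simp add: numeral_2_eq_2)

lemma opV3_eq_0D: "opV (opV (opV f)) = 0 \<Longrightarrow> xdiv 3 f \<Longrightarrow> f = 0"
  using opV2_eq_0D[of "opV f"] opV_eq_0D xdiv_op(3)[of 2 f] xdiv_mono[of 3 f 1] by (simp add: numeral_3_eq_3 numeral_2_eq_2)

lemma opU3_eq_0D: "opU (opU (opU f)) = 0 \<Longrightarrow> ydiv 3 f \<Longrightarrow> f = 0"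
  using opV3_eq_0D[of "bar3 f"] by (metis bar3_bar3 bar3_opU op_zero(4) xdiv_bar3)

text \<open>Here \<open>\<theta>\<close> will be the \<open>t\<close>-derivative of the part of the
  lowest weight term free of \<open>\<zeta>\<close> and its conjugate, and \<open>p\<close>,
  \<open>p1\<close> the first two coefficients of a series annihilated by (V + \<zeta> U)^3. Each of
  the three coefficients of the cube gets its divisibility from another source: \<open>phi21\<close>
  from \<open>p1\<close>, \<open>phi12\<close> by conjugation, \<open>phi03\<close> from
  \<open>\<theta>\<close>. The compatibility relations then leave no room for a lowest term in
  \<open>X\<close>.\<close>

lemma cubic_vanish:
  fixes p \<theta> p1 :: ser3
  assumes p: "opV (opV (opV p)) = 0"
    and th: "\<theta> = p + bar3 p" "xdiv 3 \<theta>" "ydiv 3 \<theta>" "\<And>k. xyt_coeff \<theta> 3 3 k = 0"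
    and p1: "opV (opV (opV p1)) = - smul 3 (phi21 p)" "xdiv 3 p1"
       "\<And>i j k. i \<in> {3,4} \<Longrightarrow> j \<in> {0,1} \<Longrightarrow> xyt_coeff p1 i j k = 0"
  shows "phi21 p = 0" "phi12 p = 0" "phi03 p = 0" "\<theta> = 0"
proof -
  have lt3: "xyt_coeff p1 0 j k = 0" "xyt_coeff p1 (Suc 0) j k = 0" "xyt_coeff p1 (Suc (Suc 0)) j k = 0" for j k
    using p1(2) by (simp_all add: xdiv_def)
  have z01: "xyt_coeff p1 (Suc (Suc (Suc 0))) 0 k = 0" "xyt_coeff p1 (Suc (Suc (Suc 0))) (Suc 0) k = 0"
       "xyt_coeff p1 (Suc (Suc (Suc (Suc 0)))) 0 k = 0" "xyt_coeff p1 (Suc (Suc (Suc (Suc 0)))) (Suc 0) k = 0" for k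
    using p1(3)[of 3 0 k] p1(3)[of 3 1 k] p1(3)[of 4 0 k] p1(3)[of 4 1 k] by (simp_all add: numeral_eq_Suc)
  have m3: "- 3 * xyt_coeff (phi21 p) i j k = xyt_coeff (opV (opV (opV p1))) i j k" for i j k
    by (simp add: p1(1))
  have low: "xyt_coeff (phi21 p) 0 j k = 0 \<and> xyt_coeff (phi21 p) (Suc 0) j k = 0" if "j < 2" for j k
  proof -
    have "j = 0 \<or> j = Suc 0" using that by auto
    thus ?thesis using m3[of 0 j k] m3[of "Suc 0" j k]
      by (auto simp: coeff_opV lt3 z01)
  qed
  have V2: "xyt_coeff (opV (opV (phi21 p))) i j k = 0" for i j k
    by (simp add: phi_rel1[OF p])
  \<comment> \<open>\<open>V2\<close> is a recursion of second order in \<open>X\<close> whose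
    inhomogeneous terms have a lower power of \<open>Y\<close>. For the powers 0 and 1 of
    \<open>Y\<close> its initial values vanish by \<open>low\<close>.\<close>
  have "xyt_coeff (phi21 p) i j k = 0 \<and> xyt_coeff (phi21 p) (Suc i) j k = 0" if "j < 2" for i j k
    using that
  proof (induction i arbitrary: j k)
    case 0
    then show ?case using low by simp
  next
    case (Suc i)
    have "xyt_coeff (phi21 p) (Suc i) (j - 1) l = 0" "xyt_coeff (phi21 p) i (j - Suc (Suc 0)) l = 0" for l
      using Suc.IH[of "j - 1" l] Suc.IH[of "j - Suc (Suc 0)" l] Suc.prems by auto
    hence "of_nat (Suc i) * (of_nat (Suc (Suc i)) * xyt_coeff (phi21 p) (Suc (Suc i)) j k) = 0"
      using V2[of i j k] Suc.prems by (simp add: coeff_opV del: of_nat_Suc split: if_splits)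
    thus ?case using Suc.IH[of j k] Suc.prems by (simp del: of_nat_Suc)
  qed
  hence y21: "ydiv 2 (phi21 p)" by (simp add: ydiv_def)
  \<comment> \<open>The conjugate of \<open>p\<close> is \<open>\<theta> - p\<close>. Both terms on
    the right are divisible by Y^2, and conjugation turns this into divisibility by X^2.\<close>
  have b12: "bar3 (phi12 p) = phi21 \<theta> - phi21 p"
    unfolding bar3_phi12 phi_diff[symmetric] by (simp add: th(1))
  have "ydiv 2 (phi21 \<theta>)"
    using th(3) unfolding phi21_def
    by (intro ydiv_lin ydiv_op) (auto simp: ydiv_def eval_nat_numeral coeff_opV)
  hence "ydiv 2 (bar3 (phi12 p))" unfolding b12 by (rule ydiv_lin) (rule y21)
  hence x12: "xdiv 2 (phi12 p)" by (simp add: ydiv_bar3)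
  have bp: "opU (opU (opU (bar3 p))) = 0"
    using arg_cong[OF p, of bar3] by (simp add: bar3_opV)
  \<comment> \<open>Conjugating the equation for \<open>p\<close> shows that \<open>opU\<close>
    applied three times annihilates \<open>bar3 p\<close>, so only \<open>\<theta>\<close>
    contributes.\<close>
  have p03: "phi03 p = phi03 \<theta>"
    using bp by (simp add: phi03_def th(1))
  have x03: "xdiv 3 (phi03 p)"
    unfolding p03 unfolding phi03_def by (intro xdiv_op th(2))
  define u where "u = phi21 p"
  define v where "v = phi12 p"
  define w where "w = phi03 p"
  have v0: "xyt_coeff v 0 j k = 0" "xyt_coeff v (Suc 0) j k = 0" for j k
    using x12 by (simp_all add: xdiv_def v_def)
  have w0: "xyt_coeff w 0 j k = 0" "xyt_coeff w (Suc 0) j k = 0" "xyt_coeff w (Suc (Suc 0)) j k = 0" for j k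
    using x03 by (simp_all add: xdiv_def w_def)
  note rel2 = arg_cong[OF phi_rel2[OF p], of "\<lambda>f. xyt_coeff f i j k" for i j k, folded u_def v_def w_def]
  note rel3 = arg_cong[OF phi_rel3[OF p], of "\<lambda>f. xyt_coeff f i j k" for i j k, folded u_def v_def w_def]
  note rel4 = arg_cong[OF phi_rel4[OF p], of "\<lambda>f. xyt_coeff f i j k" for i j k, folded u_def v_def w_def]
  have u0: "xyt_coeff u 0 j k = 0" for j k
  proof (cases "j < 2")
    case True thus ?thesis using low by (simp add: u_def)
  next
    case False
    then obtain j' where j': "j = Suc (Suc j')" by (metis less_2_cases_iff not0_implies_Suc One_nat_def)
    have "of_nat (Suc j') * (of_nat (Suc (Suc j')) * xyt_coeff u 0 (Suc (Suc j')) k) = 0"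
      using rel3[of 0 j' k] by (simp add: coeff_opV coeff_opU v0 w0 del: of_nat_Suc split: if_splits)
    thus ?thesis using j' by (simp del: of_nat_Suc)
  qed
  \<comment> \<open>The lowest powers of \<open>X\<close> still possible in \<open>u\<close>,
    \<open>v\<close>, \<open>w\<close>. At these orders the \<open>t\<close>-derivatives in the
    relations meet only coefficients already known to vanish, and plain recursions in
    \<open>Y\<close> remain.\<close>
  define \<alpha> where "\<alpha> = xyt_coeff u (Suc 0)"
  define \<psi> where "\<psi> = xyt_coeff v (Suc (Suc 0))"
  define \<kappa> where "\<kappa> = xyt_coeff w (Suc (Suc (Suc 0)))"
  have e2: "4 * \<psi> j k = of_nat (Suc j) * \<alpha> (Suc j) k" for j k
    using rel2[of 0 j k] by (simp add: coeff_opV coeff_opU v0 u0 \<alpha>_def \<psi>_def del: of_nat_Suc split: if_splits) (simp_all)?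
  have e3: "of_nat (Suc j) * \<psi> (Suc j) k = of_nat (Suc j) * of_nat (Suc (Suc j)) * \<alpha> (Suc (Suc j)) k - 3 * \<kappa> j k" for j k
  proof -
    have "2 * (of_nat (Suc j) * \<psi> (Suc j) k) = 2 * (of_nat (Suc j) * of_nat (Suc (Suc j)) * \<alpha> (Suc (Suc j)) k - 3 * \<kappa> j k)"
      using rel3[of "Suc 0" j k] by (simp add: coeff_opV coeff_opU v0 u0 w0 \<alpha>_def \<psi>_def \<kappa>_def del: of_nat_Suc split: if_splits)
       (auto simp: algebra_simps)
    thus ?thesis by (subst (asm) mult_left_cancel) simp_all
  qed
  have e4: "of_nat (Suc (Suc j)) * \<psi> (Suc (Suc j)) k = 3 * \<kappa> (Suc j) k" for j k
  proof -
    have "of_nat (Suc j) * (of_nat (Suc (Suc j)) * \<psi> (Suc (Suc j)) k) = of_nat (Suc j) * (3 * \<kappa> (Suc j) k)"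
      using rel4[of "Suc (Suc 0)" j k] by (simp add: coeff_opV coeff_opU v0 u0 w0 \<alpha>_def \<psi>_def \<kappa>_def del: of_nat_Suc split: if_splits) (simp_all)?
    thus ?thesis by (simp del: of_nat_Suc)
  qed
  \<comment> \<open>With n = j + 2 and m = j + 3, the relations make n m \<open>\<alpha>\<close>
    equal to 2 n \<open>\<psi>\<close> as well as to 4 n \<open>\<psi>\<close>.\<close>
  have a3: "\<alpha> (Suc (Suc (Suc j))) k = 0" for j k
  proof -
    have "n * (m * a) = 0" if "n * x = 3 * y" "n * x = n * m * a - 3 * y" "4 * x = m * a" for n m a x y :: complex
      using that by algebra
    from this[OF e4[of j k] e3[of "Suc j" k] e2[of "Suc (Suc j)" k]]
    have "of_nat (Suc (Suc j)) * (of_nat (Suc (Suc (Suc j))) * \<alpha> (Suc (Suc (Suc j))) k) = 0" .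
    thus ?thesis by (simp del: of_nat_Suc)
  qed
  have wth: "w = opU (opU (opU \<theta>))" using p03 by (simp add: w_def phi03_def)
  have "xyt_coeff \<theta> 0 j k = 0" "xyt_coeff \<theta> (Suc 0) j k = 0" "xyt_coeff \<theta> (Suc (Suc 0)) j k = 0" for j k
    using th(2) by (simp_all add: xdiv_def)
  \<comment> \<open>This coefficient is 6 times that of X^3 Y^3 in \<open>\<theta>\<close>, the one
    place where the missing term X^3 Y^3 is used.\<close>
  hence "\<kappa> 0 k = 0" for k
    using th(4)[of k] unfolding \<kappa>_def wth by (simp add: coeff_opU numeral_3_eq_3)
  hence a2: "\<alpha> (Suc (Suc 0)) k = 0" for k
    using e3[of 0 k] e2[of "Suc 0" k] by simp
  have a01: "\<alpha> 0 k = 0" "\<alpha> (Suc 0) k = 0" for k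
    using low[of 0 k] low[of "Suc 0" k] by (simp_all add: \<alpha>_def u_def)
  have "\<alpha> j k = 0" for j k
  proof (cases "j < 3")
    case True
    hence "j = 0 \<or> j = Suc 0 \<or> j = Suc (Suc 0)" by linarith
    thus ?thesis using a2 a01 by blast
  next
    case False
    hence "Suc (Suc (Suc (j - 3))) = j" by simp
    thus ?thesis using a3[of "j - 3" k] by (simp only:)
  qed
  hence u1: "xyt_coeff u (Suc 0) j k = 0" for j k by (simp only: \<alpha>_def)
  have "xdiv 2 u"
    unfolding xdiv_def
  proof (intro allI impI)
    fix i j k :: nat assume "i < 2"
    hence "i = 0 \<or> i = Suc 0" by auto
    thus "xyt_coeff u i j k = 0" using u0 u1 by blast
  qed
  with phi_rel1[OF p] have u: "u = 0" unfolding u_def[symmetric] by (rule opV2_eq_0D)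
  thus "phi21 p = 0" by (simp add: u_def)
  have "smul 2 (opV (opV v)) = 0"
    using phi_rel2[OF p] unfolding u_def[symmetric] v_def[symmetric] u by simp
  hence "opV (opV v) = 0" by (simp add: smul_eq_0_iff del: op_smul)
  with x12 have v: "v = 0" unfolding v_def[symmetric] by (intro opV2_eq_0D[of v])
  thus "phi12 p = 0" by (simp add: v_def)
  have "opV (opV w) = 0"
    using phi_rel3[OF p] unfolding u_def[symmetric] v_def[symmetric] w_def[symmetric] u v by simp
  moreover have "xdiv 2 w" using x03 unfolding w_def[symmetric] by (rule xdiv_mono) simp
  ultimately have w: "w = 0" by (rule opV2_eq_0D)
  thus "phi03 p = 0" by (simp add: w_def)
  show "\<theta> = 0"
    using w unfolding wth by (rule opU3_eq_0D) (rule th(3))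
qed

lemma nat_cases2:
  assumes "P 0" "P (Suc 0)" "\<And>n. P (Suc (Suc n))"
  shows "P n"
proof (cases n)
  case (Suc m)
  thus ?thesis using assms(2,3) by (cases m) simp_all
qed (use assms in simp)

section \<open>Power series in \<zeta> annihilated by the cube of V + \<zeta> U\<close>

definition opVz :: "ser3 fps \<Rightarrow> ser3 fps" where
  "opVz P = fps_map opV P + fps_X * fps_map opU P"

lemma opVz_0: "opVz P $ 0 = opV (P $ 0)" and opVz_Suc: "opVz P $ Suc n = opV (P $ Suc n) + opU (P $ n)"
  by (simp_all add: opVz_def)

definition Ptype :: "ser3 fps \<Rightarrow> bool" where
  "Ptype P \<longleftrightarrow> opVz (opVz (opVz P)) = 0"

lemma smul3: "smul 3 f = f + f + f"
  by (rule ser3_eqI) (simp only: coeff_add coeff_smul, simp)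

lemma Ptype_0: "Ptype P \<Longrightarrow> opV (opV (opV (P $ 0))) = 0"
  unfolding Ptype_def by (metis opVz_0 fps_zero_nth)

lemma Ptype_1:
  assumes "Ptype P"
  shows "opV (opV (opV (P $ 1))) = - smul 3 (phi21 (P $ 0))"
proof -
  have "opVz (opVz (opVz P)) $ Suc 0 = opV (opV (opV (P $ 1))) + smul 3 (phi21 (P $ 0))"
    unfolding opVz_0 opVz_Suc smul3 phi21_def op_add opV_opU opV_opC opU_opC One_nat_def
    by (rule ser3_eqI) (simp only: coeff_add, simp del: coeff_opC)
  thus ?thesis using assms by (simp add: Ptype_def eq_neg_iff_add_eq_0)
qed

lemma Ptype_2:
  assumes "Ptype P"
  shows "opV (opV (opV (P $ 2))) = - (opV (opV (opU (P $ 1))) + opV (opU (opV (P $ 1)))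
   + opU (opV (opV (P $ 1))) + smul 3 (phi12 (P $ 0)))"
proof -
  have "opVz (opVz (opVz P)) $ Suc (Suc 0) = opV (opV (opV (P $ 2))) + (opV (opV (opU (P $ 1))) + opV (opU (opV (P $ 1)))
   + opU (opV (opV (P $ 1))) + smul 3 (phi12 (P $ 0)))"
    unfolding opVz_0 opVz_Suc smul3 phi12_def op_add opV_opU opV_opC opU_opC One_nat_def numeral_2_eq_2
    by (rule ser3_eqI) (simp only: coeff_add, simp del: coeff_opC)
  thus ?thesis using assms unfolding Ptype_def eq_neg_iff_add_eq_0 by simp
qed

lemma opU_opV: "opU (opV f) = opV (opU f) - opC f"
  by (simp add: opV_opU)

text \<open>The coefficient of \<zeta>^n in the cube is V^3 applied to \<open>P $ n\<close> plus
  words with at least one \<open>opU\<close> applied to the three preceding coefficients. A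
  coefficient of positive index gives zero there by hypothesis, and index 0 contributes one of the
  three vanishing \<open>phi\<close> terms.\<close>

lemma Ptype_triangular:
  assumes "Ptype P" "phi21 (P $ 0) = 0" "phi12 (P $ 0) = 0" "phi03 (P $ 0) = 0"
    and "\<And>q. 0 < q \<Longrightarrow> q < n \<Longrightarrow> opU (P $ q) = 0 \<and> opC (P $ q) = 0" "n > 0"
  shows "opV (opV (opV (P $ n))) = 0"
proof -
  have *: "opVz (opVz (opVz P)) $ n = 0" using assms(1) by (simp add: Ptype_def)
  \<comment> \<open>The opposite order of operators: \<open>opU\<close> and \<open>opC\<close> are
    moved next to the series, where they give zero.\<close>
  note rw = opU_opV opV_opC[symmetric] opU_opC
  consider "n = 1" | "n = 2" | "n = 3" | m where "n = Suc (Suc (Suc (Suc m)))"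
  proof -
    assume *: "n = 1 \<Longrightarrow> thesis" "n = 2 \<Longrightarrow> thesis" "n = 3 \<Longrightarrow> thesis"
      "\<And>m. n = Suc (Suc (Suc (Suc m))) \<Longrightarrow> thesis"
    show thesis
    proof (cases "n \<ge> 4")
      case True
      have "n = Suc (Suc (Suc (Suc (n - 4))))" using True by simp
      thus thesis by (rule *(4))
    next
      case False
      hence "n = 1 \<or> n = 2 \<or> n = 3" using assms(6) by linarith
      thus thesis using * by blast
    qed
  qed
  thus ?thesis
  proof cases
    case 1
    thus ?thesis using Ptype_1[OF assms(1)] assms(2) by simp
  next
    case 2
    have "opU (P $ 1) = 0" "opC (P $ 1) = 0" using assms(5) 2 by simp_all
    thus ?thesis using Ptype_2[OF assms(1)] assms(3) 2 by (simp add: rw)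
  next
    case 3
    have "opU (P $ Suc 0) = 0" "opC (P $ Suc 0) = 0" "opU (P $ Suc (Suc 0)) = 0" "opC (P $ Suc (Suc 0)) = 0"
      using assms(5) 3 by simp_all
    thus ?thesis using * 3 assms(4) by (simp add: numeral_3_eq_3 opVz_Suc opVz_0 phi03_def rw)
  next
    case (4 m)
    have "opU (P $ Suc m) = 0" "opU (P $ Suc (Suc m)) = 0" "opU (P $ Suc (Suc (Suc m))) = 0"
       "opC (P $ Suc m) = 0" "opC (P $ Suc (Suc m)) = 0" "opC (P $ Suc (Suc (Suc m))) = 0"
      using assms(5) 4 by simp_all
    thus ?thesis using * 4 by (simp add: opVz_Suc rw)
  qed
qed

lemma Ptype_vanish:
  assumes "Ptype P" "phi21 (P $ 0) = 0" "phi12 (P $ 0) = 0" "phi03 (P $ 0) = 0"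
    and "\<And>q. 0 < q \<Longrightarrow> xdiv 3 (P $ q)"
  shows "0 < q \<Longrightarrow> P $ q = 0"
proof (induction q rule: less_induct)
  case (less q)
  have "opV (opV (opV (P $ q))) = 0"
    by (rule Ptype_triangular[OF assms(1-4)]) (use less in auto)
  thus ?case using assms(5)[OF less.prems] by (rule opV3_eq_0D)
qed

text \<open>The scalar form of the compatibility relations when nothing depends on \<open>t\<close>:
  then \<open>opC\<close> vanishes and \<open>opV\<close>, \<open>opU\<close> are plain partial
  derivatives. \<open>a\<close>, \<open>b\<close>, \<open>d\<close> are the coefficients of
  \<open>phi21\<close>, \<open>phi12\<close>, \<open>phi03\<close>, and \<open>G\<close> those of
  the series from which they arise; \<open>e5\<close> is an equality of mixed derivatives. The three
  exceptional pairs are the coefficients of degree at most one, which the relations do not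
  reach.\<close>

lemma rigid_coefficients:
  fixes a b G :: "nat \<Rightarrow> nat \<Rightarrow> complex"
  defines "d \<equiv> \<lambda>i j. of_nat (Suc j) * of_nat (Suc (Suc j)) * of_nat (Suc (Suc (Suc j)))
      * of_nat (Suc (Suc (Suc (Suc j)))) * G i (j + 4)"
  assumes e1: "\<And>i j. a (Suc (Suc i)) j = 0"
    and e2: "\<And>i j. 2 * (of_nat (Suc i) * of_nat (Suc (Suc i)) * b (Suc (Suc i)) j) = of_nat (Suc i) * of_nat (Suc j) * a (Suc i) (Suc j)"
    and e3: "\<And>i j. of_nat (Suc i) * of_nat (Suc j) * b (Suc i) (Suc j)
        = 2 * (of_nat (Suc j) * of_nat (Suc (Suc j)) * a i (Suc (Suc j))) - of_nat (Suc i) * of_nat (Suc (Suc i)) * d (Suc (Suc i)) j"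
    and e4: "\<And>i j. of_nat (Suc j) * of_nat (Suc (Suc j)) * b i (Suc (Suc j)) = of_nat (Suc i) * of_nat (Suc j) * d (Suc i) (Suc j)"
    and e5: "\<And>i j. of_nat (Suc i) * a (Suc i) j + of_nat (Suc j) * cnj (b (Suc j) i)
        = of_nat (Suc i) * of_nat (Suc (Suc i)) * of_nat (Suc (Suc (Suc i))) * of_nat (Suc j) * of_nat (Suc (Suc j)) * G (i + 3) (j + 2)"
    and G: "\<And>i j. i < 3 \<or> j < 3 \<Longrightarrow> G i j = 0" "G 3 3 = 0"
  shows "(i, j) \<notin> {(0,0), (0,1), (1,0)} \<Longrightarrow> a i j = 0 \<and> b i j = 0"
    and "G i j = 0" and "a 1 0 + cnj (b 1 0) = 0"
proof -
  have d12: "d (Suc 0) j = 0" "d (Suc (Suc 0)) j = 0" for j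
    by (simp_all add: d_def G)
  have b0: "b 0 (Suc (Suc j)) = 0" for j
    using e4[of j 0] by (simp add: d12 del: of_nat_Suc)
  have b1: "b (Suc 0) (Suc (Suc j)) = 0" for j
    using e4[of j "Suc 0"] by (simp add: d12 del: of_nat_Suc)
  have s3: "b (Suc 0) (Suc j) = 2 * of_nat (Suc (Suc j)) * a 0 (Suc (Suc j))" for j
  proof -
    have "of_nat (Suc j) * b (Suc 0) (Suc j) = of_nat (Suc j) * (2 * of_nat (Suc (Suc j)) * a 0 (Suc (Suc j)))"
      using e3[of 0 j] by (simp add: d12 mult_ac del: of_nat_Suc) simp
    thus ?thesis by (subst (asm) mult_left_cancel) (simp_all del: of_nat_Suc)
  qed
  have a03: "a 0 (Suc (Suc (Suc j))) = 0" for j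
    using s3[of "Suc j"] b1[of j] by (simp del: of_nat_Suc)
  have b11: "b (Suc 0) (Suc 0) = 0"
    using e5[of "Suc 0" 0] e1[of 0 0] G(1)[of "Suc 0 + 3" "0 + 2"] by simp
  hence a02: "a 0 (Suc (Suc 0)) = 0" using s3[of 0] by simp
  have b2: "4 * b (Suc (Suc 0)) j = of_nat (Suc j) * a (Suc 0) (Suc j)" for j
    using e2[of 0 j] by simp
  have b3: "b (Suc (Suc (Suc i))) j = 0" for i j
    using e2[of "Suc i" j] e1[of i] by (simp del: of_nat_Suc)
  have t3: "of_nat (Suc j) * b (Suc (Suc 0)) (Suc j) = of_nat (Suc j) * of_nat (Suc (Suc j)) * a (Suc 0) (Suc (Suc j)) - 3 * d (Suc (Suc (Suc 0))) j" for j
  proof -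
    have "x = y" if "2 * n * x' = 2 * (n * m * u) - 2 * 3 * w" "x = n * x'" "y = n * m * u - 3 * w" for n m x x' y u w :: complex
    proof -
      have "2 * x = 2 * n * x'" using that(2) by simp
      also have "\<dots> = 2 * (n * m * u) - 2 * 3 * w" by (rule that(1))
      also have "\<dots> = 2 * y" using that(3) by simp
      finally have "2 * x = 2 * y" .
      thus ?thesis by (subst (asm) mult_left_cancel) simp_all
    qed
    note * = this
    have "of_nat (Suc (Suc 0)) = (2::complex)" "of_nat (Suc 0) = (1::complex)" "of_nat (Suc (Suc (Suc 0))) = (3::complex)"
      by simp_all
    hence "2 * of_nat (Suc j) * b (Suc (Suc 0)) (Suc j) =
       2 * (of_nat (Suc j) * of_nat (Suc (Suc j)) * a (Suc 0) (Suc (Suc j))) - 2 * 3 * d (Suc (Suc (Suc 0))) j"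
      using e3[of "Suc 0" j] by metis
    from *[OF this refl refl] show ?thesis .
  qed
  have t4: "of_nat (Suc (Suc j)) * b (Suc (Suc 0)) (Suc (Suc j)) = 3 * d (Suc (Suc (Suc 0))) (Suc j)" for j
  proof -
    have "of_nat (Suc j) * (of_nat (Suc (Suc j)) * b (Suc (Suc 0)) (Suc (Suc j))) = of_nat (Suc j) * (3 * d (Suc (Suc (Suc 0))) (Suc j))"
      using e4[of j "Suc (Suc 0)"] by (simp add: algebra_simps)
    thus ?thesis by (subst (asm) mult_left_cancel) (simp_all del: of_nat_Suc)
  qed
  have b22: "b (Suc (Suc 0)) (Suc (Suc j)) = 0" for j
  proof -
    have "n * x = 0" if "4 * x = m * u" "n * x = 3 * w" "n * x = n * m * u - 3 * w" for n m x u w :: complex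
    proof -
      have "n * m * u = 4 * (n * x)" by (metis mult.assoc mult.left_commute that(1))
      hence "n * x = 4 * (n * x) - n * x" using that(2,3) by metis
      hence "2 * (n * x) = 0" by (simp only: mult_2 eq_diff_eq) simp
      thus ?thesis by simp
    qed
    from this[OF b2[of "Suc (Suc j)"] t4 t3[of "Suc j"]] show ?thesis by (simp del: of_nat_Suc)
  qed
  hence a13: "a (Suc 0) (Suc (Suc (Suc j))) = 0" for j
    using b2[of "Suc (Suc j)"] by (simp del: of_nat_Suc)
  \<comment> \<open>The same number is computed twice, as 48 and as 72 times
    \<open>G 3 4\<close>.\<close>
  have a12: "a (Suc 0) (Suc (Suc 0)) = 0"
  proof -
    have "a (Suc 0) (Suc (Suc 0)) = 2 * d (Suc (Suc (Suc 0))) 0"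
      using t3[of 0] b2[of "Suc 0"] by simp
    hence "a (Suc 0) (Suc (Suc 0)) = 48 * G 3 4" by (simp add: d_def numeral_3_eq_3)
    moreover have "a (Suc 0) (Suc (Suc 0)) = 72 * G 3 4"
    proof -
      have "0 + 3 = (3::nat)" "Suc (Suc 0) + 2 = (4::nat)" by simp_all
      from e5[of 0 "Suc (Suc 0)", unfolded this] show ?thesis using b3[of 0 0] by simp
    qed
    ultimately show ?thesis by simp
  qed
  \<comment> \<open>\<open>e5\<close> involves a conjugate, so only absolute values can be compared;
    the two relations give the ratios 2 and 4.\<close>
  have a11: "a (Suc 0) (Suc 0) = 0"
  proof -
    have "a (Suc 0) (Suc 0) = - 2 * cnj (b (Suc (Suc 0)) 0)"
    proof -
      have "0 + 3 = (3::nat)" "Suc 0 + 2 = (3::nat)" by simp_all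
      from e5[of 0 "Suc 0", unfolded this] show ?thesis using G(2) by (simp add: eq_neg_iff_add_eq_0)
    qed
    hence "norm (a (Suc 0) (Suc 0)) = 2 * norm (b (Suc (Suc 0)) 0)" by (simp add: norm_mult)
    moreover have "4 * norm (b (Suc (Suc 0)) 0) = norm (a (Suc 0) (Suc 0))"
      using arg_cong[OF b2[of 0], of norm] by (simp add: norm_mult)
    ultimately show ?thesis by simp
  qed
  have aa: "a (Suc 0) (Suc j) = 0" for j
    by (rule nat_cases2[of _ j]) (rule a11 a12 a13)+
  have bb: "b (Suc (Suc 0)) j = 0" for j
    using b2[of j] aa[of j] by simp
  have a0: "a 0 (Suc (Suc j)) = 0" for j
    using a02 a03 by (cases j) simp_all
  have b1': "b (Suc 0) (Suc j) = 0" for j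
    using b11 b1 by (cases j) simp_all
  have main: "a i j = 0 \<and> b i j = 0" if "(i, j) \<notin> {(0,0), (0,1), (1,0)}" for i j
  proof -
    have "\<not> (i = 0 \<and> j = 0)" "\<not> (i = 0 \<and> j = 1)" "\<not> (i = 1 \<and> j = 0)"
      using that by auto
    hence "(i = 0 \<and> j \<ge> 2) \<or> (i = 1 \<and> j \<ge> 1) \<or> i = 2 \<or> i \<ge> 3"
      by linarith
    then consider "i = 0" "j \<ge> 2" | "i = 1" "j \<ge> 1" | "i = 2" | "i \<ge> 3"
      by blast
    thus ?thesis
    proof cases
      case 1
      hence "j = Suc (Suc (j - 2))" by simp
      thus ?thesis using 1 a0[of "j - 2"] b0[of "j - 2"] by (simp only:)
    next
      case 2
      hence "j = Suc (j - 1)" by simp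
      thus ?thesis using 2 aa[of "j - 1"] b1'[of "j - 1"] by (simp only: One_nat_def)
    next
      case 3
      thus ?thesis using e1[of 0] bb by (simp add: numeral_2_eq_2)
    next
      case 4
      hence "i = Suc (Suc (Suc (i - 3)))" by simp
      thus ?thesis using e1[of "Suc (i - 3)" j] b3[of "i - 3" j] by (simp only:)
    qed
  qed
  show "(i, j) \<notin> {(0,0), (0,1), (1,0)} \<Longrightarrow> a i j = 0 \<and> b i j = 0" by (rule main)
  show a10: "a 1 0 + cnj (b 1 0) = 0"
  proof -
    have "0 + 3 = (3::nat)" "0 + 2 = (2::nat)" by simp_all
    from e5[of 0 0, unfolded this] show ?thesis using G(1)[of 3 2] by simp
  qed
  show "G i j = 0"
  proof (cases "i < 3 \<or> j < 3")
    case False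
    define i' where "i' = i - 3"
    define j' where "j' = j - 3"
    have ij: "i = i' + 3" "j = Suc j' + 2"
      using False unfolding i'_def j'_def by linarith+
    have "of_nat (Suc i') * a (Suc i') (Suc j') + of_nat (Suc (Suc j')) * cnj (b (Suc (Suc j')) i') = 0"
      using main[of "Suc i'" "Suc j'"] main[of "Suc (Suc j')" i'] by simp
    thus ?thesis using e5[of i' "Suc j'"] ij by (simp del: of_nat_Suc)
  qed (rule G)
qed

section \<open>Series independent of t\<close>

lemma coeff_numeral [simp]: "xyt_coeff (numeral n * f) i j k = numeral n * xyt_coeff f i j k"
  by (simp add: xyt_coeff_def numeral_fps_const)

lemma rigid_iff: "opC f = 0 \<longleftrightarrow> (\<forall>i j k. xyt_coeff f i j (Suc k) = 0)"
proof
  assume "opC f = 0"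
  hence "xyt_coeff (opC f) i j k = 0" for i j k by simp
  thus "\<forall>i j k. xyt_coeff f i j (Suc k) = 0" by (simp del: of_nat_Suc)
next
  assume "\<forall>i j k. xyt_coeff f i j (Suc k) = 0"
  thus "opC f = 0" by (intro ser3_eqI) simp
qed

lemma rigid_coeff:
  assumes "opC f = 0"
  shows "xyt_coeff (opV f) i j k = of_nat (Suc i) * xyt_coeff f (Suc i) j k"
    and "xyt_coeff (opU f) i j k = of_nat (Suc j) * xyt_coeff f i (Suc j) k"
  using assms by (simp_all add: rigid_iff coeff_opV coeff_opU)

lemma rigid_op: "opC f = 0 \<Longrightarrow> opC (opV f) = 0" "opC f = 0 \<Longrightarrow> opC (opU f) = 0" "opC f = 0 \<Longrightarrow> opC (bar3 f) = 0"
  "opC f = 0 \<Longrightarrow> opC (smul a f) = 0"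
     apply (simp_all add: opV_opC[symmetric] opU_opC[symmetric])
  by (metis bar3_opC neg_equal_0_iff_equal op_zero(4))

lemma rigid_eqI:
  assumes "opC f = 0" "opC g = 0" "\<And>i j. xyt_coeff f i j 0 = xyt_coeff g i j 0"
  shows "f = g"
proof (rule ser3_eqI)
  fix i j k show "xyt_coeff f i j k = xyt_coeff g i j k"
    using assms by (cases k) (simp_all add: rigid_iff)
qed

text \<open>\<open>g $ n\<close> will be the coefficient of \<zeta>^n free of the conjugate of
  \<open>\<zeta>\<close>. Its derivatives are known through two cubic solutions \<open>P\<close> and
  \<open>Q\<close>, and equality of mixed derivatives ties these together. A multiple of X^3 escapes
  the argument because the end result is only that four \<open>X\<close>-derivatives and one
  \<open>Y\<close>-derivative vanish.\<close>

lemma rigid_step: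
  fixes g P Q :: "ser3 fps"
  assumes P: "Ptype P" and Q: "Ptype Q"
    and rig: "\<And>n. opC (g $ n) = 0"
    and herm: "bar3 (g $ 0) = g $ 0"
    and x: "\<And>n. xdiv 3 (g $ n)"
    and e0: "opU (g $ 0) = P $ 0 + bar3 (Q $ 0)" "opV (g $ 0) = Q $ 0 + bar3 (P $ 0)"
    and en: "\<And>n. n > 0 \<Longrightarrow> opU (g $ n) = P $ n" "\<And>n. n > 0 \<Longrightarrow> opV (g $ n) = Q $ n"
    and g33: "xyt_coeff (g $ 0) 3 3 0 = 0"
    and g1: "xyt_coeff (g $ 1) 3 1 0 = 0" "xyt_coeff (g $ 1) 4 1 0 = 0"
      "xyt_coeff (g $ 1) 4 0 0 = 0" "xyt_coeff (g $ 1) 5 0 0 = 0"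
  shows "xyt_coeff (g $ 2) 5 0 0 = 0 \<Longrightarrow> g $ 0 = 0 \<and>
           (\<forall>n i j k. (i, j, k) \<noteq> (3, 0, 0) \<longrightarrow> xyt_coeff (g $ n) i j k = 0)"
proof -
  define p where "p = P $ 0"
  define q where "q = Q $ 0"
  define f21 where "f21 = phi21 p"
  define f12 where "f12 = phi12 p"
  define f03 where "f03 = phi03 p"
  have p3: "opV (opV (opV p)) = 0" unfolding p_def by (rule Ptype_0[OF P])
  have q3: "opV (opV (opV q)) = 0" unfolding q_def by (rule Ptype_0[OF Q])
  have bp3: "opU (opU (opU (bar3 p))) = 0" "opU (opU (opU (bar3 q))) = 0"
    using arg_cong[OF p3, of bar3] arg_cong[OF q3, of bar3] by (simp_all add: bar3_opV)
  note rigs = rigid_op rig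
  have comm: "opV (opU f) = opU (opV f)" if "opC f = 0" for f
    using that by (simp add: opV_opU)
  have bp: "bar3 p = opV (g $ 0) - q" and bq: "bar3 q = opU (g $ 0) - p"
    using e0 by (simp_all add: p_def q_def)
  \<comment> \<open>For n = 1 the derivative of \<open>g\<close> is \<open>P $ 1\<close> itself, so
    \<open>f21\<close> inherits independence of \<open>t\<close> from \<open>g $ 1\<close>. Nothing
    of the kind is known for \<open>p\<close>, of which only the sum with a conjugate is
    rigid.\<close>
  have m21: "smul (-3) f21 = opV (opV (opV (opU (g $ 1))))"
    using Ptype_1[OF P] en(1)[of 1]
    by (intro ser3_eqI) (simp add: f21_def p_def)
  have q21: "smul (-3) (phi21 q) = opV (opV (opV (opV (g $ 1))))"
    using Ptype_1[OF Q] en(2)[of 1]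
    by (intro ser3_eqI) (simp add: q_def)
  have r21: "opC f21 = 0"
  proof -
    have "opC (smul (-3) f21) = 0" unfolding m21 by (intro rigs)
    thus ?thesis by (simp add: smul_eq_0_iff)
  qed
  have rq21: "opC (phi21 q) = 0"
  proof -
    have "opC (smul (-3) (phi21 q)) = 0" unfolding q21 by (intro rigs)
    thus ?thesis by (simp add: smul_eq_0_iff)
  qed
  have pg: "phi21 (opV (g $ 0)) = opU (opV (opV (opV (g $ 0))))" "phi21 (opU (g $ 0)) = opU (opV (opV (opU (g $ 0))))"
    by (simp_all add: phi21_def rigs)
  have b12: "bar3 f12 = opU (opV (opV (opV (g $ 0)))) - phi21 q"
    unfolding f12_def bar3_phi12 bp phi_diff pg ..
  have r12: "opC f12 = 0"
  proof -
    have "opC (bar3 f12) = 0" unfolding b12 by (simp add: rq21) (intro rigs)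
    thus ?thesis using rigid_op(3) by (metis bar3_bar3)
  qed
  have e03: "f03 = opU (opU (opU (opU (g $ 0))))"
  proof -
    have "p = opU (g $ 0) - bar3 q" using e0 by (simp add: p_def q_def)
    thus ?thesis using bp3 by (simp add: f03_def phi03_def)
  qed
  have r03: "opC f03 = 0" unfolding e03 by (intro rigs)
  define a where "a = (\<lambda>i j. xyt_coeff f21 i j 0)"
  define b where "b = (\<lambda>i j. xyt_coeff f12 i j 0)"
  define G where "G = (\<lambda>i j. xyt_coeff (g $ 0) i j 0)"
  have d: "xyt_coeff f03 i j 0 = of_nat (Suc j) * of_nat (Suc (Suc j)) * of_nat (Suc (Suc (Suc j)))
      * of_nat (Suc (Suc (Suc (Suc j)))) * G i (j + 4)" for i j
    unfolding e03 by (simp add: rigid_coeff rigs G_def eval_nat_numeral del: of_nat_Suc)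
  have G0: "G i j = 0" if "i < 3 \<or> j < 3" for i j
  proof (cases "i < 3")
    case True thus ?thesis using x[of 0] by (simp add: G_def xdiv_def)
  next
    case False
    have "G i j = cnj (G j i)"
      unfolding G_def by (subst herm[symmetric]) simp
    thus ?thesis using x[of 0] that False by (simp add: G_def xdiv_def)
  qed
  have G33: "G 3 3 = 0" using g33 by (simp add: G_def)
  \<comment> \<open>Both sides arise from V^4 U applied to \<open>g $ 1\<close>, once through
    \<open>P\<close> and once through \<open>Q\<close>.\<close>
  have e5': "opV f21 + opU (bar3 f12) = opU (opU (opV (opV (opV (g $ 0)))))"
  proof -
    have "opV (smul (-3) f21) = opU (smul (-3) (phi21 q))"
      unfolding m21 q21 by (simp add: comm rigs)
    hence "smul (-3) (opV f21) = smul (-3) (opU (phi21 q))" by simp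
    hence "opV f21 = opU (phi21 q)" by (simp add: smul_def)
    thus ?thesis unfolding b12 by simp
  qed
  have nz: "(of_nat (Suc n) :: complex) \<noteq> 0" for n by (simp del: of_nat_Suc)
  have RR: "((i, j) \<notin> {(0,0), (0,1), (1,0)} \<longrightarrow> a i j = 0 \<and> b i j = 0) \<and> G i j = 0 \<and> a 1 0 + cnj (b 1 0) = 0" for i j
  proof -
    have 1: "a (Suc (Suc i)) j = 0" for i j
      using arg_cong[OF phi_rel1[OF p3], of "\<lambda>f. xyt_coeff f i j 0"]
      by (simp add: a_def rigid_coeff rigs r21 del: of_nat_Suc flip: f21_def)
    have 2: "2 * (of_nat (Suc i) * of_nat (Suc (Suc i)) * b (Suc (Suc i)) j) = of_nat (Suc i) * of_nat (Suc j) * a (Suc i) (Suc j)" for i j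
      using arg_cong[OF phi_rel2[OF p3], of "\<lambda>f. xyt_coeff f i j 0"]
      by (simp add: a_def b_def rigid_coeff rigs r21 r12 mult_ac del: of_nat_Suc coeff_opC flip: f21_def f12_def)
    have 3: "of_nat (Suc i) * of_nat (Suc j) * b (Suc i) (Suc j)
        = 2 * (of_nat (Suc j) * of_nat (Suc (Suc j)) * a i (Suc (Suc j)))
          - of_nat (Suc i) * of_nat (Suc (Suc i)) * xyt_coeff f03 (Suc (Suc i)) j 0" for i j
      using arg_cong[OF phi_rel3[OF p3], of "\<lambda>f. xyt_coeff f i j 0"]
      by (simp add: a_def b_def rigid_coeff rigs r21 r12 r03 mult_ac del: of_nat_Suc coeff_opC flip: f21_def f12_def f03_def)
    have 4: "of_nat (Suc j) * of_nat (Suc (Suc j)) * b i (Suc (Suc j)) = of_nat (Suc i) * of_nat (Suc j) * xyt_coeff f03 (Suc i) (Suc j) 0" for i j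
      using arg_cong[OF phi_rel4[OF p3], of "\<lambda>f. xyt_coeff f i j 0"]
      by (simp add: a_def b_def rigid_coeff rigs r21 r12 r03 mult_ac del: of_nat_Suc coeff_opC flip: f21_def f12_def f03_def)
    have 5: "of_nat (Suc i) * a (Suc i) j + of_nat (Suc j) * cnj (b (Suc j) i)
        = of_nat (Suc i) * of_nat (Suc (Suc i)) * of_nat (Suc (Suc (Suc i))) * of_nat (Suc j) * of_nat (Suc (Suc j)) * G (i + 3) (j + 2)" for i j
    proof -
      have "xyt_coeff (opV f21) i j 0 = of_nat (Suc i) * a (Suc i) j"
        by (simp only: a_def rigid_coeff[OF r21])
      moreover have "xyt_coeff (opU (bar3 f12)) i j 0 = of_nat (Suc j) * cnj (b (Suc j) i)"
        by (simp only: b_def rigid_coeff[OF rigid_op(3)[OF r12]] coeff_bar3)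
      moreover have "xyt_coeff (opU (opU (opV (opV (opV (g $ 0)))))) i j 0 = of_nat (Suc j) * (of_nat (Suc (Suc j)) *
         (of_nat (Suc i) * (of_nat (Suc (Suc i)) * (of_nat (Suc (Suc (Suc i))) * G (Suc (Suc (Suc i))) (Suc (Suc j))))))"
        by (simp only: G_def rigid_coeff rigid_op rig)
      moreover have "i + 3 = Suc (Suc (Suc i))" "j + 2 = Suc (Suc j)" by simp_all
      ultimately show ?thesis
        using arg_cong[OF e5', of "\<lambda>f. xyt_coeff f i j 0"] by (simp only: coeff_add mult_ac)
    qed
    note R = rigid_coefficients[of a b G, OF 1 2 3[unfolded d] 4[unfolded d] 5 G0 G33]
    show ?thesis using R(1)[of i j] R(2)[of i j] R(3) by simp
  qed
  have g0: "g $ 0 = 0"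
    by (rule rigid_eqI) (use RR rig in \<open>simp_all add: G_def\<close>)
  have c21: "-3 * a i j = of_nat (Suc i) * of_nat (Suc (Suc i)) * of_nat (Suc (Suc (Suc i))) * of_nat (Suc j) * xyt_coeff (g $ 1) (i + 3) (Suc j) 0" for i j
    using arg_cong[OF m21, of "\<lambda>f. xyt_coeff f i j 0"]
    by (simp add: a_def rigid_coeff rigs mult_ac eval_nat_numeral del: of_nat_Suc)
  have c12: "3 * cnj (b j i) = of_nat (Suc i) * of_nat (Suc (Suc i)) * of_nat (Suc (Suc (Suc i))) * of_nat (Suc (Suc (Suc (Suc i)))) * xyt_coeff (g $ 1) (i + 4) j 0" for i j
  proof -
    have "cnj (b j i) = - xyt_coeff (phi21 q) i j 0"
      using arg_cong[OF b12, of "\<lambda>f. xyt_coeff f i j 0"] by (simp add: b_def g0)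
    thus ?thesis using arg_cong[OF q21, of "\<lambda>f. xyt_coeff f i j 0"]
      by (simp add: a_def rigid_coeff rigs mult_ac eval_nat_numeral del: of_nat_Suc)
  qed
  \<comment> \<open>The coefficients left open by the scalar relations are multiples of normalized
    coefficients of \<open>g $ 1\<close>. Only \<open>a 0 1\<close> remains; it is visible in
    \<open>g $ 2\<close>.\<close>
  have a00: "a 0 0 = 0" using c21[of 0 0] g1(1) by simp
  have a10: "a 1 0 = 0" using c21[of 1 0] g1(2) by simp
  have b10: "b 1 0 = 0" using RR a10 by simp
  have b00: "b 0 0 = 0" using c12[of 0 0] g1(3) by simp
  have b01: "b 0 1 = 0" using c12[of 0 1] g1(4) by simp
  have "b i j = 0" for i j
    using RR[of i j] b00 b01 b10 by blast
  hence f12: "f12 = 0" by (intro rigid_eqI[of f12 0]) (simp_all add: b_def r12)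
  have f03: "f03 = 0" unfolding e03 g0 by simp
  have q21': "phi21 q = 0" using b12 by (simp add: g0 f12)
  have q03: "phi03 q = 0"
  proof -
    have "q = - bar3 p" using bp g0 by simp
    thus ?thesis using bp3 by (simp add: phi03_def)
  qed
  have q12: "phi12 q = - bar3 f21"
  proof -
    have "phi12 q = bar3 (phi21 (bar3 q))" by (simp add: bar3_phi21)
    also have "bar3 q = - p" using bq g0 by simp
    also have "phi21 (- p) = - f21" by (simp add: f21_def phi21_def)
    finally show ?thesis by simp
  qed
  assume g2: "xyt_coeff (g $ 2) 5 0 0 = 0"
  have Q1: "Q $ 1 = opV (g $ 1)" "Q $ 2 = opV (g $ 2)" using en(2)[of 1] en(2)[of 2] by simp_all
  \<comment> \<open>The coefficient of \<zeta>^2 in the equation for \<open>Q\<close>, with the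
    three words in \<open>opU\<close> and \<open>opV\<close> equal because of rigidity. It contains
    \<open>phi12 q\<close>, which is minus the conjugate of \<open>f21\<close>.\<close>
  have "xyt_coeff (opV (opV (opV (opV (g $ 2))))) 1 0 0 =
     - (3 * xyt_coeff (opU (opV (opV (opV (g $ 1))))) 1 0 0 + 3 * xyt_coeff (phi12 q) 1 0 0)"
    using arg_cong[OF Ptype_2[OF Q], of "\<lambda>f. xyt_coeff f 1 0 0"] unfolding Q1 q_def[symmetric]
    by (simp add: comm rigs)
  moreover have "xyt_coeff (opU (opV (opV (opV (g $ 1))))) 1 0 0 = 0"
    using g1(2) by (simp add: rigid_coeff rigs eval_nat_numeral del: of_nat_Suc)
  moreover have "xyt_coeff (opV (opV (opV (opV (g $ 2))))) 1 0 0 = 0"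
    using g2 by (simp add: rigid_coeff rigs eval_nat_numeral del: of_nat_Suc)
  ultimately have "xyt_coeff (phi12 q) 1 0 0 = 0" by simp
  hence a01: "a 0 1 = 0" by (simp add: q12 a_def)
  have "a i j = 0" for i j
    using RR[of i j] a00 a01 a10 by blast
  hence f21: "f21 = 0" by (intro rigid_eqI[of f21 0]) (simp_all add: a_def r21)
  have PV: "n > 0 \<Longrightarrow> P $ n = 0" for n
    using f21 f12 f03 unfolding f21_def f12_def f03_def p_def
    by (rule Ptype_vanish[OF P]) (use en(1) x xdiv_op(1) in metis)
  have U0: "n > 0 \<Longrightarrow> opU (g $ n) = 0" for n using en(1) PV by simp
  have V4: "opV (opV (opV (opV (g $ n)))) = 0" if "n > 0" for n
  proof -
    have "opV (opV (opV (Q $ n))) = 0"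
    proof (rule Ptype_triangular[OF Q])
      show "phi21 (Q $ 0) = 0" "phi12 (Q $ 0) = 0" "phi03 (Q $ 0) = 0"
        using q21' q12 q03 f21 by (simp_all add: q_def)
      show "opU (Q $ m) = 0 \<and> opC (Q $ m) = 0" if "0 < m" for m
        using U0[OF that] comm[OF rig, of m] by (simp add: en(2)[OF that, symmetric] rigs)
    qed (use that in auto)
    thus ?thesis using en(2)[OF that] by simp
  qed
  \<comment> \<open>\<open>U0\<close> removes all powers of \<open>Y\<close>, \<open>V4\<close> all
    powers of \<open>X\<close> from the fourth on, and divisibility by X^3 the lower ones.\<close>
  have "xyt_coeff (g $ n) i j k = 0" if "(i, j, k) \<noteq> (3, 0, 0)" for n i j k
  proof (cases "n = 0 \<or> k > 0 \<or> i < 3")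
    case True
    thus ?thesis using g0 rig[of n] x[of n] by (cases k) (auto simp: rigid_iff xdiv_def)
  next
    case False
    hence n: "n > 0" and [simp]: "k = 0" and i: "i \<ge> 3" by auto
    show ?thesis
    proof (cases j)
      case (Suc j')
      show ?thesis using arg_cong[OF U0[OF n], of "\<lambda>f. xyt_coeff f i j' 0"] Suc
        by (simp add: rigid_coeff rig del: of_nat_Suc)
    next
      case 0
      hence "i = Suc (Suc (Suc (Suc (i - 4))))" using that i by simp
      thus ?thesis using arg_cong[OF V4[OF n], of "\<lambda>f. xyt_coeff f (i - 4) j 0"]
        by (simp add: rigid_coeff rigs del: of_nat_Suc)
    qed
  qed
  thus "g $ 0 = 0 \<and> (\<forall>n i j k. (i, j, k) \<noteq> (3, 0, 0) \<longrightarrow> xyt_coeff (g $ n) i j k = 0)"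
    using g0 by blast
qed

section \<open>From the conditions on the leaves to the vanishing of the lowest part\<close>

lemma dT_0_rigid: "dT f = 0 \<Longrightarrow> opC f = 0 \<and> opV f = dX f \<and> opU f = dY f"
  by (simp add: opC_def opV_def opU_def)

lemma opV5_coeff_0: "xyt_coeff (opV (opV (opV (opV (opV f))))) 0 0 k = 120 * xyt_coeff f 5 0 k"
  by (simp add: coeff_opV eval_nat_numeral)

lemma ser3_constI:
  assumes "dX f = 0" "dY f = 0" "dT f = 0" "xyt_coeff f 0 0 0 = 0"
  shows "f = 0"
proof (rule ser3_eqI)
  fix i j k
  have "i \<noteq> 0 \<Longrightarrow> xyt_coeff f i j k = 0" using arg_cong[OF assms(1), of "\<lambda>f. xyt_coeff f (i - 1) j k"]
    by (simp del: of_nat_Suc of_nat_diff)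
  moreover have "j \<noteq> 0 \<Longrightarrow> xyt_coeff f i j k = 0" using arg_cong[OF assms(2), of "\<lambda>f. xyt_coeff f i (j - 1) k"]
    by (simp del: of_nat_Suc of_nat_diff)
  moreover have "k \<noteq> 0 \<Longrightarrow> xyt_coeff f i j k = 0" using arg_cong[OF assms(3), of "\<lambda>f. xyt_coeff f i j (k - 1)"]
    by (simp del: of_nat_Suc of_nat_diff)
  ultimately show "xyt_coeff f i j k = xyt_coeff 0 i j k" using assms(4) by (cases "i = 0 \<and> j = 0 \<and> k = 0") auto
qed

text \<open>A coefficient of (a Y + X) f_Y + (conj a X + Y) f_X - r f: the part linear in
  \<open>X\<close> and \<open>Y\<close> of the field that moves the origin in the direction of
  \<open>\<zeta>\<close>, less the rescaling of \<open>w\<close>.\<close>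

definition rot_coeff :: "complex \<Rightarrow> complex \<Rightarrow> ser3 \<Rightarrow> nat \<Rightarrow> nat \<Rightarrow> nat \<Rightarrow> complex" where
  "rot_coeff a r f i j k = (a * of_nat j + cnj a * of_nat i - r) * xyt_coeff f i j k
     + (if i = 0 then 0 else of_nat (Suc j) * xyt_coeff f (i - 1) (Suc j) k)
     + (if j = 0 then 0 else of_nat (Suc i) * xyt_coeff f (Suc i) (j - 1) k)"

lemma rot_coeff_0 [simp]: "rot_coeff a r 0 i j k = 0"
  by (simp add: rot_coeff_def)

text \<open>\<open>H $ q $ p\<close> is the coefficient of the q-th power of the conjugate of
  \<open>\<zeta>\<close> times \<zeta>^p. The hypotheses \<open>S\<close> and \<open>Z\<close> are
  conditional because the fields behind them take their simple form only once \<open>H\<close> is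
  independent of \<open>t\<close>. \<open>T\<close> removes \<open>t\<close>, \<open>S\<close>
  everything but a multiple of X^3, and \<open>Z\<close> the rest; \<open>Z\<close> also supplies
  the vanishing of X^5 in \<open>H $ 0 $ 2\<close> on which the use of \<open>S\<close>
  relies.\<close>

lemma leaf_vanish:
  fixes H :: "ser3 fps fps"
  assumes nu: "\<nu> \<ge> 3"
    and x3: "\<And>p. xdiv 3 (H $ 0 $ p)"
    and herm: "\<And>q p. H $ q $ p = bar3 (H $ p $ q)"
    and wt: "\<And>q p i j k. xyt_coeff (H $ q $ p) i j k \<noteq> 0 \<Longrightarrow> i + j + 2 * k = \<nu>"
    and h33: "\<And>k. xyt_coeff (H $ 0 $ 0) 3 3 k = 0"
    and h1: "\<And>i j k. i \<in> {3,4} \<Longrightarrow> j \<in> {0,1} \<Longrightarrow> xyt_coeff (H $ 0 $ 1) i j k = 0"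
    and h5: "xyt_coeff (H $ 0 $ 1) 5 0 0 = 0"
    and h2: "xyt_coeff (H $ 0 $ 2) 3 0 0 = 0"
    and T: "\<exists>P. Ptype P \<and> (\<forall>q p. dT (H $ q $ p) = (if q = 0 then P $ p else 0) + (if p = 0 then bar3 (P $ q) else 0))"
    and S: "(\<And>q p. dT (H $ q $ p) = 0) \<Longrightarrow> \<exists>P Q. Ptype P \<and> Ptype Q \<and>
        (\<forall>q p. dY (H $ q $ p) = (if q = 0 then P $ p else 0) + (if p = 0 then bar3 (Q $ q) else 0)) \<and>
        (\<forall>q p. dX (H $ q $ p) = (if q = 0 then Q $ p else 0) + (if p = 0 then bar3 (P $ q) else 0))"
    and Z: "(\<And>q p. dT (H $ q $ p) = 0) \<Longrightarrow> \<exists>R a r b. Ptype R \<and>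
        (\<forall>p i j k. of_nat (Suc p) * xyt_coeff (H $ 0 $ Suc p) i j k + b * of_nat p * xyt_coeff (H $ 0 $ p) i j k
            - of_nat (p - 1) * xyt_coeff (H $ 0 $ (p - 1)) i j k + xyt_coeff (H $ 1 $ p) i j k + rot_coeff a r (H $ 0 $ p) i j k
            = xyt_coeff (R $ p) i j k + (if p = 0 then xyt_coeff (bar3 (R $ 0)) i j k else 0))"
  shows "H = 0"
proof -
  have dT0: "dT (H $ q $ p) = 0" for q p
  proof -
    obtain P where P: "Ptype P" and HT: "\<And>q p. dT (H $ q $ p) = (if q = 0 then P $ p else 0) + (if p = 0 then bar3 (P $ q) else 0)"
      using T by blast
    have Pp: "P $ p = dT (H $ 0 $ p)" if "p > 0" for p using HT[of 0 p] that by simp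
    have th: "dT (H $ 0 $ 0) = P $ 0 + bar3 (P $ 0)" using HT[of 0 0] by simp
    have xT: "xdiv 3 (dT f)" if "xdiv 3 f" for f using that by (simp add: xdiv_def)
    have y3: "ydiv 3 (H $ 0 $ 0)" using x3[of 0] herm[of 0 0] xdiv_bar3[of 3 "H $ 0 $ 0"] by simp
    note c = cubic_vanish[OF Ptype_0[OF P] th xT[OF x3], of "P $ 1"]
    have y: "ydiv 3 (dT (H $ 0 $ 0))" using y3 by (simp add: ydiv_def)
    have t33: "xyt_coeff (dT (H $ 0 $ 0)) 3 3 k = 0" for k using h33 by simp
    have p1: "xdiv 3 (P $ 1)" using Pp[of 1] xT[OF x3] by simp
    have p1': "xyt_coeff (P $ 1) i j k = 0" if "i \<in> {3,4}" "j \<in> {0,1}" for i j k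
      using Pp[of 1] h1[OF that] by simp
    note c = c[OF y t33 Ptype_1[OF P] p1 p1']
    have P0: "P $ p = 0" if "p > 0" for p
      by (rule Ptype_vanish[OF P c(1-3) _ that]) (simp_all add: Pp xT x3)
    show ?thesis using HT[of q p] c(4) th P0 by (cases "q = 0"; cases "p = 0") auto
  qed
  note rg = dT_0_rigid[OF dT0]
  obtain P Q where P: "Ptype P" and Q: "Ptype Q"
    and HY: "\<And>q p. dY (H $ q $ p) = (if q = 0 then P $ p else 0) + (if p = 0 then bar3 (Q $ q) else 0)"
    and HX: "\<And>q p. dX (H $ q $ p) = (if q = 0 then Q $ p else 0) + (if p = 0 then bar3 (P $ q) else 0)"
    using S[OF dT0] by blast
  \<comment> \<open>In a term with both \<open>\<zeta>\<close> and its conjugate no cubic solution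
    contributes, so all derivatives vanish; a constant would have weight 0, not
    \<open>\<nu>\<close>.\<close>
  have Hpq: "H $ q $ p = 0" if "q > 0" "p > 0" for q p
  proof (rule ser3_constI)
    show "xyt_coeff (H $ q $ p) 0 0 0 = 0" using wt[of q p 0 0 0] nu by auto
  qed (use HX[of q p] HY[of q p] dT0 that in auto)
  obtain R a r b where R: "Ptype R" and
    Zp: "\<And>p i j k. of_nat (Suc p) * xyt_coeff (H $ 0 $ Suc p) i j k + b * of_nat p * xyt_coeff (H $ 0 $ p) i j k
            - of_nat (p - 1) * xyt_coeff (H $ 0 $ (p - 1)) i j k + xyt_coeff (H $ 1 $ p) i j k + rot_coeff a r (H $ 0 $ p) i j k
            = xyt_coeff (R $ p) i j k + (if p = 0 then xyt_coeff (bar3 (R $ 0)) i j k else 0)"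
    using Z[OF dT0] by blast
  have h41: "xyt_coeff (H $ 0 $ 1) 4 1 0 = 0" using h1[of 4 1 0] by simp
  \<comment> \<open>\<open>phi_rel1\<close> gives V^5 applied to \<open>R $ 1\<close> equal to zero,
    so \<open>R $ 1\<close> has no X^5. The relation \<open>Zp\<close> turns this coefficient into
    twice that of \<open>H $ 0 $ 2\<close>, because X^5 and X^4 Y are missing in
    \<open>H $ 0 $ 1\<close>.\<close>
  have g25: "xyt_coeff (H $ 0 $ 2) 5 0 0 = 0"
  proof -
    have "opV (opV (opV (opV (opV (R $ 1))))) = 0"
      unfolding Ptype_1[OF R] using phi_rel1[OF Ptype_0[OF R]] by simp
    hence "xyt_coeff (R $ 1) 5 0 0 = 0" using opV5_coeff_0[of "R $ 1" 0] by simp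
    moreover have "xyt_coeff (R $ 1) 5 0 0 = 2 * xyt_coeff (H $ 0 $ 2) 5 0 0"
      using Zp[of 1 5 0 0] h5 h41 Hpq[of 1 1] by (simp add: rot_coeff_def numeral_2_eq_2)
    ultimately show ?thesis by simp
  qed
  have x0: "H $ 0 $ 0 = 0 \<and> (\<forall>n i j k. (i, j, k) \<noteq> (3, 0, 0) \<longrightarrow> xyt_coeff (H $ 0 $ n) i j k = 0)"
  proof (rule rigid_step[OF P Q, of "H $ 0"])
    show "opC (H $ 0 $ n) = 0" for n using rg by blast
    show "bar3 (H $ 0 $ 0) = H $ 0 $ 0" using herm by metis
    show "xdiv 3 (H $ 0 $ n)" for n by (rule x3)
    show "opU (H $ 0 $ 0) = P $ 0 + bar3 (Q $ 0)" "opV (H $ 0 $ 0) = Q $ 0 + bar3 (P $ 0)"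
      using HX[of 0 0] HY[of 0 0] rg by simp_all
    show "opU (H $ 0 $ n) = P $ n" "opV (H $ 0 $ n) = Q $ n" if "n > 0" for n
      using HX[of 0 n] HY[of 0 n] rg that by simp_all
  qed (use h33 h1[of 3 1 0] h1[of 4 1 0] h1[of 4 0 0] h5 g25 in simp_all)
  have H0p: "H $ 0 $ p = 0" for p
  \<comment> \<open>X^3 has weight 3, so it can survive only for this \<open>\<nu>\<close>. There
    the normalization removes it from \<open>H $ 0 $ 1\<close>, and \<open>h2\<close>, the
    hypothesis on the coefficient 3, 0, 0, 2, from \<open>H $ 0 $ 2\<close>; the remaining powers of
    \<open>\<zeta>\<close> need the field behind \<open>Z\<close>.\<close>
  proof (cases "\<nu> = 3")
    case False
    have "xyt_coeff (H $ 0 $ p) i j k = 0" for i j k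
      using x0 wt[of 0 p i j k] False by (cases "(i, j, k) = (3, 0, 0)") auto
    thus ?thesis by (intro ser3_eqI) simp
  next
    case True
    have h01: "H $ 0 $ Suc 0 = 0"
    proof (rule ser3_eqI)
      show "xyt_coeff (H $ 0 $ Suc 0) i j k = xyt_coeff 0 i j k" for i j k
        using x0 h1[of 3 0 0] by (cases "(i, j, k) = (3, 0, 0)") auto
    qed
    have h02: "H $ 0 $ Suc (Suc 0) = 0"
    proof (rule ser3_eqI)
      show "xyt_coeff (H $ 0 $ Suc (Suc 0)) i j k = xyt_coeff 0 i j k" for i j k
        using x0 h2 by (cases "(i, j, k) = (3, 0, 0)") (auto simp: numeral_2_eq_2)
    qed
    have h10: "H $ Suc 0 $ 0 = 0" using herm[of "Suc 0" 0] h01 by simp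
    \<comment> \<open>\<open>R $ 0\<close> is thus purely imaginary, so that conjugation carries the
      vanishing of \<open>phi21\<close> over to \<open>phi12\<close>, and the cubic equation itself
      over to \<open>phi03\<close>.\<close>
    have R0: "R $ 0 + bar3 (R $ 0) = 0"
    proof (rule ser3_eqI)
      show "xyt_coeff (R $ 0 + bar3 (R $ 0)) i j k = xyt_coeff 0 i j k" for i j k
        using Zp[of 0 i j k] x0 h01 h10 by simp
    qed
    hence bR0: "bar3 (R $ 0) = - (R $ 0)" by (simp add: eq_neg_iff_add_eq_0 add.commute)
    have Rp: "R $ Suc p = 0" if "H $ 0 $ Suc (Suc p) = 0" "H $ 0 $ Suc p = 0" "H $ 0 $ p = 0" for p
    proof (rule ser3_eqI)
      show "xyt_coeff (R $ Suc p) i j k = xyt_coeff 0 i j k" for i j k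
        using Zp[of "Suc p" i j k] that Hpq[of 1 "Suc p"] by simp
    qed
    have R1: "R $ 1 = 0" using Rp[of 0] x0 h01 h02 by simp
    have f21: "phi21 (R $ 0) = 0" using Ptype_1[OF R] R1 by (simp add: smul_eq_0_iff)
    have f12: "phi12 (R $ 0) = 0"
    proof -
      have "bar3 (phi12 (R $ 0)) = - phi21 (R $ 0)" unfolding bar3_phi12 bR0 by (simp add: phi21_def)
      thus ?thesis using f21 by (metis bar3_bar3 neg_0_equal_iff_equal neg_equal_0_iff_equal op_zero(4))
    qed
    have f03: "phi03 (R $ 0) = 0"
    proof -
      have "opU (opU (opU (bar3 (R $ 0)))) = 0"
        using arg_cong[OF Ptype_0[OF R], of bar3] by (simp add: bar3_opV)
      thus ?thesis unfolding bR0 by (simp add: phi03_def)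
    qed
    show ?thesis
    proof (induction p rule: less_induct)
      case (less p)
      show ?case
      proof (cases "p \<le> 2")
        case True
        hence "p = 0 \<or> p = Suc 0 \<or> p = Suc (Suc 0)" by linarith
        thus ?thesis using x0 h01 h02 by blast
      next
        case False
        define n where "n = p - 2"
        have p: "p = Suc (Suc n)" "n > 0" using False by (simp_all add: n_def)
        \<comment> \<open>By induction all coefficients of \<open>R\<close> strictly between 0 and n
          + 1 vanish, while \<open>R $ Suc n\<close> is \<open>p\<close> times the series sought;
          hence the triangular argument applies to it.\<close>
        have V3: "opV (opV (opV (R $ Suc n))) = 0"
        proof (rule Ptype_triangular[OF R f21 f12 f03])
          fix m assume m: "0 < m" "m < Suc n"
          have "R $ m = 0" using Rp[of "m - 1"] less.IH[of "Suc m"] less.IH[of m] less.IH[of "m - 1"] m p by simp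
          thus "opU (R $ m) = 0 \<and> opC (R $ m) = 0" by simp
        qed simp
        have Rn: "R $ Suc n = smul (of_nat p) (H $ 0 $ p)"
        proof (rule ser3_eqI)
          show "xyt_coeff (R $ Suc n) i j k = xyt_coeff (smul (of_nat p) (H $ 0 $ p)) i j k" for i j k
            using Zp[of "Suc n" i j k] less.IH[of "Suc n"] less.IH[of n] p Hpq[of 1 "Suc n"] by simp
        qed
        have "xdiv 3 (R $ Suc n)" using x3[of p] unfolding Rn by (simp add: xdiv_def)
        with V3 have "R $ Suc n = 0" by (rule opV3_eq_0D)
        thus ?thesis using Rn p by (simp add: smul_eq_0_iff del: of_nat_Suc)
      qed
    qed
  qed
  have "H $ q $ p = 0" for q p
    using Hpq[of q p] H0p[of p] H0p[of q] herm[of q p] by (cases "q = 0"; cases "p = 0") auto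
  thus ?thesis by (simp add: fps_eq_iff)
qed

subsection \<open>Asymptotic and formal expansions\<close>

text \<open>Asymptotic rather than convergent expansion at 0 from the right: it passes through
  products, conjugation and compositions with controlled remainders, and it still determines all
  coefficients.\<close>

definition has_asymp :: "(real \<Rightarrow> complex) \<Rightarrow> complex fps \<Rightarrow> bool" where
  "has_asymp f x \<longleftrightarrow> (\<forall>N. (\<lambda>s. f s - (\<Sum>n<N. x $ n * of_real s ^ n)) \<in> O[at_right 0](\<lambda>s. of_real s ^ N))"

lemma has_asympD: "has_asymp f x \<Longrightarrow> (\<lambda>s. f s - (\<Sum>n<N. x $ n * of_real s ^ n)) \<in> O[at_right 0](\<lambda>s. of_real s ^ N)"
  by (simp add: has_asymp_def)

lemma bigo_power_mono:
  assumes "N \<le> m"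
  shows "(\<lambda>s::real. of_real s ^ m :: complex) \<in> O[at_right 0](\<lambda>s. of_real s ^ N)"
proof (rule bigoI[where c = 1])
  show "\<forall>\<^sub>F s in at_right 0. norm (of_real s ^ m :: complex) \<le> 1 * norm (of_real s ^ N :: complex)"
    unfolding eventually_at_right_field
    by (intro exI[of _ 1]) (simp add: norm_power power_decreasing assms)
qed

lemma bigo_poly:
  "(\<lambda>s. \<Sum>n\<in>A. c n * of_real s ^ (m n)) \<in> O[at_right 0](\<lambda>s. of_real s ^ N :: complex)"
  if "\<And>n. n \<in> A \<Longrightarrow> N \<le> m n"
  by (rule big_sum_in_bigo) (use bigo_power_mono that in \<open>auto intro: landau_o.big.cmult\<close>)

lemma has_asymp_bounded: "has_asymp f x \<Longrightarrow> f \<in> O[at_right 0](\<lambda>_. 1)"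
  using has_asympD[of f x 0] by simp

lemma has_asymp_cong:
  assumes "has_asymp f x" "eventually (\<lambda>s. f s = g s) (at_right 0)"
  shows "has_asymp g x"
  unfolding has_asymp_def
proof
  fix N
  have "eventually (\<lambda>s. f s - (\<Sum>n<N. x $ n * of_real s ^ n) = g s - (\<Sum>n<N. x $ n * of_real s ^ n)) (at_right 0)"
    using assms(2) by eventually_elim simp
  thus "(\<lambda>s. g s - (\<Sum>n<N. x $ n * of_real s ^ n)) \<in> O[at_right 0](\<lambda>s. of_real s ^ N)"
    by (rule iffD1[OF landau_o.big.in_cong has_asympD[OF assms(1)]])
qed

lemma has_asymp_const: "has_asymp (\<lambda>_. c) (fps_const c)"
  unfolding has_asymp_def
proof
  fix N show "(\<lambda>s. c - (\<Sum>n<N. fps_const c $ n * of_real s ^ n)) \<in> O[at_right 0](\<lambda>s. of_real s ^ N)"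
  proof (cases N)
    case (Suc M)
    have "(\<Sum>n<N. fps_const c $ n * of_real s ^ n) = c" for s :: real
      unfolding Suc by (subst sum.lessThan_Suc_shift) simp
    thus ?thesis by simp
  qed simp
qed

lemma has_asymp_monom: "has_asymp (\<lambda>s. c * of_real s ^ m) (fps_const c * fps_X ^ m)"
  unfolding has_asymp_def
proof
  fix N
  show "(\<lambda>s. c * of_real s ^ m - (\<Sum>n<N. (fps_const c * fps_X ^ m) $ n * of_real s ^ n)) \<in> O[at_right 0](\<lambda>s. of_real s ^ N)"
  proof (cases "m < N")
    case True
    have "(\<Sum>n<N. (fps_const c * fps_X ^ m) $ n * of_real s ^ n) = (\<Sum>n<N. if n = m then c * of_real s ^ m else 0)" for s
      by (intro sum.cong) (auto simp: fps_X_power_iff)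
    thus ?thesis using True by simp
  next
    case False
    have "(\<Sum>n<N. (fps_const c * fps_X ^ m) $ n * of_real s ^ n) = 0" for s :: real
      using False by (intro sum.neutral) (auto simp: fps_X_power_iff)
    thus ?thesis using False by (simp add: landau_o.big.cmult bigo_power_mono)
  qed
qed

lemma has_asymp_add:
  assumes "has_asymp f x" "has_asymp g y"
  shows "has_asymp (\<lambda>s. f s + g s) (x + y)"
  unfolding has_asymp_def
proof
  fix N
  have "(\<lambda>s. (f s - (\<Sum>n<N. x $ n * of_real s ^ n)) + (g s - (\<Sum>n<N. y $ n * of_real s ^ n))) \<in> O[at_right 0](\<lambda>s. of_real s ^ N)"
    by (intro sum_in_bigo has_asympD assms)
  thus "(\<lambda>s. f s + g s - (\<Sum>n<N. (x + y) $ n * of_real s ^ n)) \<in> O[at_right 0](\<lambda>s. of_real s ^ N)"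
    by (simp add: algebra_simps sum.distrib)
qed

lemma has_asymp_mult:
  assumes "has_asymp f x" "has_asymp g y"
  shows "has_asymp (\<lambda>s. f s * g s) (x * y)"
  unfolding has_asymp_def
proof
  fix N
  define X where "X = (\<lambda>s::real. \<Sum>n<N. x $ n * of_real s ^ n)"
  define Y where "Y = (\<lambda>s::real. \<Sum>n<N. y $ n * of_real s ^ n)"
  have X1: "X \<in> O[at_right 0](\<lambda>_. 1)"
    using bigo_poly[of "{..<N}" 0 "\<lambda>n. n" "\<lambda>n. x $ n"] by (simp add: X_def)
  have 1: "(\<lambda>s. (f s - X s) * g s) \<in> O[at_right 0](\<lambda>s. of_real s ^ N)"
    using landau_o.big.mult[OF has_asympD[OF assms(1), of N] has_asymp_bounded[OF assms(2)]] by (simp add: X_def)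
  have 2: "(\<lambda>s. X s * (g s - Y s)) \<in> O[at_right 0](\<lambda>s. of_real s ^ N)"
    using landau_o.big.mult[OF X1 has_asympD[OF assms(2), of N]] by (simp add: Y_def)
  \<comment> \<open>The pairs of exponents whose product has order at least \<open>N\<close>: the
    excess of the product of the truncations over the truncated product.\<close>
  define D where "D = ({..<N} \<times> {..<N}) \<inter> {z. N \<le> fst z + snd z}"
  have 3: "X s * Y s - (\<Sum>n<N. (x * y) $ n * of_real s ^ n) = (\<Sum>z\<in>D. x $ fst z * y $ snd z * of_real s ^ (fst z + snd z))" for s
  proof -
    have "X s * Y s = (\<Sum>z\<in>{..<N} \<times> {..<N}. x $ fst z * y $ snd z * of_real s ^ (fst z + snd z))"
      by (simp add: X_def Y_def sum_product sum.cartesian_product split_beta power_add mult_ac)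
    also have "{..<N} \<times> {..<N} = D \<union> (({..<N} \<times> {..<N}) \<inter> {z. fst z + snd z < N})"
      by (auto simp: D_def)
    also have "(\<Sum>z\<in>D \<union> (({..<N} \<times> {..<N}) \<inter> {z. fst z + snd z < N}). x $ fst z * y $ snd z * of_real s ^ (fst z + snd z))
       = (\<Sum>z\<in>D. x $ fst z * y $ snd z * of_real s ^ (fst z + snd z)) +
         (\<Sum>z\<in>(({..<N} \<times> {..<N}) \<inter> {z. fst z + snd z < N}). x $ fst z * y $ snd z * of_real s ^ (fst z + snd z))"
      by (intro sum.union_disjoint) (auto simp: D_def)
    also have "(\<Sum>z\<in>(({..<N} \<times> {..<N}) \<inter> {z. fst z + snd z < N}). x $ fst z * y $ snd z * of_real s ^ (fst z + snd z))
       = (\<Sum>w\<in>Sigma {..<N} (\<lambda>n. {0..n}). x $ snd w * y $ (fst w - snd w) * of_real s ^ (fst w))"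
      by (rule sum.reindex_bij_witness[of _ "\<lambda>w. (snd w, fst w - snd w)" "\<lambda>z. (fst z + snd z, fst z)"]) auto
    also have "\<dots> = (\<Sum>n<N. (x * y) $ n * of_real s ^ n)"
      by (subst sum.Sigma[symmetric, of _ _ "\<lambda>n i. x $ i * y $ (n - i) * of_real s ^ n", unfolded split_beta])
         (simp_all add: fps_mult_nth sum_distrib_right)
    finally show ?thesis by simp
  qed
  have 4: "(\<lambda>s. X s * Y s - (\<Sum>n<N. (x * y) $ n * of_real s ^ n)) \<in> O[at_right 0](\<lambda>s. of_real s ^ N)"
    unfolding 3 by (rule bigo_poly) (simp add: D_def)
  have "(\<lambda>s. (f s - X s) * g s + X s * (g s - Y s) + (X s * Y s - (\<Sum>n<N. (x * y) $ n * of_real s ^ n))) \<in> O[at_right 0](\<lambda>s. of_real s ^ N)"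
    by (rule sum_in_bigo(1)[OF sum_in_bigo(1)[OF 1 2] 4])
  thus "(\<lambda>s. f s * g s - (\<Sum>n<N. (x * y) $ n * of_real s ^ n)) \<in> O[at_right 0](\<lambda>s. of_real s ^ N)"
    by (simp add: algebra_simps)
qed

lemma has_asymp_cnj:
  assumes "has_asymp f x"
  shows "has_asymp (\<lambda>s. cnj (f s)) (fps_map cnj x)"
  unfolding has_asymp_def
proof
  fix N
  have "norm (cnj (f s) - (\<Sum>n<N. fps_map cnj x $ n * of_real s ^ n)) = norm (f s - (\<Sum>n<N. x $ n * of_real s ^ n))" for s
    by (subst complex_mod_cnj[symmetric]) simp
  thus "(\<lambda>s. cnj (f s) - (\<Sum>n<N. fps_map cnj x $ n * of_real s ^ n)) \<in> O[at_right 0](\<lambda>s. of_real s ^ N)"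
    using has_asympD[OF assms, of N] by (subst landau_o.big.norm_iff[symmetric]) (simp add: landau_o.big.norm_iff)
qed

lemma has_asymp_zero:
  assumes "has_asymp f x" "eventually (\<lambda>s. f s = 0) (at_right 0)"
  shows "x = 0"
proof -
  have "x $ n = 0" for n
  proof (induction n rule: less_induct)
    case (less n)
    have "(\<Sum>m<Suc n. x $ m * of_real s ^ m) = x $ n * of_real s ^ n" for s :: real
      using less by simp
    hence "(\<lambda>s. f s - x $ n * of_real s ^ n) \<in> O[at_right 0](\<lambda>s. of_real s ^ Suc n)"
      using has_asympD[OF assms(1), of "Suc n"] by simp
    then obtain c where c: "eventually (\<lambda>s. norm (f s - x $ n * of_real s ^ n) \<le> c * norm (of_real s ^ Suc n :: complex)) (at_right (0::real))"
      by (elim landau_o.bigE)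
    have "eventually (\<lambda>s. norm (x $ n) \<le> c * s) (at_right (0::real))"
      using c assms(2) eventually_at_right_less[of "0::real"]
    proof eventually_elim
      case (elim s)
      hence "norm (x $ n) * s ^ n \<le> (c * s) * s ^ n" by (simp add: norm_mult norm_power mult_ac)
      thus ?case using elim(3) by (subst (asm) mult_le_cancel_right) simp
    qed
    moreover have "((\<lambda>s. c * s) \<longlongrightarrow> c * 0) (at_right (0::real))"
      by (intro tendsto_intros)
    ultimately have "norm (x $ n) \<le> c * 0"
      by (intro tendsto_lowerbound[of "\<lambda>s. c * s"]) auto
    thus ?case by simp
  qed
  thus ?thesis by (simp add: fps_eq_iff)
qed

lemma has_asymp_minus: "has_asymp f x \<Longrightarrow> has_asymp (\<lambda>s. - f s) (- x)"
  using has_asymp_mult[OF has_asymp_const[of "-1"], of f x] by (simp flip: fps_const_neg)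

lemma has_asymp_diff: "has_asymp f x \<Longrightarrow> has_asymp g y \<Longrightarrow> has_asymp (\<lambda>s. f s - g s) (x - y)"
  using has_asymp_add[OF _ has_asymp_minus, of f x g y] by simp

lemma has_asymp_unique:
  assumes "has_asymp f x" "has_asymp g y" "eventually (\<lambda>s. f s = g s) (at_right 0)"
  shows "x = y"
proof -
  have "x - y = 0"
    by (rule has_asymp_zero[OF has_asymp_diff[OF assms(1,2)]]) (use assms(3) in eventually_elim, simp)
  thus ?thesis by simp
qed

lemma has_asymp_power: "has_asymp f x \<Longrightarrow> has_asymp (\<lambda>s. f s ^ n) (x ^ n)"
  by (induction n) (use has_asymp_const[of 1] in \<open>auto intro: has_asymp_mult\<close>)

lemma has_asymp_sum: "(\<And>i. i \<in> A \<Longrightarrow> has_asymp (f i) (x i)) \<Longrightarrow> has_asymp (\<lambda>s. \<Sum>i\<in>A. f i s) (\<Sum>i\<in>A. x i)"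
  by (induction A rule: infinite_finite_induct) (use has_asymp_const[of 0] in \<open>auto intro: has_asymp_add\<close>)

text \<open>Grouping the terms by exponent leaves a tail that is at most (s/s0)^N times the total
  sum at \<open>s0\<close>. Infinitely many terms may share one exponent, as happens when
  \<open>\<zeta>\<close> carries weight 0.\<close>

lemma has_asymp_infsum:
  fixes a :: "'i \<Rightarrow> complex" and d :: "'i \<Rightarrow> nat"
  assumes sm: "(\<lambda>i. norm (a i) * s0 ^ d i) summable_on UNIV" and s0: "s0 > 0"
  shows "has_asymp (\<lambda>s. \<Sum>\<^sub>\<infinity>i. a i * of_real s ^ d i) (Abs_fps (\<lambda>n. \<Sum>\<^sub>\<infinity>i\<in>{i. d i = n}. a i))"
  unfolding has_asymp_def
proof
  fix N
  define C where "C = (\<Sum>\<^sub>\<infinity>i. norm (a i) * s0 ^ d i)"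
  have smA: "(\<lambda>i. norm (a i) * s0 ^ d i) summable_on A" for A
    using sm summable_on_subset_banach by blast
  have abs: "(\<lambda>i. norm (a i * of_real s ^ d i)) summable_on A" if "0 < s" "s \<le> s0" for s A
  proof (rule summable_on_comparison_test[OF smA[of A]])
    show "norm (a i * of_real s ^ d i) \<le> norm (a i) * s0 ^ d i" for i
      using that by (auto simp: norm_mult norm_power intro!: mult_left_mono power_mono)
  qed auto
  have sums: "(\<lambda>i. a i * of_real s ^ d i) summable_on A" if "0 < s" "s \<le> s0" for s A
    by (rule abs_summable_summable[OF abs[OF that]])
  have split: "(\<Sum>\<^sub>\<infinity>i. a i * of_real s ^ d i) = (\<Sum>n<N. (\<Sum>\<^sub>\<infinity>i\<in>{i. d i = n}. a i) * of_real s ^ n) + (\<Sum>\<^sub>\<infinity>i\<in>{i. N \<le> d i}. a i * of_real s ^ d i)"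
    if s: "0 < s" "s \<le> s0" for s N
  proof (induction N)
    case (Suc N)
    have "(\<Sum>\<^sub>\<infinity>i\<in>{i. N \<le> d i}. a i * of_real s ^ d i) = (\<Sum>\<^sub>\<infinity>i\<in>{i. d i = N} \<union> {i. Suc N \<le> d i}. a i * of_real s ^ d i)"
      by (rule arg_cong[of _ _ "infsum _"]) auto
    also have "\<dots> = (\<Sum>\<^sub>\<infinity>i\<in>{i. d i = N}. a i * of_real s ^ d i) + (\<Sum>\<^sub>\<infinity>i\<in>{i. Suc N \<le> d i}. a i * of_real s ^ d i)"
      by (rule infsum_Un_disjoint[OF sums[OF s] sums[OF s]]) auto
    also have "(\<Sum>\<^sub>\<infinity>i\<in>{i. d i = N}. a i * of_real s ^ d i) = (\<Sum>\<^sub>\<infinity>i\<in>{i. d i = N}. a i * of_real s ^ N)"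
      by (intro infsum_cong) auto
    also have "\<dots> = (\<Sum>\<^sub>\<infinity>i\<in>{i. d i = N}. a i) * of_real s ^ N"
      by (rule infsum_cmult_left') 
    finally show ?case using Suc by (simp add: add_ac)
  qed simp
  have bound: "norm (\<Sum>\<^sub>\<infinity>i\<in>{i. N \<le> d i}. a i * of_real s ^ d i) \<le> C / s0 ^ N * s ^ N" if s: "0 < s" "s \<le> s0" for s
  proof -
    have "norm (\<Sum>\<^sub>\<infinity>i\<in>{i. N \<le> d i}. a i * of_real s ^ d i) \<le> (\<Sum>\<^sub>\<infinity>i\<in>{i. N \<le> d i}. norm (a i * of_real s ^ d i))"
      by (rule norm_infsum_bound[OF abs[OF s]])
    also have "\<dots> \<le> (\<Sum>\<^sub>\<infinity>i\<in>{i. N \<le> d i}. (s / s0) ^ N * (norm (a i) * s0 ^ d i))"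
    proof (rule infsum_mono[OF abs[OF s] summable_on_cmult_right[OF smA]])
      fix i assume "i \<in> {i. N \<le> d i}"
      hence "(s / s0) ^ d i \<le> (s / s0) ^ N" using s by (intro power_decreasing) auto
      hence "norm (a i) * s0 ^ d i * (s / s0) ^ d i \<le> norm (a i) * s0 ^ d i * (s / s0) ^ N"
        using s0 by (intro mult_left_mono) auto
      thus "norm (a i * of_real s ^ d i) \<le> (s / s0) ^ N * (norm (a i) * s0 ^ d i)"
        using s s0 by (simp add: norm_mult norm_power power_divide mult_ac)
    qed
    also have "\<dots> = (s / s0) ^ N * (\<Sum>\<^sub>\<infinity>i\<in>{i. N \<le> d i}. norm (a i) * s0 ^ d i)"
      by (rule infsum_cmult_right')
    also have "\<dots> \<le> (s / s0) ^ N * C"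
      unfolding C_def using s s0 by (intro mult_left_mono infsum_mono_neutral smA) auto
    finally show ?thesis by (simp add: power_divide mult_ac)
  qed
  show "(\<lambda>s. (\<Sum>\<^sub>\<infinity>i. a i * of_real s ^ d i) - (\<Sum>n<N. Abs_fps (\<lambda>n. \<Sum>\<^sub>\<infinity>i\<in>{i. d i = n}. a i) $ n * of_real s ^ n)) \<in> O[at_right 0](\<lambda>s. of_real s ^ N)"
  proof (rule bigoI[where c = "C / s0 ^ N"])
    have "eventually (\<lambda>s. 0 < s \<and> s < s0) (at_right 0)"
      using s0 by (auto simp: eventually_at_right_field)
    thus "\<forall>\<^sub>F s in at_right 0. norm ((\<Sum>\<^sub>\<infinity>i. a i * of_real s ^ d i) - (\<Sum>n<N. Abs_fps (\<lambda>n. \<Sum>\<^sub>\<infinity>i\<in>{i. d i = n}. a i) $ n * of_real s ^ n))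
         \<le> C / s0 ^ N * norm (of_real s ^ N :: complex)"
    proof eventually_elim
      case (elim s)
      thus ?case using bound[of s] split[of s N] by (simp add: norm_power)
    qed
  qed
qed


section \<open>Evaluation of formal series along rays\<close>

definition fps_hom :: "('a::comm_ring_1 \<Rightarrow> 'b::comm_ring_1) \<Rightarrow> bool" where
  "fps_hom h \<longleftrightarrow> h 0 = 0 \<and> h 1 = 1 \<and> (\<forall>a b. h (a + b) = h a + h b) \<and> (\<forall>a b. h (a * b) = h a * h b)"

lemma fps_homD: assumes "fps_hom h" shows "h 0 = 0" "h 1 = 1" "h (a + b) = h a + h b" "h (a * b) = h a * h b"
  using assms by (auto simp: fps_hom_def)

lemma fps_hom_sum: "fps_hom h \<Longrightarrow> h (\<Sum>i\<in>A. f i) = (\<Sum>i\<in>A. h (f i))"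
  by (induction A rule: infinite_finite_induct) (auto simp: fps_hom_def)

lemma fps_hom_minus: assumes "fps_hom h" shows "h (- a) = - h a"
  using fps_homD(3)[OF assms, of "- a" a] fps_homD(1)[OF assms] by (simp add: eq_neg_iff_add_eq_0)

lemma fps_hom_diff: assumes "fps_hom h" shows "h (a - b) = h a - h b"
  using fps_homD(3)[OF assms, of a "- b"] fps_hom_minus[OF assms] by simp

lemma fps_hom_power: assumes "fps_hom h" shows "h (a ^ n) = h a ^ n"
  by (induction n) (use assms in \<open>auto simp: fps_hom_def\<close>)

text \<open>Substitutes \<open>x\<close> times the series variable for the outermost variable, after
  \<open>h\<close> has done the same in the coefficients. Iteration evaluates a nested series along
  a ray.\<close>

definition scale1 :: "complex \<Rightarrow> ('a::comm_ring_1 \<Rightarrow> complex fps) \<Rightarrow> 'a fps \<Rightarrow> complex fps" where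
  "scale1 x h f = Abs_fps (\<lambda>n. \<Sum>i\<le>n. x ^ i * h (f $ i) $ (n - i))"

lemma scale1_nth: "scale1 x h f $ n = (\<Sum>i\<le>n. x ^ i * h (f $ i) $ (n - i))"
  by (simp add: scale1_def)

lemma scale1_term: "(fps_const (x ^ i) * fps_X ^ i * g) $ n = (if i \<le> n then x ^ i * g $ (n - i) else 0)"
  for g :: "complex fps"
  by (simp add: mult.assoc fps_X_power_mult_nth)

lemma scale1_trunc:
  assumes "m \<le> N"
  shows "scale1 x h f $ m = (\<Sum>i\<le>N. fps_const (x ^ i) * fps_X ^ i * h (f $ i)) $ m"
proof -
  have "(\<Sum>i\<le>N. fps_const (x ^ i) * fps_X ^ i * h (f $ i)) $ m = (\<Sum>i\<le>N. if i \<le> m then x ^ i * h (f $ i) $ (m - i) else 0)"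
    by (simp only: fps_sum_nth scale1_term)
  also have "\<dots> = (\<Sum>i\<le>m. x ^ i * h (f $ i) $ (m - i))"
    by (rule sum.mono_neutral_cong_right) (use assms in auto)
  finally show ?thesis by (simp add: scale1_nth)
qed

lemma fps_hom_scale1:
  assumes h: "fps_hom h"
  shows "fps_hom (scale1 x h)"
  unfolding fps_hom_def
proof (intro conjI allI)
  show "scale1 x h 0 = 0" by (rule fps_ext) (simp add: scale1_nth fps_homD[OF h])
  show "scale1 x h 1 = 1"
  proof (rule fps_ext)
    fix n
    have "scale1 x h 1 $ n = (\<Sum>i\<le>n. if i = 0 then 1 $ n else 0)"
      unfolding scale1_nth by (intro sum.cong) (auto simp: fps_homD[OF h])
    thus "scale1 x h 1 $ n = 1 $ n" by simp
  qed
  show "scale1 x h (a + b) = scale1 x h a + scale1 x h b" for a b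
    by (rule fps_ext) (simp add: scale1_nth fps_homD[OF h] sum.distrib algebra_simps)
  show "scale1 x h (a * b) = scale1 x h a * scale1 x h b" for a b
  proof (rule fps_ext)
    fix n
    define Ta where "Ta = (\<lambda>i. fps_const (x ^ i) * fps_X ^ i * h (a $ i))"
    define Tb where "Tb = (\<lambda>i. fps_const (x ^ i) * fps_X ^ i * h (b $ i))"
    have "(scale1 x h a * scale1 x h b) $ n = (\<Sum>i=0..n. scale1 x h a $ i * scale1 x h b $ (n - i))"
      by (rule fps_mult_nth)
    also have "\<dots> = (\<Sum>i=0..n. (\<Sum>i\<le>n. Ta i) $ i * (\<Sum>i\<le>n. Tb i) $ (n - i))"
      unfolding Ta_def Tb_def by (intro sum.cong) (simp_all add: scale1_trunc)
    also have "\<dots> = ((\<Sum>i\<le>n. Ta i) * (\<Sum>i\<le>n. Tb i)) $ n"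
      by (rule fps_mult_nth [symmetric])
    also have "\<dots> = (\<Sum>i\<le>n. \<Sum>j\<le>n. (Ta i * Tb j) $ n)"
      by (simp add: sum_product fps_sum_nth)
    also have "\<dots> = (\<Sum>i\<le>n. \<Sum>j\<le>n. if i + j \<le> n then x ^ (i + j) * (h (a $ i) * h (b $ j)) $ (n - (i + j)) else 0)"
    proof (intro sum.cong refl)
      fix i j
      have "Ta i * Tb j = fps_const (x ^ (i + j)) * fps_X ^ (i + j) * (h (a $ i) * h (b $ j))"
        by (simp add: Ta_def Tb_def power_add mult_ac flip: fps_const_mult)
      thus "(Ta i * Tb j) $ n = (if i + j \<le> n then x ^ (i + j) * (h (a $ i) * h (b $ j)) $ (n - (i + j)) else 0)"
        by (simp only: scale1_term)
    qed
    also have "\<dots> = (\<Sum>z\<in>{..n} \<times> {..n}. if fst z + snd z \<le> n then x ^ (fst z + snd z) * (h (a $ fst z) * h (b $ snd z)) $ (n - (fst z + snd z)) else 0)"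
      by (simp add: sum.cartesian_product split_beta)
    also have "\<dots> = (\<Sum>z\<in>{z \<in> {..n} \<times> {..n}. fst z + snd z \<le> n}. x ^ (fst z + snd z) * (h (a $ fst z) * h (b $ snd z)) $ (n - (fst z + snd z)))"
      by (rule sum.mono_neutral_cong_right) auto
    also have "\<dots> = (\<Sum>w\<in>Sigma {..n} (\<lambda>i. {0..i}). x ^ (fst w) * (h (a $ snd w) * h (b $ (fst w - snd w))) $ (n - fst w))"
      by (rule sum.reindex_bij_witness[of _ "\<lambda>w. (snd w, fst w - snd w)" "\<lambda>z. (fst z + snd z, fst z)"]) auto
    also have "\<dots> = (\<Sum>i\<le>n. \<Sum>j=0..i. x ^ i * (h (a $ j) * h (b $ (i - j))) $ (n - i))"
      by (subst sum.Sigma[of _ _ "\<lambda>i j. x ^ i * (h (a $ j) * h (b $ (i - j))) $ (n - i)", unfolded split_beta]) simp_all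
    also have "\<dots> = scale1 x h (a * b) $ n"
      by (simp add: scale1_nth fps_mult_nth fps_hom_sum[OF h] fps_homD[OF h] fps_sum_nth sum_distrib_left)
    finally show "scale1 x h (a * b) $ n = (scale1 x h a * scale1 x h b) $ n" ..
  qed
qed

lemma scale1_const: assumes "fps_hom h" shows "scale1 x h (fps_const a) = h a"
proof (rule fps_ext)
  fix n
  have "scale1 x h (fps_const a) $ n = (\<Sum>i\<le>n. if i = 0 then h a $ n else 0)"
    unfolding scale1_nth by (intro sum.cong) (auto simp: fps_homD[OF assms])
  thus "scale1 x h (fps_const a) $ n = h a $ n" by simp
qed

lemma scale1_X: assumes "fps_hom h" shows "scale1 x h fps_X = fps_const x * fps_X"
proof (rule fps_ext)
  fix n
  have "scale1 x h fps_X $ n = (\<Sum>i\<le>n. if i = 1 then x * 1 $ (n - 1) else 0)"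
    unfolding scale1_nth by (intro sum.cong) (auto simp: fps_homD[OF assms])
  thus "scale1 x h fps_X $ n = (fps_const x * fps_X) $ n" by auto
qed

text \<open>Every coefficient of the image is a polynomial in \<open>x\<close>; vanishing for all
  \<open>x\<close> kills its coefficients.\<close>

lemma scale1_inj:
  assumes "\<And>x. scale1 x h f = 0"
  shows "h (f $ i) = 0"
proof (rule fps_ext)
  fix m
  have "(\<Sum>j\<le>m + i. h (f $ j) $ (m + i - j) * x ^ j) = 0" for x
    using arg_cong[OF assms[of x], of "\<lambda>f. f $ (m + i)"] by (simp add: scale1_nth mult.commute)
  hence "\<forall>j\<le>m + i. h (f $ j) $ (m + i - j) = 0"
    using polyfun_eq_0[of "\<lambda>j. h (f $ j) $ (m + i - j)" "m + i"] by blast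
  hence "h (f $ i) $ (m + i - i) = 0" by (metis le_add2)
  thus "h (f $ i) $ m = 0 $ m" by simp
qed

text \<open>In \<open>f $ q $ p\<close>, the exponent of \<open>\<zeta>\<close> is \<open>p\<close> and that of its conjugate is \<open>q\<close>.\<close>

type_synonym ser5 = "ser3 fps fps"

definition scale5 :: "complex \<Rightarrow> complex \<Rightarrow> complex \<Rightarrow> complex \<Rightarrow> complex \<Rightarrow> ser5 \<Rightarrow> complex fps" where
  "scale5 \<alpha> \<zeta> x y t = scale1 \<alpha> (scale1 \<zeta> (scale1 x (scale1 y (scale1 t fps_const))))"

lemma fps_hom_const: "fps_hom fps_const"
  by (simp add: fps_hom_def flip: fps_const_add fps_const_mult)

lemmas fps_hom_scales = fps_hom_const fps_hom_scale1

lemma fps_hom_scale5: "fps_hom (scale5 \<alpha> \<zeta> x y t)"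
  unfolding scale5_def by (intro fps_hom_scales)

definition vA :: ser5 where "vA = fps_X"
definition vZ :: ser5 where "vZ = fps_const fps_X"
definition vX :: ser5 where "vX = fps_const (fps_const fps_X)"
definition vY :: ser5 where "vY = fps_const (fps_const (fps_const fps_X))"
definition vT :: ser5 where "vT = fps_const (fps_const (fps_const (fps_const fps_X)))"
definition cst :: "complex \<Rightarrow> ser5" where "cst c = fps_const (fps_const (fps_const (fps_const (fps_const c))))"

lemma scale5_vars:
  "scale5 \<alpha> \<zeta> x y t vA = fps_const \<alpha> * fps_X"
  "scale5 \<alpha> \<zeta> x y t vZ = fps_const \<zeta> * fps_X"
  "scale5 \<alpha> \<zeta> x y t vX = fps_const x * fps_X"
  "scale5 \<alpha> \<zeta> x y t vY = fps_const y * fps_X"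
  "scale5 \<alpha> \<zeta> x y t vT = fps_const t * fps_X"
  "scale5 \<alpha> \<zeta> x y t (cst c) = fps_const c"
  by (simp_all add: scale5_def vA_def vZ_def vX_def vY_def vT_def cst_def scale1_X scale1_const fps_hom_scales)

definition deg5 :: "nat \<Rightarrow> (nat \<times> nat \<times> nat \<times> nat \<times> nat) set" where
  "deg5 n = {(q, p, i, j, k). q + p + i + j + k = n}"

lemma deg5_eq: "deg5 n = (\<lambda>(q, p, i, j). (q, p, i, j, n - q - p - i - j)) ` Sigma {..n} (\<lambda>q. Sigma {..n - q} (\<lambda>p. Sigma {..n - q - p} (\<lambda>i. {..n - q - p - i})))"
  by (force simp: deg5_def image_iff)

lemma finite_deg5 [simp]: "finite (deg5 n)"
  unfolding deg5_eq by (intro finite_imageI finite_SigmaI) auto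

lemma scale5_nth:
  "scale5 \<alpha> \<zeta> x y t f $ n = (\<Sum>(q, p, i, j, k)\<in>deg5 n. f $ q $ p $ i $ j $ k * \<alpha> ^ q * \<zeta> ^ p * x ^ i * y ^ j * t ^ k)"
proof -
  have inner: "scale1 t fps_const g $ m = t ^ m * g $ m" for g m
  proof -
    have "scale1 t fps_const g $ m = (\<Sum>i\<le>m. if i = m then t ^ m * g $ m else 0)"
      unfolding scale1_nth by (intro sum.cong) auto
    thus ?thesis by simp
  qed
  define T where "T = Sigma {..n} (\<lambda>q. Sigma {..n - q} (\<lambda>p. Sigma {..n - q - p} (\<lambda>i. {..n - q - p - i})))"
  have inj: "inj_on (\<lambda>(q, p, i, j). (q, p, i, j, n - q - p - i - j)) T"
    by (auto simp: inj_on_def)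
  have "scale5 \<alpha> \<zeta> x y t f $ n = (\<Sum>q\<le>n. \<Sum>p\<le>n - q. \<Sum>i\<le>n - q - p. \<Sum>j\<le>n - q - p - i.
      f $ q $ p $ i $ j $ (n - q - p - i - j) * \<alpha> ^ q * \<zeta> ^ p * x ^ i * y ^ j * t ^ (n - q - p - i - j))"
    unfolding scale5_def by (simp add: scale1_nth[of _ "scale1 _ _"] inner sum_distrib_left mult_ac)
  also have "\<dots> = (\<Sum>(q, p, i, j)\<in>T.
      f $ q $ p $ i $ j $ (n - q - p - i - j) * \<alpha> ^ q * \<zeta> ^ p * x ^ i * y ^ j * t ^ (n - q - p - i - j))"
    unfolding T_def by (simp add: sum.Sigma)
  also have "\<dots> = (\<Sum>(q, p, i, j, k)\<in>deg5 n. f $ q $ p $ i $ j $ k * \<alpha> ^ q * \<zeta> ^ p * x ^ i * y ^ j * t ^ k)"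
    unfolding deg5_eq T_def[symmetric] by (subst sum.reindex[OF inj]) (simp add: split_beta o_def)
  finally show ?thesis .
qed

definition bar5 :: "ser5 \<Rightarrow> ser5" where
  "bar5 f = Abs_fps (\<lambda>q. Abs_fps (\<lambda>p. bar3 (f $ p $ q)))"

lemma bar5_nth: "bar5 f $ q $ p = bar3 (f $ p $ q)"
  by (simp add: bar5_def)

lemma scale5_bar5:
  "scale5 (cnj \<zeta>) \<zeta> x (cnj x) (of_real t) (bar5 f) = fps_map cnj (scale5 (cnj \<zeta>) \<zeta> x (cnj x) (of_real t) f)"
proof (rule fps_ext)
  fix n
  show "scale5 (cnj \<zeta>) \<zeta> x (cnj x) (of_real t) (bar5 f) $ n = fps_map cnj (scale5 (cnj \<zeta>) \<zeta> x (cnj x) (of_real t) f) $ n"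
    unfolding fps_map_nth scale5_nth cnj_sum
    by (rule sum.reindex_bij_witness[of _ "\<lambda>(q, p, i, j, k). (p, q, j, i, k)" "\<lambda>(q, p, i, j, k). (p, q, j, i, k)"])
       (auto simp: deg5_def bar5_def bar3_def mult_ac)
qed

lemma entire_zero_real:
  assumes "f holomorphic_on UNIV" "\<And>r::real. f (of_real r) = 0"
  shows "f z = 0"
proof (rule analytic_continuation[of f UNIV "range of_real" 0 z])
  show "(0::complex) islimpt range of_real"
    unfolding islimpt_approachable
  proof (intro allI impI)
    fix e :: real assume "e > 0"
    thus "\<exists>x'\<in>range of_real. x' \<noteq> 0 \<and> dist x' (0::complex) < e"
      by (intro bexI[of _ "of_real (e / 2)"] rangeI) auto
  qed
qed (use assms in auto)

lemma scale5_holomorphic: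
  assumes "a holomorphic_on UNIV" "z holomorphic_on UNIV" "x holomorphic_on UNIV" "y holomorphic_on UNIV" "t holomorphic_on UNIV"
  shows "(\<lambda>s. scale5 (a s) (z s) (x s) (y s) (t s) f $ n) holomorphic_on UNIV"
  unfolding scale5_nth split_beta by (intro holomorphic_intros assms)

text \<open>Polarization: the coefficients are polynomials in five complex variables which vanish
  when \<open>t\<close> is real and the other variables are conjugate in pairs. Freeing
  \<open>t\<close>, then the imaginary and real part of \<open>X\<close>, then those of
  \<open>\<zeta>\<close>, makes them vanish identically.\<close>

lemma scale5_zeroD:
  assumes "\<And>X \<zeta> (t::real). scale5 (cnj \<zeta>) \<zeta> X (cnj X) (of_real t) f = 0"
  shows "f = 0"
proof -
  define E where "E = (\<lambda>a z x y t n. scale5 a z x y t f $ n)"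
  have 0: "E (cnj z) z x (cnj x) (of_real t) n = 0" for z x t n
    by (simp add: E_def assms)
  have 1: "E (cnj z) z x (cnj x) t n = 0" for z x t n
    by (rule entire_zero_real[of "\<lambda>t. E (cnj z) z x (cnj x) t n"])
       (auto simp: E_def 0[unfolded E_def] intro!: scale5_holomorphic holomorphic_intros)
  have 2: "E (cnj z) z (of_real u + \<i> * v) (of_real u - \<i> * v) t n = 0" for z u v t n
  proof (rule entire_zero_real[of "\<lambda>v. E (cnj z) z (of_real u + \<i> * v) (of_real u - \<i> * v) t n"])
    show "E (cnj z) z (of_real u + \<i> * of_real r) (of_real u - \<i> * of_real r) t n = 0" for r
      using 1[of z "of_real u + \<i> * of_real r" t n] by simp
  qed (auto simp: E_def intro!: scale5_holomorphic holomorphic_intros)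
  have 3: "E (cnj z) z (u + \<i> * v) (u - \<i> * v) t n = 0" for z u v t n
    by (rule entire_zero_real[of "\<lambda>u. E (cnj z) z (u + \<i> * v) (u - \<i> * v) t n"])
       (auto simp: E_def 2[unfolded E_def] intro!: scale5_holomorphic holomorphic_intros)
  have 4: "E (cnj z) z x y t n = 0" for z x y t n
    using 3[of z "(x + y) / 2" "(x - y) / (2 * \<i>)" t n] by (simp add: field_simps)
  have 5: "E (of_real u - \<i> * v) (of_real u + \<i> * v) x y t n = 0" for u v x y t n
  proof (rule entire_zero_real[of "\<lambda>v. E (of_real u - \<i> * v) (of_real u + \<i> * v) x y t n"])
    show "E (of_real u - \<i> * of_real r) (of_real u + \<i> * of_real r) x y t n = 0" for r
      using 4[of "of_real u + \<i> * of_real r" x y t n] by simp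
  qed (auto simp: E_def intro!: scale5_holomorphic holomorphic_intros)
  have 6: "E (u - \<i> * v) (u + \<i> * v) x y t n = 0" for u v x y t n
    by (rule entire_zero_real[of "\<lambda>u. E (u - \<i> * v) (u + \<i> * v) x y t n"])
       (auto simp: E_def 5[unfolded E_def] intro!: scale5_holomorphic holomorphic_intros)
  have 7: "E a z x y t n = 0" for a z x y t n
    using 6[of "(a + z) / 2" "(z - a) / (2 * \<i>)" x y t n] by (simp add: field_simps)
  hence "scale5 a z x y t f = 0" for a z x y t
    by (intro fps_ext) (simp add: E_def)
  hence "scale1 z (scale1 x (scale1 y (scale1 t fps_const))) (f $ q) = 0" for z x y t q
    unfolding scale5_def by (rule scale1_inj)
  hence "scale1 x (scale1 y (scale1 t fps_const)) (f $ q $ p) = 0" for x y t q p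
    by (rule scale1_inj)
  hence "scale1 y (scale1 t fps_const) (f $ q $ p $ i) = 0" for y t q p i
    by (rule scale1_inj)
  hence "scale1 t fps_const (f $ q $ p $ i $ j) = 0" for t q p i j
    by (rule scale1_inj)
  hence 8: "fps_const (f $ q $ p $ i $ j $ k) = 0" for q p i j k
    by (rule scale1_inj)
  have "f $ q $ p $ i $ j $ k = 0" for q p i j k
    using arg_cong[OF 8[of q p i j k], of "\<lambda>f. f $ 0"] by simp
  thus ?thesis by (simp add: fps_eq_iff)
qed

text \<open>A function of \<open>(X, \<zeta>, t)\<close> near the origin has the formal expansion \<open>\<phi>\<close> in the variables
  \<open>X\<close>, \<open>\<zeta>\<close>, their conjugates and \<open>t\<close>, where only expansions along real rays are required.\<close>

definition fexp :: "(complex \<Rightarrow> complex \<Rightarrow> real \<Rightarrow> complex) \<Rightarrow> ser5 \<Rightarrow> bool" where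
  "fexp f \<phi> \<longleftrightarrow> (\<forall>X \<zeta> t. has_asymp (\<lambda>s. f (of_real s * X) (of_real s * \<zeta>) (s * t)) (scale5 (cnj \<zeta>) \<zeta> X (cnj X) (of_real t) \<phi>))"

definition near0 :: "(complex \<Rightarrow> complex \<Rightarrow> real \<Rightarrow> bool) \<Rightarrow> bool" where
  "near0 P \<longleftrightarrow> (\<exists>d>0. \<forall>X \<zeta> t. norm X < d \<longrightarrow> norm \<zeta> < d \<longrightarrow> \<bar>t\<bar> < d \<longrightarrow> P X \<zeta> t)"

lemma near0_ray:
  assumes "near0 P"
  shows "eventually (\<lambda>s. P (of_real s * X) (of_real s * \<zeta>) (s * t)) (at_right 0)"
proof -
  obtain d where d: "d > 0" "\<And>X \<zeta> t. norm X < d \<Longrightarrow> norm \<zeta> < d \<Longrightarrow> \<bar>t\<bar> < d \<Longrightarrow> P X \<zeta> t"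
    using assms by (auto simp: near0_def)
  define K where "K = 1 + norm X + norm \<zeta> + \<bar>t\<bar>"
  have K: "K > 0" "norm X \<le> K" "norm \<zeta> \<le> K" "\<bar>t\<bar> \<le> K" by (simp_all add: K_def add_pos_nonneg)
  have "P (of_real s * X) (of_real s * \<zeta>) (s * t)" if s: "0 < s" "s < d / K" for s
  proof (rule d(2))
    have "s * K < d" using s K by (simp add: field_simps)
    moreover have "s * norm X \<le> s * K" "s * norm \<zeta> \<le> s * K" "s * \<bar>t\<bar> \<le> s * K" using s K by (auto intro: mult_left_mono)
    ultimately have "s * norm X < d" "s * norm \<zeta> < d" "s * \<bar>t\<bar> < d" by linarith+
    thus "norm (of_real s * X) < d" "norm (of_real s * \<zeta>) < d" "\<bar>s * t\<bar> < d"
      using s by (simp_all add: norm_mult abs_mult)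
  qed
  thus ?thesis unfolding eventually_at_right_field using d K by (intro exI[of _ "d / K"]) auto
qed

text \<open>The bridge from analysis to algebra: an identity of functions near the origin becomes
  one of formal series.\<close>

lemma fexp_unique:
  assumes "fexp f \<phi>" "fexp g \<psi>" "near0 (\<lambda>X \<zeta> t. f X \<zeta> t = g X \<zeta> t)"
  shows "\<phi> = \<psi>"
proof -
  have "\<phi> - \<psi> = 0"
  proof (rule scale5_zeroD)
    fix X \<zeta> :: complex and t :: real
    have "scale5 (cnj \<zeta>) \<zeta> X (cnj X) (of_real t) \<phi> = scale5 (cnj \<zeta>) \<zeta> X (cnj X) (of_real t) \<psi>"
      using assms(1,2) unfolding fexp_def by (intro has_asymp_unique[OF _ _ near0_ray[OF assms(3)]]) blast+
    thus "scale5 (cnj \<zeta>) \<zeta> X (cnj X) (of_real t) (\<phi> - \<psi>) = 0"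
      by (simp add: fps_hom_diff[OF fps_hom_scale5])
  qed
  thus ?thesis by simp
qed

lemma fexp_intros:
  "fexp f \<phi> \<Longrightarrow> fexp g \<psi> \<Longrightarrow> fexp (\<lambda>X \<zeta> t. f X \<zeta> t + g X \<zeta> t) (\<phi> + \<psi>)"
  "fexp f \<phi> \<Longrightarrow> fexp g \<psi> \<Longrightarrow> fexp (\<lambda>X \<zeta> t. f X \<zeta> t - g X \<zeta> t) (\<phi> - \<psi>)"
  "fexp f \<phi> \<Longrightarrow> fexp g \<psi> \<Longrightarrow> fexp (\<lambda>X \<zeta> t. f X \<zeta> t * g X \<zeta> t) (\<phi> * \<psi>)"
  "fexp f \<phi> \<Longrightarrow> fexp (\<lambda>X \<zeta> t. - f X \<zeta> t) (- \<phi>)"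
  "fexp f \<phi> \<Longrightarrow> fexp (\<lambda>X \<zeta> t. f X \<zeta> t ^ n) (\<phi> ^ n)"
  "fexp f \<phi> \<Longrightarrow> fexp (\<lambda>X \<zeta> t. cnj (f X \<zeta> t)) (bar5 \<phi>)"
  "fexp (\<lambda>X \<zeta> t. c) (cst c)"
  "fexp (\<lambda>X \<zeta> t. X) vX" "fexp (\<lambda>X \<zeta> t. cnj X) vY" "fexp (\<lambda>X \<zeta> t. \<zeta>) vZ" "fexp (\<lambda>X \<zeta> t. cnj \<zeta>) vA"
  "fexp (\<lambda>X \<zeta> t. of_real t) vT"
proof -
  note S = fps_homD[OF fps_hom_scale5] fps_hom_diff[OF fps_hom_scale5] fps_hom_minus[OF fps_hom_scale5]
        fps_hom_power[OF fps_hom_scale5] scale5_bar5 scale5_vars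
  show "fexp f \<phi> \<Longrightarrow> fexp g \<psi> \<Longrightarrow> fexp (\<lambda>X \<zeta> t. f X \<zeta> t + g X \<zeta> t) (\<phi> + \<psi>)"
    unfolding fexp_def S by (intro allI has_asymp_add) blast+
  show "fexp f \<phi> \<Longrightarrow> fexp g \<psi> \<Longrightarrow> fexp (\<lambda>X \<zeta> t. f X \<zeta> t - g X \<zeta> t) (\<phi> - \<psi>)"
    unfolding fexp_def S by (intro allI has_asymp_diff) blast+
  show "fexp f \<phi> \<Longrightarrow> fexp g \<psi> \<Longrightarrow> fexp (\<lambda>X \<zeta> t. f X \<zeta> t * g X \<zeta> t) (\<phi> * \<psi>)"
    unfolding fexp_def S by (intro allI has_asymp_mult) blast+
  show "fexp f \<phi> \<Longrightarrow> fexp (\<lambda>X \<zeta> t. - f X \<zeta> t) (- \<phi>)"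
    unfolding fexp_def S by (intro allI has_asymp_minus) blast+
  show "fexp f \<phi> \<Longrightarrow> fexp (\<lambda>X \<zeta> t. f X \<zeta> t ^ n) (\<phi> ^ n)"
    unfolding fexp_def S by (intro allI has_asymp_power) blast+
  show "fexp f \<phi> \<Longrightarrow> fexp (\<lambda>X \<zeta> t. cnj (f X \<zeta> t)) (bar5 \<phi>)"
    unfolding fexp_def S by (intro allI has_asymp_cnj) blast+
  show "fexp (\<lambda>X \<zeta> t. c) (cst c)"
    unfolding fexp_def S by (intro allI has_asymp_const)
  have m: "has_asymp (\<lambda>s. of_real s * c) (fps_const c * fps_X)" for c
    using has_asymp_monom[of c 1] by (simp add: mult.commute)
  show "fexp (\<lambda>X \<zeta> t. X) vX" "fexp (\<lambda>X \<zeta> t. cnj X) vY" "fexp (\<lambda>X \<zeta> t. \<zeta>) vZ" "fexp (\<lambda>X \<zeta> t. cnj \<zeta>) vA"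
    "fexp (\<lambda>X \<zeta> t. of_real t) vT"
    unfolding fexp_def S by (simp_all add: m)
qed

lemma fexp_sum:
  "(\<And>i. i \<in> A \<Longrightarrow> fexp (f i) (\<phi> i)) \<Longrightarrow> fexp (\<lambda>X \<zeta> t. \<Sum>i\<in>A. f i X \<zeta> t) (\<Sum>i\<in>A. \<phi> i)"
  by (auto simp: fexp_def fps_hom_sum[OF fps_hom_scale5] intro!: has_asymp_sum)

subsection \<open>Convergent coefficient arrays\<close>

type_synonym idx5 = "nat \<times> nat \<times> nat \<times> nat \<times> nat"

definition conv :: "coeffs \<Rightarrow> real \<Rightarrow> bool" where
  "conv c r \<longleftrightarrow> r > 0 \<and> (\<lambda>(h, p, j, k, l). norm (c h p j k l) * r ^ (h + p + j + k + l)) summable_on UNIV"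

lemma convergent_series_conv: "convergent_series c \<longleftrightarrow> (\<exists>r. conv c r)"
  by (auto simp: convergent_series_def conv_def)

definition tm :: "coeffs \<Rightarrow> complex \<Rightarrow> complex \<Rightarrow> complex \<Rightarrow> complex \<Rightarrow> complex \<Rightarrow> idx5 \<Rightarrow> complex" where
  "tm c z \<zeta> a \<alpha> v = (\<lambda>(h, p, j, k, l). c h p j k l * z ^ h * \<zeta> ^ p * a ^ j * \<alpha> ^ k * v ^ l)"

lemma eval_series_tm: "eval_series c z \<zeta> a \<alpha> v = infsum (tm c z \<zeta> a \<alpha> v) UNIV"
  by (simp add: eval_series_def tm_def)

lemma norm_monomial_le:
  fixes z \<zeta> a \<alpha> v :: complex
  assumes "norm z \<le> r" "norm \<zeta> \<le> r" "norm a \<le> r" "norm \<alpha> \<le> r" "norm v \<le> r"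
  shows "norm (z ^ h * \<zeta> ^ p * a ^ j * \<alpha> ^ k * v ^ l) \<le> r ^ (h + p + j + k + l)"
proof -
  have r: "r \<ge> 0" using assms(1) norm_ge_zero order_trans by blast
  show ?thesis unfolding norm_mult norm_power power_add
    by (intro mult_mono power_mono assms norm_ge_zero zero_le_power mult_nonneg_nonneg r)
qed

lemma tm_bound:
  assumes "norm z \<le> r" "norm \<zeta> \<le> r" "norm a \<le> r" "norm \<alpha> \<le> r" "norm v \<le> r"
  shows "norm (tm c z \<zeta> a \<alpha> v w) \<le> (case w of (h, p, j, k, l) \<Rightarrow> norm (c h p j k l) * r ^ (h + p + j + k + l))"
proof (cases w)
  case (fields h p j k l)
  have "norm (tm c z \<zeta> a \<alpha> v w) = norm (c h p j k l) * norm (z ^ h * \<zeta> ^ p * a ^ j * \<alpha> ^ k * v ^ l)"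
    by (simp add: fields tm_def norm_mult mult_ac)
  also have "\<dots> \<le> norm (c h p j k l) * r ^ (h + p + j + k + l)"
    by (intro mult_left_mono norm_monomial_le assms) auto
  finally show ?thesis by (simp add: fields)
qed

lemma tm_abs_summable:
  assumes "conv c r" "norm z \<le> r" "norm \<zeta> \<le> r" "norm a \<le> r" "norm \<alpha> \<le> r" "norm v \<le> r"
  shows "(\<lambda>w. norm (tm c z \<zeta> a \<alpha> v w)) summable_on A"
proof (rule summable_on_comparison_test)
  show "(\<lambda>(h, p, j, k, l). norm (c h p j k l) * r ^ (h + p + j + k + l)) summable_on A"
    using assms(1) summable_on_subset_banach unfolding conv_def by blast
qed (use tm_bound[OF assms(2-)] in auto)

lemma tm_summable:
  assumes "conv c r" "norm z \<le> r" "norm \<zeta> \<le> r" "norm a \<le> r" "norm \<alpha> \<le> r" "norm v \<le> r"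
  shows "tm c z \<zeta> a \<alpha> v summable_on A"
  by (rule abs_summable_summable[OF tm_abs_summable[OF assms]])

lemma conv_mono:
  assumes "conv c r" "0 < r'" "r' \<le> r"
  shows "conv c r'"
  unfolding conv_def
proof
  show "(\<lambda>(h, p, j, k, l). norm (c h p j k l) * r' ^ (h + p + j + k + l)) summable_on UNIV"
  proof (rule summable_on_comparison_test)
    show "(\<lambda>(h, p, j, k, l). norm (c h p j k l) * r ^ (h + p + j + k + l)) summable_on UNIV"
      using assms(1) by (simp add: conv_def)
  qed (use assms in \<open>auto intro!: mult_left_mono power_mono\<close>)
qed (rule assms(2))

text \<open>Reorders the exponents: the conjugate of \<open>\<zeta>\<close> is outermost, then
  \<open>\<zeta>\<close>, and \<open>z\<close>, its conjugate and \<open>v\<close> take the places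
  of \<open>X\<close>, \<open>Y\<close> and \<open>t\<close>.\<close>

definition nst :: "coeffs \<Rightarrow> ser5" where
  "nst c = Abs_fps (\<lambda>k. Abs_fps (\<lambda>p. Abs_fps (\<lambda>h. Abs_fps (\<lambda>j. Abs_fps (\<lambda>l. c h p j k l)))))"

lemma nst_nth [simp]: "nst c $ k $ p $ h $ j $ l = c h p j k l"
  by (simp add: nst_def)

lemma fexp_eval:
  assumes "convergent_series c"
  shows "fexp (\<lambda>X \<zeta> t. eval_series c X \<zeta> (cnj X) (cnj \<zeta>) (of_real t)) (nst c)"
  unfolding fexp_def
proof (intro allI)
  fix X \<zeta> :: complex and t :: real
  obtain r where c: "conv c r" using assms by (auto simp: convergent_series_conv)
  define K where "K = 1 + norm X + norm \<zeta> + \<bar>t\<bar>"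
  have K: "K > 0" "norm X \<le> K" "norm \<zeta> \<le> K" "\<bar>t\<bar> \<le> K" by (simp_all add: K_def add_pos_nonneg)
  define s0 where "s0 = r / K"
  have s0: "s0 > 0" using K c by (simp add: s0_def conv_def)
  define d :: "idx5 \<Rightarrow> nat" where "d = (\<lambda>(h, p, j, k, l). h + p + j + k + l)"
  define a where "a = tm c X \<zeta> (cnj X) (cnj \<zeta>) (of_real t)"
  have eq: "a w * of_real s ^ d w = tm c (of_real s * X) (of_real s * \<zeta>) (cnj (of_real s * X)) (cnj (of_real s * \<zeta>)) (of_real (s * t)) w" for s w
    by (cases w) (simp add: a_def tm_def d_def power_add power_mult_distrib mult_ac)
  have "norm (a w) * s0 ^ d w = norm (a w * of_real s0 ^ d w)" for w
    using s0 by (simp add: norm_mult norm_power)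
  moreover have "(\<lambda>w. norm (a w * of_real s0 ^ d w)) summable_on UNIV"
  proof -
    have "s0 * norm X \<le> s0 * K" "s0 * norm \<zeta> \<le> s0 * K" "s0 * \<bar>t\<bar> \<le> s0 * K"
      using K s0 by (auto intro: mult_left_mono)
    moreover have "s0 * K = r" using K by (simp add: s0_def)
    ultimately have b: "s0 * norm X \<le> r" "s0 * norm \<zeta> \<le> r" "s0 * \<bar>t\<bar> \<le> r" by linarith+
    show ?thesis unfolding eq
      using s0 b by (intro tm_abs_summable[OF c]) (simp_all add: norm_mult abs_mult)
  qed
  ultimately have "has_asymp (\<lambda>s. \<Sum>\<^sub>\<infinity>w. a w * of_real s ^ d w) (Abs_fps (\<lambda>n. \<Sum>\<^sub>\<infinity>w\<in>{w. d w = n}. a w))"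
    by (intro has_asymp_infsum[OF _ s0]) simp
  moreover have "Abs_fps (\<lambda>n. \<Sum>\<^sub>\<infinity>w\<in>{w. d w = n}. a w) = scale5 (cnj \<zeta>) \<zeta> X (cnj X) (of_real t) (nst c)"
  proof (rule fps_ext)
    fix n
    have W: "{w. d w = n} = (\<lambda>(q, p, i, j, k). (i, p, j, q, k)) ` deg5 n"
      by (force simp: d_def deg5_def image_iff)
    have "(\<Sum>\<^sub>\<infinity>w\<in>{w. d w = n}. a w) = (\<Sum>w\<in>{w. d w = n}. a w)"
      unfolding W by (intro infsum_finite finite_imageI finite_deg5)
    also have "\<dots> = (\<Sum>(q, p, i, j, k)\<in>deg5 n. nst c $ q $ p $ i $ j $ k * cnj \<zeta> ^ q * \<zeta> ^ p * X ^ i * cnj X ^ j * of_real t ^ k)"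
      unfolding W by (subst sum.reindex) (auto simp: inj_on_def o_def a_def tm_def split_beta mult_ac intro!: sum.cong)
    finally show "Abs_fps (\<lambda>n. \<Sum>\<^sub>\<infinity>w\<in>{w. d w = n}. a w) $ n = scale5 (cnj \<zeta>) \<zeta> X (cnj X) (of_real t) (nst c) $ n"
      by (simp add: scale5_nth)
  qed
  ultimately show "has_asymp (\<lambda>s. eval_series c (of_real s * X) (of_real s * \<zeta>) (cnj (of_real s * X)) (cnj (of_real s * \<zeta>)) (of_real (s * t)))
     (scale5 (cnj \<zeta>) \<zeta> X (cnj X) (of_real t) (nst c))"
    by (simp only: eq eval_series_tm)
qed

definition dc1 :: "coeffs \<Rightarrow> coeffs" where "dc1 c = (\<lambda>h p j k l. of_nat (Suc h) * c (Suc h) p j k l)"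
definition dc2 :: "coeffs \<Rightarrow> coeffs" where "dc2 c = (\<lambda>h p j k l. of_nat (Suc p) * c h (Suc p) j k l)"
definition dc3 :: "coeffs \<Rightarrow> coeffs" where "dc3 c = (\<lambda>h p j k l. of_nat (Suc j) * c h p (Suc j) k l)"
definition dc4 :: "coeffs \<Rightarrow> coeffs" where "dc4 c = (\<lambda>h p j k l. of_nat (Suc k) * c h p j (Suc k) l)"
definition dc5 :: "coeffs \<Rightarrow> coeffs" where "dc5 c = (\<lambda>h p j k l. of_nat (Suc l) * c h p j k (Suc l))"

text \<open>Convexity of the d-th power: its tangent at \<open>s\<close> stays below the graph. It
  bounds the factors that differentiation produces, at the price of a smaller radius.\<close>

lemma bernoulli_power:
  fixes r s :: real
  assumes "0 \<le> s" "s \<le> r"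
  shows "s ^ d + of_nat d * s ^ (d - 1) * (r - s) \<le> r ^ d"
proof (induction d)
  case (Suc d)
  have e: "s * (of_nat d * s ^ (d - 1)) = of_nat d * s ^ d"
    by (cases d) (simp_all add: mult_ac)
  have nn: "of_nat d * s ^ (d - 1) * (r - s) \<ge> 0" using assms by simp
  have "s ^ Suc d + of_nat (Suc d) * s ^ d * (r - s) = s * (s ^ d + of_nat d * s ^ (d - 1) * (r - s)) + (r - s) * s ^ d"
  proof -
    have e': "s * (of_nat d * s ^ (d - 1) * (r - s)) = of_nat d * s ^ d * (r - s)"
      using e by (metis mult.assoc)
    show ?thesis by (simp only: distrib_left e') (simp add: algebra_simps)
  qed
  also have "\<dots> \<le> s * (s ^ d + of_nat d * s ^ (d - 1) * (r - s)) + (r - s) * (s ^ d + of_nat d * s ^ (d - 1) * (r - s))"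
    using assms nn by (intro add_left_mono mult_left_mono) auto
  also have "\<dots> = r * (s ^ d + of_nat d * s ^ (d - 1) * (r - s))" by (simp add: algebra_simps)
  also have "\<dots> \<le> r * r ^ d" using Suc assms by (intro mult_left_mono) auto
  finally show ?case by simp
qed simp

lemma deriv_power_bound:
  fixes r s :: real
  assumes "0 \<le> s" "s < r" "n \<le> d"
  shows "of_nat n * s ^ (d - 1) \<le> r ^ d / (r - s)"
proof -
  have "of_nat n * s ^ (d - 1) \<le> of_nat d * s ^ (d - 1)"
    using assms by (intro mult_right_mono) auto
  moreover have "of_nat d * s ^ (d - 1) * (r - s) \<le> r ^ d"
    using bernoulli_power[of s r d] assms zero_le_power[of s d] by linarith
  ultimately show ?thesis using assms by (simp add: pos_le_divide_eq) (smt (verit) mult_right_mono)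
qed

lemma conv_dc:
  assumes c: "conv c r" and s: "0 < s" "s < r"
  shows "conv (dc1 c) s" "conv (dc2 c) s" "conv (dc3 c) s" "conv (dc4 c) s" "conv (dc5 c) s"
proof -
  have sm: "(\<lambda>(h, p, j, k, l). norm (c h p j k l) * r ^ (h + p + j + k + l) * (1 / (r - s))) summable_on A" for A
  proof -
    have "(\<lambda>(h, p, j, k, l). norm (c h p j k l) * r ^ (h + p + j + k + l)) summable_on A"
      by (rule summable_on_subset_banach[OF c[unfolded conv_def, THEN conjunct2]]) simp
    from summable_on_cmult_left[OF this, of "1 / (r - s)"] show ?thesis by (simp add: case_prod_unfold)
  qed
  have bd: "of_nat n * s ^ (d - 1) \<le> r ^ d * (1 / (r - s))" if "n \<le> d" for n d
    using deriv_power_bound[of s r n d] s that by simp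
  have gen: "conv c' s" if "inj g" and "\<And>w. (case w of (h, p, j, k, l) \<Rightarrow> norm (c' h p j k l) * s ^ (h + p + j + k + l))
      \<le> ((\<lambda>(h, p, j, k, l). norm (c h p j k l) * r ^ (h + p + j + k + l) * (1 / (r - s))) \<circ> g) w" for c' g
    unfolding conv_def
  proof
    show "(\<lambda>(h, p, j, k, l). norm (c' h p j k l) * s ^ (h + p + j + k + l)) summable_on UNIV"
    proof (rule summable_on_comparison_test)
      show "((\<lambda>(h, p, j, k, l). norm (c h p j k l) * r ^ (h + p + j + k + l) * (1 / (r - s))) \<circ> g) summable_on UNIV"
        using sm[of "range g"] that(1) by (subst (asm) summable_on_reindex)
    qed (use that(2) s in auto)
  qed (rule s)
  have B: "norm (of_nat (Suc n) * x) * s ^ m \<le> norm x * r ^ Suc m * (1 / (r - s))" if "n \<le> m" for n m and x :: complex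
  proof -
    have "of_nat (Suc n) * s ^ m \<le> r ^ Suc m * (1 / (r - s))" using bd[of "Suc n" "Suc m"] that by simp
    hence "norm x * (of_nat (Suc n) * s ^ m) \<le> norm x * (r ^ Suc m * (1 / (r - s)))" by (intro mult_left_mono) auto
    thus ?thesis by (simp add: norm_mult mult_ac del: of_nat_Suc)
  qed
  show "conv (dc1 c) s"
    by (rule gen[of "\<lambda>(h, p, j, k, l). (Suc h, p, j, k, l)"]) (auto simp: inj_on_def dc1_def intro!: order_trans[OF B] simp del: of_nat_Suc)
  show "conv (dc2 c) s"
    by (rule gen[of "\<lambda>(h, p, j, k, l). (h, Suc p, j, k, l)"]) (auto simp: inj_on_def dc2_def intro!: order_trans[OF B] simp del: of_nat_Suc)
  show "conv (dc3 c) s"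
    by (rule gen[of "\<lambda>(h, p, j, k, l). (h, p, Suc j, k, l)"]) (auto simp: inj_on_def dc3_def intro!: order_trans[OF B] simp del: of_nat_Suc)
  show "conv (dc4 c) s"
    by (rule gen[of "\<lambda>(h, p, j, k, l). (h, p, j, Suc k, l)"]) (auto simp: inj_on_def dc4_def intro!: order_trans[OF B] simp del: of_nat_Suc)
  show "conv (dc5 c) s"
    by (rule gen[of "\<lambda>(h, p, j, k, l). (h, p, j, k, Suc l)"]) (auto simp: inj_on_def dc5_def intro!: order_trans[OF B] simp del: of_nat_Suc)
qed

lemma convergent_dc:
  assumes "convergent_series c"
  shows "convergent_series (dc1 c)" "convergent_series (dc2 c)" "convergent_series (dc3 c)" "convergent_series (dc4 c)" "convergent_series (dc5 c)"
proof -
  obtain r where r: "conv c r" using assms by (auto simp: convergent_series_conv)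
  hence "0 < r / 2" "r / 2 < r" by (auto simp: conv_def)
  from conv_dc[OF r this] show "convergent_series (dc1 c)" "convergent_series (dc2 c)" "convergent_series (dc3 c)" "convergent_series (dc4 c)" "convergent_series (dc5 c)"
    unfolding convergent_series_conv by blast+
qed

section \<open>Termwise differentiation of five-variable series\<close>

context
  fixes u1 u2 u3 u4 u5 :: "'a::real_normed_vector \<Rightarrow> complex"
  assumes lin: "bounded_linear u1" "bounded_linear u2" "bounded_linear u3" "bounded_linear u4" "bounded_linear u5"
    and nrm: "\<And>x. norm (u1 x) \<le> norm x" "\<And>x. norm (u2 x) \<le> norm x" "\<And>x. norm (u3 x) \<le> norm x"
      "\<And>x. norm (u4 x) \<le> norm x" "\<And>x. norm (u5 x) \<le> norm x"
begin

text \<open>The arguments are real-linear functions of the point, since conjugates and imaginary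
  parts occur among them. A single summable majorant serves all five partial derivatives, so
  termwise differentiation is justified uniformly near \<open>x\<close>.\<close>

lemma eval_series_has_derivative:
  assumes c: "conv c r" and x: "norm (u1 x) < r" "norm (u2 x) < r" "norm (u3 x) < r" "norm (u4 x) < r" "norm (u5 x) < r"
  shows "((\<lambda>y. eval_series c (u1 y) (u2 y) (u3 y) (u4 y) (u5 y)) has_derivative
     (\<lambda>y. eval_series (dc1 c) (u1 x) (u2 x) (u3 x) (u4 x) (u5 x) * u1 y + eval_series (dc2 c) (u1 x) (u2 x) (u3 x) (u4 x) (u5 x) * u2 y
        + eval_series (dc3 c) (u1 x) (u2 x) (u3 x) (u4 x) (u5 x) * u3 y + eval_series (dc4 c) (u1 x) (u2 x) (u3 x) (u4 x) (u5 x) * u4 y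
        + eval_series (dc5 c) (u1 x) (u2 x) (u3 x) (u4 x) (u5 x) * u5 y)) (at x)"
proof -
  \<comment> \<open>An enumeration of the exponents turns the unordered sum into a series, to which
    the theorem on termwise differentiation applies.\<close>
  define e :: "nat \<Rightarrow> idx5" where "e = from_nat_into UNIV"
  have be: "bij_betw e UNIV UNIV"
    unfolding e_def by (rule bij_betw_from_nat_into) (simp_all add: finite_prod)
  define m where "m = Max {norm (u1 x), norm (u2 x), norm (u3 x), norm (u4 x), norm (u5 x)}"
  have m: "norm (u1 x) \<le> m" "norm (u2 x) \<le> m" "norm (u3 x) \<le> m" "norm (u4 x) \<le> m" "norm (u5 x) \<le> m" "m < r"
    using x by (simp_all add: m_def)
  \<comment> \<open>A radius strictly between the largest argument and \<open>r\<close>: on the ball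
    \<open>S\<close> all arguments stay below \<open>s\<close>, and the gap \<open>r - s\<close>
    pays for the derivative.\<close>
  define s where "s = (m + r) / 2"
  have m0: "0 \<le> m" using m(1) norm_ge_zero order_trans by blast
  have s: "0 < s" "m < s" "s < r" using m(6) m0 by (simp_all add: s_def)
  define S where "S = ball x (s - m)"
  have uS: "norm (u y) < s" if "y \<in> S" "bounded_linear u" "\<And>x. norm (u x) \<le> norm x" "norm (u x) \<le> m" for y and u :: "'a \<Rightarrow> complex"
  proof -
    interpret bounded_linear u by fact
    have "norm (u y) \<le> norm (u x) + norm (u (y - x))" by (simp add: diff) (metis norm_triangle_sub)
    also have "\<dots> < m + (s - m)"
      using that(1,4) that(3)[of "y - x"] by (simp add: S_def dist_norm norm_minus_commute)
    finally show ?thesis by simp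
  qed
  have US: "norm (u1 y) \<le> s" "norm (u2 y) \<le> s" "norm (u3 y) \<le> s" "norm (u4 y) \<le> s" "norm (u5 y) \<le> s" if "y \<in> S" for y
    using uS[OF that lin(1) nrm(1) m(1)] uS[OF that lin(2) nrm(2) m(2)] uS[OF that lin(3) nrm(3) m(3)]
      uS[OF that lin(4) nrm(4) m(4)] uS[OF that lin(5) nrm(5) m(5)] by simp_all
  define D1 where "D1 = (\<lambda>y (h, p, j, k, l). c h p j k l * (of_nat h * u1 y ^ (h - 1)) * u2 y ^ p * u3 y ^ j * u4 y ^ k * u5 y ^ l)"
  define D2 where "D2 = (\<lambda>y (h, p, j, k, l). c h p j k l * u1 y ^ h * (of_nat p * u2 y ^ (p - 1)) * u3 y ^ j * u4 y ^ k * u5 y ^ l)"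
  define D3 where "D3 = (\<lambda>y (h, p, j, k, l). c h p j k l * u1 y ^ h * u2 y ^ p * (of_nat j * u3 y ^ (j - 1)) * u4 y ^ k * u5 y ^ l)"
  define D4 where "D4 = (\<lambda>y (h, p, j, k, l). c h p j k l * u1 y ^ h * u2 y ^ p * u3 y ^ j * (of_nat k * u4 y ^ (k - 1)) * u5 y ^ l)"
  define D5 where "D5 = (\<lambda>y (h, p, j, k, l). c h p j k l * u1 y ^ h * u2 y ^ p * u3 y ^ j * u4 y ^ k * (of_nat l * u5 y ^ (l - 1)))"
  define B :: "idx5 \<Rightarrow> real" where "B = (\<lambda>(h, p, j, k, l). norm (c h p j k l) * r ^ (h + p + j + k + l) * (1 / (r - s)))"
  have Bs: "B summable_on UNIV"
    using summable_on_cmult_left[OF c[unfolded conv_def, THEN conjunct2], of "1 / (r - s)"]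
    by (simp add: B_def case_prod_unfold)
  have bd: "of_nat n * norm M \<le> r ^ d * (1 / (r - s))" if "n \<le> d" "n \<noteq> 0 \<Longrightarrow> norm M \<le> s ^ (d - 1)" for n d and M :: complex
  proof (cases "n = 0")
    case False
    hence "of_nat n * norm M \<le> of_nat n * s ^ (d - 1)" using that by (intro mult_left_mono) auto
    also have "\<dots> \<le> r ^ d * (1 / (r - s))" using deriv_power_bound[of s r n d] s that by simp
    finally show ?thesis .
  qed (use s in simp)
  have bd': "norm (a * (of_nat n * M)) \<le> norm a * r ^ d * (1 / (r - s))" if "n \<le> d" "n \<noteq> 0 \<Longrightarrow> norm M \<le> s ^ (d - 1)" for n d and a M :: complex
    using mult_left_mono[OF bd[OF that], of "norm a"] by (simp add: norm_mult mult_ac)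
  have DB: "norm (D1 y w) \<le> B w \<and> norm (D2 y w) \<le> B w \<and> norm (D3 y w) \<le> B w \<and> norm (D4 y w) \<le> B w \<and> norm (D5 y w) \<le> B w"
    if y: "y \<in> S" for y w
  proof (cases w)
    case w: (fields h p j k l)
    let ?d = "h + p + j + k + l"
    have "D1 y w = c h p j k l * (of_nat h * (u1 y ^ (h - 1) * u2 y ^ p * u3 y ^ j * u4 y ^ k * u5 y ^ l))"
      by (simp add: w D1_def mult_ac)
    moreover have "norm (u1 y ^ (h - 1) * u2 y ^ p * u3 y ^ j * u4 y ^ k * u5 y ^ l) \<le> s ^ (?d - 1)" if "h \<noteq> 0"
      using norm_monomial_le[OF US[OF y], of "h - 1" p j k l] that by simp
    moreover have "D2 y w = c h p j k l * (of_nat p * (u1 y ^ h * u2 y ^ (p - 1) * u3 y ^ j * u4 y ^ k * u5 y ^ l))"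
      by (simp add: w D2_def mult_ac)
    moreover have "norm (u1 y ^ h * u2 y ^ (p - 1) * u3 y ^ j * u4 y ^ k * u5 y ^ l) \<le> s ^ (?d - 1)" if "p \<noteq> 0"
      using norm_monomial_le[OF US[OF y], of h "p - 1" j k l] that by simp
    moreover have "D3 y w = c h p j k l * (of_nat j * (u1 y ^ h * u2 y ^ p * u3 y ^ (j - 1) * u4 y ^ k * u5 y ^ l))"
      by (simp add: w D3_def mult_ac)
    moreover have "norm (u1 y ^ h * u2 y ^ p * u3 y ^ (j - 1) * u4 y ^ k * u5 y ^ l) \<le> s ^ (?d - 1)" if "j \<noteq> 0"
      using norm_monomial_le[OF US[OF y], of h p "j - 1" k l] that by simp
    moreover have "D4 y w = c h p j k l * (of_nat k * (u1 y ^ h * u2 y ^ p * u3 y ^ j * u4 y ^ (k - 1) * u5 y ^ l))"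
      by (simp add: w D4_def mult_ac)
    moreover have "norm (u1 y ^ h * u2 y ^ p * u3 y ^ j * u4 y ^ (k - 1) * u5 y ^ l) \<le> s ^ (?d - 1)" if "k \<noteq> 0"
      using norm_monomial_le[OF US[OF y], of h p j "k - 1" l] that by simp
    moreover have "D5 y w = c h p j k l * (of_nat l * (u1 y ^ h * u2 y ^ p * u3 y ^ j * u4 y ^ k * u5 y ^ (l - 1)))"
      by (simp add: w D5_def mult_ac)
    moreover have "norm (u1 y ^ h * u2 y ^ p * u3 y ^ j * u4 y ^ k * u5 y ^ (l - 1)) \<le> s ^ (?d - 1)" if "l \<noteq> 0"
      using norm_monomial_le[OF US[OF y], of h p j k "l - 1"] that by simp
    moreover have "B w = norm (c h p j k l) * r ^ ?d * (1 / (r - s))" by (simp add: w B_def)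
    ultimately show ?thesis by (simp only: bd' le_add1 le_add2 trans_le_add1 simp_thms)
  qed
  define Bn where "Bn = B \<circ> e"
  have Bn: "summable Bn"
  proof -
    have "Bn summable_on UNIV" unfolding Bn_def using Bs be by (simp add: summable_on_reindex_bij_betw o_def)
    thus ?thesis by (rule summable_on_imp_summable)
  qed
  have key: "summable (\<lambda>n. D (e n)) \<and> (\<Sum>n. D (e n)) = infsum D UNIV \<and> norm ((\<Sum>i<n. D (e i)) - (\<Sum>n. D (e n))) \<le> (\<Sum>i. Bn (i + n))"
    if "\<And>w. norm (D w) \<le> B w" for D :: "idx5 \<Rightarrow> complex" and n
  proof -
    have D: "D summable_on UNIV"
      by (rule abs_summable_summable, rule summable_on_comparison_test[OF Bs]) (use that in auto)
    hence "(D has_sum infsum D UNIV) UNIV" by (rule has_sum_infsum)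
    hence "((\<lambda>n. D (e n)) has_sum infsum D UNIV) UNIV" by (subst has_sum_reindex_bij_betw[OF be])
    hence su: "(\<lambda>n. D (e n)) sums infsum D UNIV" by (rule has_sum_imp_sums)
    hence sm: "summable (\<lambda>n. D (e n))" by (rule sums_summable)
    have "(\<Sum>i<n. D (e i)) - (\<Sum>n. D (e n)) = - (\<Sum>i. D (e (i + n)))"
      using suminf_minus_initial_segment[OF sm, of n] by simp
    hence "norm ((\<Sum>i<n. D (e i)) - (\<Sum>n. D (e n))) = norm (\<Sum>i. D (e (i + n)))" by simp
    also have "\<dots> \<le> (\<Sum>i. Bn (i + n))"
      by (rule norm_suminf_le) (use that summable_ignore_initial_segment[OF Bn] in \<open>auto simp: Bn_def\<close>)
    finally show ?thesis using su sm by (simp add: sums_iff)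
  qed
  define f where "f = (\<lambda>n y. tm c (u1 y) (u2 y) (u3 y) (u4 y) (u5 y) (e n))"
  define f' where "f' = (\<lambda>n y q. D1 y (e n) * u1 q + D2 y (e n) * u2 q + D3 y (e n) * u3 q + D4 y (e n) * u4 q + D5 y (e n) * u5 q)"
  define g' where "g' = (\<lambda>y q. (\<Sum>n. D1 y (e n)) * u1 q + (\<Sum>n. D2 y (e n)) * u2 q + (\<Sum>n. D3 y (e n)) * u3 q + (\<Sum>n. D4 y (e n)) * u4 q + (\<Sum>n. D5 y (e n)) * u5 q)"
  have xS: "x \<in> S" using s by (simp add: S_def)
  have fs: "(\<lambda>n. f n y) sums eval_series c (u1 y) (u2 y) (u3 y) (u4 y) (u5 y)" if "y \<in> S" for y
  proof -
    have "tm c (u1 y) (u2 y) (u3 y) (u4 y) (u5 y) summable_on UNIV"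
      using US[OF that] s by (intro tm_summable[OF c]) auto
    from has_sum_infsum[OF this] have "((\<lambda>n. f n y) has_sum eval_series c (u1 y) (u2 y) (u3 y) (u4 y) (u5 y)) UNIV"
      unfolding f_def eval_series_tm by (subst has_sum_reindex_bij_betw[OF be])
    thus ?thesis by (rule has_sum_imp_sums)
  qed
  have "\<exists>g. \<forall>y\<in>S. (\<lambda>n. f n y) sums (g y) \<and> (g has_derivative g' y) (at y within S)"
  proof (rule has_derivative_series)
    show "convex S" by (simp add: S_def)
    show "(f n has_derivative f' n y) (at y within S)" if "y \<in> S" for n y
    proof -
      obtain h p j k l where w: "e n = (h, p, j, k, l)" by (cases "e n")
      note d = lin[THEN bounded_linear_imp_has_derivative]
      show ?thesis unfolding f_def f'_def w tm_def D1_def D2_def D3_def D4_def D5_def prod.case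
        by (rule derivative_eq_intros d | rule refl)+ (simp add: fun_eq_iff algebra_simps)
    qed
    show "\<forall>\<^sub>F n in sequentially. \<forall>y\<in>S. \<forall>q. norm ((\<Sum>i<n. f' i y q) - g' y q) \<le> \<epsilon> * norm q" if "\<epsilon> > 0" for \<epsilon> :: real
    proof -
      have eps: "\<epsilon> / 5 > 0" using that by simp
      from suminf_exist_split[OF eps Bn] obtain N where N: "\<And>n. n \<ge> N \<Longrightarrow> norm (\<Sum>i. Bn (i + n)) < \<epsilon> / 5"
        by blast
      have "norm ((\<Sum>i<n. f' i y q) - g' y q) \<le> \<epsilon> * norm q" if n: "n \<ge> N" and y: "y \<in> S" for n y q
      proof -
        have t: "norm (((\<Sum>i<n. D (e i)) - (\<Sum>n. D (e n))) * u q) \<le> \<epsilon> / 5 * norm q"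
          if "\<And>w. norm (D w) \<le> B w" "norm (u q) \<le> norm q" for D :: "idx5 \<Rightarrow> complex" and u :: "'a \<Rightarrow> complex"
        proof -
          have "norm ((\<Sum>i<n. D (e i)) - (\<Sum>n. D (e n))) \<le> (\<Sum>i. Bn (i + n))" using key[of D n] that(1) by blast
          also have "\<dots> \<le> \<epsilon> / 5" using N[OF n] by simp
          finally show ?thesis using that(2) eps unfolding norm_mult by (intro mult_mono) auto
        qed
        have eq: "(\<Sum>i<n. f' i y q) - g' y q =
           ((\<Sum>i<n. D1 y (e i)) - (\<Sum>n. D1 y (e n))) * u1 q + ((\<Sum>i<n. D2 y (e i)) - (\<Sum>n. D2 y (e n))) * u2 q
         + ((\<Sum>i<n. D3 y (e i)) - (\<Sum>n. D3 y (e n))) * u3 q + ((\<Sum>i<n. D4 y (e i)) - (\<Sum>n. D4 y (e n))) * u4 q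
         + ((\<Sum>i<n. D5 y (e i)) - (\<Sum>n. D5 y (e n))) * u5 q"
          by (simp add: f'_def g'_def sum.distrib left_diff_distrib flip: sum_distrib_right)
        have "norm ((\<Sum>i<n. f' i y q) - g' y q) \<le> \<epsilon> / 5 * norm q + \<epsilon> / 5 * norm q + \<epsilon> / 5 * norm q + \<epsilon> / 5 * norm q + \<epsilon> / 5 * norm q"
          unfolding eq using DB[OF y] nrm
          by (intro norm_triangle_le add_mono t) blast+
        thus ?thesis by simp
      qed
      thus ?thesis unfolding eventually_sequentially by blast
    qed
    show "x \<in> S" by (rule xS)
    show "(\<lambda>n. f n x) sums eval_series c (u1 x) (u2 x) (u3 x) (u4 x) (u5 x)" by (rule fs[OF xS])
  qed
  then obtain g where g: "\<And>y. y \<in> S \<Longrightarrow> (\<lambda>n. f n y) sums g y" "\<And>y. y \<in> S \<Longrightarrow> (g has_derivative g' y) (at y within S)"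
    by blast
  have geq: "g y = eval_series c (u1 y) (u2 y) (u3 y) (u4 y) (u5 y)" if "y \<in> S" for y
    using g(1)[OF that] fs[OF that] sums_unique2 by blast
  have "(g has_derivative g' x) (at x)"
    using g(2)[OF xS] at_within_open[OF xS] by (simp add: S_def)
  hence der: "((\<lambda>y. eval_series c (u1 y) (u2 y) (u3 y) (u4 y) (u5 y)) has_derivative g' x) (at x)"
    by (rule has_derivative_transform_within_open[OF _ _ xS]) (auto simp: S_def geq)
  have ev: "infsum D UNIV = infsum (D \<circ> \<sigma>) UNIV" if "inj \<sigma>" "\<And>w. w \<notin> range \<sigma> \<Longrightarrow> D w = 0" for D :: "idx5 \<Rightarrow> complex" and \<sigma>
  proof -
    have "infsum D UNIV = infsum D (range \<sigma>)" using that(2) by (intro infsum_cong_neutral) auto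
    thus ?thesis using infsum_reindex[OF that(1)] by metis
  qed
  have "infsum (D1 x) UNIV = eval_series (dc1 c) (u1 x) (u2 x) (u3 x) (u4 x) (u5 x)"
  proof (subst ev[of "\<lambda>(h, p, j, k, l). (Suc h, p, j, k, l)"])
    show "D1 x w = 0" if "w \<notin> range (\<lambda>(h, p, j, k, l). (Suc h, p, j, k, l))" for w
    proof (cases w)
      case (fields h p j k l)
      show ?thesis
      proof (cases h)
        case (Suc h')
        have "w = (\<lambda>(h, p, j, k, l). (Suc h, p, j, k, l)) (h', p, j, k, l)" by (simp add: fields Suc)
        hence "w \<in> range (\<lambda>(h, p, j, k, l). (Suc h, p, j, k, l))" by (rule range_eqI)
        thus ?thesis using that by contradiction
      qed (simp add: fields D1_def)
    qed
  qed (auto simp: inj_on_def eval_series_tm tm_def dc1_def D1_def split_beta mult_ac simp del: of_nat_Suc intro!: infsum_cong)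
  moreover have "infsum (D2 x) UNIV = eval_series (dc2 c) (u1 x) (u2 x) (u3 x) (u4 x) (u5 x)"
  proof (subst ev[of "\<lambda>(h, p, j, k, l). (h, Suc p, j, k, l)"])
    show "D2 x w = 0" if "w \<notin> range (\<lambda>(h, p, j, k, l). (h, Suc p, j, k, l))" for w
    proof (cases w)
      case (fields h p j k l)
      show ?thesis
      proof (cases p)
        case (Suc p')
        have "w = (\<lambda>(h, p, j, k, l). (h, Suc p, j, k, l)) (h, p', j, k, l)" by (simp add: fields Suc)
        hence "w \<in> range (\<lambda>(h, p, j, k, l). (h, Suc p, j, k, l))" by (rule range_eqI)
        thus ?thesis using that by contradiction
      qed (simp add: fields D2_def)
    qed
  qed (auto simp: inj_on_def eval_series_tm tm_def dc2_def D2_def split_beta mult_ac simp del: of_nat_Suc intro!: infsum_cong)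
  moreover have "infsum (D3 x) UNIV = eval_series (dc3 c) (u1 x) (u2 x) (u3 x) (u4 x) (u5 x)"
  proof (subst ev[of "\<lambda>(h, p, j, k, l). (h, p, Suc j, k, l)"])
    show "D3 x w = 0" if "w \<notin> range (\<lambda>(h, p, j, k, l). (h, p, Suc j, k, l))" for w
    proof (cases w)
      case (fields h p j k l)
      show ?thesis
      proof (cases j)
        case (Suc j')
        have "w = (\<lambda>(h, p, j, k, l). (h, p, Suc j, k, l)) (h, p, j', k, l)" by (simp add: fields Suc)
        hence "w \<in> range (\<lambda>(h, p, j, k, l). (h, p, Suc j, k, l))" by (rule range_eqI)
        thus ?thesis using that by contradiction
      qed (simp add: fields D3_def)
    qed
  qed (auto simp: inj_on_def eval_series_tm tm_def dc3_def D3_def split_beta mult_ac simp del: of_nat_Suc intro!: infsum_cong)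
  moreover have "infsum (D4 x) UNIV = eval_series (dc4 c) (u1 x) (u2 x) (u3 x) (u4 x) (u5 x)"
  proof (subst ev[of "\<lambda>(h, p, j, k, l). (h, p, j, Suc k, l)"])
    show "D4 x w = 0" if "w \<notin> range (\<lambda>(h, p, j, k, l). (h, p, j, Suc k, l))" for w
    proof (cases w)
      case (fields h p j k l)
      show ?thesis
      proof (cases k)
        case (Suc k')
        have "w = (\<lambda>(h, p, j, k, l). (h, p, j, Suc k, l)) (h, p, j, k', l)" by (simp add: fields Suc)
        hence "w \<in> range (\<lambda>(h, p, j, k, l). (h, p, j, Suc k, l))" by (rule range_eqI)
        thus ?thesis using that by contradiction
      qed (simp add: fields D4_def)
    qed
  qed (auto simp: inj_on_def eval_series_tm tm_def dc4_def D4_def split_beta mult_ac simp del: of_nat_Suc intro!: infsum_cong)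
  moreover have "infsum (D5 x) UNIV = eval_series (dc5 c) (u1 x) (u2 x) (u3 x) (u4 x) (u5 x)"
  proof (subst ev[of "\<lambda>(h, p, j, k, l). (h, p, j, k, Suc l)"])
    show "D5 x w = 0" if "w \<notin> range (\<lambda>(h, p, j, k, l). (h, p, j, k, Suc l))" for w
    proof (cases w)
      case (fields h p j k l)
      show ?thesis
      proof (cases l)
        case (Suc l')
        have "w = (\<lambda>(h, p, j, k, l). (h, p, j, k, Suc l)) (h, p, j, k, l')" by (simp add: fields Suc)
        hence "w \<in> range (\<lambda>(h, p, j, k, l). (h, p, j, k, Suc l))" by (rule range_eqI)
        thus ?thesis using that by contradiction
      qed (simp add: fields D5_def)
    qed
  qed (auto simp: inj_on_def eval_series_tm tm_def dc5_def D5_def split_beta mult_ac simp del: of_nat_Suc intro!: infsum_cong)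
  moreover have "(\<Sum>n. D (e n)) = infsum D UNIV" if "\<And>w. norm (D w) \<le> B w" for D :: "idx5 \<Rightarrow> complex"
    using key[OF that] by blast
  ultimately show ?thesis
    using der DB[OF xS] by (simp add: g'_def)
qed

end

subsection \<open>Power series of holomorphic functions\<close>

lemma taylor_coeff_bound:
  assumes "f holomorphic_on ball 0 R" "0 < \<rho>" "\<rho> < R" "\<And>w. norm w < R \<Longrightarrow> norm (f w) \<le> M"
  shows "norm ((deriv ^^ k) f 0 / fact k) \<le> M / \<rho> ^ k"
proof -
  have "norm ((deriv ^^ k) f 0) \<le> fact k * M / \<rho> ^ k"
  proof (rule Cauchy_inequality)
    show "f holomorphic_on ball 0 \<rho>" using assms by (auto intro: holomorphic_on_subset)
    show "continuous_on (cball 0 \<rho>) f"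
      using assms(1,3) by (intro holomorphic_on_imp_continuous_on) (auto intro: holomorphic_on_subset)
  qed (use assms in auto)
  thus ?thesis by (simp add: norm_divide divide_le_eq mult_ac)
qed

lemma geometric_tail:
  fixes a :: "nat \<Rightarrow> complex"
  assumes "\<And>k. norm (a k) \<le> M / \<rho> ^ k" "0 < \<rho>" "norm w \<le> \<rho> / 2" "(\<lambda>k. a k * w ^ k) sums s"
  shows "norm (s - (\<Sum>j<k. a j * w ^ j)) \<le> 2 * M / \<rho> ^ k * norm w ^ k"
proof -
  have M: "M \<ge> 0" using order_trans[OF norm_ge_zero assms(1)[of 0]] by simp
  have "(\<lambda>i. a (i + k) * w ^ (i + k)) sums (s - (\<Sum>j<k. a j * w ^ j))"
    by (rule sums_split_initial_segment[OF assms(4)])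
  hence "norm (s - (\<Sum>j<k. a j * w ^ j)) = norm (\<Sum>i. a (i + k) * w ^ (i + k))"
    by (simp add: sums_iff)
  also have "\<dots> \<le> (\<Sum>i. M / \<rho> ^ k * norm w ^ k * (1 / 2) ^ i)"
  proof (rule norm_suminf_le)
    fix i
    have "norm (a (i + k) * w ^ (i + k)) \<le> M / \<rho> ^ (i + k) * norm w ^ (i + k)"
      unfolding norm_mult norm_power by (intro mult_right_mono assms) auto
    also have "\<dots> = M / \<rho> ^ k * norm w ^ k * (norm w / \<rho>) ^ i"
      by (simp add: power_add power_divide mult_ac)
    also have "\<dots> \<le> M / \<rho> ^ k * norm w ^ k * (1 / 2) ^ i"
      using assms(2,3) M by (intro mult_left_mono power_mono) (auto simp: field_simps)
    finally show "norm (a (i + k) * w ^ (i + k)) \<le> M / \<rho> ^ k * norm w ^ k * (1 / 2) ^ i" .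
  qed (intro summable_mult summable_geometric, simp)
  also have "\<dots> = M / \<rho> ^ k * norm w ^ k * (\<Sum>i. (1 / 2) ^ i)"
    by (intro suminf_mult summable_geometric) simp
  also have "\<dots> = 2 * M / \<rho> ^ k * norm w ^ k" by (subst suminf_geometric) simp_all
  finally show ?thesis .
qed

lemma taylor_sums:
  assumes "f holomorphic_on ball 0 R" "norm w < R"
  shows "(\<lambda>k. (deriv ^^ k) f 0 / fact k * w ^ k) sums f w"
  using holomorphic_power_series[OF assms(1), of w] assms(2) by (simp add: dist_norm)

text \<open>By induction on \<open>k\<close>: the k-th coefficient is the locally uniform limit, as
  w tends to 0, of the remainder after \<open>k\<close> terms divided by w^k, and these quotients
  are holomorphic in \<open>z\<close>.\<close>

lemma taylor_coeff_holomorphic: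
  fixes f :: "complex \<Rightarrow> complex \<Rightarrow> complex"
  assumes S: "open S" and \<rho>: "0 < \<rho>" "\<rho> < R"
    and h1: "\<And>z. z \<in> S \<Longrightarrow> f z holomorphic_on ball 0 R"
    and h2: "\<And>w. norm w < R \<Longrightarrow> (\<lambda>z. f z w) holomorphic_on S"
    and M: "\<And>z w. z \<in> S \<Longrightarrow> norm w < R \<Longrightarrow> norm (f z w) \<le> M"
  shows "(\<lambda>z. (deriv ^^ k) (f z) 0 / fact k) holomorphic_on S"
proof (induction k rule: less_induct)
  case (less k)
  define a where "a = (\<lambda>k z. (deriv ^^ k) (f z) 0 / fact k)"
  \<comment> \<open>Nonzero points tending to 0 inside the disc of radius \<open>\<rho> / 2\<close>,
    where the tail is dominated by a geometric series of ratio 1/2.\<close>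
  define w where "w = (\<lambda>n::nat. complex_of_real (\<rho> / 2 / of_nat (Suc n)))"
  have w0: "w n \<noteq> 0" and wn: "norm (w n) = \<rho> / 2 / of_nat (Suc n)" for n
    using \<rho> by (auto simp: w_def norm_divide simp del: of_nat_Suc)
  have wl: "norm (w n) \<le> \<rho> / 2" for n
    using \<rho> unfolding wn by (simp add: divide_le_eq mult_le_cancel_left1)
  hence wR: "norm (w n) < R" for n using \<rho> by (smt (verit) field_sum_of_halves)
  define g where "g = (\<lambda>n z. (f z (w n) - (\<Sum>j<k. a j z * w n ^ j)) / w n ^ k)"
  have "a k holomorphic_on S"
  proof (rule holomorphic_uniform_sequence[OF S])
    show "g n holomorphic_on S" for n
      unfolding g_def using w0 wR by (intro holomorphic_intros h2) (auto simp: a_def intro!: less)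
    fix x assume "x \<in> S"
    then obtain d where d: "d > 0" "cball x d \<subseteq> S" using S open_contains_cball by blast
    have ab: "norm (a k z) \<le> M / \<rho> ^ k" if "z \<in> S" for z k
      unfolding a_def using taylor_coeff_bound[OF h1[OF that] \<rho> M[OF that]] .
    have est: "norm (g n z - a k z) \<le> 2 * M / \<rho> ^ Suc k * norm (w n)" if z: "z \<in> S" for n z
    proof -
      have "norm (f z (w n) - (\<Sum>j<Suc k. a j z * w n ^ j)) \<le> 2 * M / \<rho> ^ Suc k * norm (w n) ^ Suc k"
        by (rule geometric_tail[OF _ \<rho>(1) wl]) (use ab[OF z] taylor_sums[OF h1[OF z] wR] in \<open>auto simp: a_def\<close>)
      moreover have "g n z - a k z = (f z (w n) - (\<Sum>j<Suc k. a j z * w n ^ j)) / w n ^ k"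
        using w0[of n] by (simp add: g_def field_simps)
      ultimately show ?thesis using w0[of n] by (simp add: norm_divide norm_power divide_le_eq mult_ac)
    qed
    have "uniform_limit (cball x d) g (a k) sequentially"
    proof (rule uniform_limitI)
      fix e :: real assume e: "e > 0"
      have "(\<lambda>n. 2 * M / \<rho> ^ Suc k * norm (w n)) \<longlonglongrightarrow> 2 * M / \<rho> ^ Suc k * 0"
        unfolding wn by (intro tendsto_intros LIMSEQ_Suc[OF lim_const_over_n])
      hence "\<forall>\<^sub>F n in sequentially. 2 * M / \<rho> ^ Suc k * norm (w n) < e"
        using e by (intro order_tendstoD) simp_all
      thus "\<forall>\<^sub>F n in sequentially. \<forall>z\<in>cball x d. dist (g n z) (a k z) < e"
      proof eventually_elim
        case (elim n)
        show ?case
        proof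
          fix z assume "z \<in> cball x d"
          hence "z \<in> S" using d(2) by blast
          from le_less_trans[OF est[OF this, of n] elim] show "dist (g n z) (a k z) < e"
            by (simp only: dist_norm)
        qed
      qed
    qed
    thus "\<exists>d>0. cball x d \<subseteq> S \<and> uniform_limit (cball x d) g (a k) sequentially" using d by blast
  qed
  thus ?case by (simp add: a_def)
qed

lemma has_sum_power_series:
  fixes a :: "nat \<Rightarrow> complex"
  assumes "\<And>k. norm (a k) \<le> M / \<rho> ^ k" "0 < \<rho>" "norm w \<le> \<rho> / 2" "(\<lambda>k. a k * w ^ k) sums s"
  shows "((\<lambda>k. a k * w ^ k) has_sum s) UNIV"
proof (rule norm_summable_imp_has_sum[OF _ assms(4)])
  have M: "M \<ge> 0" using order_trans[OF norm_ge_zero assms(1)[of 0]] by simp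
  show "summable (\<lambda>k. norm (a k * w ^ k))"
  proof (rule summable_comparison_test')
    show "summable (\<lambda>k. M * (1 / 2) ^ k)" by (intro summable_mult summable_geometric) simp
    fix k :: nat
    have "norm (a k * w ^ k) \<le> M / \<rho> ^ k * norm w ^ k"
      unfolding norm_mult norm_power by (intro mult_right_mono assms) auto
    also have "\<dots> = M * (norm w / \<rho>) ^ k" by (simp add: power_divide)
    also have "\<dots> \<le> M * (1 / 2) ^ k"
      using assms(2,3) M by (intro mult_left_mono power_mono) (auto simp: field_simps)
    finally show "norm (norm (a k * w ^ k)) \<le> M * (1 / 2) ^ k" by simp
  qed
qed

text \<open>Expansion in \<open>w\<close>, then \<open>z\<close>, then \<open>\<zeta>\<close>. The
  Cauchy estimate at each stage keeps the coefficients bounded and the previous lemma keeps them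
  holomorphic, so that the iterated expansion has a product of geometric series as majorant and may
  be read as one absolutely convergent triple sum.\<close>

lemma holomorphic3_series:
  fixes f :: "complex \<Rightarrow> complex \<Rightarrow> complex \<Rightarrow> complex"
  assumes R: "R > 0"
    and hw: "\<And>z \<zeta>. norm z < R \<Longrightarrow> norm \<zeta> < R \<Longrightarrow> f z \<zeta> holomorphic_on ball 0 R"
    and h\<zeta>: "\<And>z w. norm z < R \<Longrightarrow> norm w < R \<Longrightarrow> (\<lambda>\<zeta>. f z \<zeta> w) holomorphic_on ball 0 R"
    and hz: "\<And>\<zeta> w. norm \<zeta> < R \<Longrightarrow> norm w < R \<Longrightarrow> (\<lambda>z. f z \<zeta> w) holomorphic_on ball 0 R"
    and M: "\<And>z \<zeta> w. norm z < R \<Longrightarrow> norm \<zeta> < R \<Longrightarrow> norm w < R \<Longrightarrow> norm (f z \<zeta> w) \<le> M"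
  shows "\<exists>c r. conv c r \<and> (\<forall>h p j k l. j \<noteq> 0 \<or> k \<noteq> 0 \<longrightarrow> c h p j k l = 0) \<and>
     (\<forall>z \<zeta> w a \<alpha>. norm z \<le> r \<longrightarrow> norm \<zeta> \<le> r \<longrightarrow> norm w \<le> r \<longrightarrow> f z \<zeta> w = eval_series c z \<zeta> a \<alpha> w)"
proof -
  define \<rho> where "\<rho> = R / 2"
  have \<rho>: "0 < \<rho>" "\<rho> < R" using R by (simp_all add: \<rho>_def)
  define A where "A = (\<lambda>k z \<zeta>. (deriv ^^ k) (f z \<zeta>) 0 / fact k)"
  define B where "B = (\<lambda>k h \<zeta>. (deriv ^^ h) (\<lambda>z. A k z \<zeta>) 0 / fact h)"
  define C where "C = (\<lambda>k h q. (deriv ^^ q) (B k h) 0 / fact q)"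
  have A1: "(\<lambda>z. A k z \<zeta>) holomorphic_on ball 0 R" if "norm \<zeta> < R" for k \<zeta>
    unfolding A_def using that by (intro taylor_coeff_holomorphic[OF _ \<rho>, where M = M]) (auto intro: hw hz M)
  have A2: "(\<lambda>\<zeta>. A k z \<zeta>) holomorphic_on ball 0 R" if "norm z < R" for k z
    unfolding A_def using that by (intro taylor_coeff_holomorphic[OF _ \<rho>, where M = M]) (auto intro: hw h\<zeta> M)
  have AM: "norm (A k z \<zeta>) \<le> M / \<rho> ^ k" if "norm z < R" "norm \<zeta> < R" for k z \<zeta>
    unfolding A_def using that by (intro taylor_coeff_bound[OF _ \<rho>]) (auto intro: hw M)
  have B1: "B k h holomorphic_on ball 0 R" for k h
    unfolding B_def by (intro taylor_coeff_holomorphic[OF _ \<rho>, where M = "M / \<rho> ^ k"]) (auto intro: A1 A2 AM)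
  have BM: "norm (B k h \<zeta>) \<le> M / \<rho> ^ k / \<rho> ^ h" if "norm \<zeta> < R" for k h \<zeta>
    unfolding B_def using that by (intro taylor_coeff_bound[OF _ \<rho>]) (auto intro: A1 AM)
  have CM: "norm (C k h q) \<le> M / \<rho> ^ k / \<rho> ^ h / \<rho> ^ q" for k h q
    unfolding C_def by (rule taylor_coeff_bound[OF B1 \<rho> BM])
  \<comment> \<open>Half of the radius of the Cauchy estimates: every exponent then contributes a
    factor 1/2.\<close>
  define r where "r = \<rho> / 2"
  have r: "0 < r" "r < R" "r = \<rho> / 2" using \<rho> by (simp_all add: r_def)
  define c :: coeffs where "c = (\<lambda>h p j k l. if j = 0 \<and> k = 0 then C l h p else 0)"
  define g where "g = (\<lambda>(k::nat, h::nat, q::nat). (h, q, 0::nat, 0::nat, k))"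
  have g: "inj g" by (auto simp: inj_on_def g_def)
  have geo: "((\<lambda>n. (1 / 2 :: real) ^ n) has_sum 2) UNIV"
    using norm_summable_imp_has_sum[of "\<lambda>n. (1 / 2 :: real) ^ n" 2] geometric_sums[of "1 / 2 :: real"]
    by (simp add: summable_geometric)
  have geo3: "(\<lambda>(k, h, q). M * ((1 / 2) ^ k * ((1 / 2) ^ h * (1 / 2 :: real) ^ q))) summable_on UNIV"
  proof -
    have g1: "(\<lambda>n. (1 / 2 :: real) ^ n) summable_on UNIV" using geo by (auto simp: summable_on_def)
    define G where "G = (\<lambda>(h, q). (1 / 2) ^ h * (1 / 2 :: real) ^ q)"
    have g2: "G summable_on UNIV \<times> UNIV"
    proof (rule summable_on_SigmaI)
      show "((\<lambda>q. G (h, q)) has_sum (1 / 2) ^ h * 2) UNIV" for h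
        unfolding G_def prod.case by (rule has_sum_cmult_right[OF geo])
    qed (auto simp: G_def intro!: summable_on_cmult_left g1)
    have "(\<lambda>(k, hq). (1 / 2) ^ k * G hq) summable_on UNIV \<times> (UNIV \<times> UNIV)"
    proof (rule summable_on_SigmaI)
      show "((\<lambda>hq. case (k, hq) of (k, hq) \<Rightarrow> (1 / 2) ^ k * G hq) has_sum (1 / 2) ^ k * infsum G (UNIV \<times> UNIV)) (UNIV \<times> UNIV)" for k
        unfolding prod.case by (rule has_sum_cmult_right[OF has_sum_infsum[OF g2]])
    qed (auto simp: G_def intro!: summable_on_cmult_left g1)
    from summable_on_cmult_right[OF this, of M] show ?thesis by (simp add: case_prod_unfold G_def)
  qed
  have Cr: "norm (C k h q) * r ^ (h + q + k) \<le> M * ((1 / 2) ^ k * ((1 / 2) ^ h * (1 / 2) ^ q))" for k h q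
  proof -
    have "norm (C k h q) * r ^ (h + q + k) \<le> M / \<rho> ^ k / \<rho> ^ h / \<rho> ^ q * r ^ (h + q + k)"
      using r by (intro mult_right_mono CM) auto
    also have "\<dots> = M * ((1 / 2) ^ k * ((1 / 2) ^ h * (1 / 2) ^ q))"
      using \<rho> by (simp add: r_def power_add power_divide field_simps)
    finally show ?thesis .
  qed
  have csum: "(\<lambda>(k, h, q). norm (C k h q) * r ^ (h + q + k)) summable_on UNIV"
    by (rule summable_on_comparison_test[OF geo3]) (use Cr r in auto)
  have conv: "conv c r"
    unfolding conv_def
  proof
    have "((\<lambda>(h, p, j, k, l). norm (c h p j k l) * r ^ (h + p + j + k + l)) \<circ> g) summable_on UNIV"
      using csum by (simp add: o_def g_def c_def case_prod_unfold)
    hence "(\<lambda>(h, p, j, k, l). norm (c h p j k l) * r ^ (h + p + j + k + l)) summable_on range g"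
      by (subst summable_on_reindex[OF g])
    thus "(\<lambda>(h, p, j, k, l). norm (c h p j k l) * r ^ (h + p + j + k + l)) summable_on UNIV"
      by (rule summable_on_cong_neutral[THEN iffD1, rotated -1]) (force simp: g_def c_def image_iff)+
  qed (rule r)
  have "f z \<zeta> w = eval_series c z \<zeta> a \<alpha> w" if z: "norm z \<le> r" and \<zeta>: "norm \<zeta> \<le> r" and w: "norm w \<le> r" for z \<zeta> w a \<alpha>
  proof -
    have R': "norm z < R" "norm \<zeta> < R" "norm w < R" using that r by auto
    define F where "F = (\<lambda>(k, h, q). C k h q * \<zeta> ^ q * z ^ h * w ^ k)"
    have s1: "((\<lambda>q. C k h q * \<zeta> ^ q) has_sum B k h \<zeta>) UNIV" for k h
      by (rule has_sum_power_series[OF CM \<rho>(1)]) (use \<zeta> r taylor_sums[OF B1 R'(2)] in \<open>auto simp: C_def\<close>)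
    have s2: "((\<lambda>h. B k h \<zeta> * z ^ h) has_sum A k z \<zeta>) UNIV" for k
      by (rule has_sum_power_series[OF BM[OF R'(2)] \<rho>(1)]) (use z r taylor_sums[OF A1[OF R'(2)] R'(1)] in \<open>auto simp: B_def\<close>)
    have s3: "((\<lambda>k. A k z \<zeta> * w ^ k) has_sum f z \<zeta> w) UNIV"
      by (rule has_sum_power_series[OF AM[OF R'(1,2)] \<rho>(1)]) (use w r taylor_sums[OF hw[OF R'(1,2)] R'(3)] in \<open>auto simp: A_def\<close>)
    have Fs: "F summable_on UNIV"
    proof (rule abs_summable_summable, rule summable_on_comparison_test[OF csum])
      fix x show "norm (F x) \<le> (case x of (k, h, q) \<Rightarrow> norm (C k h q) * r ^ (h + q + k))"
      proof (cases x)
        case (fields k h q)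
        have "norm (F x) = norm (C k h q) * (norm z ^ h * norm \<zeta> ^ q * norm w ^ k)"
          by (simp add: fields F_def norm_mult norm_power mult_ac)
        also have "\<dots> \<le> norm (C k h q) * (r ^ h * r ^ q * r ^ k)"
          using that r by (intro mult_left_mono mult_mono power_mono) auto
        finally show ?thesis by (simp add: fields power_add)
      qed
    qed auto
    have FS: "F summable_on A" for A by (rule summable_on_subset_banach[OF Fs]) simp
    have in2: "((\<lambda>(h, q). F (k, h, q)) has_sum A k z \<zeta> * w ^ k) UNIV" for k
    proof -
      have sm: "(\<lambda>(h, q). F (k, h, q)) summable_on UNIV"
        using FS[of "range (Pair k)"] by (subst (asm) summable_on_reindex) (auto simp: inj_on_def o_def case_prod_unfold)
      have "infsum (\<lambda>(h, q). F (k, h, q)) (UNIV \<times> UNIV) = (\<Sum>\<^sub>\<infinity>h. \<Sum>\<^sub>\<infinity>q. F (k, h, q))"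
        using infsum_Sigma'_banach[of "\<lambda>h q. F (k, h, q)" UNIV "\<lambda>_. UNIV"] sm by simp
      also have "\<dots> = (\<Sum>\<^sub>\<infinity>h. B k h \<zeta> * z ^ h * w ^ k)"
      proof (rule infsum_cong)
        show "(\<Sum>\<^sub>\<infinity>q. F (k, h, q)) = B k h \<zeta> * z ^ h * w ^ k" for h
          using infsumI[OF has_sum_cmult_left[OF s1[of k h], of "z ^ h * w ^ k"]] by (simp add: F_def mult_ac)
      qed
      also have "(\<Sum>\<^sub>\<infinity>h. B k h \<zeta> * z ^ h * w ^ k) = A k z \<zeta> * w ^ k"
        by (rule infsumI[OF has_sum_cmult_left[OF s2]])
      finally show ?thesis using sm has_sum_infsum by fastforce
    qed
    have "infsum F (UNIV \<times> UNIV) = (\<Sum>\<^sub>\<infinity>k. \<Sum>\<^sub>\<infinity>hq. F (k, hq))"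
      using infsum_Sigma'_banach[of "\<lambda>k hq. F (k, hq)" UNIV "\<lambda>_. UNIV"] Fs by (simp add: case_prod_unfold)
    also have "\<dots> = (\<Sum>\<^sub>\<infinity>k. A k z \<zeta> * w ^ k)"
    proof (rule infsum_cong)
      show "(\<Sum>\<^sub>\<infinity>hq. F (k, hq)) = A k z \<zeta> * w ^ k" for k
        using infsumI[OF in2[of k]] by (simp add: case_prod_unfold)
    qed
    also have "(\<Sum>\<^sub>\<infinity>k. A k z \<zeta> * w ^ k) = f z \<zeta> w" by (rule infsumI[OF s3])
    finally have "f z \<zeta> w = infsum F UNIV" by simp
    also have "F = tm c z \<zeta> a \<alpha> w \<circ> g"
      by (auto simp: fun_eq_iff F_def tm_def g_def c_def)
    also have "infsum (tm c z \<zeta> a \<alpha> w \<circ> g) UNIV = infsum (tm c z \<zeta> a \<alpha> w) (range g)"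
      by (rule infsum_reindex[OF g, symmetric])
    also have "\<dots> = infsum (tm c z \<zeta> a \<alpha> w) UNIV"
      by (rule infsum_cong_neutral) (force simp: g_def c_def tm_def image_iff)+
    finally show ?thesis by (simp add: eval_series_tm)
  qed
  thus ?thesis using conv by (intro exI[of _ c] exI[of _ r]) (auto simp: c_def)
qed

subsection \<open>Derivations and supports of formal series\<close>

definition derivation :: "('a::comm_ring_1 \<Rightarrow> 'a) \<Rightarrow> bool" where
  "derivation d \<longleftrightarrow> (\<forall>a b. d (a + b) = d a + d b) \<and> (\<forall>a b. d (a * b) = d a * b + a * d b)"

lemma derivation_fps_deriv: "derivation (fps_deriv :: 'a::comm_ring_1 fps \<Rightarrow> 'a fps)"
  by (simp add: derivation_def add.commute)

context
  fixes d :: "'a::comm_ring_1 \<Rightarrow> 'a"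
  assumes d: "derivation d"
begin

lemma derivation_add: "d (a + b) = d a + d b" and derivation_mult: "d (a * b) = d a * b + a * d b"
  using d by (auto simp: derivation_def)

lemma derivation_0: "d 0 = 0"
  using derivation_add[of 0 0] by simp

lemma derivation_1: "d 1 = 0"
  using derivation_mult[of 1 1] by simp

lemma derivation_minus: "d (- a) = - d a"
  using derivation_add[of "- a" a] by (simp add: derivation_0 eq_neg_iff_add_eq_0)

lemma derivation_diff: "d (a - b) = d a - d b"
  using derivation_add[of a "- b"] by (simp add: derivation_minus)

lemma derivation_sum: "d (\<Sum>i\<in>A. f i) = (\<Sum>i\<in>A. d (f i))"
  by (induction A rule: infinite_finite_induct) (simp_all add: derivation_0 derivation_add)

lemma derivation_power: "d (a ^ n) = of_nat n * a ^ (n - 1) * d a"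
proof (induction n)
  case (Suc n)
  have "a * (of_nat n * a ^ (n - 1) * d a) = of_nat n * a ^ n * d a"
    by (cases n) (simp_all add: mult_ac)
  thus ?case using Suc by (simp add: derivation_mult algebra_simps)
qed (simp add: derivation_1)

lemma derivation_fps_map: "derivation (fps_map d)"
  unfolding derivation_def
proof (intro conjI allI)
  show "fps_map d (a + b) = fps_map d a + fps_map d b" for a b
    by (rule fps_ext) (simp add: derivation_add)
  show "fps_map d (a * b) = fps_map d a * b + a * fps_map d b" for a b
    by (rule fps_ext) (simp add: fps_mult_nth derivation_sum derivation_mult sum.distrib)
qed

end

lemma fps_map_const: "d 0 = 0 \<Longrightarrow> fps_map d (fps_const a) = fps_const (d a)"
  by (rule fps_ext) auto

lemma fps_map_X: "d 0 = 0 \<Longrightarrow> d 1 = 0 \<Longrightarrow> fps_map d fps_X = 0"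
  by (rule fps_ext) auto

lemma fps_map_01: "d 0 = 0 \<Longrightarrow> fps_map d 0 = 0" "d 0 = 0 \<Longrightarrow> d 1 = 0 \<Longrightarrow> fps_map d 1 = 0"
  by (rule fps_ext, simp)+

lemma derivation_dX: "derivation dX" and derivation_dY: "derivation dY" and derivation_dT: "derivation dT"
  unfolding dX_def dY_def dT_def by (intro derivation_fps_map derivation_fps_deriv)+

definition pdX :: "ser5 \<Rightarrow> ser5" where "pdX = fps_map (fps_map dX)"
definition pdY :: "ser5 \<Rightarrow> ser5" where "pdY = fps_map (fps_map dY)"
definition pdT :: "ser5 \<Rightarrow> ser5" where "pdT = fps_map (fps_map dT)"
definition pdZ :: "ser5 \<Rightarrow> ser5" where "pdZ = fps_map fps_deriv"
definition pdA :: "ser5 \<Rightarrow> ser5" where "pdA = fps_deriv"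

lemma derivation_pd: "derivation pdX" "derivation pdY" "derivation pdT" "derivation pdZ" "derivation pdA"
  unfolding pdX_def pdY_def pdT_def pdZ_def pdA_def
  by (intro derivation_fps_map derivation_fps_deriv derivation_dX derivation_dY derivation_dT)+

lemma d3_vars:
  "dX fps_X = 1" "dX (fps_const f) = 0" "dY fps_X = 0" "dY (fps_const fps_X) = 1" "dY (fps_const (fps_const g)) = 0"
  "dT fps_X = 0" "dT (fps_const fps_X) = 0" "dT (fps_const (fps_const fps_X)) = 1" "dT (fps_const (fps_const (fps_const c))) = 0"
  by (simp_all add: dX_def dY_def dT_def fps_map_const fps_map_X fps_map_01)

lemma d3_01: "dX 0 = 0" "dX 1 = 0" "dY 0 = 0" "dY 1 = 0" "dT 0 = 0" "dT 1 = 0"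
  using derivation_0[OF derivation_dX] derivation_0[OF derivation_dY] derivation_0[OF derivation_dT]
    derivation_1[OF derivation_dX] derivation_1[OF derivation_dY] derivation_1[OF derivation_dT] by simp_all

lemma pd_vars [simp]:
  "pdX vX = 1" "pdX vY = 0" "pdX vT = 0" "pdX vZ = 0" "pdX vA = 0" "pdX (cst c) = 0"
  "pdY vX = 0" "pdY vY = 1" "pdY vT = 0" "pdY vZ = 0" "pdY vA = 0" "pdY (cst c) = 0"
  "pdT vX = 0" "pdT vY = 0" "pdT vT = 1" "pdT vZ = 0" "pdT vA = 0" "pdT (cst c) = 0"
  "pdZ vX = 0" "pdZ vY = 0" "pdZ vT = 0" "pdZ vZ = 1" "pdZ vA = 0" "pdZ (cst c) = 0"
  "pdA vX = 0" "pdA vY = 0" "pdA vT = 0" "pdA vZ = 0" "pdA vA = 1" "pdA (cst c) = 0"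
  by (simp_all add: pdX_def pdY_def pdT_def pdZ_def pdA_def vX_def vY_def vT_def vZ_def vA_def cst_def
      fps_map_const fps_map_X fps_map_01 d3_vars d3_01)

lemmas pd_rules = derivation_pd[THEN derivation_add] derivation_pd[THEN derivation_diff] derivation_pd[THEN derivation_mult]
  derivation_pd[THEN derivation_minus] derivation_pd[THEN derivation_0] derivation_pd[THEN derivation_1]

lemma ser5_eqI: "(\<And>q p i j k. f $ q $ p $ i $ j $ k = g $ q $ p $ i $ j $ k) \<Longrightarrow> f = (g :: ser5)"
  by (simp add: fps_eq_iff)

lemma xyt: "f $ i $ j $ k = xyt_coeff f i j k"
  by (simp add: xyt_coeff_def)

lemma nst_dc: "nst (dc1 c) = pdX (nst c)" "nst (dc2 c) = pdZ (nst c)" "nst (dc3 c) = pdY (nst c)"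
  "nst (dc4 c) = pdA (nst c)" "nst (dc5 c) = pdT (nst c)"
proof -
  have ofn: "(of_nat n * f) $ m = of_nat n * f $ m" for n m and f :: "'a::comm_ring_1 fps"
    by (simp add: of_nat_fps_const flip: fps_of_nat)
  show "nst (dc1 c) = pdX (nst c)" "nst (dc3 c) = pdY (nst c)" "nst (dc5 c) = pdT (nst c)"
    by (rule ser5_eqI, simp add: pdX_def pdY_def pdT_def, simp add: xyt dc1_def dc3_def dc5_def, simp add: xyt_coeff_def)+
  show "nst (dc2 c) = pdZ (nst c)" "nst (dc4 c) = pdA (nst c)"
    by (rule ser5_eqI, simp add: pdZ_def pdA_def dc2_def dc4_def ofn del: of_nat_Suc)+
qed

text \<open>The pair recorded for a monomial is its degree in \<open>\<zeta>\<close> and its conjugate, and its weight.\<close>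

definition supp_in :: "ser5 \<Rightarrow> (nat \<Rightarrow> nat \<Rightarrow> bool) \<Rightarrow> bool" where
  "supp_in f S \<longleftrightarrow> (\<forall>q p i j k. f $ q $ p $ i $ j $ k \<noteq> 0 \<longrightarrow> S (q + p) (i + j + 2 * k))"

lemma supp_in_lin:
  "supp_in f S \<Longrightarrow> supp_in g S \<Longrightarrow> supp_in (f + g) S"
  "supp_in f S \<Longrightarrow> supp_in g S \<Longrightarrow> supp_in (f - g) S"
  "supp_in f S \<Longrightarrow> supp_in (- f) S"
  "supp_in 0 S"
proof -
  show "supp_in f S \<Longrightarrow> supp_in g S \<Longrightarrow> supp_in (f + g) S"
    unfolding supp_in_def
  proof (intro allI impI)
    fix q p i j k
    assume *: "\<forall>q p i j k. f $ q $ p $ i $ j $ k \<noteq> 0 \<longrightarrow> S (q + p) (i + j + 2 * k)"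
       "\<forall>q p i j k. g $ q $ p $ i $ j $ k \<noteq> 0 \<longrightarrow> S (q + p) (i + j + 2 * k)"
    assume "(f + g) $ q $ p $ i $ j $ k \<noteq> 0"
    hence "f $ q $ p $ i $ j $ k \<noteq> 0 \<or> g $ q $ p $ i $ j $ k \<noteq> 0" by auto
    thus "S (q + p) (i + j + 2 * k)" using * by blast
  qed
  show "supp_in f S \<Longrightarrow> supp_in g S \<Longrightarrow> supp_in (f - g) S"
    unfolding supp_in_def
  proof (intro allI impI)
    fix q p i j k
    assume *: "\<forall>q p i j k. f $ q $ p $ i $ j $ k \<noteq> 0 \<longrightarrow> S (q + p) (i + j + 2 * k)"
       "\<forall>q p i j k. g $ q $ p $ i $ j $ k \<noteq> 0 \<longrightarrow> S (q + p) (i + j + 2 * k)"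
    assume "(f - g) $ q $ p $ i $ j $ k \<noteq> 0"
    hence "f $ q $ p $ i $ j $ k \<noteq> 0 \<or> g $ q $ p $ i $ j $ k \<noteq> 0" by auto
    thus "S (q + p) (i + j + 2 * k)" using * by blast
  qed
  show "supp_in f S \<Longrightarrow> supp_in (- f) S" "supp_in 0 S" by (simp_all add: supp_in_def)
qed

lemma supp_in_mono: "supp_in f S \<Longrightarrow> (\<And>a b. S a b \<Longrightarrow> T a b) \<Longrightarrow> supp_in f T"
  by (auto simp: supp_in_def)

text \<open>A nonzero coefficient of the product requires, in each of the five nested Cauchy
  products, a nonzero contribution; these locate one monomial in each factor.\<close>

lemma supp_in_mult:
  assumes "supp_in f S" "supp_in g T" "\<And>a b a' b'. S a b \<Longrightarrow> T a' b' \<Longrightarrow> U (a + a') (b + b')"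
  shows "supp_in (f * g) U"
  unfolding supp_in_def
proof (intro allI impI)
  fix q p i j k assume nz: "(f * g) $ q $ p $ i $ j $ k \<noteq> 0"
  have "(\<Sum>q'=0..q. (f $ q' * g $ (q - q')) $ p $ i $ j $ k) \<noteq> 0" 
    using nz unfolding fps_mult_nth[of f g q] fps_sum_nth .
  then obtain q' where q': "q' \<in> {0..q}" "(f $ q' * g $ (q - q')) $ p $ i $ j $ k \<noteq> 0"
    by (rule sum.not_neutral_contains_not_neutral)
  hence "(\<Sum>p'=0..p. (f $ q' $ p' * g $ (q - q') $ (p - p')) $ i $ j $ k) \<noteq> 0"
    unfolding fps_mult_nth[of "f $ q'" "g $ (q - q')" p] fps_sum_nth by -
  then obtain p' where p': "p' \<in> {0..p}" "(f $ q' $ p' * g $ (q - q') $ (p - p')) $ i $ j $ k \<noteq> 0"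
    by (rule sum.not_neutral_contains_not_neutral)
  hence "(\<Sum>i'=0..i. (f $ q' $ p' $ i' * g $ (q - q') $ (p - p') $ (i - i')) $ j $ k) \<noteq> 0"
    unfolding fps_mult_nth[of "f $ q' $ p'" "g $ (q - q') $ (p - p')" i] fps_sum_nth by -
  then obtain i' where i': "i' \<in> {0..i}" "(f $ q' $ p' $ i' * g $ (q - q') $ (p - p') $ (i - i')) $ j $ k \<noteq> 0"
    by (rule sum.not_neutral_contains_not_neutral)
  hence "(\<Sum>j'=0..j. (f $ q' $ p' $ i' $ j' * g $ (q - q') $ (p - p') $ (i - i') $ (j - j')) $ k) \<noteq> 0"
    unfolding fps_mult_nth[of "f $ q' $ p' $ i'" "g $ (q - q') $ (p - p') $ (i - i')" j] fps_sum_nth by -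
  then obtain j' where j': "j' \<in> {0..j}" "(f $ q' $ p' $ i' $ j' * g $ (q - q') $ (p - p') $ (i - i') $ (j - j')) $ k \<noteq> 0"
    by (rule sum.not_neutral_contains_not_neutral)
  hence "(\<Sum>k'=0..k. f $ q' $ p' $ i' $ j' $ k' * g $ (q - q') $ (p - p') $ (i - i') $ (j - j') $ (k - k')) \<noteq> 0"
    unfolding fps_mult_nth by -
  then obtain k' where k': "k' \<in> {0..k}" "f $ q' $ p' $ i' $ j' $ k' * g $ (q - q') $ (p - p') $ (i - i') $ (j - j') $ (k - k') \<noteq> 0"
    by (rule sum.not_neutral_contains_not_neutral)
  have "S (q' + p') (i' + j' + 2 * k')" "T ((q - q') + (p - p')) ((i - i') + (j - j') + 2 * (k - k'))"
    using k'(2) assms(1,2) by (auto simp: supp_in_def)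
  moreover have "(q' + p') + ((q - q') + (p - p')) = q + p"
    using q'(1) p'(1) by simp
  moreover have "(i' + j' + 2 * k') + ((i - i') + (j - j') + 2 * (k - k')) = i + j + 2 * k"
    using i'(1) j'(1) k'(1) by simp
  ultimately show "U (q + p) (i + j + 2 * k)"
    using assms(3) by metis
qed

subsection \<open>The Levi determinant\<close>

unbundle no fps_syntax
unbundle vec_syntax

definition cnj_coeffs :: "coeffs \<Rightarrow> coeffs" where
  "cnj_coeffs c = (\<lambda>h p j k l. cnj (c j k h p l))"

lemma cnj_graph_value: "cnj (graph_value c p) = graph_value (cnj_coeffs c) p"
proof -
  let ?g = "\<lambda>(h, p, j, k, l). (j, k, h, p, l) :: idx5"
  have "cnj (graph_value c p) = (\<Sum>\<^sub>\<infinity>w. cnj (tm c (p $ 1) (p $ 2) (cnj (p $ 1)) (cnj (p $ 2)) (of_real (Im (p $ 3))) w))"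
    unfolding graph_value_def eval_series_tm by (rule infsum_cnj [symmetric])
  also have "\<dots> = (\<Sum>\<^sub>\<infinity>w. tm (cnj_coeffs c) (p $ 1) (p $ 2) (cnj (p $ 1)) (cnj (p $ 2)) (of_real (Im (p $ 3))) w)"
    by (rule infsum_reindex_bij_witness[of _ ?g ?g]) (auto simp: tm_def cnj_coeffs_def mult_ac)
  finally show ?thesis by (simp add: graph_value_def eval_series_tm)
qed

lemma hermitian_cnj_coeffs:
  assumes "hermitian_coeffs F"
  shows "cnj_coeffs F = F" "cnj_coeffs (dc1 F) = dc3 F" "cnj_coeffs (dc2 F) = dc4 F" "cnj_coeffs (dc5 F) = dc5 F"
  using assms by (simp_all add: cnj_coeffs_def dc1_def dc2_def dc3_def dc4_def dc5_def hermitian_coeffs_def fun_eq_iff)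

lemma norm_component_le: "norm (x $ i) \<le> norm x" for x :: "complex ^ 3"
  by (rule Finite_Cartesian_Product.norm_nth_le)

lemma graph_value_has_derivative:
  assumes "conv c r" "norm p < r"
  shows "(graph_value c has_derivative (\<lambda>q. graph_value (dc1 c) p * q $ 1 + graph_value (dc2 c) p * q $ 2
     + graph_value (dc3 c) p * cnj (q $ 1) + graph_value (dc4 c) p * cnj (q $ 2)
     + graph_value (dc5 c) p * of_real (Im (q $ 3)))) (at p)"
proof -
  have n1: "norm (cnj (x $ i)) \<le> norm x" for x :: "complex ^ 3" and i
    using norm_component_le[of x i] by simp
  have n3: "norm (complex_of_real (Im (x $ 3))) \<le> norm x" for x :: "complex ^ 3"
    using abs_Im_le_cmod[of "x $ 3"] norm_component_le[of x 3] by simp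
  have b: "bounded_linear (\<lambda>x::complex^3. cnj (x $ i))" "bounded_linear (\<lambda>x::complex^3. complex_of_real (Im (x $ i)))" for i
    by (intro bounded_linear_compose[OF bounded_linear_cnj] bounded_linear_compose[OF bounded_linear_of_real]
        bounded_linear_compose[OF bounded_linear_Im] bounded_linear_vec_nth)+
  note lt = le_less_trans[OF _ assms(2)]
  show ?thesis
    unfolding graph_value_def[abs_def]
    by (rule eval_series_has_derivative[OF bounded_linear_vec_nth bounded_linear_vec_nth b(1) b(1) b(2)
          norm_component_le norm_component_le n1 n1 n3 assms(1) lt[OF norm_component_le] lt[OF norm_component_le] lt[OF n1] lt[OF n1] lt[OF n3]])
qed

lemma frechet_derivative_local:
  assumes "(g has_derivative D) (at p)" "norm p < r" "\<And>q. norm q < r \<Longrightarrow> f q = g q"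
  shows "frechet_derivative f (at p) = D"
proof -
  have "(f has_derivative D) (at p)"
    by (rule has_derivative_transform_within_open[OF assms(1), of "ball 0 r"]) (use assms in auto)
  thus ?thesis by (rule frechet_derivative_at [symmetric])
qed

lemma axis_nth3: "axis i x $ j = (if j = i then x else 0)"
  by (simp add: axis_def)

text \<open>The function depends on \<open>w\<close> only through \<open>v\<close>, its imaginary
  part; this is the source of the factors with \<i> / 2.\<close>

lemma dZ_local:
  assumes "conv c r" "norm p < r" "\<And>q. norm q < r \<Longrightarrow> f q = A * graph_value c q + B"
  shows "dZ 1 f p = A * graph_value (dc1 c) p" "dZ 2 f p = A * graph_value (dc2 c) p" "dZ 3 f p = - \<i> / 2 * A * graph_value (dc5 c) p"
   "dZbar 1 f p = A * graph_value (dc3 c) p" "dZbar 2 f p = A * graph_value (dc4 c) p" "dZbar 3 f p = \<i> / 2 * A * graph_value (dc5 c) p"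
proof -
  have "((\<lambda>q. A * graph_value c q + B) has_derivative (\<lambda>q. A * (graph_value (dc1 c) p * q $ 1 + graph_value (dc2 c) p * q $ 2
     + graph_value (dc3 c) p * cnj (q $ 1) + graph_value (dc4 c) p * cnj (q $ 2)
     + graph_value (dc5 c) p * of_real (Im (q $ 3))) + 0)) (at p)"
    by (intro has_derivative_add has_derivative_const has_derivative_mult_right graph_value_has_derivative[OF assms(1,2)])
  note D = frechet_derivative_local[OF this assms(2,3)]
  show "dZ 1 f p = A * graph_value (dc1 c) p" "dZ 2 f p = A * graph_value (dc2 c) p" "dZ 3 f p = - \<i> / 2 * A * graph_value (dc5 c) p"
   "dZbar 1 f p = A * graph_value (dc3 c) p" "dZbar 2 f p = A * graph_value (dc4 c) p" "dZbar 3 f p = \<i> / 2 * A * graph_value (dc5 c) p"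
    by (simp_all add: dZ_def dZbar_def D axis_nth3 algebra_simps)
qed

lemma dZ_height:
  assumes "conv c r" "norm p < r" "\<And>q. f q = graph_value c q - of_real (Re (q $ 3))"
  shows "dZ 1 f p = graph_value (dc1 c) p" "dZ 2 f p = graph_value (dc2 c) p" "dZ 3 f p = - \<i> / 2 * graph_value (dc5 c) p - 1 / 2"
proof -
  have "((\<lambda>q. graph_value c q - of_real (Re (q $ 3))) has_derivative (\<lambda>q. (graph_value (dc1 c) p * q $ 1 + graph_value (dc2 c) p * q $ 2
     + graph_value (dc3 c) p * cnj (q $ 1) + graph_value (dc4 c) p * cnj (q $ 2)
     + graph_value (dc5 c) p * of_real (Im (q $ 3))) - of_real (Re (q $ 3)))) (at p)"
    by (intro has_derivative_diff graph_value_has_derivative[OF assms(1,2)] bounded_linear_imp_has_derivative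
      bounded_linear_compose[OF bounded_linear_of_real] bounded_linear_compose[OF bounded_linear_Re] bounded_linear_vec_nth)
  note D = frechet_derivative_local[OF this assms(2) assms(3)]
  show "dZ 1 f p = graph_value (dc1 c) p" "dZ 2 f p = graph_value (dc2 c) p" "dZ 3 f p = - \<i> / 2 * graph_value (dc5 c) p - 1 / 2"
    by (simp_all add: dZ_def D axis_nth3 algebra_simps) (simp add: diff_divide_distrib)
qed

text \<open>The two vectors lie in \<open>T10\<close>, whose dimension is therefore at least 2; rank
  one forces a nonzero vector in the Levi kernel. Such a vector is a combination of the two, so
  their Gram matrix for the Levi form is singular.\<close>

lemma levi_rank_det:
  fixes \<rho> :: "complex ^ 3 \<Rightarrow> real" and p :: "complex ^ 3"
  defines "a \<equiv> \<lambda>j. dZ j (\<lambda>q. of_real (\<rho> q)) p"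
  defines "X1 \<equiv> vector [1, 0, - a 1 / a 3] :: complex ^ 3" and "X2 \<equiv> vector [0, 1, - a 2 / a 3] :: complex ^ 3"
  assumes a3: "a 3 \<noteq> 0" and rank: "levi_rank \<rho> p = 1"
  shows "levi_form \<rho> p X1 X1 * levi_form \<rho> p X2 X2 = levi_form \<rho> p X1 X2 * levi_form \<rho> p X2 X1"
proof -
  have T: "X \<in> T10 \<rho> p \<longleftrightarrow> a 1 * X $ 1 + a 2 * X $ 2 + a 3 * X $ 3 = 0" for X
    by (simp add: T10_def a_def sum_3)
  have X12: "X1 \<in> T10 \<rho> p" "X2 \<in> T10 \<rho> p" using a3 by (simp_all add: T X1_def X2_def)
  have "vec.independent {X1, X2}"
  proof (rule vec.independent_insertI)
    show "X1 \<notin> vec.span {X2}"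
    proof
      assume "X1 \<in> vec.span {X2}"
      then obtain k where "X1 = k *s X2" by (auto simp: vec.span_singleton)
      hence "X1 $ 1 = k * X2 $ 1" by simp
      thus False by (simp add: X1_def X2_def)
    qed
    have "X2 \<noteq> 0"
    proof
      assume "X2 = 0"
      hence "X2 $ 2 = 0" by simp
      thus False by (simp add: X2_def)
    qed
    thus "vec.independent {X2}" by simp
  qed
  moreover have "X1 \<noteq> X2"
  proof
    assume "X1 = X2"
    hence "X1 $ 1 = X2 $ 1" by simp
    thus False by (simp add: X1_def X2_def)
  qed
  ultimately have "2 \<le> vec.dim (T10 \<rho> p)"
    using vec.independent_card_le_dim[of "{X1, X2}" "T10 \<rho> p"] X12 by simp
  hence "vec.dim (levi_kernel \<rho> p) \<noteq> 0" using rank unfolding levi_rank_def by linarith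
  then obtain K where K: "K \<in> levi_kernel \<rho> p" "K \<noteq> 0"
    unfolding vec.dim_eq_0 by blast
  have KT: "K \<in> T10 \<rho> p" using K(1) by (simp add: levi_kernel_def)
  have K3: "K $ 3 = K $ 1 * (- a 1 / a 3) + K $ 2 * (- a 2 / a 3)"
  proof -
    have "a 3 * K $ 3 = - (a 1 * K $ 1 + a 2 * K $ 2)"
      using KT unfolding T by (metis add_eq_0_iff add.commute minus_minus)
    hence "K $ 3 = - (a 1 * K $ 1 + a 2 * K $ 2) / a 3" using a3 by (simp add: eq_divide_eq mult.commute)
    thus ?thesis by (simp add: add_divide_distrib diff_divide_distrib mult.commute)
  qed
  have K12: "K $ 1 \<noteq> 0 \<or> K $ 2 \<noteq> 0"
  proof (rule ccontr)
    assume "\<not> (K $ 1 \<noteq> 0 \<or> K $ 2 \<noteq> 0)"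
    hence "K = 0" using K3 by (simp add: vec_eq_iff forall_3)
    thus False using K(2) by contradiction
  qed
  have Kl: "levi_form \<rho> p K Y = K $ 1 * levi_form \<rho> p X1 Y + K $ 2 * levi_form \<rho> p X2 Y" for Y
    unfolding levi_form_def sum_3 K3 by (simp add: X1_def X2_def algebra_simps add_divide_distrib diff_divide_distrib)
  have e1: "K $ 1 * levi_form \<rho> p X1 X1 + K $ 2 * levi_form \<rho> p X2 X1 = 0"
    and e2: "K $ 1 * levi_form \<rho> p X1 X2 + K $ 2 * levi_form \<rho> p X2 X2 = 0"
    using K(1) X12 unfolding Kl[symmetric] by (auto simp: levi_kernel_def)
  have det: "x * w = y * v" if "k1 * x + k2 * v = 0" "k1 * y + k2 * w = 0" "k1 \<noteq> 0 \<or> k2 \<noteq> 0" for k1 k2 x y v w :: complex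
  proof -
    have "k1 * (x * w - y * v) = (k1 * x + k2 * v) * w - (k1 * y + k2 * w) * v" by (simp add: algebra_simps)
    moreover have "k2 * (x * w - y * v) = (k1 * y + k2 * w) * x - (k1 * x + k2 * v) * y" by (simp add: algebra_simps)
    ultimately show ?thesis using that by auto
  qed
  show ?thesis by (rule det[OF e1 e2 K12])
qed

text \<open>The Levi form on the frame of the graph, multiplied by \<open>1 + (F\<^sub>v)\<^sup>2\<close>.\<close>

definition levi_entry :: "'a::comm_ring_1 \<Rightarrow> 'a \<Rightarrow> 'a \<Rightarrow> 'a \<Rightarrow> 'a \<Rightarrow> 'a \<Rightarrow> 'a \<Rightarrow> 'a \<Rightarrow> 'a" where
  "levi_entry \<iota> fij f5 fi f5j fj fi5 f55 =
     fij * (1 + f5 * f5) - \<iota> * fi * f5j * (1 - \<iota> * f5) + \<iota> * fj * fi5 * (1 + \<iota> * f5) + fi * fj * f55"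

text \<open>The factor 1 + \<open>f5 * f5\<close> splits into the two denominators of the frame, so
  multiplication by it clears them.\<close>

lemma levi_entry_eq:
  fixes f5 :: complex
  assumes "1 + \<i> * f5 \<noteq> 0" "1 - \<i> * f5 \<noteq> 0" "x = 2 * fi / (1 + \<i> * f5)" "y = 2 * fj / (1 - \<i> * f5)"
  shows "(fij + x * (- \<i> / 2 * f5j) + y * (\<i> / 2 * fi5) + x * y * (f55 / 4)) * (1 + f5 * f5)
    = levi_entry \<i> fij f5 fi f5j fj fi5 f55"
proof -
  define P where "P = 1 + \<i> * f5"
  define N where "N = 1 - \<i> * f5"
  have f: "1 + f5 * f5 = P * N" by (simp add: P_def N_def algebra_simps)
  have x: "x * P = 2 * fi" and y: "y * N = 2 * fj" using assms by (simp_all add: P_def N_def)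
  have "(fij + x * (- \<i> / 2 * f5j) + y * (\<i> / 2 * fi5) + x * y * (f55 / 4)) * (P * N)
    = fij * (P * N) - \<i> / 2 * (x * P) * f5j * N + \<i> / 2 * (y * N) * fi5 * P + (x * P) * (y * N) * f55 / 4"
    by (simp add: algebra_simps)
  also have "\<dots> = fij * (P * N) - \<i> * fi * f5j * N + \<i> * fj * fi5 * P + fi * fj * f55"
    unfolding x y by simp
  finally show ?thesis unfolding levi_entry_def f by (simp only: P_def N_def)
qed

lemma levi_det_graph:
  assumes herm: "hermitian_coeffs F"
    and c: "conv F r" "conv (dc1 F) r" "conv (dc2 F) r" "conv (dc5 F) r"
    and p: "norm p < r" and rank: "levi_rank (graph_defining_function F) p = 1"
  defines "E \<equiv> \<lambda>c. graph_value c p"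
  shows "levi_entry \<i> (E (dc3 (dc1 F))) (E (dc5 F)) (E (dc1 F)) (E (dc3 (dc5 F))) (E (dc3 F)) (E (dc5 (dc1 F))) (E (dc5 (dc5 F))) *
         levi_entry \<i> (E (dc4 (dc2 F))) (E (dc5 F)) (E (dc2 F)) (E (dc4 (dc5 F))) (E (dc4 F)) (E (dc5 (dc2 F))) (E (dc5 (dc5 F)))
       = levi_entry \<i> (E (dc4 (dc1 F))) (E (dc5 F)) (E (dc1 F)) (E (dc4 (dc5 F))) (E (dc4 F)) (E (dc5 (dc1 F))) (E (dc5 (dc5 F))) *
         levi_entry \<i> (E (dc3 (dc2 F))) (E (dc5 F)) (E (dc2 F)) (E (dc3 (dc5 F))) (E (dc3 F)) (E (dc5 (dc2 F))) (E (dc5 (dc5 F)))"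
proof -
  let ?\<rho> = "graph_defining_function F"
  define R where "R = (\<lambda>q. complex_of_real (?\<rho> q))"
  have Im0: "Im (graph_value F q) = 0" and Im5: "Im (graph_value (dc5 F) q) = 0" for q
    using cnj_graph_value[of F q] cnj_graph_value[of "dc5 F" q] hermitian_cnj_coeffs[OF herm]
    by (simp_all add: complex_eq_iff)
  have R: "R q = graph_value F q - of_real (Re (q $ 3))" for q
    using Im0[of q] by (simp add: R_def graph_defining_function_def complex_eq_iff)
  note d1 = dZ_height[OF c(1) _ R]
  define f5 where "f5 = E (dc5 F)"
  have f5: "1 + \<i> * f5 \<noteq> 0" "1 - \<i> * f5 \<noteq> 0"
    using Im5[of p] by (auto simp: f5_def E_def complex_eq_iff)
  have a: "dZ 1 R p = E (dc1 F)" "dZ 2 R p = E (dc2 F)" "dZ 3 R p = - (1 + \<i> * f5) / 2"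
    unfolding d1[OF p] E_def f5_def by (simp_all add: field_simps)
  have cn: "cnj (E (dc1 F)) = E (dc3 F)" "cnj (E (dc2 F)) = E (dc4 F)" "cnj f5 = f5"
    by (simp_all add: E_def f5_def cnj_graph_value hermitian_cnj_coeffs[OF herm])
  have h1: "dZbar 1 (dZ 1 R) p = E (dc3 (dc1 F))" "dZbar 2 (dZ 1 R) p = E (dc4 (dc1 F))" "dZbar 3 (dZ 1 R) p = \<i> / 2 * E (dc5 (dc1 F))"
    using dZ_local[OF c(2) p, of "dZ 1 R" 1 0] d1 by (simp_all add: E_def)
  have h2: "dZbar 1 (dZ 2 R) p = E (dc3 (dc2 F))" "dZbar 2 (dZ 2 R) p = E (dc4 (dc2 F))" "dZbar 3 (dZ 2 R) p = \<i> / 2 * E (dc5 (dc2 F))"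
    using dZ_local[OF c(3) p, of "dZ 2 R" 1 0] d1 by (simp_all add: E_def)
  have h3: "dZbar 1 (dZ 3 R) p = - \<i> / 2 * E (dc3 (dc5 F))" "dZbar 2 (dZ 3 R) p = - \<i> / 2 * E (dc4 (dc5 F))" "dZbar 3 (dZ 3 R) p = E (dc5 (dc5 F)) / 4"
    using dZ_local[OF c(4) p, of "dZ 3 R" "- \<i> / 2" "- 1 / 2"] d1 by (simp_all add: E_def)
  \<comment> \<open>The third components of the frame: minus the \<open>z\<close>- or
    \<open>\<zeta>\<close>-derivative of the defining function divided by its
    \<open>w\<close>-derivative.\<close>
  define x1 where "x1 = 2 * E (dc1 F) / (1 + \<i> * f5)"
  define x2 where "x2 = 2 * E (dc2 F) / (1 + \<i> * f5)"
  have q: "- b / (- (1 + \<i> * f5) / 2) = 2 * b / (1 + \<i> * f5)" for b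
  proof -
    have "- b / (- P / 2) = 2 * b / P" for P :: complex by (cases "P = 0") (simp_all add: field_simps)
    thus ?thesis by blast
  qed
  have y: "cnj x1 = 2 * E (dc3 F) / (1 - \<i> * f5)" "cnj x2 = 2 * E (dc4 F) / (1 - \<i> * f5)"
    using cn by (simp_all add: x1_def x2_def)
  define X1 where "X1 = (vector [1, 0, x1] :: complex ^ 3)"
  define X2 where "X2 = (vector [0, 1, x2] :: complex ^ 3)"
  have a3: "- (1 + \<i> * f5) / 2 \<noteq> 0"
    using f5(1) by (metis divide_eq_0_iff neg_equal_0_iff_equal zero_neq_numeral)
  have Xc: "X1 $ 1 = 1" "X1 $ 2 = 0" "X1 $ 3 = x1" "X2 $ 1 = 0" "X2 $ 2 = 1" "X2 $ 3 = x2"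
    by (simp_all add: X1_def X2_def)
  have "levi_form ?\<rho> p X1 X1 * levi_form ?\<rho> p X2 X2 = levi_form ?\<rho> p X1 X2 * levi_form ?\<rho> p X2 X1"
    using levi_rank_det[of ?\<rho> p, folded R_def, unfolded a q, OF a3 rank]
    by (simp only: X1_def X2_def x1_def x2_def)
  moreover have "levi_form ?\<rho> p X1 X1 * (1 + f5 * f5) = levi_entry \<i> (E (dc3 (dc1 F))) f5 (E (dc1 F)) (E (dc3 (dc5 F))) (E (dc3 F)) (E (dc5 (dc1 F))) (E (dc5 (dc5 F)))"
    unfolding levi_entry_eq[OF f5 x1_def y(1), symmetric] levi_form_def sum_3 R_def[symmetric] Xc h1 h2 h3
    by (simp add: mult_ac)
  moreover have "levi_form ?\<rho> p X2 X2 * (1 + f5 * f5) = levi_entry \<i> (E (dc4 (dc2 F))) f5 (E (dc2 F)) (E (dc4 (dc5 F))) (E (dc4 F)) (E (dc5 (dc2 F))) (E (dc5 (dc5 F)))"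
    unfolding levi_entry_eq[OF f5 x2_def y(2), symmetric] levi_form_def sum_3 R_def[symmetric] Xc h1 h2 h3
    by (simp add: mult_ac)
  moreover have "levi_form ?\<rho> p X1 X2 * (1 + f5 * f5) = levi_entry \<i> (E (dc4 (dc1 F))) f5 (E (dc1 F)) (E (dc4 (dc5 F))) (E (dc4 F)) (E (dc5 (dc1 F))) (E (dc5 (dc5 F)))"
    unfolding levi_entry_eq[OF f5 x1_def y(2), symmetric] levi_form_def sum_3 R_def[symmetric] Xc h1 h2 h3
    by (simp add: mult_ac)
  moreover have "levi_form ?\<rho> p X2 X1 * (1 + f5 * f5) = levi_entry \<i> (E (dc3 (dc2 F))) f5 (E (dc2 F)) (E (dc3 (dc5 F))) (E (dc3 F)) (E (dc5 (dc2 F))) (E (dc5 (dc5 F)))"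
    unfolding levi_entry_eq[OF f5 x2_def y(1), symmetric] levi_form_def sum_3 R_def[symmetric] Xc h1 h2 h3
    by (simp add: mult_ac)
  ultimately show ?thesis unfolding f5_def[symmetric] by (metis mult.assoc mult.commute)
qed

lemma norm3_le: "norm x \<le> norm (x $ 1) + norm (x $ 2) + norm (x $ 3)" for x :: "complex ^ 3"
  unfolding norm_vec_def using L2_set_le_sum[of UNIV "\<lambda>i. norm (x $ i)"] by (simp add: sum_3)

section \<open>Points of the hypersurface near the origin\<close>

abbreviation graph_point :: "coeffs \<Rightarrow> complex \<Rightarrow> complex \<Rightarrow> real \<Rightarrow> complex ^ 3" where
  "graph_point F z \<zeta> v \<equiv> vector [z, \<zeta>, Complex (Re (eval_series F z \<zeta> (cnj z) (cnj \<zeta>) (of_real v))) v]"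

lemma graph_value_vector: "graph_value c (vector [z, \<zeta>, Complex u v]) = eval_series c z \<zeta> (cnj z) (cnj \<zeta>) (of_real v)"
  by (simp add: graph_value_def)

lemma graph_value_0: "graph_value c 0 = c 0 0 0 0 0"
proof -
  have "graph_value c 0 = infsum (tm c 0 0 0 0 0) UNIV" by (simp add: graph_value_def eval_series_tm)
  also have "\<dots> = infsum (tm c 0 0 0 0 0) {(0, 0, 0, 0, 0)}"
    by (rule infsum_cong_neutral) (auto simp: tm_def power_0_left split: if_splits)
  finally show ?thesis by (simp add: tm_def)
qed

lemma graph_point_near0:
  assumes c: "conv F r" and F0: "F 0 0 0 0 0 = 0" and Q: "eventually Q (nhds (0 :: complex ^ 3))"
  shows "near0 (\<lambda>z \<zeta> v. Q (graph_point F z \<zeta> v))"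
proof -
  obtain \<delta> where \<delta>: "\<delta> > 0" "\<And>p. norm p < \<delta> \<Longrightarrow> Q p"
    using Q unfolding eventually_nhds_metric by (auto simp: dist_norm)
  have "r > 0" using c by (simp add: conv_def)
  hence "isCont (graph_value F) 0"
    using graph_value_has_derivative[OF c, of 0] has_derivative_continuous by auto
  hence "\<exists>s>0. \<forall>p. norm p < s \<longrightarrow> norm (graph_value F p) < \<delta> / 4"
    unfolding continuous_at_eps_delta using \<delta>(1) by (auto simp: dist_norm graph_value_0 F0 dest!: spec[of _ "\<delta> / 4"])
  then obtain s where s: "s > 0" "\<And>p. norm p < s \<Longrightarrow> norm (graph_value F p) < \<delta> / 4" by blast
  define d where "d = min (s / 4) (\<delta> / 8)"
  have "Q (graph_point F z \<zeta> v)" if "norm z < d" "norm \<zeta> < d" "\<bar>v\<bar> < d" for z \<zeta> v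
  proof (rule \<delta>(2))
    have dd: "norm z < s / 4" "norm \<zeta> < s / 4" "\<bar>v\<bar> < s / 4" "norm z < \<delta> / 8" "norm \<zeta> < \<delta> / 8" "\<bar>v\<bar> < \<delta> / 8"
      using that by (simp_all add: d_def)
    define e where "e = eval_series F z \<zeta> (cnj z) (cnj \<zeta>) (of_real v)"
    have "norm (vector [z, \<zeta>, Complex 0 v] :: complex ^ 3) < s"
      using norm3_le[of "vector [z, \<zeta>, Complex 0 v]"] dd s(1) by (simp add: cmod_def)
    from s(2)[OF this] have e: "norm e < \<delta> / 4" by (simp add: graph_value_vector e_def)
    have "norm (Complex (Re e) v) \<le> \<bar>Re e\<bar> + \<bar>v\<bar>"
      using cmod_le[of "Complex (Re e) v"] by simp
    hence "norm (Complex (Re e) v) < \<delta> / 2" using e abs_Re_le_cmod[of e] dd by linarith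
    thus "norm (graph_point F z \<zeta> v) < \<delta>"
      using norm3_le[of "graph_point F z \<zeta> v"] dd \<delta>(1) by (simp add: e_def)
  qed
  moreover have "d > 0" using s \<delta> by (simp add: d_def)
  ultimately show ?thesis unfolding near0_def by blast
qed

lemma near0_conj: "near0 P \<Longrightarrow> near0 Q \<Longrightarrow> near0 (\<lambda>X \<zeta> t. P X \<zeta> t \<and> Q X \<zeta> t)"
  unfolding near0_def
proof (elim exE conjE)
  fix d e :: real
  assume "d > 0" "e > 0" "\<forall>X \<zeta> t. norm X < d \<longrightarrow> norm \<zeta> < d \<longrightarrow> \<bar>t\<bar> < d \<longrightarrow> P X \<zeta> t"
     "\<forall>X \<zeta> t. norm X < e \<longrightarrow> norm \<zeta> < e \<longrightarrow> \<bar>t\<bar> < e \<longrightarrow> Q X \<zeta> t"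
  thus "\<exists>d>0. \<forall>X \<zeta> t. norm X < d \<longrightarrow> norm \<zeta> < d \<longrightarrow> \<bar>t\<bar> < d \<longrightarrow> P X \<zeta> t \<and> Q X \<zeta> t"
    by (intro exI[of _ "min d e"]) auto
qed

lemma near0_mono: "near0 P \<Longrightarrow> (\<And>X \<zeta> t. P X \<zeta> t \<Longrightarrow> Q X \<zeta> t) \<Longrightarrow> near0 Q"
  unfolding near0_def by blast

lemma graph_point_in_M:
  assumes c: "conv F r" and F0: "F 0 0 0 0 0 = 0" and herm: "hermitian_coeffs F"
    and M: "is_graph_of M (graph_value F)"
  shows "near0 (\<lambda>z \<zeta> v. graph_point F z \<zeta> v \<in> M)"
proof (rule near0_mono[OF graph_point_near0[OF c F0 M[unfolded is_graph_of_def]]])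
  fix z \<zeta> v
  assume *: "(graph_point F z \<zeta> v \<in> M) = (complex_of_real (Re (graph_point F z \<zeta> v $ 3)) = graph_value F (graph_point F z \<zeta> v))"
  have "cnj (graph_value F (graph_point F z \<zeta> v)) = graph_value F (graph_point F z \<zeta> v)"
    by (simp add: cnj_graph_value hermitian_cnj_coeffs[OF herm])
  hence "Im (eval_series F z \<zeta> (cnj z) (cnj \<zeta>) (of_real v)) = 0"
    by (simp add: graph_value_vector complex_eq_iff)
  thus "graph_point F z \<zeta> v \<in> M"
    unfolding * by (simp add: graph_value_vector complex_eq_iff)
qed

lemma levi_det_near0:
  assumes herm: "hermitian_coeffs F" and c0: "convergent_series F" and F0: "F 0 0 0 0 0 = 0"
    and M: "is_graph_of M (graph_value F)" and C: "C21_hypersurface M (graph_defining_function F)"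
  shows "near0 (\<lambda>z \<zeta> v. let E = (\<lambda>c. eval_series c z \<zeta> (cnj z) (cnj \<zeta>) (of_real v)) in
         levi_entry \<i> (E (dc3 (dc1 F))) (E (dc5 F)) (E (dc1 F)) (E (dc3 (dc5 F))) (E (dc3 F)) (E (dc5 (dc1 F))) (E (dc5 (dc5 F))) *
         levi_entry \<i> (E (dc4 (dc2 F))) (E (dc5 F)) (E (dc2 F)) (E (dc4 (dc5 F))) (E (dc4 F)) (E (dc5 (dc2 F))) (E (dc5 (dc5 F)))
       = levi_entry \<i> (E (dc4 (dc1 F))) (E (dc5 F)) (E (dc1 F)) (E (dc4 (dc5 F))) (E (dc4 F)) (E (dc5 (dc1 F))) (E (dc5 (dc5 F))) *
         levi_entry \<i> (E (dc3 (dc2 F))) (E (dc5 F)) (E (dc2 F)) (E (dc3 (dc5 F))) (E (dc3 F)) (E (dc5 (dc2 F))) (E (dc5 (dc5 F))))"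
proof -
  obtain r0 where r0: "conv F r0" using c0 by (auto simp: convergent_series_conv)
  define r where "r = r0 / 2"
  have r: "0 < r" "r < r0" using r0 by (simp_all add: r_def conv_def)
  note c = conv_mono[OF r0 r(1) less_imp_le[OF r(2)]] conv_dc(1,2,5)[OF r0 r]
  have "eventually (\<lambda>p. norm p < r \<and> (p \<in> M \<longrightarrow> levi_rank (graph_defining_function F) p = 1)) (nhds 0)"
    using C r(1) unfolding C21_hypersurface_def eventually_conj_iff
    by (auto elim: eventually_mono simp: eventually_nhds_metric dist_norm)
  note near = near0_conj[OF graph_point_near0[OF r0 F0 this] graph_point_in_M[OF r0 F0 herm M]]
  show ?thesis
  proof (rule near0_mono[OF near])
    fix z \<zeta> v
    assume *: "(norm (graph_point F z \<zeta> v) < r \<and> (graph_point F z \<zeta> v \<in> M \<longrightarrow> levi_rank (graph_defining_function F) (graph_point F z \<zeta> v) = 1)) \<and> graph_point F z \<zeta> v \<in> M"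
    have n: "norm (graph_point F z \<zeta> v) < r" and k: "levi_rank (graph_defining_function F) (graph_point F z \<zeta> v) = 1"
      using * by blast+
    show "let E = (\<lambda>c. eval_series c z \<zeta> (cnj z) (cnj \<zeta>) (of_real v)) in
         levi_entry \<i> (E (dc3 (dc1 F))) (E (dc5 F)) (E (dc1 F)) (E (dc3 (dc5 F))) (E (dc3 F)) (E (dc5 (dc1 F))) (E (dc5 (dc5 F))) *
         levi_entry \<i> (E (dc4 (dc2 F))) (E (dc5 F)) (E (dc2 F)) (E (dc4 (dc5 F))) (E (dc4 F)) (E (dc5 (dc2 F))) (E (dc5 (dc5 F)))
       = levi_entry \<i> (E (dc4 (dc1 F))) (E (dc5 F)) (E (dc1 F)) (E (dc4 (dc5 F))) (E (dc4 F)) (E (dc5 (dc1 F))) (E (dc5 (dc5 F))) *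
         levi_entry \<i> (E (dc3 (dc2 F))) (E (dc5 F)) (E (dc2 F)) (E (dc3 (dc5 F))) (E (dc3 F)) (E (dc5 (dc2 F))) (E (dc5 (dc5 F)))"
      using levi_det_graph[OF herm c n k] by (simp only: graph_value_vector Let_def)
  qed
qed

subsection \<open>The perturbation has weight at least three\<close>

unbundle no vec_syntax
unbundle fps_syntax

lemma pd_nth:
  "pdX f $ q $ p $ i $ j $ k = of_nat (Suc i) * f $ q $ p $ Suc i $ j $ k"
  "pdY f $ q $ p $ i $ j $ k = of_nat (Suc j) * f $ q $ p $ i $ Suc j $ k"
  "pdT f $ q $ p $ i $ j $ k = of_nat (Suc k) * f $ q $ p $ i $ j $ Suc k"
  "pdZ f $ q $ p $ i $ j $ k = of_nat (Suc p) * f $ q $ Suc p $ i $ j $ k"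
  "pdA f $ q $ p $ i $ j $ k = of_nat (Suc q) * f $ Suc q $ p $ i $ j $ k"
proof -
  have ofn: "(of_nat n * f) $ m = of_nat n * f $ m" for n m and f :: "'a::comm_ring_1 fps"
    by (simp add: of_nat_fps_const flip: fps_of_nat)
  show "pdX f $ q $ p $ i $ j $ k = of_nat (Suc i) * f $ q $ p $ Suc i $ j $ k"
    "pdY f $ q $ p $ i $ j $ k = of_nat (Suc j) * f $ q $ p $ i $ Suc j $ k"
    "pdT f $ q $ p $ i $ j $ k = of_nat (Suc k) * f $ q $ p $ i $ j $ Suc k"
    by (simp add: pdX_def pdY_def pdT_def, simp add: xyt)+
  show "pdZ f $ q $ p $ i $ j $ k = of_nat (Suc p) * f $ q $ Suc p $ i $ j $ k"
    "pdA f $ q $ p $ i $ j $ k = of_nat (Suc q) * f $ Suc q $ p $ i $ j $ k"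
    by (simp_all add: pdZ_def pdA_def ofn del: of_nat_Suc)
qed

lemma supp_in_pd:
  assumes "supp_in f S"
  shows "supp_in (pdX f) (\<lambda>a b. S a (b + 1))" "supp_in (pdY f) (\<lambda>a b. S a (b + 1))"
    "supp_in (pdT f) (\<lambda>a b. S a (b + 2))" "supp_in (pdZ f) (\<lambda>a b. S (a + 1) b)" "supp_in (pdA f) (\<lambda>a b. S (a + 1) b)"
proof -
  have S: "f $ q $ p $ i $ j $ k \<noteq> 0 \<Longrightarrow> a = q + p \<Longrightarrow> b = i + j + 2 * k \<Longrightarrow> S a b" for q p i j k a b
    using assms by (auto simp: supp_in_def)
  show "supp_in (pdX f) (\<lambda>a b. S a (b + 1))" "supp_in (pdY f) (\<lambda>a b. S a (b + 1))"
    "supp_in (pdT f) (\<lambda>a b. S a (b + 2))" "supp_in (pdZ f) (\<lambda>a b. S (a + 1) b)" "supp_in (pdA f) (\<lambda>a b. S (a + 1) b)"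
    unfolding supp_in_def pd_nth mult_eq_0_iff by (auto intro: S)
qed

text \<open>The geometric expansion of the denominator of the model: its numerator along the
  diagonal and the two neighbouring diagonals in the powers of \<open>\<zeta>\<close> and its
  conjugate.\<close>

definition gm_ser :: ser5 where
  "gm_ser = Abs_fps (\<lambda>q. Abs_fps (\<lambda>p. (if q = p then fps_X * fps_const fps_X else 0)
     + (if p = Suc q then fps_const (fps_const (fps_const (1/2))) * fps_const (fps_X ^ 2) else 0)
     + (if q = Suc p then fps_const (fps_const (fps_const (1/2))) * fps_X ^ 2 else 0)))"

lemma cst_mult: "cst a * cst b = cst (a * b)" and cst_1: "cst 1 = 1" and cst_add: "cst a + cst b = cst (a + b)"
  by (simp_all add: cst_def)

lemma gm_ser_eq: "(1 - vZ * vA) * gm_ser = vX * vY + cst (1/2) * vY ^ 2 * vZ + cst (1/2) * vX ^ 2 * vA"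
proof (rule fps_ext, rule fps_ext)
  fix q p
  have l: "((1 - vZ * vA) * gm_ser) $ q $ p = gm_ser $ q $ p - (if q = 0 \<or> p = 0 then 0 else gm_ser $ (q - 1) $ (p - 1))"
    by (simp add: vZ_def vA_def algebra_simps mult.assoc fps_X_mult_nth[where 'a = "ser3 fps"] fps_X_mult_nth[where 'a = ser3])
  have r: "(vX * vY + cst (1/2) * vY ^ 2 * vZ + cst (1/2) * vX ^ 2 * vA) $ q $ p
     = (if q = 0 \<and> p = 0 then fps_X * fps_const fps_X else 0)
     + (if q = 0 \<and> p = 1 then fps_const (fps_const (fps_const (1/2))) * fps_const (fps_X ^ 2) else 0)
     + (if q = 1 \<and> p = 0 then fps_const (fps_const (fps_const (1/2))) * fps_X ^ 2 else 0)"
    by (auto simp: vX_def vY_def vZ_def vA_def cst_def power2_eq_square)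
  show "((1 - vZ * vA) * gm_ser) $ q $ p = (vX * vY + cst (1/2) * vY ^ 2 * vZ + cst (1/2) * vX ^ 2 * vA) $ q $ p"
    unfolding l r by (cases q; cases p) (auto simp: gm_ser_def)
qed

lemma vZA_neq_1: "1 - vZ * vA \<noteq> 0"
proof
  assume "1 - vZ * vA = 0"
  hence "(1 - vZ * vA) $ 0 $ 0 = 0" by simp
  thus False by (simp add: vA_def vZ_def)
qed

lemma gm_ser_nth: "gm_ser $ k $ p $ h $ j $ l = (if k = p \<and> h = 1 \<and> j = 1 \<and> l = 0 then 1
   else if p = Suc k \<and> h = 0 \<and> j = 2 \<and> l = 0 then 1/2 else if k = Suc p \<and> h = 2 \<and> j = 0 \<and> l = 0 then 1/2 else 0)"
  by (auto simp: gm_ser_def fps_X_power_iff)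

lemma pd_two: "pdX 2 = 0" "pdY 2 = 0" "pdT 2 = 0" "pdZ 2 = 0" "pdA 2 = 0"
  using derivation_pd[THEN derivation_add, of 1 1] by (simp_all add: pd_rules)

lemma double_zero: "f + f = 0 \<Longrightarrow> f = (0 :: ser5)"
  by (simp add: fps_eq_iff)

text \<open>The model does not involve \<open>v\<close>, so this is the vanishing of its Levi
  determinant. All derivatives are multiplied by enough powers of 1 - \<zeta> conj \<zeta> to become
  polynomials, which are compared and then cancelled.\<close>

lemma gm_levi: "pdY (pdX gm_ser) * pdA (pdZ gm_ser) = pdA (pdX gm_ser) * pdY (pdZ gm_ser)"
proof -
  define D where "D = 1 - vZ * vA"
  \<comment> \<open>Twice the model: this avoids the constant 1/2, which lives in a five-fold nested
    constant and resists ring normalization.\<close>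
  define K where "K = gm_ser + gm_ser"
  have c: "cst (1/2) + cst (1/2) = 1" by (simp add: cst_add cst_1)
  have K: "D * K = 2 * (vX * vY) + vY * vY * vZ + vX * vX * vA"
  proof -
    have "D * K = (vX * vY + cst (1/2) * vY ^ 2 * vZ + cst (1/2) * vX ^ 2 * vA) + (vX * vY + cst (1/2) * vY ^ 2 * vZ + cst (1/2) * vX ^ 2 * vA)"
      unfolding K_def D_def distrib_left gm_ser_eq ..
    also have "\<dots> = 2 * (vX * vY) + (cst (1/2) + cst (1/2)) * (vY * vY * vZ) + (cst (1/2) + cst (1/2)) * (vX * vX * vA)"
      by (simp add: algebra_simps power2_eq_square)
    finally show ?thesis unfolding c by (simp add: mult_ac)
  qed
  have D: "D \<noteq> 0" using vZA_neq_1 by (simp add: D_def)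
  have pD: "pdX D = 0" "pdY D = 0" "pdZ D = - vA" "pdA D = - vZ"
    by (simp_all add: D_def pd_rules)
  have "vX * vY + vX * vY = 2 * (vX * vY)" by simp
  have K': "D * K = vX * vY + vX * vY + vY * vY * vZ + vX * vX * vA" using K by simp
  have d1: "D * pdX K = 2 * (vY + vX * vA)"
    using arg_cong[OF K', of pdX] by (simp add: pd_rules pd_two pD algebra_simps)
  have d4: "D * pdA K = vX * vX + vZ * K"
    using arg_cong[OF K', of pdA] by (simp add: pd_rules pd_two pD algebra_simps)
  have d2: "D * pdZ K = vY * vY + vA * K"
    using arg_cong[OF K', of pdZ] by (simp add: pd_rules pd_two pD algebra_simps)
  have d3: "D * pdY K = 2 * (vX + vY * vZ)"
    using arg_cong[OF K', of pdY] by (simp add: pd_rules pd_two pD algebra_simps)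
  have d1': "D * pdX K = (vY + vX * vA) + (vY + vX * vA)" using d1 by simp
  have d31: "D * pdY (pdX K) = 2"
    using arg_cong[OF d1', of pdY] by (simp add: pd_rules pd_two pD)
  have d41: "D * (D * pdA (pdX K)) = 2 * (vX + vZ * vY)"
  proof -
    have "D * pdA (pdX K) = vX + vX + vZ * pdX K"
      using arg_cong[OF d1', of pdA] by (simp add: pd_rules pd_two pD algebra_simps)
    hence "D * (D * pdA (pdX K)) = 2 * vX * D + vZ * (D * pdX K)" by (simp add: algebra_simps)
    thus ?thesis unfolding d1 by (simp add: D_def algebra_simps)
  qed
  have d32: "D * (D * pdY (pdZ K)) = 2 * (vY + vX * vA)"
  proof -
    have "D * pdY (pdZ K) = vY + vY + vA * pdY K"
      using arg_cong[OF d2, of pdY] by (simp add: pd_rules pd_two pD algebra_simps)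
    hence "D * (D * pdY (pdZ K)) = 2 * vY * D + vA * (D * pdY K)" by (simp add: algebra_simps)
    thus ?thesis unfolding d3 by (simp add: D_def algebra_simps)
  qed
  have d42: "D * (D * (D * pdA (pdZ K))) = 2 * ((vX + vZ * vY) * (vY + vX * vA))"
  proof -
    have "D * pdA (pdZ K) = K + vA * pdA K + vZ * pdZ K"
      using arg_cong[OF d2, of pdA] by (simp add: pd_rules pd_two pD algebra_simps)
    hence "D * (D * pdA (pdZ K)) = D * K + vA * (D * pdA K) + vZ * (D * pdZ K)" by (simp add: algebra_simps)
    hence "D * (D * pdA (pdZ K)) = D * K + vA * vX * vX + vZ * vY * vY + 2 * vA * vZ * K"
      unfolding d2 d4 by (simp add: algebra_simps)
    hence "D * (D * (D * pdA (pdZ K))) = (D + 2 * vA * vZ) * (D * K) + D * (vA * vX * vX + vZ * vY * vY)"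
      by (simp add: algebra_simps)
    thus ?thesis unfolding K by (simp add: D_def algebra_simps)
  qed
  have "D * D * (D * D) * (pdY (pdX K) * pdA (pdZ K)) = (D * pdY (pdX K)) * (D * (D * (D * pdA (pdZ K))))"
    by (simp add: mult_ac)
  also have "\<dots> = (D * (D * pdA (pdX K))) * (D * (D * pdY (pdZ K)))"
    unfolding d31 d42 d41 d32 by (simp add: algebra_simps)
  also have "\<dots> = D * D * (D * D) * (pdA (pdX K) * pdY (pdZ K))" by (simp add: mult_ac)
  finally have "pdY (pdX K) * pdA (pdZ K) = pdA (pdX K) * pdY (pdZ K)"
    using D by (simp only: mult_left_cancel[OF no_zero_divisors[OF no_zero_divisors[OF D D] no_zero_divisors[OF D D]]])
  moreover have "(a + a) * (b + b) = (c + c) * (d + d) \<Longrightarrow> (a * b - c * d) + (a * b - c * d) + ((a * b - c * d) + (a * b - c * d)) = 0" for a b c d :: ser5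
  proof -
    assume *: "(a + a) * (b + b) = (c + c) * (d + d)"
    have "(a * b - c * d) + (a * b - c * d) + ((a * b - c * d) + (a * b - c * d)) = (a + a) * (b + b) - (c + c) * (d + d)"
      by (simp only: ring_distribs add_ac diff_conv_add_uminus minus_add_distrib)
    thus "(a * b - c * d) + (a * b - c * d) + ((a * b - c * d) + (a * b - c * d)) = 0" using * by simp
  qed
  ultimately have "(pdY (pdX gm_ser) * pdA (pdZ gm_ser) - pdA (pdX gm_ser) * pdY (pdZ gm_ser)) + (pdY (pdX gm_ser) * pdA (pdZ gm_ser) - pdA (pdX gm_ser) * pdY (pdZ gm_ser))
     + ((pdY (pdX gm_ser) * pdA (pdZ gm_ser) - pdA (pdX gm_ser) * pdY (pdZ gm_ser)) + (pdY (pdX gm_ser) * pdA (pdZ gm_ser) - pdA (pdX gm_ser) * pdY (pdZ gm_ser))) = 0"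
    by (simp only: K_def pd_rules)
  from double_zero[OF double_zero[OF this]] show ?thesis by simp
qed

text \<open>The exceptional values in the normal form are exactly the corresponding coefficients of
  the model, so after subtraction only zeros remain.\<close>

definition normalized :: "coeffs \<Rightarrow> bool" where
  "normalized G \<longleftrightarrow> (\<forall>h p j l. j \<le> 2 \<longrightarrow> G h p j 0 l = 0) \<and> (\<forall>h p j k l. cnj (G h p j k l) = G j k h p l) \<and>
     (\<forall>l. G 3 0 0 1 l = 0 \<and> G 4 0 0 1 l = 0 \<and> G 3 0 1 1 l = 0 \<and> G 4 0 1 1 l = 0 \<and> G 3 0 3 0 l = 0) \<and>
     G 3 0 0 2 0 = 0 \<and> G 5 0 0 1 0 = 0"

lemma normalized_if_normal_form:
  assumes "nst F = gm_ser + nst G" "hermitian_coeffs F" "poincare_moser_normal_form F" "F 3 0 0 2 0 = 0" "F 5 0 0 1 0 = 0"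
  shows "normalized G"
proof -
  have G: "G h p j k l = F h p j k l - gm_ser $ k $ p $ h $ j $ l" for h p j k l
    using arg_cong[OF assms(1), of "\<lambda>f. f $ k $ p $ h $ j $ l"] by simp
  have "v_coeff F h p j k $ l = F h p j k l" for h p j k l by (simp add: v_coeff_def)
  hence v: "v_coeff F h p j k = f \<Longrightarrow> F h p j k l = f $ l" for h p j k l f by metis
  note nf = assms(3)[unfolded poincare_moser_normal_form_def]
  have 0: "G h p 0 0 l = 0" "G h p 1 0 l = 0" "G h p 2 0 l = 0" for h p l
  proof -
    have "v_coeff F h p 0 0 = 0" using nf by blast
    thus "G h p 0 0 l = 0" using v by (auto simp: G gm_ser_nth)
    have "v_coeff F h p 1 0 = (if (h, p) = (1, 0) then 1 else 0)" using nf by blast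
    thus "G h p 1 0 l = 0" using v[of h p 1 0] by (auto simp: G gm_ser_nth)
    have "v_coeff F h p 2 0 = (if (h, p) = (0, 1) then fps_const (1/2) else 0)" using nf by blast
    thus "G h p 2 0 l = 0" using v[of h p 2 0] by (auto simp: G gm_ser_nth)
  qed
  have "G h p j 0 l = 0" if "j \<le> 2" for h p j l
    using 0 that by (metis One_nat_def le_SucE le_zero_eq numeral_2_eq_2)
  moreover have "cnj (G h p j k l) = G j k h p l" for h p j k l
    using assms(2) by (auto simp: G gm_ser_nth hermitian_coeffs_def)
  moreover have "G 3 0 0 1 l = 0 \<and> G 4 0 0 1 l = 0 \<and> G 3 0 1 1 l = 0 \<and> G 4 0 1 1 l = 0 \<and> G 3 0 3 0 l = 0" for l
    using nf v[of 3 0 0 1 0] v[of 4 0 0 1 0] v[of 3 0 1 1 0] v[of 4 0 1 1 0] v[of 3 0 3 0 0] by (simp add: G gm_ser_nth)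
  moreover have "G 3 0 0 2 0 = 0" "G 5 0 0 1 0 = 0" using assms(4,5) by (simp_all add: G gm_ser_nth)
  ultimately show ?thesis unfolding normalized_def by blast
qed

section \<open>The vanishing Levi determinant as a formal identity\<close>

lemma fexp_1: "fexp (\<lambda>X \<zeta> t. 1) 1"
  using fexp_intros(7)[of 1] by (simp add: cst_1)

lemma levi_det_formal:
  assumes herm: "hermitian_coeffs F" and c0: "convergent_series F" and F0: "F 0 0 0 0 0 = 0"
    and M: "is_graph_of M (graph_value F)" and C: "C21_hypersurface M (graph_defining_function F)"
  defines "f \<equiv> nst F" and "\<iota> \<equiv> cst \<i>"
  shows "levi_entry \<iota> (pdY (pdX f)) (pdT f) (pdX f) (pdY (pdT f)) (pdY f) (pdT (pdX f)) (pdT (pdT f)) *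
         levi_entry \<iota> (pdA (pdZ f)) (pdT f) (pdZ f) (pdA (pdT f)) (pdA f) (pdT (pdZ f)) (pdT (pdT f)) =
         levi_entry \<iota> (pdA (pdX f)) (pdT f) (pdX f) (pdA (pdT f)) (pdA f) (pdT (pdX f)) (pdT (pdT f)) *
         levi_entry \<iota> (pdY (pdZ f)) (pdT f) (pdZ f) (pdY (pdT f)) (pdY f) (pdT (pdZ f)) (pdT (pdT f))"
proof -
  note c = c0 convergent_dc[OF c0]
  note cc = c convergent_dc[OF c(2)] convergent_dc[OF c(3)] convergent_dc[OF c(6)]
  note near = levi_det_near0[OF herm c0 F0 M C, unfolded Let_def levi_entry_def]
  show ?thesis
    unfolding levi_entry_def f_def \<iota>_def nst_dc[symmetric]
    by (rule fexp_unique[OF _ _ near]; intro fexp_intros fexp_1 fexp_eval cc)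
qed

text \<open>Weight at least \<open>m\<close>, disregarding everything of degree at least
  \<open>N\<close> in \<open>\<zeta>\<close> and its conjugate. Weights add under multiplication, so
  these sets of series behave like a filtration.\<close>

definition supp_J :: "nat \<Rightarrow> nat \<Rightarrow> nat \<Rightarrow> nat \<Rightarrow> bool" where
  "supp_J N m a b \<longleftrightarrow> m \<le> b \<or> N \<le> a"

text \<open>Factors that raise either the degree in \<open>\<zeta>\<close> and its conjugate or the
  weight far enough to push the critical terms into \<open>supp_J N 3\<close>.\<close>

definition supp_H :: "nat \<Rightarrow> nat \<Rightarrow> bool" where
  "supp_H a b \<longleftrightarrow> 1 \<le> a \<or> 3 \<le> b"

lemma supp_J_mult: "supp_in f (supp_J N m) \<Longrightarrow> supp_in g (supp_J N n) \<Longrightarrow> k \<le> m + n \<Longrightarrow> supp_in (f * g) (supp_J N k)"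
  by (erule (1) supp_in_mult) (auto simp: supp_J_def)

lemma supp_J_0: "supp_in f (supp_J N 0)"
  by (simp add: supp_in_def supp_J_def)

lemma supp_J_mult1: "supp_in f (supp_J N m) \<Longrightarrow> supp_in (f * g) (supp_J N m)"
  by (rule supp_J_mult[OF _ supp_J_0]) auto

lemma supp_J_mult2: "supp_in f (supp_J N m) \<Longrightarrow> supp_in (g * f) (supp_J N m)"
  by (rule supp_J_mult[OF supp_J_0]) auto

lemma supp_H_mult: "supp_in f supp_H \<Longrightarrow> supp_in (f * g) supp_H" "supp_in f supp_H \<Longrightarrow> supp_in (g * f) supp_H"
proof -
  have T: "supp_in g (\<lambda>_ _. True)" by (simp add: supp_in_def)
  show "supp_in (f * g) supp_H" if "supp_in f supp_H" by (rule supp_in_mult[OF that T]) (auto simp: supp_H_def)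
  show "supp_in (g * f) supp_H" if "supp_in f supp_H" by (rule supp_in_mult[OF T that]) (auto simp: supp_H_def)
qed

text \<open>In the determinant the mixed \<open>\<zeta>\<close>-derivative of \<open>G\<close> is
  multiplied by an entry that starts with 1. Everything else in the difference from the model turns
  out to have weight at least 3 or to exceed the critical degree, so a term of lower weight cannot
  be compensated.\<close>

lemma weight_ge_3:
  assumes fg: "nst F = gm_ser + nst G" and nG: "normalized G"
    and levi: "let f = nst F; \<iota> = cst \<i> in
         levi_entry \<iota> (pdY (pdX f)) (pdT f) (pdX f) (pdY (pdT f)) (pdY f) (pdT (pdX f)) (pdT (pdT f)) *
         levi_entry \<iota> (pdA (pdZ f)) (pdT f) (pdZ f) (pdA (pdT f)) (pdA f) (pdT (pdZ f)) (pdT (pdT f)) =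
         levi_entry \<iota> (pdA (pdX f)) (pdT f) (pdX f) (pdA (pdT f)) (pdA f) (pdT (pdX f)) (pdT (pdT f)) *
         levi_entry \<iota> (pdY (pdZ f)) (pdT f) (pdZ f) (pdY (pdT f)) (pdY f) (pdT (pdZ f)) (pdT (pdT f))"
    and nz: "G h p j k l \<noteq> 0"
  shows "3 \<le> h + j + 2 * l"
proof (rule ccontr)
  assume "\<not> 3 \<le> h + j + 2 * l"
  define bad where "bad = (\<lambda>n. \<exists>h p j k l. G h p j k l \<noteq> 0 \<and> h + j + 2 * l \<le> 2 \<and> p + k = n)"
  have "bad (p + k)" using nz \<open>\<not> 3 \<le> h + j + 2 * l\<close> unfolding bad_def by fastforce
  hence bl: "bad (LEAST n. bad n)" and least: "\<And>n. bad n \<Longrightarrow> (LEAST n. bad n) \<le> n"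
    by (auto intro: LeastI Least_le)
  have j3: "3 \<le> j" if "G h p j 0 l \<noteq> 0" for h p j l using nG that unfolding normalized_def by (metis not_less_eq_eq numeral_2_eq_2 numeral_3_eq_3)
  have h3: "3 \<le> h" if "G h 0 j k l \<noteq> 0" for h j k l
    using j3[of j k h l] that nG unfolding normalized_def by (metis complex_cnj_zero_iff)
  obtain h p j k l where b: "G h p j k l \<noteq> 0" "h + j + 2 * l \<le> 2" "p + k = (LEAST n. bad n)"
    using bl unfolding bad_def by blast
  \<comment> \<open>A term without the conjugate of \<open>\<zeta>\<close> has at least three
    factors conj z, and a term without \<open>\<zeta>\<close> at least three factors z.\<close>
  have pk: "p \<noteq> 0" "k \<noteq> 0"
  proof -
    show "p \<noteq> 0"
    proof
      assume "p = 0"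
      thus False using h3[of h j k l] b(1,2) by simp
    qed
    show "k \<noteq> 0"
    proof
      assume "k = 0"
      thus False using j3[of h p j l] b(1,2) by simp
    qed
  qed
  \<comment> \<open>The minimal bad degree is \<open>N + 1\<close>. Two
    \<open>\<zeta>\<close>-derivatives bring the bad term down to degree \<open>N - 1\<close>, just
    below what \<open>supp_J N\<close> disregards.\<close>
  define N where "N = p + k - 1"
  have N1: "1 \<le> N" and Nl: "Suc N = (LEAST n. bad n)" using pk b(3) by (simp_all add: N_def)
  define f where "f = nst F"
  define g where "g = nst G"
  define m where "m = gm_ser"
  have f: "f = m + g" using fg by (simp add: f_def g_def m_def)
  \<comment> \<open>The first half is minimality of the degree; the second says that without
    \<open>\<zeta>\<close> and its conjugate both \<open>z\<close> and its conjugate occur at least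
    three times.\<close>
  define Sg where "Sg = (\<lambda>a b::nat. (3 \<le> b \<or> N + 1 \<le> a) \<and> (a = 0 \<longrightarrow> 6 \<le> b))"
  have g: "supp_in g Sg"
    unfolding supp_in_def
  proof (intro allI impI)
    fix q p i j k assume nz: "g $ q $ p $ i $ j $ k \<noteq> 0"
    hence nz: "G i p j q k \<noteq> 0" by (simp add: g_def)
    have "6 \<le> i + j + 2 * k" if "q + p = 0" using h3[of i j q k] j3[of i p j k] nz that by simp
    moreover have "3 \<le> i + j + 2 * k \<or> N + 1 \<le> q + p"
    proof (rule ccontr)
      assume *: "\<not> (3 \<le> i + j + 2 * k \<or> N + 1 \<le> q + p)"
      have "bad (p + q)" using nz * unfolding bad_def by fastforce
      from least[OF this] * Nl show False by simp
    qed
    ultimately show "Sg (q + p) (i + j + 2 * k)" by (simp add: Sg_def)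
  qed
  have m: "supp_in m (\<lambda>a b. b = 2)"
    by (auto simp: supp_in_def m_def gm_ser_nth split: if_splits)
  have mT: "pdT m = 0" by (rule ser5_eqI) (simp add: pd_nth m_def gm_ser_nth)
  note md = supp_in_pd[OF m]
  note gd = supp_in_pd[OF g]
  have fd: "pdX f = pdX m + pdX g" "pdY f = pdY m + pdY g" "pdZ f = pdZ m + pdZ g" "pdA f = pdA m + pdA g" "pdT f = pdT g"
    by (simp_all add: f pd_rules mT)
  have comm: "pdT (pdX f) = pdX (pdT g)" "pdT (pdZ f) = pdZ (pdT g)"
  proof -
    have "pdT (pdX u) = pdX (pdT u)" "pdT (pdZ u) = pdZ (pdT u)" for u
      by (rule ser5_eqI, simp add: pd_nth mult_ac del: of_nat_Suc)+
    thus "pdT (pdX f) = pdX (pdT g)" "pdT (pdZ f) = pdZ (pdT g)" by (metis fd(5))+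
  qed
  note fd2 = fd(1-4)[THEN arg_cong, of pdY, unfolded pd_rules] fd(1-4)[THEN arg_cong, of pdA, unfolded pd_rules]
  let ?J = "supp_J N"
  note lin = supp_in_lin
  note JD = supp_J_def Sg_def
  have f1: "supp_in (pdX f) (?J 1)" "supp_in (pdY f) (?J 1)" "supp_in (pdZ f) (?J 2)" "supp_in (pdA f) (?J 2)" "supp_in (pdT f) (?J 1)"
    unfolding fd
        apply (rule lin(1)[OF supp_in_mono[OF md(1)] supp_in_mono[OF gd(1)]]; auto simp: JD)
       apply (rule lin(1)[OF supp_in_mono[OF md(2)] supp_in_mono[OF gd(2)]]; auto simp: JD)
      apply (rule lin(1)[OF supp_in_mono[OF md(4)] supp_in_mono[OF gd(4)]]; auto simp: JD)
     apply (rule lin(1)[OF supp_in_mono[OF md(5)] supp_in_mono[OF gd(5)]]; auto simp: JD)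
    by (rule supp_in_mono[OF gd(3)]) (auto simp: JD)
  have fH: "supp_in (pdT f) supp_H" "supp_in (pdX (pdT f)) supp_H" "supp_in (pdY (pdT f)) supp_H" "supp_in (pdT (pdT f)) (\<lambda>a b. 1 \<le> a \<or> 2 \<le> b)"
    unfolding fd(5) using gd(3) supp_in_pd[OF gd(3)]
    by (auto elim!: supp_in_mono simp: supp_H_def Sg_def)
  have f5J: "supp_in (pdZ (pdT f)) (?J 1)" "supp_in (pdA (pdT f)) (?J 1)"
    unfolding fd(5) using supp_in_pd[OF gd(3)] by (auto elim!: supp_in_mono simp: JD)
  define G22 where "G22 = pdA (pdZ g)"
  have G22: "supp_in G22 (\<lambda>a b. 3 \<le> b \<or> N \<le> a + 1)"
    unfolding G22_def using supp_in_pd(5)[OF gd(4)] by (auto elim!: supp_in_mono simp: JD)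
  have G22H: "supp_in (G22 * u) (?J 3)" if "supp_in u supp_H" for u
    by (rule supp_in_mult[OF G22 that]) (auto simp: supp_J_def supp_H_def)
  have m2: "supp_in (pdA (pdZ m)) (?J 2)" "supp_in (pdA (pdX m)) (?J 1)" "supp_in (pdY (pdZ m)) (?J 1)"
    using supp_in_pd[OF md(4)] supp_in_pd[OF md(1)] by (auto elim!: supp_in_mono simp: supp_J_def)
  have g2: "supp_in (pdY (pdX g)) (?J 1)" "supp_in (pdA (pdX g)) (?J 2)" "supp_in (pdY (pdZ g)) (?J 2)" "supp_in (pdY (pdX g)) supp_H"
    using supp_in_pd[OF gd(4)] supp_in_pd[OF gd(1)] by (auto elim!: supp_in_mono simp: JD supp_H_def)
  have m11: "supp_in (pdY (pdX m) - 1) supp_H"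
    by (auto simp: supp_in_def supp_H_def pd_nth m_def gm_ser_nth fps_one_nth split: if_splits)
  define \<iota> where "\<iota> = cst \<i>"
  define L11 where "L11 = levi_entry \<iota> (pdY (pdX f)) (pdT f) (pdX f) (pdY (pdT f)) (pdY f) (pdX (pdT f)) (pdT (pdT f))"
  define L22 where "L22 = levi_entry \<iota> (pdA (pdZ f)) (pdT f) (pdZ f) (pdA (pdT f)) (pdA f) (pdZ (pdT f)) (pdT (pdT f))"
  define L12 where "L12 = levi_entry \<iota> (pdA (pdX f)) (pdT f) (pdX f) (pdA (pdT f)) (pdA f) (pdX (pdT f)) (pdT (pdT f))"
  define L21 where "L21 = levi_entry \<iota> (pdY (pdZ f)) (pdT f) (pdZ f) (pdY (pdT f)) (pdY f) (pdZ (pdT f)) (pdT (pdT f))"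
  have det: "L11 * L22 = L12 * L21"
    using levi unfolding Let_def f_def[symmetric] \<iota>_def[symmetric] comm fd(5)[symmetric] L11_def L12_def L21_def L22_def .
  have entry: "levi_entry \<iota> fij f5 fi f5j fj fi5 f55 - fij = fij * (f5 * f5) - \<iota> * (fi * f5j) * (1 - \<iota> * f5) + \<iota> * (fj * fi5) * (1 + \<iota> * f5) + fi * fj * f55"
    for fij f5 fi f5j fj fi5 f55 by (simp add: levi_entry_def algebra_simps)
  have f2: "pdY (pdX f) = pdY (pdX m) + pdY (pdX g)" "pdA (pdX f) = pdA (pdX m) + pdA (pdX g)"
     "pdY (pdZ f) = pdY (pdZ m) + pdY (pdZ g)" "pdA (pdZ f) = pdA (pdZ m) + G22"
    by (simp_all add: fd pd_rules G22_def)
  note J12 = supp_J_mult1 supp_J_mult2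
  have L11H: "supp_in (L11 - 1) supp_H"
  proof -
    have E: "L11 - 1 = (L11 - pdY (pdX f)) + ((pdY (pdX m) - 1) + pdY (pdX g))" by (simp add: f2)
    have "supp_in (pdX f) (\<lambda>a b. 1 \<le> a \<or> 1 \<le> b)" using f1(1) N1 by (auto elim!: supp_in_mono simp: supp_J_def)
    hence "supp_in (pdX f * pdT (pdT f)) supp_H"
      by (rule supp_in_mult[OF _ fH(4)]) (auto simp: supp_H_def)
    hence x: "supp_in (pdX f * pdY f * pdT (pdT f)) supp_H"
      using supp_H_mult(1)[of "pdX f * pdT (pdT f)" "pdY f"] by (simp add: mult_ac)
    show ?thesis unfolding E unfolding L11_def entry
      by (intro lin x m11 g2) ((rule supp_H_mult(2) supp_H_mult(1), rule supp_H_mult(2) supp_H_mult(1), rule fH; fail)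
        | (rule supp_H_mult(1), rule supp_H_mult(2), rule supp_H_mult(2), rule fH; fail))+
  qed
  have L11J: "supp_in (L11 - pdY (pdX m)) (?J 1)"
  proof -
    have E: "L11 - pdY (pdX m) = (L11 - pdY (pdX f)) + pdY (pdX g)" by (simp add: f2)
    show ?thesis unfolding E unfolding L11_def entry
      by (intro lin g2 J12(2)[OF J12(1)[OF f1(5)]] J12(1)[OF J12(2)[OF J12(1)[OF f1(1)]]] J12(1)[OF J12(2)[OF J12(1)[OF f1(2)]]] J12(1)[OF J12(1)[OF f1(1)]])
  qed
  have L12J: "supp_in (L12 - pdA (pdX m)) (?J 2)"
  proof -
    have E: "L12 - pdA (pdX m) = (L12 - pdA (pdX f)) + pdA (pdX g)" by (simp add: f2)
    have a: "supp_in (pdT f * pdT f) (?J 2)" "supp_in (pdX f * pdA (pdT f)) (?J 2)" "supp_in (pdX f * pdA f) (?J 2)"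
      by (rule supp_J_mult[OF f1(5) f1(5)] supp_J_mult[OF f1(1) f5J(2)] supp_J_mult[OF f1(1) f1(4)], simp)+
    show ?thesis unfolding E unfolding L12_def entry
      by (intro lin g2 J12(2)[OF a(1)] J12(1)[OF J12(2)[OF a(2)]] J12(1)[OF J12(2)[OF J12(1)[OF f1(4)]]] J12(1)[OF a(3)])
  qed
  have L21J: "supp_in (L21 - pdY (pdZ m)) (?J 2)"
  proof -
    have E: "L21 - pdY (pdZ m) = (L21 - pdY (pdZ f)) + pdY (pdZ g)" by (simp add: f2)
    have a: "supp_in (pdT f * pdT f) (?J 2)" "supp_in (pdY f * pdZ (pdT f)) (?J 2)" "supp_in (pdZ f * pdY f) (?J 2)"
      by (rule supp_J_mult[OF f1(5) f1(5)] supp_J_mult[OF f1(2) f5J(1)] supp_J_mult[OF f1(3) f1(2)], simp)+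
    show ?thesis unfolding E unfolding L21_def entry
      by (intro lin g2 J12(2)[OF a(1)] J12(1)[OF J12(2)[OF a(2)]] J12(1)[OF J12(2)[OF J12(1)[OF f1(3)]]] J12(1)[OF a(3)])
  qed
  have L22J: "supp_in (L22 - pdA (pdZ m) - G22) (?J 3)"
  proof -
    have E: "L22 - pdA (pdZ m) - G22 = (L22 - pdA (pdZ f))" by (simp add: f2)
    have a: "supp_in (pdT f * pdT f) (?J 2)" "supp_in (pdZ f * pdA (pdT f)) (?J 3)" "supp_in (pdA f * pdZ (pdT f)) (?J 3)" "supp_in (pdZ f * pdA f) (?J 3)"
      by (rule supp_J_mult[OF f1(5) f1(5)] supp_J_mult[OF f1(3) f5J(2)] supp_J_mult[OF f1(4) f5J(1)] supp_J_mult[OF f1(3) f1(4)], simp)+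
    have b: "supp_in (pdA (pdZ f) * (pdT f * pdT f)) (?J 3)"
      unfolding f2 distrib_right by (intro lin supp_J_mult[OF m2(1) a(1)] G22H supp_H_mult(1) fH) simp
    show ?thesis unfolding E unfolding L22_def entry
      by (intro lin b J12(1)[OF J12(2)[OF a(2)]] J12(1)[OF J12(2)[OF a(3)]] J12(1)[OF a(4)])
  qed
  define P where "P = pdA (pdZ m)"
  define Q where "Q = pdY (pdX m)"
  define R where "R = pdA (pdX m)"
  define S where "S = pdY (pdZ m)"
  have QP: "Q * P = R * S" using gm_levi by (simp add: P_def Q_def R_def S_def m_def)
  \<comment> \<open>The determinants of the graph and of the model both vanish; their difference is
    solved for the term in question.\<close>
  have "G22 = (L12 - R) * L21 + R * (L21 - S) - (L11 - Q) * P - G22 * (L11 - 1) - L11 * (L22 - P - G22)"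
  proof -
    have "(L12 - R) * L21 + R * (L21 - S) - (L11 - Q) * P - G22 * (L11 - 1) - L11 * (L22 - P - G22)
      = (L12 * L21 - L11 * L22) + (Q * P - R * S) + G22" by (simp add: algebra_simps)
    thus ?thesis using det QP by simp
  qed
  moreover have "supp_in ((L12 - R) * L21 + R * (L21 - S) - (L11 - Q) * P - G22 * (L11 - 1) - L11 * (L22 - P - G22)) (?J 3)"
  proof -
    have L21: "supp_in L21 (?J 1)"
    proof -
      have "supp_in (L21 - S) (?J 1)" using L21J unfolding S_def by (rule supp_in_mono) (auto simp: supp_J_def)
      from lin(1)[OF this m2(3)] show ?thesis by (simp add: S_def)
    qed
    have "supp_in ((L12 - R) * L21) (?J 3)" unfolding R_def by (rule supp_J_mult[OF L12J L21]) simp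
    moreover have "supp_in (R * (L21 - S)) (?J 3)" unfolding R_def S_def by (rule supp_J_mult[OF m2(2) L21J]) simp
    moreover have "supp_in ((L11 - Q) * P) (?J 3)" unfolding P_def Q_def by (rule supp_J_mult[OF L11J m2(1)]) simp
    moreover have "supp_in (L11 * (L22 - P - G22)) (?J 3)" unfolding P_def by (rule J12(2)[OF L22J])
    ultimately show ?thesis by (intro lin G22H L11H)
  qed
  ultimately have "supp_in G22 (?J 3)" by simp
  moreover have "G22 $ (k - 1) $ (p - 1) $ h $ j $ l \<noteq> 0"
    using b(1) pk by (simp add: G22_def pd_nth g_def del: of_nat_Suc)
  ultimately have "supp_J N 3 (k - 1 + (p - 1)) (h + j + 2 * l)" unfolding supp_in_def by blast
  thus False using b(2) pk by (auto simp: supp_J_def N_def)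
qed

text \<open>The comparison is made after multiplication by 1 - \<zeta> conj \<zeta>, which turns the
  quotient into a polynomial; this factor is nonzero near the origin and not a zero divisor among
  the formal series.\<close>

lemma gm_formal:
  assumes F: "convergent_series F" and G: "convergent_series G" and F0: "F 0 0 0 0 0 = 0"
    and eq: "\<forall>\<^sub>F p in nhds 0. graph_value F p = gaussier_merker_value p + graph_value G p"
  shows "nst F = gm_ser + nst G"
proof -
  obtain r where r: "conv F r" using F by (auto simp: convergent_series_conv)
  have near1: "near0 (\<lambda>z \<zeta> v. norm \<zeta> < 1)" unfolding near0_def by (intro exI[of _ 1]) auto
  have n: "near0 (\<lambda>z \<zeta> v. (1 - \<zeta> * cnj \<zeta>) * (eval_series F z \<zeta> (cnj z) (cnj \<zeta>) (of_real v) - eval_series G z \<zeta> (cnj z) (cnj \<zeta>) (of_real v))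
     = z * cnj z + 1/2 * cnj z ^ 2 * \<zeta> + 1/2 * z ^ 2 * cnj \<zeta>)"
  proof (rule near0_mono[OF near0_conj[OF graph_point_near0[OF r F0 eq] near1]])
    fix z \<zeta> v
    assume *: "graph_value F (graph_point F z \<zeta> v) = gaussier_merker_value (graph_point F z \<zeta> v) + graph_value G (graph_point F z \<zeta> v) \<and> norm \<zeta> < 1"
    have "1 - \<zeta> * cnj \<zeta> \<noteq> 0"
    proof
      assume "1 - \<zeta> * cnj \<zeta> = 0"
      hence "norm (\<zeta> * cnj \<zeta>) = 1" by simp
      hence "norm \<zeta> * norm \<zeta> = 1" by (simp add: norm_mult)
      thus False using * by (smt (verit) mult_less_cancel_left1 norm_ge_zero mult_cancel_left1)
    qed
    thus "(1 - \<zeta> * cnj \<zeta>) * (eval_series F z \<zeta> (cnj z) (cnj \<zeta>) (of_real v) - eval_series G z \<zeta> (cnj z) (cnj \<zeta>) (of_real v))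
     = z * cnj z + 1/2 * cnj z ^ 2 * \<zeta> + 1/2 * z ^ 2 * cnj \<zeta>"
      using * by (simp add: graph_value_vector gaussier_merker_value_def gaussier_merker_def)
  qed
  have "(1 - vZ * vA) * (nst F - nst G) = vX * vY + cst (1/2) * vY ^ 2 * vZ + cst (1/2) * vX ^ 2 * vA"
    by (rule fexp_unique[OF _ _ n]; intro fexp_intros fexp_1 fexp_eval F G)
  also have "\<dots> = (1 - vZ * vA) * gm_ser" by (rule gm_ser_eq[symmetric])
  finally have "nst F - nst G = gm_ser" using vZA_neq_1 by simp
  thus ?thesis by (simp add: algebra_simps)
qed

subsection \<open>Infinitesimal automorphisms\<close>

unbundle no fps_syntax
unbundle vec_syntax

lemma eval_series_0: "eval_series c 0 0 0 0 0 = c 0 0 0 0 0"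
  using graph_value_0[of c] by (simp add: graph_value_def)

lemma norm_axis_complex: "norm (axis k x :: complex ^ 3) = norm x"
  using exhaust_3[of k] by (auto simp: norm_vec_def L2_set_def sum_3 axis_def)

lemma bounded_linear_axis: "bounded_linear (axis k :: complex \<Rightarrow> complex ^ 3)"
proof (rule bounded_linear_intro[where K = 1])
  show "norm (axis k x :: complex ^ 3) \<le> norm x * 1" for x by (simp add: norm_axis_complex)
qed (auto simp: vec_eq_iff axis_def)

lemma linear_smult: "Vector_Spaces.linear (*s) (*s) D \<Longrightarrow> D (c *s x) = c *s D x"
  for D :: "complex ^ 3 \<Rightarrow> complex ^ 3"
  by (rule vec.linear_scale)

lemma holomorphic_component:
  fixes X :: "complex ^ 3 \<Rightarrow> complex ^ 3"
  assumes X: "\<And>p. norm p < \<delta> \<Longrightarrow> \<exists>D. (X has_derivative D) (at p) \<and> Vector_Spaces.linear (*s) (*s) D"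
    and S: "open S" "\<And>w. w \<in> S \<Longrightarrow> norm (p0 + axis k w) < \<delta>"
  shows "(\<lambda>w. X (p0 + axis k w) $ i) holomorphic_on S"
  unfolding holomorphic_on_open[OF S(1)]
proof (intro ballI)
  fix w assume "w \<in> S"
  then obtain D where D: "(X has_derivative D) (at (p0 + axis k w))" "Vector_Spaces.linear (*s) (*s) D"
    using X S by blast
  have "((\<lambda>w. p0 + axis k w) has_derivative (\<lambda>w. 0 + axis k w)) (at w)"
    by (intro has_derivative_add has_derivative_const bounded_linear_imp_has_derivative bounded_linear_axis)
  from bounded_linear.has_derivative[OF bounded_linear_vec_nth has_derivative_compose[OF this D(1)], of i]
  have "((\<lambda>w. X (p0 + axis k w) $ i) has_derivative (\<lambda>v. D (axis k v) $ i)) (at w)"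
    by (simp only: add_0)
  moreover have "(\<lambda>v. D (axis k v) $ i) = (*) (D (axis k 1) $ i)"
  proof
    fix v
    have "axis k v = v *s (axis k 1 :: complex ^ 3)" by (simp add: vec_eq_iff axis_def)
    thus "D (axis k v) $ i = D (axis k 1) $ i * v" by (simp add: linear_smult[OF D(2)] mult.commute)
  qed
  ultimately have "((\<lambda>w. X (p0 + axis k w) $ i) has_field_derivative D (axis k 1) $ i) (at w)"
    by (simp only: has_field_derivative_def)
  thus "\<exists>f'. ((\<lambda>w. X (p0 + axis k w) $ i) has_field_derivative f') (at w)" by blast
qed

text \<open>A holomorphic function of \<open>z\<close>, \<open>\<zeta>\<close>, \<open>w\<close>
  stored in a five-index array: the conjugate exponents are zero, and the last exponent belongs to
  \<open>w\<close> instead of \<open>v\<close>.\<close>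

definition hol_series :: "coeffs \<Rightarrow> bool" where
  "hol_series c \<longleftrightarrow> convergent_series c \<and> (\<forall>h p j k l. j \<noteq> 0 \<or> k \<noteq> 0 \<longrightarrow> c h p j k l = 0)"

lemma hol_component_series:
  fixes X :: "complex ^ 3 \<Rightarrow> complex ^ 3"
  assumes "\<forall>\<^sub>F p in nhds 0. \<exists>D. (X has_derivative D) (at p) \<and> Vector_Spaces.linear (*s) (*s) D"
  shows "\<exists>c r. r > 0 \<and> hol_series c \<and> (\<forall>z \<zeta> w. norm z \<le> r \<longrightarrow> norm \<zeta> \<le> r \<longrightarrow> norm w \<le> r \<longrightarrow> X (vector [z, \<zeta>, w]) $ i = eval_series c z \<zeta> 0 0 w)"
proof -
  obtain \<delta> where \<delta>: "\<delta> > 0" and X: "\<And>p. norm p < \<delta> \<Longrightarrow> \<exists>D. (X has_derivative D) (at p) \<and> Vector_Spaces.linear (*s) (*s) D"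
    using assms unfolding eventually_nhds_metric by (auto simp: dist_norm)
  define R where "R = \<delta> / 8"
  have R: "R > 0" using \<delta> by (simp add: R_def)
  have b: "norm (vector [z, \<zeta>, w] :: complex ^ 3) < \<delta> / 2" if "norm z < R" "norm \<zeta> < R" "norm w < R" for z \<zeta> w
  proof -
    have "norm (vector [z, \<zeta>, w] :: complex ^ 3) \<le> norm z + norm \<zeta> + norm w" using norm3_le[of "vector [z, \<zeta>, w]"] by simp
    thus ?thesis using that \<delta> by (simp add: R_def)
  qed
  hence b': "norm (vector [z, \<zeta>, w] :: complex ^ 3) < \<delta>" if "norm z < R" "norm \<zeta> < R" "norm w < R" for z \<zeta> w
    using that \<delta> by fastforce
  have "continuous_on (cball 0 (\<delta> / 2)) X"
    by (rule continuous_at_imp_continuous_on) (use X \<delta> has_derivative_continuous in force)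
  hence "compact (X ` cball 0 (\<delta> / 2))" by (rule compact_continuous_image) simp
  then obtain M where M: "\<And>p. norm p \<le> \<delta> / 2 \<Longrightarrow> norm (X p) \<le> M"
    using compact_imp_bounded[of "X ` cball 0 (\<delta> / 2)"] unfolding bounded_iff ball_simps by fastforce
  have e: "vector [z, \<zeta>, w] = vector [z, \<zeta>, 0] + (axis 3 w :: complex ^ 3)"
     "vector [z, \<zeta>, w] = vector [z, 0, w] + (axis 2 \<zeta> :: complex ^ 3)"
     "vector [z, \<zeta>, w] = vector [0, \<zeta>, w] + (axis 1 z :: complex ^ 3)" for z \<zeta> w
    by (simp_all add: vec_eq_iff forall_3 axis_def)
  have "\<exists>c r. conv c r \<and> (\<forall>h p j k l. j \<noteq> 0 \<or> k \<noteq> 0 \<longrightarrow> c h p j k l = 0) \<and>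
     (\<forall>z \<zeta> w a \<alpha>. norm z \<le> r \<longrightarrow> norm \<zeta> \<le> r \<longrightarrow> norm w \<le> r \<longrightarrow> X (vector [z, \<zeta>, w]) $ i = eval_series c z \<zeta> a \<alpha> w)"
  proof (rule holomorphic3_series[OF R, where M = M])
    show "(\<lambda>w. X (vector [z, \<zeta>, w]) $ i) holomorphic_on ball 0 R" if n: "norm z < R" "norm \<zeta> < R" for z \<zeta>
    proof -
      have "(\<lambda>w. X (vector [z, \<zeta>, 0] + axis 3 w) $ i) holomorphic_on ball 0 R"
      proof (rule holomorphic_component[OF X open_ball])
        fix w :: complex assume "w \<in> ball 0 R"
        hence "norm w < R" by simp
        from b'[of z \<zeta> w] this n show "norm (vector [z, \<zeta>, 0] + axis 3 w :: complex ^ 3) < \<delta>"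
          by (simp only: e(1)[symmetric])
      qed
      thus ?thesis by (simp only: e(1)[symmetric])
    qed
    show "(\<lambda>\<zeta>. X (vector [z, \<zeta>, w]) $ i) holomorphic_on ball 0 R" if n: "norm z < R" "norm w < R" for z w
    proof -
      have "(\<lambda>\<zeta>. X (vector [z, 0, w] + axis 2 \<zeta>) $ i) holomorphic_on ball 0 R"
      proof (rule holomorphic_component[OF X open_ball])
        fix \<zeta> :: complex assume "\<zeta> \<in> ball 0 R"
        hence "norm \<zeta> < R" by simp
        from b'[of z \<zeta> w] this n show "norm (vector [z, 0, w] + axis 2 \<zeta> :: complex ^ 3) < \<delta>"
          by (simp only: e(2)[symmetric])
      qed
      thus ?thesis by (simp only: e(2)[symmetric])
    qed
    show "(\<lambda>z. X (vector [z, \<zeta>, w]) $ i) holomorphic_on ball 0 R" if n: "norm \<zeta> < R" "norm w < R" for \<zeta> w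
    proof -
      have "(\<lambda>z. X (vector [0, \<zeta>, w] + axis 1 z) $ i) holomorphic_on ball 0 R"
      proof (rule holomorphic_component[OF X open_ball])
        fix z :: complex assume "z \<in> ball 0 R"
        hence "norm z < R" by simp
        from b'[of z \<zeta> w] this n show "norm (vector [0, \<zeta>, w] + axis 1 z :: complex ^ 3) < \<delta>"
          by (simp only: e(3)[symmetric])
      qed
      thus ?thesis by (simp only: e(3)[symmetric])
    qed
    show "norm (X (vector [z, \<zeta>, w]) $ i) \<le> M" if "norm z < R" "norm \<zeta> < R" "norm w < R" for z \<zeta> w
      using order_trans[OF norm_component_le M[OF less_imp_le[OF b[OF that]]]] .
  qed
  then obtain c r where "conv c r" "\<forall>h p j k l. j \<noteq> 0 \<or> k \<noteq> 0 \<longrightarrow> c h p j k l = 0"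
     "\<forall>z \<zeta> w a \<alpha>. norm z \<le> r \<longrightarrow> norm \<zeta> \<le> r \<longrightarrow> norm w \<le> r \<longrightarrow> X (vector [z, \<zeta>, w]) $ i = eval_series c z \<zeta> a \<alpha> w"
    by blast
  thus ?thesis
    by (intro exI[of _ c] exI[of _ r]) (auto simp: hol_series_def convergent_series_conv conv_def)
qed

text \<open>Twice the condition Re C = 2 Re (F_z A + F_\<zeta> B) + F_v Im C at the point with w = F
  + i v. The imaginary part appears as a difference of conjugates so that the identity is polynomial
  in series and their conjugates.\<close>

definition tangent_series :: "coeffs \<Rightarrow> coeffs \<Rightarrow> coeffs \<Rightarrow> coeffs \<Rightarrow> bool" where
  "tangent_series F a b c \<longleftrightarrow> hol_series a \<and> hol_series b \<and> hol_series c \<and>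
    near0 (\<lambda>z \<zeta> v. let E = (\<lambda>c. eval_series c z \<zeta> (cnj z) (cnj \<zeta>) (of_real v)); w = E F + \<i> * of_real v;
        A = eval_series a z \<zeta> 0 0 w; B = eval_series b z \<zeta> 0 0 w; C = eval_series c z \<zeta> 0 0 w in
      C + cnj C = 2 * (E (dc1 F) * A + E (dc2 F) * B) + cnj (2 * (E (dc1 F) * A + E (dc2 F) * B))
        - \<i> * E (dc5 F) * (C - cnj C))"

lemma rho_derivative:
  assumes "conv F r" "norm p < r"
  shows "(graph_defining_function F has_derivative (\<lambda>q. Re (graph_value (dc1 F) p * q $ 1 + graph_value (dc2 F) p * q $ 2
     + graph_value (dc3 F) p * cnj (q $ 1) + graph_value (dc4 F) p * cnj (q $ 2)
     + graph_value (dc5 F) p * of_real (Im (q $ 3))) - Re (q $ 3))) (at p)"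
  unfolding graph_defining_function_def[abs_def]
  by (intro has_derivative_diff bounded_linear.has_derivative[OF bounded_linear_Re] graph_value_has_derivative[OF assms]
      bounded_linear_imp_has_derivative bounded_linear_compose[OF bounded_linear_Re] bounded_linear_vec_nth)

lemma tangent_space_iff:
  assumes "conv F r" "norm p < r"
  shows "V \<in> tangent_space (graph_defining_function F) p \<longleftrightarrow> Re (graph_value (dc1 F) p * V $ 1 + graph_value (dc2 F) p * V $ 2
     + graph_value (dc3 F) p * cnj (V $ 1) + graph_value (dc4 F) p * cnj (V $ 2)
     + graph_value (dc5 F) p * of_real (Im (V $ 3))) = Re (V $ 3)"
  unfolding tangent_space_def using frechet_derivative_at[OF rho_derivative[OF assms], symmetric] by simp

lemma hol_tangent_series:
  fixes X :: "complex ^ 3 \<Rightarrow> complex ^ 3"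
  assumes herm: "hermitian_coeffs F" and c0: "convergent_series F" and F0: "F 0 0 0 0 0 = 0"
    and M: "is_graph_of M (graph_value F)" and X: "X \<in> hol M (graph_defining_function F)"
  shows "\<exists>a b c. tangent_series F a b c \<and> a 0 0 0 0 0 = X 0 $ 1 \<and> b 0 0 0 0 0 = X 0 $ 2 \<and> c 0 0 0 0 0 = X 0 $ 3"
proof -
  obtain r0 where r0: "conv F r0" using c0 by (auto simp: convergent_series_conv)
  have r00: "r0 > 0" using r0 by (simp add: conv_def)
  have h: "\<forall>\<^sub>F p in nhds 0. \<exists>D. (X has_derivative D) (at p) \<and> Vector_Spaces.linear (*s) (*s) D"
    and t: "\<forall>\<^sub>F p in nhds 0. p \<in> M \<longrightarrow> X p \<in> tangent_space (graph_defining_function F) p"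
    using X by (auto simp: hol_def)
  obtain a ra where a: "ra > 0" "hol_series a" "\<And>z \<zeta> w. norm z \<le> ra \<Longrightarrow> norm \<zeta> \<le> ra \<Longrightarrow> norm w \<le> ra \<Longrightarrow> X (vector [z, \<zeta>, w]) $ 1 = eval_series a z \<zeta> 0 0 w"
    using hol_component_series[OF h, of 1] by blast
  obtain b rb where b: "rb > 0" "hol_series b" "\<And>z \<zeta> w. norm z \<le> rb \<Longrightarrow> norm \<zeta> \<le> rb \<Longrightarrow> norm w \<le> rb \<Longrightarrow> X (vector [z, \<zeta>, w]) $ 2 = eval_series b z \<zeta> 0 0 w"
    using hol_component_series[OF h, of 2] by blast
  obtain c rc where c: "rc > 0" "hol_series c" "\<And>z \<zeta> w. norm z \<le> rc \<Longrightarrow> norm \<zeta> \<le> rc \<Longrightarrow> norm w \<le> rc \<Longrightarrow> X (vector [z, \<zeta>, w]) $ 3 = eval_series c z \<zeta> 0 0 w"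
    using hol_component_series[OF h, of 3] by blast
  define r where "r = Min {r0, ra, rb, rc}"
  have r: "r > 0" "r \<le> r0" "r \<le> ra" "r \<le> rb" "r \<le> rc" using r00 a b c by (simp_all add: r_def)
  have "\<forall>\<^sub>F p in nhds 0. norm p < r \<and> (p \<in> M \<longrightarrow> X p \<in> tangent_space (graph_defining_function F) p)"
    using t r(1) unfolding eventually_conj_iff by (auto simp: eventually_nhds_metric dist_norm)
  note near = near0_conj[OF graph_point_near0[OF r0 F0 this] graph_point_in_M[OF r0 F0 herm M]]
  have "near0 (\<lambda>z \<zeta> v. let E = (\<lambda>c. eval_series c z \<zeta> (cnj z) (cnj \<zeta>) (of_real v)); w = E F + \<i> * of_real v;
        A = eval_series a z \<zeta> 0 0 w; B = eval_series b z \<zeta> 0 0 w; C = eval_series c z \<zeta> 0 0 w in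
      C + cnj C = 2 * (E (dc1 F) * A + E (dc2 F) * B) + cnj (2 * (E (dc1 F) * A + E (dc2 F) * B))
        - \<i> * E (dc5 F) * (C - cnj C))"
  proof (rule near0_mono[OF near])
    fix z \<zeta> v
    define p where "p = graph_point F z \<zeta> v"
    assume "(norm (graph_point F z \<zeta> v) < r \<and> (graph_point F z \<zeta> v \<in> M \<longrightarrow> X (graph_point F z \<zeta> v) \<in> tangent_space (graph_defining_function F) (graph_point F z \<zeta> v))) \<and> graph_point F z \<zeta> v \<in> M"
    hence p: "norm p < r" "X p \<in> tangent_space (graph_defining_function F) p" by (simp_all add: p_def)
    have nr: "norm p < r0" using p(1) r by simp
    define w where "w = eval_series F z \<zeta> (cnj z) (cnj \<zeta>) (of_real v) + \<i> * of_real v"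
    have gv: "graph_value c p = eval_series c z \<zeta> (cnj z) (cnj \<zeta>) (of_real v)" for c
      by (simp add: p_def graph_value_vector)
    have Im0: "Im (graph_value F p) = 0" "Im (graph_value (dc5 F) p) = 0"
      using cnj_graph_value[of F p] cnj_graph_value[of "dc5 F" p] hermitian_cnj_coeffs[OF herm] by (simp_all add: complex_eq_iff)
    have pw: "p = vector [z, \<zeta>, w]"
      using Im0(1) unfolding gv by (simp add: p_def w_def vec_eq_iff forall_3 complex_eq_iff)
    have n: "norm z < r" "norm \<zeta> < r" "norm w < r"
      using norm_component_le[of p 1] norm_component_le[of p 2] norm_component_le[of p 3] p(1) by (simp_all add: pw)
    have Xa: "X p $ 1 = eval_series a z \<zeta> 0 0 w" unfolding pw by (rule a(3)) (use n r in auto)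
    have Xb: "X p $ 2 = eval_series b z \<zeta> 0 0 w" unfolding pw by (rule b(3)) (use n r in auto)
    have Xc: "X p $ 3 = eval_series c z \<zeta> 0 0 w" unfolding pw by (rule c(3)) (use n r in auto)
    have g34: "graph_value (dc3 F) p = cnj (graph_value (dc1 F) p)" "graph_value (dc4 F) p = cnj (graph_value (dc2 F) p)"
      by (simp_all add: cnj_graph_value hermitian_cnj_coeffs[OF herm])
    have "C + cnj C = 2 * (g1 * A + g2 * B) + cnj (2 * (g1 * A + g2 * B)) - \<i> * g5 * (C - cnj C)"
      if "Re (g1 * A + g2 * B + cnj g1 * cnj A + cnj g2 * cnj B + g5 * of_real (Im C)) = Re C" "Im g5 = 0" for g1 g2 g5 A B C
      using that by (simp add: complex_eq_iff algebra_simps)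
    note eq = this[OF p(2)[unfolded tangent_space_iff[OF r0 nr] g34] Im0(2)]
    show "let E = (\<lambda>c. eval_series c z \<zeta> (cnj z) (cnj \<zeta>) (of_real v)); w = E F + \<i> * of_real v;
        A = eval_series a z \<zeta> 0 0 w; B = eval_series b z \<zeta> 0 0 w; C = eval_series c z \<zeta> 0 0 w in
      C + cnj C = 2 * (E (dc1 F) * A + E (dc2 F) * B) + cnj (2 * (E (dc1 F) * A + E (dc2 F) * B))
        - \<i> * E (dc5 F) * (C - cnj C)"
      unfolding Let_def w_def[symmetric] using eq unfolding Xa Xb Xc gv .
  qed
  moreover have "vector [0, 0, 0] = (0 :: complex ^ 3)" by (simp add: vec_eq_iff forall_3)
  hence "a 0 0 0 0 0 = X 0 $ 1" "b 0 0 0 0 0 = X 0 $ 2" "c 0 0 0 0 0 = X 0 $ 3"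
    using a(1) a(3)[of 0 0 0] b(1) b(3)[of 0 0 0] c(1) c(3)[of 0 0 0] by (simp_all add: eval_series_0)
  ultimately show ?thesis using a(2) b(2) c(2) unfolding tangent_series_def by blast
qed

text \<open>The values at the origin form a real subspace, hence agree with their span: homogeneity
  then gives, for each tangent vector, one single field having it as value.\<close>

lemma hol_subspace:
  assumes c: "conv F r" and r: "r > 0"
  shows "subspace {X 0 | X. X \<in> hol M (graph_defining_function F)}"
proof -
  let ?\<rho> = "graph_defining_function F"
  have ev: "\<forall>\<^sub>F p in nhds 0. norm (p :: complex ^ 3) < r"
    using r by (auto simp: eventually_nhds_metric dist_norm)
  have tl: "subspace (tangent_space ?\<rho> p)" if pr: "norm p < r" for p
  proof -
    obtain D :: "complex ^ 3 \<Rightarrow> real" where D: "linear D" "tangent_space ?\<rho> p = {V. D V = 0}"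
    proof (rule that[OF has_derivative_linear[OF rho_derivative[OF c pr]]])
      show "tangent_space ?\<rho> p = {V. Re (graph_value (dc1 F) p * V $ 1 + graph_value (dc2 F) p * V $ 2
       + graph_value (dc3 F) p * cnj (V $ 1) + graph_value (dc4 F) p * cnj (V $ 2)
       + graph_value (dc5 F) p * of_real (Im (V $ 3))) - Re (V $ 3) = 0}"
        unfolding tangent_space_def frechet_derivative_at[OF rho_derivative[OF c pr], symmetric] ..
    qed
    show ?thesis unfolding D(2) by (rule linear_subspace_kernel[OF D(1)])
  qed
  have z: "(\<lambda>_. 0) \<in> hol M ?\<rho>"
    unfolding hol_def
  proof (intro CollectI conjI)
    show "\<forall>\<^sub>F p in nhds 0. \<exists>D. ((\<lambda>_. 0) has_derivative D) (at (p :: complex ^ 3)) \<and> Vector_Spaces.linear (*s) (*s) (D :: complex ^ 3 \<Rightarrow> complex ^ 3)"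
      by (rule always_eventually, rule allI, rule exI[of _ "\<lambda>_. 0"], intro conjI has_derivative_const vec.linear_zero)
    show "\<forall>\<^sub>F p in nhds 0. p \<in> M \<longrightarrow> 0 \<in> tangent_space ?\<rho> p"
      using ev by eventually_elim (use tl subspace_0 in blast)
  qed
  have add: "(\<lambda>p. X p + Y p) \<in> hol M ?\<rho>" if X: "X \<in> hol M ?\<rho>" and Y: "Y \<in> hol M ?\<rho>" for X Y
    unfolding hol_def
  proof (intro CollectI conjI)
    have "\<forall>\<^sub>F p in nhds 0. (\<exists>D. (X has_derivative D) (at p) \<and> Vector_Spaces.linear (*s) (*s) D) \<and> (\<exists>D. (Y has_derivative D) (at p) \<and> Vector_Spaces.linear (*s) (*s) D)"
      using X Y unfolding hol_def eventually_conj_iff by blast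
    thus "\<forall>\<^sub>F p in nhds 0. \<exists>D. ((\<lambda>p. X p + Y p) has_derivative D) (at p) \<and> Vector_Spaces.linear (*s) (*s) D"
      by eventually_elim (blast intro: has_derivative_add vec.linear_compose_add)
    have "\<forall>\<^sub>F p in nhds 0. (p \<in> M \<longrightarrow> X p \<in> tangent_space ?\<rho> p) \<and> (p \<in> M \<longrightarrow> Y p \<in> tangent_space ?\<rho> p) \<and> norm p < r"
      using X Y ev unfolding hol_def eventually_conj_iff by blast
    thus "\<forall>\<^sub>F p in nhds 0. p \<in> M \<longrightarrow> X p + Y p \<in> tangent_space ?\<rho> p"
      by eventually_elim (use tl subspace_add in blast)
  qed
  have sc: "(\<lambda>p. k *\<^sub>R X p) \<in> hol M ?\<rho>" if X: "X \<in> hol M ?\<rho>" for X k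
    unfolding hol_def
  proof (intro CollectI conjI)
    have sR: "k *\<^sub>R x = of_real k *s x" for x :: "complex ^ 3" unfolding vec_eq_iff vector_scaleR_component vector_smult_component by (simp add: scaleR_conv_of_real)
    have "\<forall>\<^sub>F p in nhds 0. (\<exists>D. (X has_derivative D) (at p) \<and> Vector_Spaces.linear (*s) (*s) D)"
      using X unfolding hol_def by blast
    thus "\<forall>\<^sub>F p in nhds 0. \<exists>D. ((\<lambda>p. k *\<^sub>R X p) has_derivative D) (at p) \<and> Vector_Spaces.linear (*s) (*s) D"
    proof eventually_elim
      case (elim p)
      then obtain D where D: "(X has_derivative D) (at p)" "Vector_Spaces.linear (*s) (*s) D" by blast
      have "((\<lambda>p. k *\<^sub>R X p) has_derivative (\<lambda>q. k *\<^sub>R D q)) (at p)" by (rule has_derivative_scaleR_right[OF D(1)])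
      moreover have "Vector_Spaces.linear (*s) (*s) (\<lambda>q. k *\<^sub>R D q)"
        unfolding sR using vec.linear_compose_scale_right[OF D(2)] .
      ultimately show ?case by blast
    qed
    have "\<forall>\<^sub>F p in nhds 0. (p \<in> M \<longrightarrow> X p \<in> tangent_space ?\<rho> p) \<and> norm p < r"
      using X ev unfolding hol_def eventually_conj_iff by blast
    thus "\<forall>\<^sub>F p in nhds 0. p \<in> M \<longrightarrow> k *\<^sub>R X p \<in> tangent_space ?\<rho> p"
      by eventually_elim (use tl subspace_scale in blast)
  qed
  show ?thesis unfolding subspace_def
  proof (intro conjI ballI allI)
    show "0 \<in> {X 0 |X. X \<in> hol M ?\<rho>}" using z by force
    show "x + y \<in> {X 0 |X. X \<in> hol M ?\<rho>}" if "x \<in> {X 0 |X. X \<in> hol M ?\<rho>}" "y \<in> {X 0 |X. X \<in> hol M ?\<rho>}" for x y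
    proof -
      obtain X Y where "X \<in> hol M ?\<rho>" "Y \<in> hol M ?\<rho>" and xy: "x = X 0" "y = Y 0" using \<open>x \<in> _\<close> \<open>y \<in> _\<close> by auto
      note a = add[OF this(1,2)]
      show ?thesis unfolding xy mem_Collect_eq by (rule exI[of _ "\<lambda>p. X p + Y p"], rule conjI[OF refl a])
    qed
    show "k *\<^sub>R x \<in> {X 0 |X. X \<in> hol M ?\<rho>}" if "x \<in> {X 0 |X. X \<in> hol M ?\<rho>}" for x k
    proof -
      obtain X where "X \<in> hol M ?\<rho>" and x: "x = X 0" using \<open>x \<in> _\<close> by auto
      note a = sc[OF this(1), of k]
      show ?thesis unfolding x mem_Collect_eq by (rule exI[of _ "\<lambda>p. k *\<^sub>R X p"], rule conjI[OF refl a])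
    qed
  qed
qed

lemma tangent_series_exists:
  assumes herm: "hermitian_coeffs F" and c0: "convergent_series F" and F0: "F 0 0 0 0 0 = 0"
    and F1: "F 1 0 0 0 0 = 0" "F 0 1 0 0 0 = 0" "F 0 0 1 0 0 = 0" "F 0 0 0 1 0 = 0" "F 0 0 0 0 1 = 0"
    and M: "is_graph_of M (graph_value F)" and hom: "locally_homogeneous M (graph_defining_function F)"
    and V: "Re V3 = 0"
  shows "\<exists>a b c. tangent_series F a b c \<and> a 0 0 0 0 0 = V1 \<and> b 0 0 0 0 0 = V2 \<and> c 0 0 0 0 0 = V3"
proof -
  obtain r where r: "conv F r" using c0 by (auto simp: convergent_series_conv)
  have r0: "r > 0" using r by (simp add: conv_def)
  \<comment> \<open>The first derivatives of \<open>F\<close> vanish at the origin, so the tangent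
    space there is given by Re w = 0.\<close>
  have "vector [V1, V2, V3] \<in> tangent_space (graph_defining_function F) 0"
    using tangent_space_iff[OF r, of 0] r0 F1 V by (simp add: graph_value_0 dc1_def dc2_def dc3_def dc4_def dc5_def)
  also have "tangent_space (graph_defining_function F) 0 = {X 0 | X. X \<in> hol M (graph_defining_function F)}"
    by (rule trans[OF hom[unfolded locally_homogeneous_def] span_eq_iff[THEN iffD2, OF hol_subspace[OF r r0]]])
  finally obtain X where X: "X \<in> hol M (graph_defining_function F)" "X 0 = vector [V1, V2, V3]" by force
  show ?thesis using hol_tangent_series[OF herm c0 F0 M X(1)] by (simp add: X(2))
qed

subsection \<open>Weight expansion of the tangency condition\<close>

unbundle no vec_syntax
unbundle fps_syntax

definition wpart :: "nat \<Rightarrow> coeffs \<Rightarrow> coeffs" where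
  "wpart n c = (\<lambda>h p j k l. if h + j + 2 * l = n then c h p j k l else 0)"

text \<open>The coefficient function of z^h (conj z)^j v^l, a power series in \<open>\<zeta>\<close>
  and its conjugate, moved to exponent 0. Polynomials in the weighted variables are handled through
  these coefficients.\<close>

definition slice :: "coeffs \<Rightarrow> nat \<Rightarrow> nat \<Rightarrow> nat \<Rightarrow> coeffs" where
  "slice c h j l = (\<lambda>h' p j' k l'. if h' = 0 \<and> j' = 0 \<and> l' = 0 then c h p j k l else 0)"

lemma eval_slice: "eval_series (slice c h j l) z \<zeta> a \<alpha> v = eval_series (slice c h j l) 0 \<zeta> 0 \<alpha> 0"
  unfolding eval_series_tm by (rule infsum_cong) (auto simp: tm_def slice_def)

lemma eval_series_zero: "eval_series (\<lambda>_ _ _ _ _. 0) z \<zeta> a \<alpha> v = 0"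
  unfolding eval_series_def by (rule infsum_0) auto

lemma conv_le:
  assumes "conv c r" "\<And>h p j k l. norm (c' h p j k l) \<le> norm (c h p j k l)"
  shows "conv c' r"
  unfolding conv_def
proof
  show "(\<lambda>(h, p, j, k, l). norm (c' h p j k l) * r ^ (h + p + j + k + l)) summable_on UNIV"
  proof (rule summable_on_comparison_test)
    show "(\<lambda>(h, p, j, k, l). norm (c h p j k l) * r ^ (h + p + j + k + l)) summable_on UNIV"
      using assms(1) by (simp add: conv_def)
  qed (use assms in \<open>auto intro!: mult_right_mono simp: conv_def\<close>)
qed (use assms(1) in \<open>simp add: conv_def\<close>)

lemma conv_wpart: "conv c r \<Longrightarrow> conv (wpart n c) r"
  by (erule conv_le) (simp add: wpart_def)

lemma conv_slice:
  assumes "conv c r"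
  shows "conv (slice c h j l) r"
  unfolding conv_def
proof
  have r: "r > 0" using assms by (simp add: conv_def)
  let ?g = "(\<lambda>(h', p, j', k, l'). (h' + h, p, j' + j, k, l' + l)) :: idx5 \<Rightarrow> idx5"
  let ?f = "\<lambda>(h, p, j, k, l). norm (c h p j k l) * r ^ (h + p + j + k + l)"
  have "?f summable_on range ?g"
    by (rule summable_on_subset_banach[OF assms[unfolded conv_def, THEN conjunct2]]) simp
  hence "(?f \<circ> ?g) summable_on UNIV"
    by (subst (asm) summable_on_reindex) (auto simp: inj_on_def)
  hence sm: "(\<lambda>w. (?f \<circ> ?g) w * (1 / r ^ (h + j + l))) summable_on UNIV"
    by (rule summable_on_cmult_left)
  show "(\<lambda>(h', p, j', k, l'). norm (slice c h j l h' p j' k l') * r ^ (h' + p + j' + k + l')) summable_on UNIV"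
  proof (rule summable_on_comparison_test[OF sm])
    show "(case w of (h', p, j', k, l') \<Rightarrow> norm (slice c h j l h' p j' k l') * r ^ (h' + p + j' + k + l')) \<le> (?f \<circ> ?g) w * (1 / r ^ (h + j + l))" for w
    proof (cases w)
      case (fields h' p j' k l')
      show ?thesis using r by (simp add: fields slice_def power_add)
    qed
  qed (use r in auto)
qed (use assms in \<open>simp add: conv_def\<close>)

lemma infsum_finite_sum:
  assumes "finite B" "\<And>b. b \<in> B \<Longrightarrow> u b summable_on A"
  shows "(\<Sum>\<^sub>\<infinity>w\<in>A. \<Sum>b\<in>B. u b w) = (\<Sum>b\<in>B. infsum (u b) A :: complex) \<and> (\<lambda>w. \<Sum>b\<in>B. u b w) summable_on A"
  using assms
proof (induction B rule: finite_induct)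
  case (insert b B)
  thus ?case by (simp add: infsum_add summable_on_add)
qed simp

definition ibox :: "nat \<Rightarrow> (nat \<times> nat \<times> nat) set" where
  "ibox N = {..N} \<times> {..N} \<times> {..N}"

lemma finite_ibox [simp]: "finite (ibox N)"
  by (simp add: ibox_def)

lemma eval_box:
  assumes c: "conv c r" and n: "norm z \<le> r" "norm \<zeta> \<le> r" "norm a \<le> r" "norm \<alpha> \<le> r" "norm v \<le> r"
    and bx: "\<And>h p j k l. c h p j k l \<noteq> 0 \<Longrightarrow> (h, j, l) \<in> ibox N"
  shows "eval_series c z \<zeta> a \<alpha> v = (\<Sum>(h, j, l)\<in>ibox N. eval_series (slice c h j l) 0 \<zeta> 0 \<alpha> 0 * z ^ h * a ^ j * v ^ l)"
proof -
  define pr :: "idx5 \<Rightarrow> nat \<times> nat \<times> nat" where "pr = (\<lambda>(h, p, j, k, l). (h, j, l))"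
  define u where "u = (\<lambda>b w. if pr w = b then tm c z \<zeta> a \<alpha> v w else 0)"
  have sm: "u b summable_on UNIV" for b
  proof -
    have "tm c z \<zeta> a \<alpha> v summable_on {w. pr w = b}" by (rule tm_summable[OF c n])
    thus ?thesis by (rule summable_on_cong_neutral[THEN iffD1, rotated -1]) (auto simp: u_def)
  qed
  have U: "infsum (u b) UNIV = (case b of (h, j, l) \<Rightarrow> eval_series (slice c h j l) 0 \<zeta> 0 \<alpha> 0 * z ^ h * a ^ j * v ^ l)" for b
  proof (cases b)
    case (fields h j l)
    let ?g = "(\<lambda>(h', p, j', k, l'). (h' + h, p, j' + j, k, l' + l)) :: idx5 \<Rightarrow> idx5"
    have inj: "inj ?g" by (auto simp: inj_on_def)
    have "infsum (u b) UNIV = infsum (u b) (range ?g)"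
    proof (rule infsum_cong_neutral)
      fix w assume w: "w \<in> UNIV - range ?g"
      show "u b w = 0"
      proof (rule ccontr)
        assume nz: "u b w \<noteq> 0"
        obtain h' p j' k l' where w': "w = (h', p, j', k, l')" by (cases w)
        have "w = (h, p, j, k, l)" using nz by (auto simp: u_def pr_def w' fields split: if_splits)
        hence "w = ?g (0, p, 0, k, 0)" by simp
        thus False using w by blast
      qed
    qed auto
    also have "\<dots> = infsum (u b \<circ> ?g) UNIV" by (rule infsum_reindex[OF inj])
    also have "\<dots> = (\<Sum>\<^sub>\<infinity>w. tm (slice c h j l) 0 \<zeta> 0 \<alpha> 0 w * (z ^ h * a ^ j * v ^ l))"
      by (rule infsum_cong) (auto simp: u_def pr_def fields tm_def slice_def power_add)
    also have "\<dots> = eval_series (slice c h j l) 0 \<zeta> 0 \<alpha> 0 * (z ^ h * a ^ j * v ^ l)"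
      unfolding eval_series_tm by (rule infsum_cmult_left')
    finally show ?thesis by (simp add: fields mult.assoc)
  qed
  have tmB: "tm c z \<zeta> a \<alpha> v w = (\<Sum>b\<in>ibox N. u b w)" for w
  proof (cases w)
    case (fields h p j k l)
    show ?thesis
    proof (cases "(h, j, l) \<in> ibox N")
      case True
      thus ?thesis by (simp add: u_def pr_def fields)
    next
      case False
      hence "c h p j k l = 0" using bx by blast
      thus ?thesis using False by (simp add: u_def pr_def fields tm_def)
    qed
  qed
  have "eval_series c z \<zeta> a \<alpha> v = (\<Sum>\<^sub>\<infinity>w. \<Sum>b\<in>ibox N. u b w)"
    unfolding eval_series_tm by (intro infsum_cong tmB)
  also have "\<dots> = (\<Sum>b\<in>ibox N. infsum (u b) UNIV)" using infsum_finite_sum[of "ibox N" u UNIV] sm by simp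
  finally show ?thesis by (simp add: U split_beta)
qed

lemma eval_asymp:
  assumes c: "conv c r" and n: "norm z \<le> r" "norm \<zeta> \<le> r" "\<bar>v\<bar> \<le> r"
  shows "has_asymp (\<lambda>s. eval_series c (of_real s * z) \<zeta> (cnj (of_real s * z)) (cnj \<zeta>) (of_real (s ^ 2 * v)))
     (Abs_fps (\<lambda>n. eval_series (wpart n c) z \<zeta> (cnj z) (cnj \<zeta>) (of_real v)))"
proof -
  define d :: "idx5 \<Rightarrow> nat" where "d = (\<lambda>(h, p, j, k, l). h + j + 2 * l)"
  define t where "t = tm c z \<zeta> (cnj z) (cnj \<zeta>) (of_real v)"
  have "(\<lambda>w. norm (t w) * 1 ^ d w) summable_on UNIV"
    unfolding t_def using tm_abs_summable[OF c, of z \<zeta> "cnj z" "cnj \<zeta>" "of_real v"] n by simp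
  from has_asymp_infsum[OF this] have "has_asymp (\<lambda>s. \<Sum>\<^sub>\<infinity>i. t i * of_real s ^ d i) (Abs_fps (\<lambda>n. \<Sum>\<^sub>\<infinity>i\<in>{i. d i = n}. t i))"
    by simp
  moreover have "t w * of_real s ^ d w = tm c (of_real s * z) \<zeta> (cnj (of_real s * z)) (cnj \<zeta>) (of_real (s ^ 2 * v)) w" for s w
    by (cases w) (simp add: t_def tm_def d_def power_add power_mult_distrib mult_ac flip: power_mult)
  moreover have "(\<Sum>\<^sub>\<infinity>i\<in>{i. d i = n}. t i) = eval_series (wpart n c) z \<zeta> (cnj z) (cnj \<zeta>) (of_real v)" for n
    unfolding eval_series_tm by (rule infsum_cong_neutral) (auto simp: t_def tm_def d_def wpart_def)
  ultimately show ?thesis by (simp only: eval_series_tm)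
qed

section \<open>Expansion of a holomorphic series along the graph\<close>

definition slv :: "coeffs \<Rightarrow> nat \<Rightarrow> nat \<Rightarrow> complex \<Rightarrow> complex" where
  "slv a h l \<zeta> = eval_series (slice a h 0 l) 0 \<zeta> 0 0 0"

text \<open>The formal composition with (s z, \<zeta>, w(s)). It is used for \<open>w\<close>
  starting with s^2, so exponents above \<open>n\<close> cannot contribute to the order
  \<open>n\<close>.\<close>

definition compo :: "coeffs \<Rightarrow> complex \<Rightarrow> complex \<Rightarrow> complex fps \<Rightarrow> complex fps" where
  "compo a z \<zeta> w = Abs_fps (\<lambda>n. \<Sum>(h, l)\<in>{..n} \<times> {..n}. slv a h l \<zeta> * z ^ h * (w ^ l) $ (n - h))"

lemma power_order2:
  fixes w :: "complex fps"
  assumes "w $ 0 = 0" "w $ 1 = 0"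
  shows "(w ^ l) $ m = (if m < 2 * l then 0 else (fps_shift 2 w ^ l) $ (m - 2 * l))"
proof -
  have "w = fps_X ^ 2 * fps_shift 2 w"
  proof (rule fps_ext)
    fix n show "w $ n = (fps_X ^ 2 * fps_shift 2 w) $ n"
      by (rule nat_cases2[of _ n]) (use assms in \<open>simp_all add: fps_X_power_mult_nth\<close>)
  qed
  hence "w ^ l = fps_X ^ (2 * l) * fps_shift 2 w ^ l" by (metis power_mult power_mult_distrib)
  thus ?thesis by (simp add: fps_X_power_mult_nth)
qed

lemma eval_tail_bound:
  assumes c: "conv c r" and t: "0 \<le> \<tau>" "\<tau> \<le> 1" and n: "norm z \<le> \<tau> * r" "norm \<zeta> \<le> r" "norm w \<le> \<tau> ^ 2 * r"
    and N: "\<And>h p j k l. c h p j k l \<noteq> 0 \<Longrightarrow> N \<le> h + 2 * l"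
  shows "norm (eval_series c z \<zeta> 0 0 w) \<le> (\<Sum>\<^sub>\<infinity>(h, p, j, k, l). norm (c h p j k l) * r ^ (h + p + j + k + l)) * \<tau> ^ N"
proof -
  have r: "r > 0" using c by (simp add: conv_def)
  define f where "f = (\<lambda>(h, p, j, k, l). norm (c h p j k l) * r ^ (h + p + j + k + l))"
  have fs: "f summable_on UNIV" using c by (simp add: f_def conv_def)
  have t2: "\<tau> ^ 2 \<le> 1" using t by (simp add: power_le_one)
  have b: "norm (tm c z \<zeta> 0 0 w i) \<le> f i * \<tau> ^ N" for i
  proof (cases i)
    case (fields h p j k l)
    show ?thesis
    proof (cases "c h p j k l = 0")
      case False
      have z: "(0::real) ^ n \<le> r ^ n" for n using r by (cases n) auto
      have tN: "\<tau> ^ (h + 2 * l) \<le> \<tau> ^ N" by (rule power_decreasing[OF N[OF False] t])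
      have "norm (tm c z \<zeta> 0 0 w i) = norm (c h p j k l) * (norm z ^ h * norm \<zeta> ^ p * 0 ^ j * 0 ^ k * norm w ^ l)"
        by (simp add: fields tm_def norm_mult norm_power mult_ac)
      also have "\<dots> \<le> norm (c h p j k l) * ((\<tau> * r) ^ h * r ^ p * r ^ j * r ^ k * (\<tau> ^ 2 * r) ^ l)"
        using n t r by (intro mult_left_mono mult_mono power_mono z) auto
      also have "\<dots> = f i * \<tau> ^ (h + 2 * l)"
      proof -
        have "\<tau> ^ (2 * l) = (\<tau> ^ 2) ^ l" by (rule power_mult)
        thus ?thesis by (simp add: fields f_def power_add power_mult_distrib mult_ac)
      qed
      also have "\<dots> \<le> f i * \<tau> ^ N" using r tN by (intro mult_left_mono) (auto simp: f_def fields)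
      finally show ?thesis .
    next
      case True
      thus ?thesis by (simp add: fields tm_def f_def)
    qed
  qed
  have s2: "(\<lambda>i. f i * \<tau> ^ N) summable_on UNIV" by (rule summable_on_cmult_left[OF fs])
  have s1: "(\<lambda>i. norm (tm c z \<zeta> 0 0 w i)) summable_on UNIV"
    by (rule summable_on_comparison_test[OF s2]) (use b in auto)
  have "norm (eval_series c z \<zeta> 0 0 w) \<le> (\<Sum>\<^sub>\<infinity>i. norm (tm c z \<zeta> 0 0 w i))"
    unfolding eval_series_tm by (rule norm_infsum_bound[OF s1])
  also have "\<dots> \<le> (\<Sum>\<^sub>\<infinity>i. f i * \<tau> ^ N)" by (rule infsum_mono[OF s1 s2 b])
  also have "\<dots> = infsum f UNIV * \<tau> ^ N" by (rule infsum_cmult_left')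
  finally show ?thesis by (simp add: f_def)
qed

lemma eval_series_add:
  assumes "conv c r" "conv d r" "norm z \<le> r" "norm \<zeta> \<le> r" "norm a \<le> r" "norm \<alpha> \<le> r" "norm v \<le> r"
  shows "eval_series (\<lambda>h p j k l. c h p j k l + d h p j k l) z \<zeta> a \<alpha> v = eval_series c z \<zeta> a \<alpha> v + eval_series d z \<zeta> a \<alpha> v"
proof -
  have "tm (\<lambda>h p j k l. c h p j k l + d h p j k l) z \<zeta> a \<alpha> v = (\<lambda>w. tm c z \<zeta> a \<alpha> v w + tm d z \<zeta> a \<alpha> v w)"
    by (auto simp: tm_def fun_eq_iff algebra_simps)
  thus ?thesis unfolding eval_series_tm
    by (simp add: infsum_add[OF tm_summable[OF assms(1,3-)] tm_summable[OF assms(2-)]])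
qed

text \<open>The terms of weight below \<open>N\<close> form a polynomial in \<open>z\<close> and
  \<open>w\<close> with coefficients depending on \<zeta>, and expand exactly; the others are of
  order s^N by the tail estimate.\<close>

lemma compo_asymp:
  assumes a: "conv a r" and hol: "\<And>h p j k l. j \<noteq> 0 \<or> k \<noteq> 0 \<Longrightarrow> a h p j k l = 0"
    and \<zeta>: "norm \<zeta> \<le> r" and w: "has_asymp W w" "w $ 0 = 0" "w $ 1 = 0"
  shows "has_asymp (\<lambda>s. eval_series a (of_real s * z) \<zeta> 0 0 (W s)) (compo a z \<zeta> w)"
  unfolding has_asymp_def
proof
  fix N
  have r: "r > 0" using a by (simp add: conv_def)
  define lo where "lo = (\<lambda>h p j k l. if h + 2 * l < N then a h p j k l else 0)"
  define hi where "hi = (\<lambda>h p j k l. if h + 2 * l < N then 0 else a h p j k l)"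
  have aj: "a h p j k l \<noteq> 0 \<Longrightarrow> j = 0" for h p j k l using hol by blast
  have clo: "conv lo r" and chi: "conv hi r" by (rule conv_le[OF a], simp add: lo_def hi_def)+
  have "W \<in> O[at_right 0](\<lambda>s. of_real s ^ 2)"
    using has_asympD[OF w(1), of 2] w(2,3) by (simp add: numeral_2_eq_2)
  then obtain K0 where K0: "K0 > 0" "eventually (\<lambda>s. norm (W s) \<le> K0 * norm (of_real s ^ 2 :: complex)) (at_right 0)"
    by (elim landau_o.bigE)
  \<comment> \<open>For s below \<open>e\<close>, the quotient \<open>s / e\<close> serves as the
    parameter \<open>\<tau>\<close> of the tail estimate: s z is bounded by
    \<open>\<tau> * r\<close> and the value of \<open>W\<close> by
    \<open>\<tau> ^ 2 * r\<close>.\<close>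
  define e where "e = min 1 (r / (1 + norm z + K0))"
  have e: "0 < e" "e \<le> 1" using r K0 by (auto simp: e_def intro!: divide_pos_pos add_pos_nonneg)
  have ek: "e * (1 + norm z + K0) \<le> r"
  proof -
    have "e \<le> r / (1 + norm z + K0)" by (simp add: e_def)
    moreover have "0 < 1 + norm z + K0" using K0(1) by (simp add: add_pos_nonneg)
    ultimately show ?thesis by (simp add: pos_le_divide_eq)
  qed
  have ez: "e * norm z \<le> r" "e ^ 2 * K0 \<le> r"
  proof -
    have "e * norm z \<le> e * (1 + norm z + K0)" using e K0 by (intro mult_left_mono) auto
    thus "e * norm z \<le> r" using ek by linarith
    have "e ^ 2 * K0 \<le> e * K0" using e K0 by (intro mult_right_mono) (auto simp: power2_eq_square mult_le_cancel_left1)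
    also have "\<dots> \<le> e * (1 + norm z + K0)" using e K0 by (intro mult_left_mono) auto
    finally show "e ^ 2 * K0 \<le> r" using ek by linarith
  qed
  have ev: "eventually (\<lambda>s. 0 < s \<and> s < e \<and> norm (W s) \<le> K0 * s ^ 2) (at_right 0)"
  proof -
    have "eventually (\<lambda>s. 0 < s \<and> s < e) (at_right 0)" using e by (auto simp: eventually_at_right_field)
    thus ?thesis using K0(2) by eventually_elim (simp add: norm_power)
  qed
  have nn: "norm (of_real s * z) \<le> s / e * r" "norm (W s) \<le> (s / e) ^ 2 * r" "s / e \<le> 1" "0 \<le> s / e"
    if "0 < s \<and> s < e \<and> norm (W s) \<le> K0 * s ^ 2" for s
  proof -
    have "s * norm z = s / e * (e * norm z)" using e by simp
    also have "\<dots> \<le> s / e * r" using that e by (intro mult_left_mono ez) auto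
    finally show "norm (of_real s * z) \<le> s / e * r" using that by (simp add: norm_mult)
    have "K0 * s ^ 2 = (s / e) ^ 2 * (e ^ 2 * K0)" using e by (simp add: power_divide)
    also have "\<dots> \<le> (s / e) ^ 2 * r" by (intro mult_left_mono ez) auto
    finally show "norm (W s) \<le> (s / e) ^ 2 * r" using that by linarith
  qed (use that e in auto)
  have nr: "norm (of_real s * z) \<le> r" "norm (W s) \<le> r" if "0 < s \<and> s < e \<and> norm (W s) \<le> K0 * s ^ 2" for s
  proof -
    have "s / e * r \<le> 1 * r" "(s / e) ^ 2 * r \<le> 1 * r"
      using nn(3,4)[OF that] r by (intro mult_right_mono power_le_one; simp)+
    thus "norm (of_real s * z) \<le> r" "norm (W s) \<le> r" using nn(1,2)[OF that] by linarith+
  qed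
  define y where "y = (\<Sum>(h, j, l)\<in>ibox N. fps_const (eval_series (slice lo h j l) 0 \<zeta> 0 0 0) * (fps_const (z ^ h) * fps_X ^ h) * fps_const (0 ^ j) * w ^ l)"
  have lo_asymp: "has_asymp (\<lambda>s. eval_series lo (of_real s * z) \<zeta> 0 0 (W s)) y"
  proof (rule has_asymp_cong)
    have m: "has_asymp (\<lambda>s. (of_real s * z) ^ h) (fps_const (z ^ h) * fps_X ^ h)" for h
      using has_asymp_monom[of "z ^ h" h] by (simp add: power_mult_distrib mult.commute)
    show "has_asymp (\<lambda>s. \<Sum>(h, j, l)\<in>ibox N. eval_series (slice lo h j l) 0 \<zeta> 0 0 0 * (of_real s * z) ^ h * 0 ^ j * W s ^ l) y"
      unfolding y_def split_beta
      by (intro has_asymp_sum has_asymp_mult has_asymp_const m has_asymp_power w(1))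
    show "eventually (\<lambda>s. (\<Sum>(h, j, l)\<in>ibox N. eval_series (slice lo h j l) 0 \<zeta> 0 0 0 * (of_real s * z) ^ h * 0 ^ j * W s ^ l)
       = eval_series lo (of_real s * z) \<zeta> 0 0 (W s)) (at_right 0)"
      using ev
    proof eventually_elim
      case (elim s)
      show ?case
        by (rule eval_box[OF clo nr(1)[OF elim] \<zeta> _ _ nr(2)[OF elim], symmetric])
           (use r in \<open>auto simp: lo_def ibox_def dest!: aj split: if_splits\<close>)
    qed
  qed
  have slo: "eval_series (slice lo h j l) 0 \<zeta> 0 0 0 = (if h + 2 * l < N \<and> j = 0 then slv a h l \<zeta> else 0)" for h j l
  proof -
    have "slice lo h j l = (if h + 2 * l < N \<and> j = 0 then slice a h 0 l else (\<lambda>_ _ _ _ _. 0))"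
      using hol by (auto simp: slice_def lo_def fun_eq_iff)
    thus ?thesis by (simp add: slv_def eval_series_zero)
  qed
  have yn: "y $ n = compo a z \<zeta> w $ n" if "n < N" for n
  proof -
    have "y $ n = (\<Sum>(h, j, l)\<in>ibox N. if h + 2 * l < N \<and> j = 0 \<and> h \<le> n then slv a h l \<zeta> * z ^ h * (w ^ l) $ (n - h) else 0)"
      unfolding y_def fps_sum_nth
    proof (rule sum.cong[OF refl], clarify)
      fix h j l
      have e: "fps_const K * (fps_const (z ^ h) * fps_X ^ h) * fps_const (0 ^ j) * w ^ l = fps_const (K * z ^ h * 0 ^ j) * (fps_X ^ h * w ^ l)" for K
        by (simp add: mult_ac flip: fps_const_mult)
      show "(fps_const (eval_series (slice lo h j l) 0 \<zeta> 0 0 0) * (fps_const (z ^ h) * fps_X ^ h) * fps_const (0 ^ j) * w ^ l) $ n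
        = (if h + 2 * l < N \<and> j = 0 \<and> h \<le> n then slv a h l \<zeta> * z ^ h * (w ^ l) $ (n - h) else 0)"
        unfolding e slo by (simp add: fps_X_power_mult_nth)
    qed
    also have "\<dots> = (\<Sum>(h, l)\<in>{..n} \<times> {..n}. slv a h l \<zeta> * z ^ h * (w ^ l) $ (n - h))"
    proof -
      have "(\<Sum>(h, l)\<in>{..n} \<times> {..n}. slv a h l \<zeta> * z ^ h * (w ^ l) $ (n - h)) =
         (\<Sum>(h, j, l)\<in>(\<lambda>(h, l). (h, 0::nat, l)) ` ({..n} \<times> {..n}). slv a h l \<zeta> * z ^ h * (w ^ l) $ (n - h))"
        by (subst sum.reindex) (auto simp: inj_on_def intro!: sum.cong)
      also have "\<dots> = (\<Sum>(h, j, l)\<in>ibox N. if h + 2 * l < N \<and> j = 0 \<and> h \<le> n then slv a h l \<zeta> * z ^ h * (w ^ l) $ (n - h) else 0)"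
      proof (rule sum.mono_neutral_cong_left)
        show "(\<lambda>(h, l). (h, 0::nat, l)) ` ({..n} \<times> {..n}) \<subseteq> ibox N" using that by (auto simp: ibox_def)
        show "\<forall>i\<in>ibox N - (\<lambda>(h, l). (h, 0::nat, l)) ` ({..n} \<times> {..n}).
          (case i of (h, j, l) \<Rightarrow> if h + 2 * l < N \<and> j = 0 \<and> h \<le> n then slv a h l \<zeta> * z ^ h * (w ^ l) $ (n - h) else 0) = 0"
        proof (clarify, goal_cases)
          case (1 h j l)
          show ?case
          proof (cases "j = 0 \<and> h \<le> n")
            case True
            hence "\<not> l \<le> n" using 1 by (auto simp: image_iff)
            hence "(w ^ l) $ (n - h) = 0" using power_order2[OF w(2,3), of l "n - h"] by simp
            thus ?thesis by simp
          qed auto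
        qed
        show "(case i of (h, j, l) \<Rightarrow> slv a h l \<zeta> * z ^ h * (w ^ l) $ (n - h)) = (case i of (h, j, l) \<Rightarrow> if h + 2 * l < N \<and> j = 0 \<and> h \<le> n then slv a h l \<zeta> * z ^ h * (w ^ l) $ (n - h) else 0)"
          if ii: "i \<in> (\<lambda>(h, l). (h, 0::nat, l)) ` ({..n} \<times> {..n})" for i
        proof -
          obtain h l where i: "i = (h, 0, l)" "h \<le> n" using ii by auto
          have "(w ^ l) $ (n - h) = 0" if "\<not> h + 2 * l < N"
            using power_order2[OF w(2,3), of l "n - h"] that \<open>n < N\<close> i by simp
          thus ?thesis using i by auto
        qed
      qed simp
      finally show ?thesis ..
    qed
    finally show ?thesis by (simp add: compo_def)
  qed
  have 1: "(\<lambda>s. eval_series lo (of_real s * z) \<zeta> 0 0 (W s) - (\<Sum>n<N. compo a z \<zeta> w $ n * of_real s ^ n)) \<in> O[at_right 0](\<lambda>s. of_real s ^ N)"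
    using has_asympD[OF lo_asymp, of N] yn by simp
  define C where "C = (\<Sum>\<^sub>\<infinity>(h, p, j, k, l). norm (hi h p j k l) * r ^ (h + p + j + k + l))"
  have 2: "(\<lambda>s. eval_series hi (of_real s * z) \<zeta> 0 0 (W s)) \<in> O[at_right 0](\<lambda>s. of_real s ^ N)"
  proof (rule bigoI[where c = "C / e ^ N"])
    show "\<forall>\<^sub>F s in at_right 0. norm (eval_series hi (of_real s * z) \<zeta> 0 0 (W s)) \<le> C / e ^ N * norm (of_real s ^ N :: complex)"
      using ev
    proof eventually_elim
      case (elim s)
      have "norm (eval_series hi (of_real s * z) \<zeta> 0 0 (W s)) \<le> C * (s / e) ^ N"
        unfolding C_def
        by (rule eval_tail_bound[OF chi nn(4)[OF elim] nn(3)[OF elim] nn(1)[OF elim] \<zeta> nn(2)[OF elim]])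
           (auto simp: hi_def split: if_splits)
      thus ?case using elim by (simp add: norm_power power_divide)
    qed
  qed
  have ae: "a = (\<lambda>h p j k l. lo h p j k l + hi h p j k l)" by (auto simp: lo_def hi_def fun_eq_iff)
  have "eventually (\<lambda>s. eval_series lo (of_real s * z) \<zeta> 0 0 (W s) - (\<Sum>n<N. compo a z \<zeta> w $ n * of_real s ^ n) + eval_series hi (of_real s * z) \<zeta> 0 0 (W s)
     = eval_series a (of_real s * z) \<zeta> 0 0 (W s) - (\<Sum>n<N. compo a z \<zeta> w $ n * of_real s ^ n)) (at_right 0)"
    using ev
  proof eventually_elim
    case (elim s)
    have "eval_series a (of_real s * z) \<zeta> 0 0 (W s) = eval_series lo (of_real s * z) \<zeta> 0 0 (W s) + eval_series hi (of_real s * z) \<zeta> 0 0 (W s)"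
      by (subst ae, rule eval_series_add[OF clo chi nr(1)[OF elim] \<zeta> _ _ nr(2)[OF elim]]) (use r in auto)
    thus ?case by simp
  qed
  from iffD1[OF landau_o.big.in_cong[OF this] sum_in_bigo(1)[OF 1 2]]
  show "(\<lambda>s. eval_series a (of_real s * z) \<zeta> 0 0 (W s) - (\<Sum>n<N. compo a z \<zeta> w $ n * of_real s ^ n)) \<in> O[at_right 0](\<lambda>s. of_real s ^ N)" .
qed

definition hpart :: "nat \<Rightarrow> coeffs \<Rightarrow> complex \<Rightarrow> complex \<Rightarrow> complex \<Rightarrow> complex" where
  "hpart n a z \<zeta> \<omega> = (\<Sum>(h, l)\<in>{..n} \<times> {..n}. if h + 2 * l = n then slv a h l \<zeta> * z ^ h * \<omega> ^ l else 0)"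

lemma fps_power_gap:
  fixes f :: "complex fps"
  assumes "\<And>j. 0 < j \<Longrightarrow> j < d \<Longrightarrow> f $ j = 0"
  shows "0 < j \<Longrightarrow> j < d \<Longrightarrow> (f ^ l) $ j = 0"
proof (induction l arbitrary: j)
  case (Suc l)
  have "(f ^ Suc l) $ j = (\<Sum>i=0..j. f $ i * (f ^ l) $ (j - i))" by (simp add: fps_mult_nth)
  also have "\<dots> = 0"
  proof (rule sum.neutral, intro ballI)
    fix i assume i: "i \<in> {0..j}"
    show "f $ i * (f ^ l) $ (j - i) = 0"
      using i Suc.prems Suc.IH[of "j - i"] assms[of i] by (cases "i = 0") auto
  qed
  finally show ?case .
qed simp

text \<open>The series \<open>w\<close> has no terms strictly between the orders 2 and
  \<open>\<nu>\<close>. Up to order \<open>\<nu>\<close> the deviation from its quadratic term can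
  therefore enter only once, linearly, through the coefficient of \<open>w\<close> without
  \<open>z\<close>.\<close>

lemma compo_nth:
  assumes w: "w $ 0 = 0" "w $ 1 = 0" "\<And>m. 2 < m \<Longrightarrow> m < \<nu> \<Longrightarrow> w $ m = 0" and N: "N \<le> \<nu>" "3 \<le> \<nu>"
  shows "compo a z \<zeta> w $ N = hpart N a z \<zeta> (w $ 2) + (if N = \<nu> then slv a 0 1 \<zeta> * w $ \<nu> else 0)"
proof -
  define u where "u = fps_shift 2 w"
  have u0: "u $ 0 = w $ 2" by (simp add: u_def numeral_2_eq_2)
  have ug: "u $ j = 0" if "0 < j" "j < \<nu> - 2" for j using w(3)[of "j + 2"] that by (simp add: u_def)
  have t: "slv a h l \<zeta> * z ^ h * (w ^ l) $ (N - h) =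
     (if h + 2 * l = N then slv a h l \<zeta> * z ^ h * (w $ 2) ^ l else 0) + (if (h, l) = (0, 1) then (if N = \<nu> then slv a 0 1 \<zeta> * w $ \<nu> else 0) else 0)"
    if h: "h \<le> N" for h l
  proof (cases "h + 2 * l = N")
    case True
    have "(h, l) \<noteq> (0, 1) \<or> N \<noteq> \<nu>" using True N by auto
    moreover have "N - h = 2 * l" using True by simp
    hence "(w ^ l) $ (N - h) = (w $ 2) ^ l" using power_order2[OF w(1,2), of l "N - h"] by (simp add: u_def[symmetric] u0 fps_nth_power_0)
    ultimately show ?thesis using True by auto
  next
    case False
    show ?thesis
    proof (cases "N - h < 2 * l")
      case True
      hence "(w ^ l) $ (N - h) = 0" using power_order2[OF w(1,2), of l "N - h"] by simp
      moreover have "\<not> ((h, l) = (0, 1) \<and> N = \<nu>)" using True N by auto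
      ultimately show ?thesis using False by auto
    next
      case lt: False
      define m where "m = N - h - 2 * l"
      have m: "0 < m" "m \<le> N" using lt False h by (simp_all add: m_def)
      have wm: "(w ^ l) $ (N - h) = (u ^ l) $ m" using power_order2[OF w(1,2), of l "N - h"] lt by (simp add: u_def m_def)
      show ?thesis
      proof (cases "m < \<nu> - 2")
        case True
        hence "(u ^ l) $ m = 0" using fps_power_gap[OF ug] m by blast
        moreover have "\<not> ((h, l) = (0, 1) \<and> N = \<nu>)" using True m_def by auto
        ultimately show ?thesis using False wm by auto
      next
        case big: False
        \<comment> \<open>The deviation costs at least \<open>\<nu> - 2\<close> orders beyond the
          quadratic term, which leaves weight at most 2 for the monomial.\<close>
        hence hl: "h + 2 * l \<le> 2" using N m m_def lt h by linarith
        show ?thesis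
        proof (cases "l = 0")
          case True
          thus ?thesis using False m wm by simp
        next
          case l0: False
          hence hl: "h = 0" "l = 1" using hl by auto
          hence "N = \<nu>" using big m m_def N by linarith
          thus ?thesis using hl False by simp
        qed
      qed
    qed
  qed
  have "compo a z \<zeta> w $ N = (\<Sum>(h, l)\<in>{..N} \<times> {..N}. (if h + 2 * l = N then slv a h l \<zeta> * z ^ h * (w $ 2) ^ l else 0) +
      (if (h, l) = (0, 1) then (if N = \<nu> then slv a 0 1 \<zeta> * w $ \<nu> else 0) else 0))"
    unfolding compo_def fps_nth_Abs_fps by (rule sum.cong) (use t in auto)
  also have "\<dots> = hpart N a z \<zeta> (w $ 2) + (\<Sum>x\<in>{..N} \<times> {..N}. (if x = (0, 1) then (if N = \<nu> then slv a 0 1 \<zeta> * w $ \<nu> else 0) else 0))"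
    unfolding split_beta sum.distrib hpart_def by simp
  also have "(\<Sum>x\<in>{..N} \<times> {..N}. (if x = (0, 1) then (if N = \<nu> then slv a 0 1 \<zeta> * w $ \<nu> else 0) else 0)) = (if N = \<nu> then slv a 0 1 \<zeta> * w $ \<nu> else 0)"
    using N by (auto simp: sum.delta)
  finally show ?thesis .
qed


lemma eval_wpart_zero:
  assumes "\<And>h p j k l. c h p j k l \<noteq> 0 \<Longrightarrow> h + j + 2 * l \<noteq> n"
  shows "eval_series (wpart n c) z \<zeta> a \<alpha> v = 0"
proof -
  have "wpart n c h p j k l = 0" for h p j k l
    using assms[of h p j k l] by (cases "c h p j k l = 0") (auto simp: wpart_def)
  hence "wpart n c = (\<lambda>_ _ _ _ _. 0)" by blast
  thus ?thesis by (simp add: eval_series_zero)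
qed

text \<open>The tangency condition at the points \<open>(s z, \<zeta>, s\<^sup>2 v)\<close>, order by order in \<open>s\<close>.\<close>

lemma tangent_weight_identity:
  assumes T: "tangent_series F a b c" and cF: "convergent_series F"
    and gap: "\<And>h p j k l. F h p j k l \<noteq> 0 \<Longrightarrow> h + j + 2 * l = 2 \<or> \<nu> \<le> h + j + 2 * l" and nu: "3 \<le> \<nu>" and N: "N \<le> \<nu>"
  shows "near0 (\<lambda>z \<zeta> v. let Ew = (\<lambda>n c. eval_series (wpart n c) z \<zeta> (cnj z) (cnj \<zeta>) (of_real v)); \<omega> = Ew 2 F + \<i> * of_real v;
    P = (\<lambda>n a. hpart n a z \<zeta> \<omega> + (if n = \<nu> then slv a 0 1 \<zeta> * Ew \<nu> F else 0)) in
    P N c + cnj (P N c) = 2 * (\<Sum>i=0..N. Ew i (dc1 F) * P (N - i) a + Ew i (dc2 F) * P (N - i) b)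
      + cnj (2 * (\<Sum>i=0..N. Ew i (dc1 F) * P (N - i) a + Ew i (dc2 F) * P (N - i) b))
      - \<i> * (\<Sum>i=0..N. Ew i (dc5 F) * (P (N - i) c - cnj (P (N - i) c))))"
proof -
  note dcs = convergent_dc[OF cF]
  have "hol_series a" "hol_series b" "hol_series c" using T unfolding tangent_series_def by simp_all
  hence "convergent_series a" "convergent_series b" "convergent_series c" unfolding hol_series_def by simp_all
  note ex = cF dcs(1,2,5) this
  obtain r0 where r0: "conv F r0" using ex(1) unfolding convergent_series_conv by (elim exE)
  obtain r1 where r1: "conv (dc1 F) r1" using ex(2) unfolding convergent_series_conv by (elim exE)
  obtain r2 where r2: "conv (dc2 F) r2" using ex(3) unfolding convergent_series_conv by (elim exE)
  obtain r5 where r5: "conv (dc5 F) r5" using ex(4) unfolding convergent_series_conv by (elim exE)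
  obtain ra where ra: "conv a ra" using ex(5) unfolding convergent_series_conv by (elim exE)
  obtain rb where rb: "conv b rb" using ex(6) unfolding convergent_series_conv by (elim exE)
  obtain rc where rc: "conv c rc" using ex(7) unfolding convergent_series_conv by (elim exE)
  note rs = r0 r1 r2 r5 ra rb rc
  define r where "r = Min {r0, r1, r2, r5, ra, rb, rc}"
  have r0: "0 < r" using rs by (simp add: r_def conv_def)
  have le: "r \<le> r0" "r \<le> r1" "r \<le> r2" "r \<le> r5" "r \<le> ra" "r \<le> rb" "r \<le> rc"
    unfolding r_def by (rule Min_le; simp)+
  note r = conv_mono[OF rs(1) r0 le(1)] conv_mono[OF rs(2) r0 le(2)] conv_mono[OF rs(3) r0 le(3)] conv_mono[OF rs(4) r0 le(4)]
    conv_mono[OF rs(5) r0 le(5)] conv_mono[OF rs(6) r0 le(6)] conv_mono[OF rs(7) r0 le(7)]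
  have hol: "\<And>h p j k l. j \<noteq> 0 \<or> k \<noteq> 0 \<Longrightarrow> a h p j k l = 0" "\<And>h p j k l. j \<noteq> 0 \<or> k \<noteq> 0 \<Longrightarrow> b h p j k l = 0"
    "\<And>h p j k l. j \<noteq> 0 \<or> k \<noteq> 0 \<Longrightarrow> c h p j k l = 0"
    using T by (auto simp: tangent_series_def hol_series_def)
  obtain d where d: "d > 0" and eq: "\<And>z \<zeta> v. norm z < d \<Longrightarrow> norm \<zeta> < d \<Longrightarrow> \<bar>v\<bar> < d \<Longrightarrow>
     (let E = (\<lambda>c. eval_series c z \<zeta> (cnj z) (cnj \<zeta>) (of_real v)); w = E F + \<i> * of_real v;
        A = eval_series a z \<zeta> 0 0 w; B = eval_series b z \<zeta> 0 0 w; C = eval_series c z \<zeta> 0 0 w in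
      C + cnj C = 2 * (E (dc1 F) * A + E (dc2 F) * B) + cnj (2 * (E (dc1 F) * A + E (dc2 F) * B))
        - \<i> * E (dc5 F) * (C - cnj C))"
    using T unfolding tangent_series_def near0_def by blast
  show ?thesis unfolding near0_def
  proof (intro exI[of _ "min d r"] conjI allI impI)
    show "0 < min d r" using d r0 by simp
    fix z \<zeta> :: complex and v :: real
    assume n: "norm z < min d r" "norm \<zeta> < min d r" "\<bar>v\<bar> < min d r"
    define Ew where "Ew = (\<lambda>n c. eval_series (wpart n c) z \<zeta> (cnj z) (cnj \<zeta>) (of_real v))"
    define \<omega> where "\<omega> = Ew 2 F + \<i> * of_real v"
    define P where "P = (\<lambda>n a. hpart n a z \<zeta> \<omega> + (if n = \<nu> then slv a 0 1 \<zeta> * Ew \<nu> F else 0))"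
    define E where "E = (\<lambda>c s. eval_series c (of_real s * z) \<zeta> (cnj (of_real s * z)) (cnj \<zeta>) (of_real (s ^ 2 * v)))"
    define W where "W = (\<lambda>s. E F s + \<i> * of_real (s ^ 2 * v))"
    define w where "w = Abs_fps (\<lambda>n. Ew n F) + fps_const (\<i> * of_real v) * fps_X ^ 2"
    have EA: "has_asymp (E c) (Abs_fps (\<lambda>n. Ew n c))" if "conv c r" for c
      unfolding E_def Ew_def by (rule eval_asymp[OF that]) (use n in auto)
    have "has_asymp (\<lambda>s. \<i> * of_real (s ^ 2 * v)) (fps_const (\<i> * of_real v) * fps_X ^ 2)"
      using has_asymp_monom[of "\<i> * of_real v" 2] by (simp add: mult_ac)
    hence WA: "has_asymp W w" unfolding W_def w_def by (rule has_asymp_add[OF EA[OF r(1)]])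
    \<comment> \<open>Between the weight of the model and \<open>\<nu>\<close> the graph has no
      terms.\<close>
    have Ew0: "Ew m F = 0" if "m \<noteq> 2" "m < \<nu>" for m
      unfolding Ew_def by (rule eval_wpart_zero) (use gap that in force)
    have w2: "w $ 2 = \<omega>" by (simp add: w_def \<omega>_def)
    have wm: "w $ m = Ew m F" if "m \<noteq> 2" for m using that by (simp add: w_def)
    have w0: "w $ 0 = 0" "w $ 1 = 0" "\<And>m. 2 < m \<Longrightarrow> m < \<nu> \<Longrightarrow> w $ m = 0" using Ew0 nu by (simp_all add: wm)
    have CA: "has_asymp (\<lambda>s. eval_series x (of_real s * z) \<zeta> 0 0 (W s)) (compo x z \<zeta> w)"
      if "conv x r" "\<And>h p j k l. j \<noteq> 0 \<or> k \<noteq> 0 \<Longrightarrow> x h p j k l = 0" for x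
      by (rule compo_asymp[OF that _ WA w0(1,2)]) (use n in auto)
    have Cn: "compo x z \<zeta> w $ m = P m x" if "m \<le> N" for x m
      using compo_nth[OF w0, where N = m and a = x and z = z and \<zeta> = \<zeta>] that N nu by (simp add: P_def w2 wm)
    note CA3 = CA[OF r(5) hol(1)] CA[OF r(6) hol(2)] CA[OF r(7) hol(3)]
    define Ca where "Ca = compo a z \<zeta> w"
    define Cb where "Cb = compo b z \<zeta> w"
    define Cc where "Cc = compo c z \<zeta> w"
    define f1 where "f1 = Abs_fps (\<lambda>n. Ew n (dc1 F))"
    define f2 where "f2 = Abs_fps (\<lambda>n. Ew n (dc2 F))"
    define f5 where "f5 = Abs_fps (\<lambda>n. Ew n (dc5 F))"
    have ev: "eventually (\<lambda>s. 0 < s \<and> s < (1::real)) (at_right 0)" by (auto simp: eventually_at_right_field intro: exI[of _ 1])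
    define A where "A = (\<lambda>s. eval_series a (of_real s * z) \<zeta> 0 0 (W s))"
    define B where "B = (\<lambda>s. eval_series b (of_real s * z) \<zeta> 0 0 (W s))"
    define C where "C = (\<lambda>s. eval_series c (of_real s * z) \<zeta> 0 0 (W s))"
    note ABC = CA3[folded A_def B_def C_def Ca_def Cb_def Cc_def]
    note Fs = EA[OF r(2), folded f1_def] EA[OF r(3), folded f2_def] EA[OF r(4), folded f5_def]
    define S where "S = fps_const 2 * (f1 * Ca + f2 * Cb)"
    have SA: "has_asymp (\<lambda>s. 2 * (E (dc1 F) s * A s + E (dc2 F) s * B s)) S"
      unfolding S_def by (intro has_asymp_mult has_asymp_add has_asymp_const ABC Fs)
    have L: "has_asymp (\<lambda>s. C s + cnj (C s)) (Cc + fps_map cnj Cc)"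
      by (intro has_asymp_add has_asymp_cnj ABC)
    have R: "has_asymp (\<lambda>s. 2 * (E (dc1 F) s * A s + E (dc2 F) s * B s) + cnj (2 * (E (dc1 F) s * A s + E (dc2 F) s * B s)) - \<i> * (E (dc5 F) s * (C s - cnj (C s))))
       (S + fps_map cnj S - fps_const \<i> * (f5 * (Cc - fps_map cnj Cc)))"
      by (intro has_asymp_add has_asymp_diff has_asymp_cnj has_asymp_mult has_asymp_const ABC Fs SA)
    have "eventually (\<lambda>s. C s + cnj (C s) = 2 * (E (dc1 F) s * A s + E (dc2 F) s * B s) + cnj (2 * (E (dc1 F) s * A s + E (dc2 F) s * B s)) - \<i> * (E (dc5 F) s * (C s - cnj (C s)))) (at_right 0)"
      using ev
    proof eventually_elim
      case (elim s)
      have b: "x * y < d" if "0 < x" "x < 1" "0 \<le> y" "y < d" for x y :: real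
        using mult_right_mono[of x 1 y] that by linarith
      have s2: "0 < s ^ 2" "s ^ 2 < 1" using elim by (simp_all add: power_less_one_iff)
      have "norm (of_real s * z) < d" using b[of s "norm z"] elim n by (simp add: norm_mult)
      moreover have "\<bar>s ^ 2 * v\<bar> < d" using b[OF s2, of "\<bar>v\<bar>"] n by (simp add: abs_mult)
      ultimately show ?case
        using eq[of "of_real s * z" \<zeta> "s ^ 2 * v"] n
        unfolding Let_def A_def B_def C_def W_def E_def by (simp only: mult.assoc)
    qed
    from has_asymp_unique[OF L R this]
    have "(Cc + fps_map cnj Cc) $ N = (S + fps_map cnj S - fps_const \<i> * (f5 * (Cc - fps_map cnj Cc))) $ N" by simp
    moreover have "S $ N = 2 * (\<Sum>i=0..N. Ew i (dc1 F) * P (N - i) a + Ew i (dc2 F) * P (N - i) b)"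
      unfolding S_def fps_mult_left_const_nth fps_add_nth fps_mult_nth[of f1] fps_mult_nth[of f2]
      by (simp add: f1_def f2_def Ca_def Cb_def Cn sum.distrib)
    moreover have "(f5 * (Cc - fps_map cnj Cc)) $ N = (\<Sum>i=0..N. Ew i (dc5 F) * (P (N - i) c - cnj (P (N - i) c)))"
      unfolding fps_mult_nth[of f5] by (simp add: f5_def Cc_def Cn)
    moreover have "Cc $ N = P N c" by (simp add: Cc_def Cn)
    ultimately have "P N c + cnj (P N c) = 2 * (\<Sum>i=0..N. Ew i (dc1 F) * P (N - i) a + Ew i (dc2 F) * P (N - i) b)
      + cnj (2 * (\<Sum>i=0..N. Ew i (dc1 F) * P (N - i) a + Ew i (dc2 F) * P (N - i) b))
      - \<i> * (\<Sum>i=0..N. Ew i (dc5 F) * (P (N - i) c - cnj (P (N - i) c)))"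
      by simp
    thus "let Ew = (\<lambda>n c. eval_series (wpart n c) z \<zeta> (cnj z) (cnj \<zeta>) (of_real v)); \<omega> = Ew 2 F + \<i> * of_real v;
    P = (\<lambda>n a. hpart n a z \<zeta> \<omega> + (if n = \<nu> then slv a 0 1 \<zeta> * Ew \<nu> F else 0)) in
    P N c + cnj (P N c) = 2 * (\<Sum>i=0..N. Ew i (dc1 F) * P (N - i) a + Ew i (dc2 F) * P (N - i) b)
      + cnj (2 * (\<Sum>i=0..N. Ew i (dc1 F) * P (N - i) a + Ew i (dc2 F) * P (N - i) b))
      - \<i> * (\<Sum>i=0..N. Ew i (dc5 F) * (P (N - i) c - cnj (P (N - i) c)))"
      unfolding Let_def P_def \<omega>_def Ew_def .
  qed
qed

subsection \<open>Leaf coordinates\<close>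

lemma fps_map_cnj_hom: "fps_map cnj (f + g) = fps_map cnj f + fps_map cnj g" "fps_map cnj (f * g) = fps_map cnj f * fps_map cnj g"
  "fps_map cnj (f - g) = fps_map cnj f - fps_map cnj g"
  by (rule fps_ext; simp add: fps_mult_nth)+

lemma bar5_hom: "bar5 (f + g) = bar5 f + bar5 g" "bar5 (f - g) = bar5 f - bar5 g" "bar5 (f * g) = bar5 f * bar5 g"
proof -
  have "bar5 (f + g) - (bar5 f + bar5 g) = 0"
    by (rule scale5_zeroD) (simp add: fps_hom_diff[OF fps_hom_scale5] fps_homD[OF fps_hom_scale5] scale5_bar5 fps_map_cnj_hom)
  thus "bar5 (f + g) = bar5 f + bar5 g" by simp
  have "bar5 (f - g) - (bar5 f - bar5 g) = 0"
    by (rule scale5_zeroD) (simp add: fps_hom_diff[OF fps_hom_scale5] scale5_bar5 fps_map_cnj_hom)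
  thus "bar5 (f - g) = bar5 f - bar5 g" by simp
  have "bar5 (f * g) - bar5 f * bar5 g = 0"
    by (rule scale5_zeroD) (simp add: fps_hom_diff[OF fps_hom_scale5] fps_homD[OF fps_hom_scale5] scale5_bar5 fps_map_cnj_hom)
  thus "bar5 (f * g) = bar5 f * bar5 g" by simp
qed

lemma near0_triv: "(\<And>X \<zeta> t. P X \<zeta> t) \<Longrightarrow> near0 P"
  unfolding near0_def by (intro exI[of _ 1]) auto

lemma fexp_bar:
  assumes "fexp f \<phi>" "fexp g \<psi>" "\<And>X \<zeta> t. cnj (f X \<zeta> t) = g X \<zeta> t"
  shows "bar5 \<phi> = \<psi>"
  by (rule fexp_unique[OF fexp_intros(6)[OF assms(1)] assms(2)]) (rule near0_triv, rule assms(3))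

lemma bar5_vars: "bar5 vX = vY" "bar5 vY = vX" "bar5 vZ = vA" "bar5 vA = vZ" "bar5 vT = vT" "bar5 (cst c) = cst (cnj c)" "bar5 0 = 0" "bar5 1 = 1"
proof -
  show "bar5 vX = vY" "bar5 vY = vX" "bar5 vZ = vA" "bar5 vA = vZ" "bar5 vT = vT" "bar5 (cst c) = cst (cnj c)"
    by (rule fexp_bar, rule fexp_intros, rule fexp_intros, simp)+
  show "bar5 0 = 0" using bar5_hom(2)[of 0 0] by simp
  show "bar5 1 = 1" by (rule fexp_bar, rule fexp_1, rule fexp_1, simp)
qed

text \<open>The functions \<open>z\<close>, \<open>cnj z\<close>, \<open>v\<close> and, on the model, \<open>w\<close> in leaf coordinates.\<close>

definition zz :: ser5 where "zz = vY - vZ * vX"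
definition aa :: ser5 where "aa = vX - vA * vY"
definition vv :: ser5 where "vv = vT + cst (\<i> / 2) * (vZ * (vX * vX) - vA * (vY * vY))"
definition ww :: ser5 where "ww = cst \<i> * vT + vX * vY - vZ * (vX * vX)"

text \<open>Substitution of the leaf coordinates into an array that is polynomial in
  \<open>z\<close>, its conjugate and \<open>v\<close>. It is applied when these exponents lie in
  \<open>ibox N\<close>, so the finite sum is exact while the dependence on \<open>\<zeta>\<close>
  stays a full power series.\<close>

definition sub :: "nat \<Rightarrow> coeffs \<Rightarrow> ser5" where
  "sub N c = (\<Sum>h\<le>N. \<Sum>j\<le>N. \<Sum>l\<le>N. nst (slice c h j l) * zz ^ h * aa ^ j * vv ^ l)"

lemma near0_leaf:
  assumes "near0 P"
  shows "near0 (\<lambda>X \<zeta> t. P (cnj X - \<zeta> * X) \<zeta> (t - Im (\<zeta> * X ^ 2)))"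
proof -
  obtain d where d: "d > 0" "\<And>X \<zeta> t. norm X < d \<Longrightarrow> norm \<zeta> < d \<Longrightarrow> \<bar>t\<bar> < d \<Longrightarrow> P X \<zeta> t"
    using assms by (auto simp: near0_def)
  define e where "e = min 1 (d / 2)"
  have e: "e > 0" "e \<le> 1" "2 * e \<le> d" using d by (auto simp: e_def)
  have "P (cnj X - \<zeta> * X) \<zeta> (t - Im (\<zeta> * X ^ 2))" if n: "norm X < e" "norm \<zeta> < e" "\<bar>t\<bar> < e" for X \<zeta> t
  proof (rule d(2))
    have p: "norm \<zeta> * norm X \<le> norm X" "norm \<zeta> * norm X \<le> norm \<zeta>" "norm \<zeta> * norm X * norm X \<le> norm \<zeta>"
    proof -
      have "norm \<zeta> \<le> 1" "norm X \<le> 1" using n e by linarith+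
      thus "norm \<zeta> * norm X \<le> norm X" "norm \<zeta> * norm X \<le> norm \<zeta>" by (simp_all add: mult_left_le mult_left_le_one_le)
      hence "norm \<zeta> * norm X * norm X \<le> norm \<zeta> * norm X" using \<open>norm X \<le> 1\<close> by (intro mult_left_le) auto
      thus "norm \<zeta> * norm X * norm X \<le> norm \<zeta>" using \<open>norm \<zeta> * norm X \<le> norm \<zeta>\<close> by linarith
    qed
    have "norm (cnj X - \<zeta> * X) \<le> norm X + norm \<zeta> * norm X"
      using norm_triangle_ineq4[of "cnj X" "\<zeta> * X"] by (simp add: norm_mult)
    thus "norm (cnj X - \<zeta> * X) < d" using p n e by linarith
    show "norm \<zeta> < d" using n e by linarith
    have "\<bar>Im (\<zeta> * X ^ 2)\<bar> \<le> norm \<zeta> * norm X * norm X"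
      using abs_Im_le_cmod[of "\<zeta> * X ^ 2"] by (simp add: norm_mult power2_eq_square mult.assoc)
    thus "\<bar>t - Im (\<zeta> * X ^ 2)\<bar> < d" using p n e by linarith
  qed
  thus ?thesis unfolding near0_def using e(1) by blast
qed

lemma fexp_cong:
  assumes "fexp f \<phi>" "near0 (\<lambda>X \<zeta> t. f X \<zeta> t = g X \<zeta> t)"
  shows "fexp g \<phi>"
  unfolding fexp_def
proof (intro allI)
  fix X \<zeta> t
  show "has_asymp (\<lambda>s. g (of_real s * X) (of_real s * \<zeta>) (s * t)) (scale5 (cnj \<zeta>) \<zeta> X (cnj X) (of_real t) \<phi>)"
    by (rule has_asymp_cong[OF _ near0_ray[OF assms(2)]]) (use assms(1) in \<open>simp add: fexp_def\<close>)
qed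

abbreviation "leaf c X \<zeta> t \<equiv> eval_series c (cnj X - \<zeta> * X) \<zeta> (cnj (cnj X - \<zeta> * X)) (cnj \<zeta>) (of_real (t - Im (\<zeta> * X ^ 2)))"

lemma fexp_leaf_vars: "fexp (\<lambda>X \<zeta> t. cnj X - \<zeta> * X) zz" "fexp (\<lambda>X \<zeta> t. cnj (cnj X - \<zeta> * X)) aa"
  "fexp (\<lambda>X \<zeta> t. of_real (t - Im (\<zeta> * X ^ 2))) vv"
proof -
  show z: "fexp (\<lambda>X \<zeta> t. cnj X - \<zeta> * X) zz" unfolding zz_def by (intro fexp_intros)
  have "bar5 zz = aa" by (simp add: zz_def aa_def bar5_hom bar5_vars)
  thus "fexp (\<lambda>X \<zeta> t. cnj (cnj X - \<zeta> * X)) aa" using fexp_intros(6)[OF z] by simp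
  have "of_real (t - Im (\<zeta> * X ^ 2)) = of_real t + \<i> / 2 * (\<zeta> * (X * X) - cnj \<zeta> * (cnj X * cnj X))" for X \<zeta> t
    by (simp add: complex_eq_iff power2_eq_square)
  thus "fexp (\<lambda>X \<zeta> t. of_real (t - Im (\<zeta> * X ^ 2))) vv"
    unfolding vv_def by (simp only:) (intro fexp_intros)
qed

lemma fexp_slice:
  assumes "convergent_series c"
  shows "fexp (\<lambda>X \<zeta> t. eval_series (slice c h j l) 0 \<zeta> 0 (cnj \<zeta>) 0) (nst (slice c h j l))"
proof -
  have "convergent_series (slice c h j l)" using assms conv_slice unfolding convergent_series_conv by blast
  from fexp_eval[OF this] show ?thesis by (subst (asm) eval_slice)
qed

lemma fexp_sub:
  assumes c: "convergent_series c" and bx: "\<And>h p j k l. c h p j k l \<noteq> 0 \<Longrightarrow> (h, j, l) \<in> ibox N"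
  shows "fexp (leaf c) (sub N c)"
proof (rule fexp_cong)
  show "fexp (\<lambda>X \<zeta> t. \<Sum>h\<le>N. \<Sum>j\<le>N. \<Sum>l\<le>N. eval_series (slice c h j l) 0 \<zeta> 0 (cnj \<zeta>) 0 * (cnj X - \<zeta> * X) ^ h * (cnj (cnj X - \<zeta> * X)) ^ j
    * of_real (t - Im (\<zeta> * X ^ 2)) ^ l) (sub N c)"
    unfolding sub_def by (intro fexp_sum fexp_intros(3) fexp_intros(5) fexp_leaf_vars fexp_slice c)
  obtain r where r: "conv c r" using c by (auto simp: convergent_series_conv)
  have r0: "r > 0" using r by (simp add: conv_def)
  have "near0 (\<lambda>z \<zeta> v. norm z \<le> r \<and> norm \<zeta> \<le> r \<and> \<bar>v\<bar> \<le> r)" unfolding near0_def using r0 by (intro exI[of _ r]) auto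
  note near = near0_leaf[OF this]
  show "near0 (\<lambda>X \<zeta> t. (\<Sum>h\<le>N. \<Sum>j\<le>N. \<Sum>l\<le>N. eval_series (slice c h j l) 0 \<zeta> 0 (cnj \<zeta>) 0 * (cnj X - \<zeta> * X) ^ h * (cnj (cnj X - \<zeta> * X)) ^ j
    * of_real (t - Im (\<zeta> * X ^ 2)) ^ l) = leaf c X \<zeta> t)"
  proof (rule near0_mono[OF near])
    fix X \<zeta> :: complex and t :: real
    assume n: "norm (cnj X - \<zeta> * X) \<le> r \<and> norm \<zeta> \<le> r \<and> \<bar>t - Im (\<zeta> * X ^ 2)\<bar> \<le> r"
    have "leaf c X \<zeta> t = (\<Sum>(h, j, l)\<in>ibox N. eval_series (slice c h j l) 0 \<zeta> 0 (cnj \<zeta>) 0 * (cnj X - \<zeta> * X) ^ h * (cnj (cnj X - \<zeta> * X)) ^ j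
    * of_real (t - Im (\<zeta> * X ^ 2)) ^ l)"
      by (rule eval_box[OF r _ _ _ _ _ bx]) (use n in \<open>auto simp only: complex_mod_cnj norm_of_real\<close>)
    thus "(\<Sum>h\<le>N. \<Sum>j\<le>N. \<Sum>l\<le>N. eval_series (slice c h j l) 0 \<zeta> 0 (cnj \<zeta>) 0 * (cnj X - \<zeta> * X) ^ h * (cnj (cnj X - \<zeta> * X)) ^ j
    * of_real (t - Im (\<zeta> * X ^ 2)) ^ l) = leaf c X \<zeta> t"
      by (simp only: ibox_def sum.cartesian_product)
  qed
qed

lemma bar5_sub:
  assumes c: "convergent_series c" "convergent_series (cnj_coeffs c)" and bx: "\<And>h p j k l. c h p j k l \<noteq> 0 \<Longrightarrow> (h, j, l) \<in> ibox N"
  shows "bar5 (sub N c) = sub N (cnj_coeffs c)"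
proof (rule fexp_bar[OF fexp_sub[OF c(1) bx] fexp_sub[OF c(2)]])
  show "(h, j, l) \<in> ibox N" if "cnj_coeffs c h p j k l \<noteq> 0" for h p j k l
    using bx[of j k h p l] that by (auto simp: cnj_coeffs_def ibox_def)
  fix X \<zeta> :: complex and t :: real
  define z where "z = cnj X - \<zeta> * X"
  define v where "v = t - Im (\<zeta> * X ^ 2)"
  show "cnj (leaf c X \<zeta> t) = leaf (cnj_coeffs c) X \<zeta> t"
    unfolding z_def[symmetric] v_def[symmetric] graph_value_vector[of _ z \<zeta> 0 v, symmetric] by (rule cnj_graph_value)
qed

lemma sum_shift:
  fixes g :: "nat \<Rightarrow> 'a::comm_monoid_add"
  assumes "g 0 = 0" "g (Suc N) = 0"
  shows "(\<Sum>i\<le>N. g i) = (\<Sum>i\<le>N. g (Suc i))"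
  using sum.atMost_Suc[of g N] sum.atMost_Suc_shift[of g N] assms by simp

lemma of_nat_cst: "(of_nat n :: ser5) = cst (of_nat n)"
  by (simp add: cst_def of_nat_fps_const)

lemma nst_cmult: "nst (\<lambda>h p j k l. a * c h p j k l) = cst a * nst c"
  by (rule ser5_eqI) (simp add: cst_def)

lemma nst_zero: "nst (\<lambda>_ _ _ _ _. 0) = 0"
  by (rule ser5_eqI) simp

lemma slice_dc: "nst (slice (dc1 c) h j l) = of_nat (Suc h) * nst (slice c (Suc h) j l)"
  "nst (slice (dc3 c) h j l) = of_nat (Suc j) * nst (slice c h (Suc j) l)"
  "nst (slice (dc5 c) h j l) = of_nat (Suc l) * nst (slice c h j (Suc l))"
  "nst (slice (dc2 c) h j l) = pdZ (nst (slice c h j l))"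
  "pdX (nst (slice c h j l)) = 0" "pdY (nst (slice c h j l)) = 0" "pdT (nst (slice c h j l)) = 0"
proof -
  show "nst (slice (dc1 c) h j l) = of_nat (Suc h) * nst (slice c (Suc h) j l)"
    "nst (slice (dc3 c) h j l) = of_nat (Suc j) * nst (slice c h (Suc j) l)"
    "nst (slice (dc5 c) h j l) = of_nat (Suc l) * nst (slice c h j (Suc l))"
    unfolding of_nat_cst nst_cmult[symmetric]
    by (auto simp: slice_def dc1_def dc3_def dc5_def fun_eq_iff intro!: arg_cong[of _ _ nst])
  show "nst (slice (dc2 c) h j l) = pdZ (nst (slice c h j l))" "pdX (nst (slice c h j l)) = 0" "pdY (nst (slice c h j l)) = 0" "pdT (nst (slice c h j l)) = 0"
    by (rule ser5_eqI, simp add: pd_nth slice_def dc2_def)+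
qed

text \<open>The chain rule, by Leibniz on every monomial: a shift of one exponent turns each of the
  three resulting sums into the substitution of a derivative. The boundary terms of the shift vanish
  because the exponents are confined to the box.\<close>

lemma derivation_sub:
  assumes d: "derivation d" and bx: "\<And>h p j k l. c h p j k l \<noteq> 0 \<Longrightarrow> (h, j, l) \<in> ibox N"
  shows "d (sub N c) = (\<Sum>h\<le>N. \<Sum>j\<le>N. \<Sum>l\<le>N. d (nst (slice c h j l)) * zz ^ h * aa ^ j * vv ^ l)
    + d zz * sub N (dc1 c) + d aa * sub N (dc3 c) + d vv * sub N (dc5 c)"
proof -
  let ?s = "\<lambda>h j l. nst (slice c h j l)"
  have z: "?s h j l = 0" if "h > N \<or> j > N \<or> l > N" for h j l
  proof -
    have "slice c h j l = (\<lambda>_ _ _ _ _. 0)" using bx that by (fastforce simp: slice_def fun_eq_iff ibox_def)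
    thus ?thesis by (simp add: nst_zero)
  qed
  have 1: "(\<Sum>h\<le>N. \<Sum>j\<le>N. \<Sum>l\<le>N. ?s h j l * (of_nat h * zz ^ (h - 1) * d zz) * aa ^ j * vv ^ l) = d zz * sub N (dc1 c)"
    unfolding sub_def slice_dc
    by (subst sum_shift) (auto simp: z sum_distrib_left mult_ac simp del: of_nat_Suc)
  have 2: "(\<Sum>h\<le>N. \<Sum>j\<le>N. \<Sum>l\<le>N. ?s h j l * zz ^ h * (of_nat j * aa ^ (j - 1) * d aa) * vv ^ l) = d aa * sub N (dc3 c)"
    unfolding sub_def slice_dc sum_distrib_left
    by (rule sum.cong[OF refl], subst sum_shift) (auto simp: z mult_ac simp del: of_nat_Suc)
  have 3: "(\<Sum>h\<le>N. \<Sum>j\<le>N. \<Sum>l\<le>N. ?s h j l * zz ^ h * aa ^ j * (of_nat l * vv ^ (l - 1) * d vv)) = d vv * sub N (dc5 c)"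
    unfolding sub_def slice_dc sum_distrib_left
    by (rule sum.cong[OF refl], rule sum.cong[OF refl], subst sum_shift) (auto simp: z mult_ac simp del: of_nat_Suc)
  have t: "d (s * zz ^ h * aa ^ j * vv ^ l) = d s * zz ^ h * aa ^ j * vv ^ l + s * (of_nat h * zz ^ (h - 1) * d zz) * aa ^ j * vv ^ l
     + s * zz ^ h * (of_nat j * aa ^ (j - 1) * d aa) * vv ^ l + s * zz ^ h * aa ^ j * (of_nat l * vv ^ (l - 1) * d vv)" for s h j l
    by (simp only: derivation_mult[OF d] derivation_power[OF d] distrib_right)
  have "d (sub N c) = (\<Sum>h\<le>N. \<Sum>j\<le>N. \<Sum>l\<le>N. d (?s h j l * zz ^ h * aa ^ j * vv ^ l))"
    unfolding sub_def by (simp only: derivation_sum[OF d])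
  thus ?thesis unfolding t sum.distrib 1 2 3 .
qed

lemma pd_leaf:
  "pdX zz = - vZ" "pdX aa = 1" "pdX vv = cst \<i> * vZ * vX"
  "pdY zz = 1" "pdY aa = - vA" "pdY vv = - (cst \<i> * vA * vY)"
  "pdT zz = 0" "pdT aa = 0" "pdT vv = 1"
  "pdZ zz = - vX" "pdZ aa = 0" "pdZ vv = cst (\<i> / 2) * (vX * vX)"
proof -
  have h: "cst (\<i> / 2) * f + cst (\<i> / 2) * f = cst \<i> * f" for f
    by (simp add: distrib_right[symmetric] cst_add)
  show "pdX zz = - vZ" "pdX aa = 1" "pdY zz = 1" "pdY aa = - vA" "pdT zz = 0" "pdT aa = 0" "pdT vv = 1"
    "pdZ zz = - vX" "pdZ aa = 0" "pdZ vv = cst (\<i> / 2) * (vX * vX)"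
    by (simp_all add: zz_def aa_def vv_def pd_rules)
  have "pdX vv = cst (\<i> / 2) * (vZ * vX) + cst (\<i> / 2) * (vZ * vX)" by (simp only: vv_def pd_rules pd_vars) (simp add: algebra_simps)
  thus "pdX vv = cst \<i> * vZ * vX" unfolding h by (simp add: mult_ac)
  have "pdY vv = - (cst (\<i> / 2) * (vA * vY) + cst (\<i> / 2) * (vA * vY))" by (simp only: vv_def pd_rules pd_vars) (simp add: algebra_simps)
  thus "pdY vv = - (cst \<i> * vA * vY)" unfolding h by (simp add: mult_ac)
qed

lemma chain_rule:
  assumes bx: "\<And>h p j k l. c h p j k l \<noteq> 0 \<Longrightarrow> (h, j, l) \<in> ibox N"
  shows "pdX (sub N c) = sub N (dc3 c) - vZ * sub N (dc1 c) + cst \<i> * vZ * vX * sub N (dc5 c)"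
    "pdY (sub N c) = sub N (dc1 c) - vA * sub N (dc3 c) - cst \<i> * vA * vY * sub N (dc5 c)"
    "pdT (sub N c) = sub N (dc5 c)"
    "pdZ (sub N c) = sub N (dc2 c) - vX * sub N (dc1 c) + cst (\<i> / 2) * (vX * vX) * sub N (dc5 c)"
  using derivation_pd[THEN derivation_sub, of c N] bx
  by (simp_all add: pd_leaf slice_dc(5-7)) (simp_all add: sub_def slice_dc(4))

lemma nth_00_hom: "(f * g :: ser5) $ 0 $ 0 = f $ 0 $ 0 * g $ 0 $ 0" "(f ^ n :: ser5) $ 0 $ 0 = (f $ 0 $ 0) ^ n"
  by (simp_all add: fps_nth_power_0)

lemma leaf_00: "zz $ 0 $ 0 = fps_const fps_X" "aa $ 0 $ 0 = fps_X" "vv $ 0 $ 0 = fps_const (fps_const fps_X)"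
  by (simp_all add: zz_def aa_def vv_def vX_def vY_def vZ_def vA_def vT_def cst_def)

lemma monomial_nth: "(fps_const (fps_const (fps_const a)) * fps_const fps_X ^ h * fps_X ^ j * fps_const (fps_const fps_X) ^ l :: ser3) $ j' $ h' $ l'
   = (if j' = j \<and> h' = h \<and> l' = l then a else 0)"
proof -
  have "fps_const (fps_const (fps_const a)) * fps_const fps_X ^ h * fps_X ^ j * fps_const (fps_const fps_X) ^ l
    = fps_X ^ j * fps_const (fps_X ^ h * fps_const (fps_const a * fps_X ^ l) :: complex fps fps)"
    by (simp add: fps_const_power fps_const_mult[symmetric] mult_ac del: fps_const_mult)
  thus ?thesis by (auto simp: fps_X_power_mult_nth fps_X_power_iff)
qed

lemma sub_nth_lowest:
  assumes bx: "\<And>h p j k l. c h p j k l \<noteq> 0 \<Longrightarrow> (h, j, l) \<in> ibox N"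
    and low: "\<And>h p' j k' l. p' + k' < p + k \<Longrightarrow> c h p' j k' l = 0"
  shows "sub N c $ k $ p $ j $ h $ l = c h p j k l"
proof -
  have t: "(nst (slice c h' j' l') * m) $ k $ p = fps_const (fps_const (fps_const (c h' p j' k l'))) * m $ 0 $ 0" for h' j' l' m
  proof -
    have s: "nst (slice c h' j' l') $ k' $ p' = fps_const (fps_const (fps_const (c h' p' j' k' l')))" for k' p'
      by (simp add: nst_def slice_def fps_eq_iff)
    have "(nst (slice c h' j' l') * m) $ k $ p = (\<Sum>k'=0..k. \<Sum>p'=0..p. nst (slice c h' j' l') $ k' $ p' * m $ (k - k') $ (p - p'))"
      by (simp only: fps_mult_nth[of "nst _" m] fps_sum_nth fps_mult_nth[of "nst _ $ _"])
    also have "\<dots> = (\<Sum>k'=0..k. \<Sum>p'=0..p. if k' = k \<and> p' = p then fps_const (fps_const (fps_const (c h' p j' k l'))) * m $ 0 $ 0 else 0)"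
      by (intro sum.cong refl) (auto simp: s low)
    also have "\<dots> = (\<Sum>k'=0..k. if k' = k then fps_const (fps_const (fps_const (c h' p j' k l'))) * m $ 0 $ 0 else 0)"
      by (rule sum.cong) auto
    finally show ?thesis by simp
  qed
  have "sub N c $ k $ p = (\<Sum>h\<le>N. \<Sum>j\<le>N. \<Sum>l\<le>N. fps_const (fps_const (fps_const (c h p j k l))) * fps_const fps_X ^ h * fps_X ^ j * fps_const (fps_const fps_X) ^ l)"
    by (simp only: sub_def fps_sum_nth mult.assoc t nth_00_hom leaf_00)
  hence "sub N c $ k $ p $ j $ h $ l = (\<Sum>h'\<le>N. \<Sum>j'\<le>N. \<Sum>l'\<le>N. if j = j' \<and> h = h' \<and> l = l' then c h' p j' k l' else 0)"
    by (simp only: fps_sum_nth monomial_nth)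
  also have "\<dots> = (\<Sum>x\<in>ibox N. if x = (h, j, l) then c h p j k l else 0)"
    by (simp only: ibox_def sum.cartesian_product) (rule sum.cong, auto split: if_splits)
  also have "\<dots> = (if (h, j, l) \<in> ibox N then c h p j k l else 0)"
    by (simp add: sum.delta)
  finally show ?thesis using bx[of h p j k l] by auto
qed

lemma sub_inj:
  assumes bx: "\<And>h p j k l. c h p j k l \<noteq> 0 \<Longrightarrow> (h, j, l) \<in> ibox N" and z: "sub N c = 0"
  shows "c h p j k l = 0"
proof (induction "p + k" arbitrary: h p j k l rule: less_induct)
  case less
  have "sub N c $ k $ p $ j $ h $ l = c h p j k l" by (rule sub_nth_lowest[OF bx less]) auto
  thus ?case by (simp add: z)
qed

lemma supp_in_power:
  assumes "supp_in f (\<lambda>a b. b = m)"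
  shows "supp_in (f ^ n) (\<lambda>a b. b = n * m)"
proof (induction n)
  case (Suc n)
  show ?case unfolding power_Suc by (rule supp_in_mult[OF assms Suc]) auto
qed (auto simp: supp_in_def fps_one_nth split: if_splits)

lemma supp_in_sum: "(\<And>i. i \<in> A \<Longrightarrow> supp_in (f i) S) \<Longrightarrow> supp_in (\<Sum>i\<in>A. f i) S"
  by (induction A rule: infinite_finite_induct) (auto intro: supp_in_lin)

lemma supp_in_vars: "supp_in vX (\<lambda>a b. b = 1)" "supp_in vY (\<lambda>a b. b = 1)" "supp_in vT (\<lambda>a b. b = 2)" "supp_in vZ (\<lambda>a b. b = 0)" "supp_in vA (\<lambda>a b. b = 0)"
  "supp_in (cst c) (\<lambda>a b. b = 0)"
  by (auto simp: supp_in_def vX_def vY_def vT_def vZ_def vA_def cst_def split: if_splits)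

lemma supp_in_sub:
  assumes "\<And>h p j k l. c h p j k l \<noteq> 0 \<Longrightarrow> h + j + 2 * l = \<nu>"
  shows "supp_in (sub N c) (\<lambda>a b. b = \<nu>)"
proof -
  note m = supp_in_mult[where U = "\<lambda>a b. b = m" for m]
  have xx: "supp_in (vX * vX) (\<lambda>a b. b = 2)" "supp_in (vY * vY) (\<lambda>a b. b = 2)"
    by (rule m[OF supp_in_vars(1) supp_in_vars(1)] m[OF supp_in_vars(2) supp_in_vars(2)], simp)+
  have z: "supp_in zz (\<lambda>a b. b = 1)" unfolding zz_def by (intro supp_in_lin supp_in_vars m[OF supp_in_vars(4) supp_in_vars(1)]) simp
  have a: "supp_in aa (\<lambda>a b. b = 1)" unfolding aa_def by (intro supp_in_lin supp_in_vars m[OF supp_in_vars(5) supp_in_vars(2)]) simp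
  have v: "supp_in vv (\<lambda>a b. b = 2)" unfolding vv_def
    by (intro supp_in_lin supp_in_vars(3), rule m[OF supp_in_vars(6)], intro supp_in_lin, rule m[OF supp_in_vars(4) xx(1)], simp, rule m[OF supp_in_vars(5) xx(2)], auto)
  show ?thesis unfolding sub_def
  proof (intro supp_in_sum)
    fix h j l
    show "supp_in (nst (slice c h j l) * zz ^ h * aa ^ j * vv ^ l) (\<lambda>a b. b = \<nu>)"
    proof (cases "h + j + 2 * l = \<nu>")
      case True
      have s: "supp_in (nst (slice c h j l)) (\<lambda>a b. b = 0)" by (auto simp: supp_in_def slice_def split: if_splits)
      have 1: "supp_in (nst (slice c h j l) * zz ^ h) (\<lambda>a b. b = h)" by (rule m[OF s supp_in_power[OF z]]) simp
      have 2: "supp_in (nst (slice c h j l) * zz ^ h * aa ^ j) (\<lambda>a b. b = h + j)" by (rule m[OF 1 supp_in_power[OF a]]) simp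
      show ?thesis by (rule m[OF 2 supp_in_power[OF v]]) (use True in simp)
    next
      case False
      hence "c h p j k l = 0" for p k using assms by blast
      hence "slice c h j l = (\<lambda>_ _ _ _ _. 0)" by (auto simp: slice_def fun_eq_iff)
      thus ?thesis by (simp add: nst_zero supp_in_def)
    qed
  qed
qed

lemma xdiv_sum: "(\<And>i. i \<in> A \<Longrightarrow> xdiv m (f i)) \<Longrightarrow> xdiv m (\<Sum>i\<in>A. f i)"
  by (induction A rule: infinite_finite_induct) (auto intro: xdiv_lin simp: xdiv_def)

text \<open>Without the conjugate of \<open>\<zeta>\<close> the conjugate of \<open>z\<close> is
  \<open>X\<close> itself, so at least three factors of it give X^3.\<close>

lemma xdiv_sub:
  assumes "\<And>h p j l. j < 3 \<Longrightarrow> c h p j 0 l = 0"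
  shows "xdiv 3 (sub N c $ 0 $ p)"
proof -
  have "xdiv 3 ((nst (slice c h j l) * zz ^ h * aa ^ j * vv ^ l) $ 0 $ p)" for h j l
  proof (cases "j < 3")
    case True
    have "nst (slice c h j l) $ 0 = 0" using assms[OF True] by (simp add: fps_eq_iff slice_def)
    thus ?thesis by (simp add: xdiv_def xyt_coeff_def)
  next
    case False
    have a0: "aa $ 0 = fps_const fps_X" by (simp add: aa_def vX_def vA_def)
    have e: "fps_const fps_X ^ j = (fps_const fps_X ^ 3 * fps_const fps_X ^ (j - 3) :: ser3 fps)"
      using False power_add[of "fps_const fps_X :: ser3 fps" 3 "j - 3"] by simp
    have "(nst (slice c h j l) * zz ^ h * aa ^ j * vv ^ l) $ 0 = nst (slice c h j l) $ 0 * (zz $ 0) ^ h * (aa $ 0) ^ j * (vv $ 0) ^ l"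
      by (simp add: fps_nth_power_0)
    hence "(nst (slice c h j l) * zz ^ h * aa ^ j * vv ^ l) $ 0 = fps_const fps_X ^ 3 * (nst (slice c h j l) $ 0 * (zz $ 0) ^ h * fps_const fps_X ^ (j - 3) * (vv $ 0) ^ l)"
      unfolding a0 e by (simp only: mult_ac)
    hence "(nst (slice c h j l) * zz ^ h * aa ^ j * vv ^ l) $ 0 $ p = fps_X ^ 3 * (nst (slice c h j l) $ 0 * (zz $ 0) ^ h * fps_const fps_X ^ (j - 3) * (vv $ 0) ^ l) $ p"
      by (simp only: fps_const_power fps_mult_left_const_nth)
    thus ?thesis by (simp add: xdiv_def xyt_coeff_def fps_X_power_mult_nth)
  qed
  thus ?thesis unfolding sub_def fps_sum_nth by (intro xdiv_sum)
qed

section \<open>Weighted parts of holomorphic series in leaf coordinates\<close>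

definition Zs :: "(nat \<Rightarrow> complex) \<Rightarrow> ser5" where
  "Zs u = fps_const (Abs_fps (\<lambda>p. fps_const (fps_const (fps_const (u p)))))"

definition zs :: "coeffs \<Rightarrow> nat \<Rightarrow> nat \<Rightarrow> ser5" where
  "zs a h l = Zs (\<lambda>p. a h p 0 0 l)"

lemma zs_slice: "hol_series a \<Longrightarrow> nst (slice a h 0 l) = zs a h l"
  by (rule ser5_eqI) (auto simp: Zs_def zs_def slice_def hol_series_def)

lemma fexp_slv:
  assumes "hol_series a"
  shows "fexp (\<lambda>X \<zeta> t. slv a h l \<zeta>) (zs a h l)"
proof -
  have "slv a h l \<zeta> = eval_series (slice a h 0 l) 0 \<zeta> 0 (cnj \<zeta>) 0" for \<zeta>
    unfolding slv_def eval_series_tm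
  proof (rule infsum_cong)
    fix w :: idx5
    obtain h' p j k l' where w: "w = (h', p, j, k, l')" by (cases w)
    show "tm (slice a h 0 l) 0 \<zeta> 0 0 0 w = tm (slice a h 0 l) 0 \<zeta> 0 (cnj \<zeta>) 0 w"
      using assms by (cases "k = 0") (simp_all add: w tm_def slice_def hol_series_def)
  qed
  moreover have "convergent_series a" using assms by (simp add: hol_series_def)
  ultimately show ?thesis using fexp_slice[of a h 0 l] zs_slice[OF assms, of h l] by simp
qed

definition hf :: "nat \<Rightarrow> coeffs \<Rightarrow> ser5" where
  "hf n a = (\<Sum>x\<in>{..n} \<times> {..n}. if fst x + 2 * snd x = n then zs a (fst x) (snd x) * zz ^ fst x * ww ^ snd x else 0)"

lemma fexp_if: "(P \<Longrightarrow> fexp f \<phi>) \<Longrightarrow> (\<not> P \<Longrightarrow> fexp g \<psi>) \<Longrightarrow> fexp (\<lambda>X \<zeta> t. if P then f X \<zeta> t else g X \<zeta> t) (if P then \<phi> else \<psi>)"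
  by simp

lemma cst_0: "cst 0 = 0"
  by (simp add: cst_def)

lemma fexp_0: "fexp (\<lambda>X \<zeta> t. 0) 0"
  using fexp_intros(7)[of 0] by (simp add: cst_0)

lemma fexp_hpart:
  assumes "hol_series a" "fexp \<omega> ww"
  shows "fexp (\<lambda>X \<zeta> t. hpart n a (cnj X - \<zeta> * X) \<zeta> (\<omega> X \<zeta> t)) (hf n a)"
  unfolding hpart_def hf_def split_beta
  by (intro fexp_sum fexp_if fexp_intros(3) fexp_intros(5) fexp_slv fexp_leaf_vars fexp_0 assms)

section \<open>The model in leaf coordinates\<close>

definition gmc :: coeffs where
  "gmc = (\<lambda>h p j k l. gm_ser $ k $ p $ h $ j $ l)"

lemma gmc_weight: "gmc h p j k l \<noteq> 0 \<Longrightarrow> h + j + 2 * l = 2"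
  by (auto simp: gmc_def gm_ser_nth split: if_splits)

lemma gm_slice: "(1 - vZ * vA) * nst (slice gmc h j l) =
   (if (h, j, l) = (1, 1, 0) then 1 else 0) + (if (h, j, l) = (0, 2, 0) then cst (1/2) * vZ else 0) + (if (h, j, l) = (2, 0, 0) then cst (1/2) * vA else 0)"
proof (rule fps_ext, rule fps_ext)
  fix q p
  define f where "f = nst (slice gmc h j l)"
  have f: "f $ q $ p = fps_const (fps_const (fps_const (gmc h p j q l)))" for q p
    by (simp add: f_def fps_eq_iff slice_def)
  have 1: "((1 - vZ * vA) * f) $ q $ p = f $ q $ p - (if q = 0 \<or> p = 0 then 0 else f $ (q - 1) $ (p - 1))"
    by (simp add: vZ_def vA_def algebra_simps mult.assoc fps_X_mult_nth[where 'a = "ser3 fps"] fps_X_mult_nth[where 'a = ser3])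
  have r: "((if (h, j, l) = (1, 1, 0) then 1 else 0) + (if (h, j, l) = (0, 2, 0) then cst (1/2) * vZ else 0) + (if (h, j, l) = (2, 0, 0) then cst (1/2) * vA else 0)) $ q $ p
    = fps_const (fps_const (fps_const (if (h, j, l) = (1, 1, 0) \<and> q = 0 \<and> p = 0 \<or> False then 1 else if (h, j, l) = (0, 2, 0) \<and> q = 0 \<and> p = 1 then 1/2
       else if (h, j, l) = (2, 0, 0) \<and> q = 1 \<and> p = 0 then 1/2 else 0)))"
    by (auto simp: cst_def vZ_def vA_def)
  show "((1 - vZ * vA) * nst (slice gmc h j l)) $ q $ p = ((if (h, j, l) = (1, 1, 0) then 1 else 0) + (if (h, j, l) = (0, 2, 0) then cst (1/2) * vZ else 0) + (if (h, j, l) = (2, 0, 0) then cst (1/2) * vA else 0)) $ q $ p"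
    unfolding f_def[symmetric] 1 r by (cases q; cases p) (auto simp: f gmc_def gm_ser_nth)
qed

abbreviation half :: ser5 where "half \<equiv> cst (1/2)"

lemma half2: "half + half = 1"
  by (simp add: cst_add cst_1)

lemma half_double: "half * f + half * f = f"
  by (simp add: distrib_right[symmetric] half2)

lemma sub_gm:
  assumes "2 \<le> N"
  shows "sub N gmc = vX * vY - half * (vZ * (vX * vX)) - half * (vA * (vY * vY))"
proof -
  define D where "D = 1 - vZ * vA"
  have "D * sub N gmc = (\<Sum>h\<le>N. \<Sum>j\<le>N. \<Sum>l\<le>N. (D * nst (slice gmc h j l)) * zz ^ h * aa ^ j * vv ^ l)"
    unfolding sub_def by (simp add: sum_distrib_left mult.assoc)
  also have "\<dots> = (\<Sum>(h, j, l)\<in>ibox N. (D * nst (slice gmc h j l)) * zz ^ h * aa ^ j * vv ^ l)"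
    by (simp only: ibox_def sum.cartesian_product)
  also have "\<dots> = (\<Sum>x\<in>ibox N. (if x = (1, 1, 0) then zz * aa else 0) + (if x = (0, 2, 0) then half * vZ * aa ^ 2 else 0) + (if x = (2, 0, 0) then half * vA * zz ^ 2 else 0))"
  proof (rule sum.cong[OF refl])
    fix x :: "nat \<times> nat \<times> nat"
    obtain h j l where x: "x = (h, j, l)" by (cases x)
    have "((if P then (1::ser5) else 0) + (if Q then half * vZ else 0) + (if R then half * vA else 0)) * m
      = (if P then m else 0) + (if Q then half * vZ * m else 0) + (if R then half * vA * m else 0)" for P Q R m
      by (simp add: distrib_right)
    note e = this[of "(h, j, l) = (1, 1, 0)" "(h, j, l) = (0, 2, 0)" "(h, j, l) = (2, 0, 0)" "zz ^ h * aa ^ j * vv ^ l"]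
    show "(case x of (h, j, l) \<Rightarrow> (D * nst (slice gmc h j l)) * zz ^ h * aa ^ j * vv ^ l) = (if x = (1, 1, 0) then zz * aa else 0) + (if x = (0, 2, 0) then half * vZ * aa ^ 2 else 0) + (if x = (2, 0, 0) then half * vA * zz ^ 2 else 0)"
      unfolding x prod.case D_def gm_slice mult.assoc[of _ "zz ^ h"] mult.assoc[of _ "zz ^ h * aa ^ j"] e by auto
  qed
  also have "\<dots> = zz * aa + half * vZ * aa ^ 2 + half * vA * zz ^ 2"
    using assms by (simp add: sum.distrib sum.delta ibox_def)
  \<comment> \<open>The two polynomials differ by a multiple of \<open>half + half - 1\<close>,
    written out explicitly because ring normalization does not see that it is zero.\<close>
  also have "\<dots> = D * (vX * vY - half * (vZ * (vX * vX)) - half * (vA * (vY * vY))) + (half + half - 1) * (vA * (vY * vY) + vZ * (vX * vX) - (vZ * vA * vX * vY + vZ * vA * vX * vY))"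
    by (simp add: D_def zz_def aa_def algebra_simps power2_eq_square)
  finally have "D * sub N gmc = D * (vX * vY - half * (vZ * (vX * vX)) - half * (vA * (vY * vY)))" by (simp add: half2)
  moreover have "D \<noteq> 0" using vZA_neq_1 by (simp add: D_def)
  ultimately show ?thesis by simp
qed

lemma dc5_gmc: "dc5 gmc = (\<lambda>_ _ _ _ _. 0)"
  by (auto simp: dc5_def gmc_def gm_ser_nth fun_eq_iff)

lemma sub_zero: "sub N (\<lambda>_ _ _ _ _. 0) = 0"
proof -
  have "nst (slice (\<lambda>_ _ _ _ _. 0) h j l) = 0" for h j l by (rule ser5_eqI) (simp add: slice_def)
  thus ?thesis by (simp add: sub_def)
qed

text \<open>The chain rule in \<open>X\<close> and \<open>Y\<close> is a linear system for the
  derivatives of the model by \<open>z\<close> and its conjugate, with determinant 1 - \<zeta> conj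
  \<zeta>. Its solution is the origin of the coordinate \<open>X\<close>; the
  \<open>\<zeta>\<close>-derivative then follows.\<close>

lemma sub_dc_gm:
  assumes N: "2 \<le> N"
  shows "sub N (dc1 gmc) = vX" "sub N (dc2 gmc) = half * (vX * vX)"
proof -
  have bx: "gmc h p j k l \<noteq> 0 \<Longrightarrow> (h, j, l) \<in> ibox N" for h p j k l using gmc_weight[of h p j k l] N by (auto simp: ibox_def)
  have "pdX (sub N gmc) = sub N (dc3 gmc) - vZ * sub N (dc1 gmc) + cst \<i> * vZ * vX * sub N (dc5 gmc)"
    "pdY (sub N gmc) = sub N (dc1 gmc) - vA * sub N (dc3 gmc) - cst \<i> * vA * vY * sub N (dc5 gmc)"
    "pdZ (sub N gmc) = sub N (dc2 gmc) - vX * sub N (dc1 gmc) + cst (\<i> / 2) * (vX * vX) * sub N (dc5 gmc)"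
    by (rule chain_rule, erule bx)+
  note ch = this[unfolded sub_gm[OF N] dc5_gmc sub_zero mult_zero_right add_0_right diff_zero]
  have pX: "pdX (vX * vY - half * (vZ * (vX * vX)) - half * (vA * (vY * vY))) = vY - vZ * vX"
  proof -
    have "pdX (vX * vY - half * (vZ * (vX * vX)) - half * (vA * (vY * vY))) = vY - (half * (vZ * vX) + half * (vZ * vX))"
      by (simp only: pd_rules pd_vars) (simp add: algebra_simps)
    thus ?thesis by (simp only: half_double)
  qed
  have pY: "pdY (vX * vY - half * (vZ * (vX * vX)) - half * (vA * (vY * vY))) = vX - vA * vY"
  proof -
    have "pdY (vX * vY - half * (vZ * (vX * vX)) - half * (vA * (vY * vY))) = vX - (half * (vA * vY) + half * (vA * vY))"
      by (simp only: pd_rules pd_vars) (simp add: algebra_simps)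
    thus ?thesis by (simp only: half_double)
  qed
  have e1: "sub N (dc3 gmc) = vY - vZ * vX + vZ * sub N (dc1 gmc)" using ch(1) pX by simp
  have e2: "sub N (dc1 gmc) = vX - vA * vY + vA * sub N (dc3 gmc)" using ch(2) pY by simp
  have "(1 - vZ * vA) * sub N (dc1 gmc) = (1 - vZ * vA) * vX"
    using e2 unfolding e1 by (simp add: algebra_simps)
  thus 1: "sub N (dc1 gmc) = vX" using vZA_neq_1 by simp
  have "- (half * (vX * vX)) = sub N (dc2 gmc) - vX * vX"
    using ch(3) unfolding 1 by (simp add: pd_rules)
  then have "sub N (dc2 gmc) = - (half * (vX * vX)) + vX * vX" by (simp only: eq_diff_eq)
  also have "\<dots> = - (half * (vX * vX)) + (half * (vX * vX) + half * (vX * vX))" by (simp only: half_double)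
  also have "\<dots> = half * (vX * vX)" by (simp only: minus_add_cancel)
  finally show "sub N (dc2 gmc) = half * (vX * vX)" .
qed

text \<open>The terms with the conjugate of \<open>\<zeta>\<close> cancel: along a leaf of the model
  \<open>w\<close> is an affine function of \<open>\<zeta>\<close>.\<close>

lemma ww_eq: assumes "2 \<le> N" shows "sub N gmc + cst \<i> * vv = ww"
proof -
  have "cst \<i> * cst (\<i> / 2) = - half" by (simp add: cst_mult) (simp add: cst_def)
  hence "cst \<i> * vv = cst \<i> * vT - half * (vZ * (vX * vX)) + half * (vA * (vY * vY))"
    unfolding vv_def distrib_left mult.assoc[symmetric, of "cst \<i>" "cst (\<i> / 2)"] by (simp add: algebra_simps)
  hence "sub N gmc + cst \<i> * vv = cst \<i> * vT + vX * vY - (half * (vZ * (vX * vX)) + half * (vZ * (vX * vX)))"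
    unfolding sub_gm[OF assms] by simp
  thus ?thesis by (simp only: half_double ww_def)
qed

lemma wpart_dc: "wpart n (dc1 c) = dc1 (wpart (Suc n) c)" "wpart n (dc3 c) = dc3 (wpart (Suc n) c)" "wpart n (dc2 c) = dc2 (wpart n c)"
  "wpart n (dc5 c) = dc5 (wpart (Suc (Suc n)) c)"
  by (auto simp: wpart_def dc1_def dc2_def dc3_def dc5_def fun_eq_iff)

lemma wpart_ibox: "n \<le> N \<Longrightarrow> wpart n c h p j k l \<noteq> 0 \<Longrightarrow> (h, j, l) \<in> ibox N"
  by (auto simp: wpart_def ibox_def split: if_splits)

lemma convergent_wpart: "convergent_series c \<Longrightarrow> convergent_series (wpart n c)"
  using conv_wpart unfolding convergent_series_conv by blast

lemma dc_zero: "dc1 (\<lambda>_ _ _ _ _. 0) = (\<lambda>_ _ _ _ _. 0)" "dc2 (\<lambda>_ _ _ _ _. 0) = (\<lambda>_ _ _ _ _. 0)" "dc5 (\<lambda>_ _ _ _ _. 0) = (\<lambda>_ _ _ _ _. 0)"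
  by (auto simp: dc1_def dc2_def dc5_def)

context
  fixes F G :: coeffs and \<nu> :: nat
  assumes fg: "nst F = gm_ser + nst G" and cF: "convergent_series F"
    and nu: "3 \<le> \<nu>" and Gw: "\<And>h p j k l. G h p j k l \<noteq> 0 \<Longrightarrow> \<nu> \<le> h + j + 2 * l"
begin

abbreviation "\<Gamma> \<equiv> wpart \<nu> G"
abbreviation "L n c \<equiv> sub \<nu> (wpart n c)"

lemma F_eq: "F h p j k l = gmc h p j k l + G h p j k l"
  using arg_cong[OF fg, of "\<lambda>f. f $ k $ p $ h $ j $ l"] by (simp add: gmc_def)

lemma F_gap: "F h p j k l \<noteq> 0 \<Longrightarrow> h + j + 2 * l = 2 \<or> \<nu> \<le> h + j + 2 * l"
  using F_eq[of h p j k l] gmc_weight[of h p j k l] Gw[of h p j k l] by fastforce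

lemma wpart_F: "wpart n F = (if n = 2 then gmc else if n = \<nu> then \<Gamma> else (\<lambda>_ _ _ _ _. 0))" if "n \<le> \<nu>"
proof (intro ext)
  fix h p j k l
  have "h + j + 2 * l \<noteq> 2 \<Longrightarrow> gmc h p j k l = 0" "h + j + 2 * l < \<nu> \<Longrightarrow> G h p j k l = 0"
    using gmc_weight[of h p j k l] Gw[of h p j k l] by fastforce+
  thus "wpart n F h p j k l = (if n = 2 then gmc else if n = \<nu> then \<Gamma> else (\<lambda>_ _ _ _ _. 0)) h p j k l"
    using that nu by (auto simp: wpart_def F_eq)
qed

lemma L_F:
  "i < \<nu> \<Longrightarrow> L i (dc1 F) = (if i = 1 then vX else 0) + (if i = \<nu> - 1 then sub \<nu> (dc1 \<Gamma>) else 0)"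
  "i \<le> \<nu> \<Longrightarrow> L i (dc2 F) = (if i = 2 then half * (vX * vX) else 0) + (if i = \<nu> then sub \<nu> (dc2 \<Gamma>) else 0)"
  "i \<le> \<nu> - 2 \<Longrightarrow> L i (dc5 F) = (if i = \<nu> - 2 then sub \<nu> (dc5 \<Gamma>) else 0)"
  using nu by (auto simp: wpart_dc wpart_F dc_zero sub_zero sub_dc_gm dc5_gmc)

text \<open>The order \<open>n\<close> of a holomorphic series along the perturbed graph: the model
  value \<open>hf\<close>, with the linear correction by the lowest part of \<open>G\<close> at
  order \<open>\<nu>\<close>.\<close>

definition PN :: "nat \<Rightarrow> coeffs \<Rightarrow> ser5" where
  "PN n a = hf n a + (if n = \<nu> then zs a 0 1 * sub \<nu> \<Gamma> else 0)"

lemma formal_identity: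
  assumes T: "tangent_series F a b c" and N: "N \<le> \<nu>"
  shows "PN N c + bar5 (PN N c) = cst 2 * (\<Sum>i=0..N. L i (dc1 F) * PN (N - i) a + L i (dc2 F) * PN (N - i) b)
     + bar5 (cst 2 * (\<Sum>i=0..N. L i (dc1 F) * PN (N - i) a + L i (dc2 F) * PN (N - i) b))
     - cst \<i> * (\<Sum>i=0..N. L i (dc5 F) * (PN (N - i) c - bar5 (PN (N - i) c)))"
proof -
  define e where "e = (\<lambda>i c X \<zeta> t. leaf (wpart i c) X \<zeta> t)"
  define \<omega> where "\<omega> = (\<lambda>X \<zeta> t. e 2 F X \<zeta> t + \<i> * of_real (t - Im (\<zeta> * X ^ 2)))"
  define p where "p = (\<lambda>n a X \<zeta> t. hpart n a (cnj X - \<zeta> * X) \<zeta> (\<omega> X \<zeta> t) + (if n = \<nu> then slv a 0 1 \<zeta> * e \<nu> F X \<zeta> t else 0))"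
  have near: "near0 (\<lambda>X \<zeta> t. p N c X \<zeta> t + cnj (p N c X \<zeta> t) = 2 * (\<Sum>i=0..N. e i (dc1 F) X \<zeta> t * p (N - i) a X \<zeta> t + e i (dc2 F) X \<zeta> t * p (N - i) b X \<zeta> t)
      + cnj (2 * (\<Sum>i=0..N. e i (dc1 F) X \<zeta> t * p (N - i) a X \<zeta> t + e i (dc2 F) X \<zeta> t * p (N - i) b X \<zeta> t))
      - \<i> * (\<Sum>i=0..N. e i (dc5 F) X \<zeta> t * (p (N - i) c X \<zeta> t - cnj (p (N - i) c X \<zeta> t))))"
    using near0_leaf[OF tangent_weight_identity[OF T cF F_gap nu N]] unfolding Let_def p_def e_def \<omega>_def .
  have fe: "fexp (e i x) (L i x)" if "i \<le> \<nu>" "convergent_series x" for i x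
    unfolding e_def by (rule fexp_sub[OF convergent_wpart[OF that(2)] wpart_ibox[OF that(1)]])
  have "L 2 F + cst \<i> * vv = ww" using wpart_F[of 2] ww_eq[of \<nu>] nu by simp
  moreover have "fexp \<omega> (L 2 F + cst \<i> * vv)"
    unfolding \<omega>_def by (intro fexp_intros(1) fexp_intros(3) fexp_intros(7) fexp_leaf_vars fe cF) (use nu in simp)
  ultimately have w: "fexp \<omega> ww" by simp
  have "L \<nu> F = sub \<nu> \<Gamma>" using wpart_F[of \<nu>] nu by simp
  hence fp: "fexp (p n x) (PN n x)" if "hol_series x" for n x
    unfolding p_def PN_def using fe[OF order_refl cF]
    by (intro fexp_intros(1) fexp_if fexp_intros(3) fexp_hpart[OF that w] fexp_slv[OF that] fexp_0) simp
  have hol: "hol_series a" "hol_series b" "hol_series c" using T by (simp_all add: tangent_series_def)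
  note fp3 = fp[OF hol(1)] fp[OF hol(2)] fp[OF hol(3)]
  note dcs = convergent_dc[OF cF]
  have le: "i \<in> {0..N} \<Longrightarrow> i \<le> \<nu>" for i using N by simp
  have S: "fexp (\<lambda>X \<zeta> t. 2 * (\<Sum>i=0..N. e i (dc1 F) X \<zeta> t * p (N - i) a X \<zeta> t + e i (dc2 F) X \<zeta> t * p (N - i) b X \<zeta> t))
     (cst 2 * (\<Sum>i=0..N. L i (dc1 F) * PN (N - i) a + L i (dc2 F) * PN (N - i) b))"
    by (rule fexp_intros(3)[OF fexp_intros(7)], rule fexp_sum, rule fexp_intros(1); rule fexp_intros(3)[OF fe]; (rule le; assumption | rule dcs | rule fp3))
  have R: "fexp (\<lambda>X \<zeta> t. \<i> * (\<Sum>i=0..N. e i (dc5 F) X \<zeta> t * (p (N - i) c X \<zeta> t - cnj (p (N - i) c X \<zeta> t))))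
    (cst \<i> * (\<Sum>i=0..N. L i (dc5 F) * (PN (N - i) c - bar5 (PN (N - i) c))))"
    by (rule fexp_intros(3)[OF fexp_intros(7)], rule fexp_sum, rule fexp_intros(3)[OF fe])
       (rule le, assumption, rule dcs, rule fexp_intros(2)[OF fp3(3) fexp_intros(6)[OF fp3(3)]])
  show ?thesis
    by (rule fexp_unique[OF fexp_intros(1)[OF fp3(3) fexp_intros(6)[OF fp3(3)]] fexp_intros(2)[OF fexp_intros(1)[OF S fexp_intros(6)[OF S]] R] near])
qed

end

subsection \<open>Low order parts of infinitesimal automorphisms\<close>

lemma v_nth:
  "(vX * f) $ q $ p $ i $ j $ k = (if i = 0 then 0 else f $ q $ p $ (i - 1) $ j $ k)"
  "(vY * f) $ q $ p $ i $ j $ k = (if j = 0 then 0 else f $ q $ p $ i $ (j - 1) $ k)"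
  "(vZ * f) $ q $ p $ i $ j $ k = (if p = 0 then 0 else f $ q $ (p - 1) $ i $ j $ k)"
  "(vA * f) $ q $ p $ i $ j $ k = (if q = 0 then 0 else f $ (q - 1) $ p $ i $ j $ k)"
  "(cst c * f) $ q $ p $ i $ j $ k = c * f $ q $ p $ i $ j $ k"
  by (simp_all add: vX_def vY_def vZ_def vA_def cst_def)

lemma bar5_nth5: "bar5 f $ q $ p $ i $ j $ k = cnj (f $ p $ q $ j $ i $ k)"
  by (simp add: bar5_nth bar3_def)

lemma bar5_pdZ: "bar5 (pdZ f) = pdA (bar5 f)"
  by (rule ser5_eqI) (simp add: bar5_nth5 pd_nth del: of_nat_Suc)

lemma Zs_nth: "Zs u $ q $ p $ i $ j $ k = (if q = 0 \<and> i = 0 \<and> j = 0 \<and> k = 0 then u p else 0)"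
  by (simp add: Zs_def)

lemma cst_nth: "cst c $ q $ p $ i $ j $ k = (if q = 0 \<and> p = 0 \<and> i = 0 \<and> j = 0 \<and> k = 0 then c else 0)"
  by (simp add: cst_def)

lemma pd_Zs [simp]: "pdX (Zs u) = 0" "pdY (Zs u) = 0" "pdT (Zs u) = 0"
  "pdX (bar5 (Zs u)) = 0" "pdY (bar5 (Zs u)) = 0" "pdT (bar5 (Zs u)) = 0"
  by (rule ser5_eqI, simp add: pd_nth Zs_nth bar5_nth5)+

text \<open>The vector field \<open>V + \<zeta> U\<close> on five-variable series annihilates the leaf coordinates
  \<open>z\<close>, \<open>\<zeta>\<close> and \<open>w\<close>.\<close>

definition Dv :: "ser5 \<Rightarrow> ser5" where
  "Dv f = pdX f + vZ * pdY f + cst \<i> * (vY * pdT f) - cst \<i> * (vZ * (vX * pdT f))"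

lemma derivation_Dv: "derivation Dv"
  unfolding derivation_def Dv_def by (simp add: pd_rules algebra_simps)

lemma Dv_0: "Dv f $ 0 = opVz (f $ 0)"
proof (rule fps_ext)
  fix n show "Dv f $ 0 $ n = opVz (f $ 0) $ n"
    by (cases n) (simp_all add: Dv_def opVz_def opV_def opU_def pdX_def pdY_def pdT_def vX_def vY_def vZ_def cst_def algebra_simps)
qed

lemma cst_minus: "cst (- c) = - cst c"
  by (simp add: cst_def)

lemma Dv_leaf: "Dv zz = 0" "Dv ww = 0" "Dv vX = 1" "Dv (Zs u) = 0" "Dv (cst c) = 0"
proof -
  show "Dv zz = 0" by (simp add: Dv_def pd_leaf)
  have "cst \<i> * (cst \<i> * f) = - f" for f by (simp add: mult.assoc[symmetric] cst_mult cst_minus cst_1)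
  thus "Dv ww = 0" by (simp add: Dv_def ww_def pd_rules algebra_simps)
qed (simp_all add: Dv_def)

lemma Dv_hf: "Dv (hf n a) = 0"
  unfolding hf_def derivation_sum[OF derivation_Dv]
  by (intro sum.neutral ballI) (simp add: derivation_mult[OF derivation_Dv] derivation_power[OF derivation_Dv] derivation_0[OF derivation_Dv] zs_def Dv_leaf)

section \<open>Cubic solutions without the conjugate of \<zeta>\<close>

definition afree :: "ser5 \<Rightarrow> bool" where
  "afree f \<longleftrightarrow> f = fps_const (f $ 0)"

lemma afree_const: "afree (fps_const f)"
  by (simp add: afree_def)

lemma afreeE: assumes "afree f" obtains g where "f = fps_const g"
  using assms unfolding afree_def by blast

lemma afree_hom:
  assumes "afree f" "afree g"
  shows "afree (f + g)" "afree (f - g)" "afree (f * g)" "afree (f ^ n)"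
proof -
  obtain f' g' where "f = fps_const f'" "g = fps_const g'" using assms by (elim afreeE)
  thus "afree (f + g)" "afree (f - g)" "afree (f * g)" "afree (f ^ n)"
    by (simp_all add: afree_const fps_const_power)
qed

lemma afree_vars: "afree vX" "afree vY" "afree vZ" "afree vT" "afree (cst c)" "afree (Zs u)" "afree 0"
  by (simp_all add: afree_def vX_def vY_def vZ_def vT_def cst_def Zs_def)

lemma afree_hf: "afree (hf n a)"
proof -
  have z: "afree zz" "afree ww" unfolding zz_def ww_def by (intro afree_hom(1-3) afree_vars)+
  have "afree (\<Sum>x\<in>A. f x)" if "\<And>x. afree (f x)" for f and A :: "(nat \<times> nat) set"
    by (induction A rule: infinite_finite_induct) (auto intro: afree_hom(1) afree_vars that)
  note S = this
  have "afree (zz ^ h)" "afree (ww ^ h)" for h by (rule afree_hom(4)[OF z(1) z(1)] afree_hom(4)[OF z(2) z(2)])+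
  thus ?thesis unfolding hf_def zs_def by (intro S) (auto intro!: afree_hom(3) afree_vars)
qed

text \<open>The form in which polynomials of degree at most two in \<open>X\<close>, over functions
  of \<open>z\<close>, \<open>\<zeta>\<close> and \<open>w\<close>, enter. Having no conjugate of
  \<open>\<zeta>\<close>, such a series fills only the row \<open>q = 0\<close>, and its conjugate
  only the column \<open>p = 0\<close>.\<close>

definition polyK :: "ser5 \<Rightarrow> bool" where
  "polyK K \<longleftrightarrow> afree K \<and> Dv (Dv (Dv K)) = 0"

lemma polyK_lin: "polyK K \<Longrightarrow> polyK K' \<Longrightarrow> polyK (K + K')" "polyK K \<Longrightarrow> polyK K' \<Longrightarrow> polyK (K - K')" "polyK K \<Longrightarrow> polyK (cst c * K)"
  by (auto simp: polyK_def afree_vars derivation_add[OF derivation_Dv] derivation_diff[OF derivation_Dv] derivation_mult[OF derivation_Dv] Dv_leaf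
     intro: afree_hom(1-3))

lemma polyK_Ptype:
  assumes "polyK K"
  shows "Ptype (K $ 0)" "K $ q $ p = (if q = 0 then K $ 0 $ p else 0)" "bar5 K $ q $ p = (if p = 0 then bar3 (K $ 0 $ q) else 0)"
proof -
  show "Ptype (K $ 0)" using assms by (simp add: Ptype_def polyK_def flip: Dv_0)
  have K: "K = fps_const (K $ 0)" using assms by (simp add: polyK_def afree_def)
  show 1: "K $ q $ p = (if q = 0 then K $ 0 $ p else 0)" for q p by (subst K) simp
  show "bar5 K $ q $ p = (if p = 0 then bar3 (K $ 0 $ q) else 0)"
    unfolding bar5_nth by (subst 1) simp
qed

text \<open>The order \<open>n\<close> of C - 2 X A - X^2 B, whose real part is the tangency defect
  for the model. \<open>hf\<close> at every order is annihilated by \<open>Dv\<close>, and each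
  \<open>Dv\<close> lowers the degree in \<open>X\<close>.\<close>

definition Kf :: "nat \<Rightarrow> coeffs \<Rightarrow> coeffs \<Rightarrow> coeffs \<Rightarrow> ser5" where
  "Kf n a b c = hf n c - cst 2 * (vX * (if n < 1 then 0 else hf (n - 1) a)) - vX * vX * (if n < 2 then 0 else hf (n - 2) b)"

lemma polyK_Kf: "polyK (Kf n a b c)"
proof -
  define A where "A = (if n < 1 then 0 else hf (n - 1) a)"
  define B where "B = (if n < 2 then 0 else hf (n - 2) b)"
  have AB: "Dv A = 0" "Dv B = 0" "afree A" "afree B"
    by (simp_all add: A_def B_def Dv_hf derivation_0[OF derivation_Dv] afree_hf afree_vars)
  note r = derivation_add[OF derivation_Dv] derivation_diff[OF derivation_Dv] derivation_mult[OF derivation_Dv] derivation_0[OF derivation_Dv] derivation_1[OF derivation_Dv]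
    derivation_minus[OF derivation_Dv]
  have "Dv (Kf n a b c) = - (cst 2 * A) - (vX + vX) * B"
    unfolding Kf_def A_def[symmetric] B_def[symmetric] by (simp only: r Dv_leaf Dv_hf AB) (simp add: algebra_simps)
  moreover have "Dv (- (cst 2 * A) - (vX + vX) * B) = - (B + B)" by (simp only: r Dv_leaf AB) (simp add: algebra_simps)
  moreover have "Dv (- (B + B)) = 0" by (simp only: r AB) simp
  ultimately have "Dv (Dv (Dv (Kf n a b c))) = 0" by simp
  moreover have "afree (Kf n a b c)"
    unfolding Kf_def A_def[symmetric] B_def[symmetric] by (intro afree_hom(1-3) afree_hf afree_vars AB)
  ultimately show ?thesis by (simp add: polyK_def)
qed

section \<open>Fields of the model up to order two\<close>

lemma hf_nested: "hf n a = (\<Sum>h\<le>n. \<Sum>l\<le>n. if h + 2 * l = n then zs a h l * zz ^ h * ww ^ l else 0)"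
  by (simp add: hf_def sum.cartesian_product split_beta)

lemma hf_low: "hf 0 a = zs a 0 0" "hf (Suc 0) a = zs a 1 0 * zz" "hf 2 a = zs a 2 0 * (zz * zz) + zs a 0 1 * ww"
  by (simp_all add: hf_nested numeral_2_eq_2 mult.assoc)

lemma Zs_const: "(\<And>p. 0 < p \<Longrightarrow> u p = 0) \<Longrightarrow> Zs u = cst (u 0)"
  by (rule ser5_eqI) (auto simp: Zs_nth cst_nth)

lemma order0:
  assumes "Zs u + bar5 (Zs u) = 0"
  shows "Zs u = cst (u 0)"
proof (rule Zs_const)
  fix p :: nat assume "0 < p"
  thus "u p = 0" using arg_cong[OF assms, of "\<lambda>f. f $ 0 $ p $ 0 $ 0 $ 0"] by (simp add: Zs_nth bar5_nth5)
qed

lemma bar5_leaf: "bar5 zz = aa" "bar5 aa = zz" "bar5 ww = cst (- \<i>) * vT + vX * vY - vA * (vY * vY)"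
  by (simp_all add: zz_def aa_def ww_def bar5_hom bar5_vars mult.commute)

text \<open>One \<open>X\<close>-derivative separates powers of \<open>\<zeta>\<close> from powers
  of its conjugate. The solution is the translation field of the model with value \<open>u 0\<close>
  in the direction of \<open>z\<close>.\<close>

lemma order1:
  assumes "Zs g * zz + bar5 (Zs g * zz) = cst 2 * (vX * Zs u) + bar5 (cst 2 * (vX * Zs u))"
  shows "Zs g = cst (2 * cnj (u 0))" "Zs u = cst (u 0) - cst (cnj (u 0)) * vZ"
proof -
  have "bar5 (Zs g) - vZ * Zs g = cst 2 * Zs u"
    using arg_cong[OF assms, of pdX] by (simp add: bar5_hom bar5_leaf bar5_vars pd_rules pd_leaf mult.commute)
  hence "(bar5 (Zs g) - vZ * Zs g) $ q $ p $ 0 $ 0 $ 0 = (cst 2 * Zs u) $ q $ p $ 0 $ 0 $ 0" for q p by simp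
  note e = this[unfolded fps_sub_nth bar5_nth5 Zs_nth v_nth]
  have g: "g q = 0" if "0 < q" for q using e[where q = "q" and p = "0"] that by (simp add: bar5_nth5 Zs_nth v_nth)
  have g0: "cnj (g 0) = 2 * u 0" using e[where q = "0" and p = "0"] by (simp add: bar5_nth5 Zs_nth v_nth)
  hence g0': "g 0 = 2 * cnj (u 0)" by (metis complex_cnj_cnj complex_cnj_mult complex_cnj_numeral)
  show "Zs g = cst (2 * cnj (u 0))" using Zs_const[of g] g g0' by simp
  have u1: "u (Suc 0) = - cnj (u 0)" using e[where q = "0" and p = "Suc 0"] by (simp add: bar5_nth5 Zs_nth v_nth g0' minus_equation_iff)
  have u2: "u (Suc (Suc p)) = 0" for p using e[where q = "0" and p = "Suc (Suc p)"] g[of "Suc p"] by (simp add: bar5_nth5 Zs_nth v_nth)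
  show "Zs u = cst (u 0) - cst (cnj (u 0)) * vZ"
  proof (rule ser5_eqI)
    fix q p i j k
    show "Zs u $ q $ p $ i $ j $ k = (cst (u 0) - cst (cnj (u 0)) * vZ) $ q $ p $ i $ j $ k"
      by (rule nat_cases2[of _ p]) (auto simp: Zs_nth cst_nth v_nth(5) vZ_def u1 u2)
  qed
qed

text \<open>The derivatives by \<open>t\<close>, twice by \<open>X\<close>, and by \<open>X\<close>
  and \<open>Y\<close> yield three equations in \<open>\<zeta>\<close> and its conjugate alone. The
  number \<open>u 0\<close> stays free: it belongs to the isotropy of the model, the dilations and
  rotations u z, (u - conj u) \<zeta>, (u + conj u) w.\<close>

lemma order2:
  assumes e: "Zs \<kappa> * (zz * zz) + Zs \<rho> * ww + bar5 (Zs \<kappa> * (zz * zz) + Zs \<rho> * ww)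
     = cst 2 * (vX * (Zs u * zz) + half * (vX * vX) * Zs b) + bar5 (cst 2 * (vX * (Zs u * zz) + half * (vX * vX) * Zs b))"
    and b0: "b 0 = 1"
  shows "Zs \<rho> = cst (u 0 + cnj (u 0))" "Zs u = cst (u 0) - vZ" "Zs b = 1 + (cst (u 0) - cst (cnj (u 0))) * vZ - vZ * vZ"
proof -
  note bs = bar5_hom bar5_leaf bar5_vars pd_rules pd_leaf pd_vars pd_Zs
  have w: "pdX ww = vY - vZ * (vX + vX)" "pdY ww = vX" "pdT ww = cst \<i>"
    by (simp_all add: ww_def pd_rules algebra_simps)
  have "cst \<i> * Zs \<rho> - cst \<i> * bar5 (Zs \<rho>) = 0"
    using arg_cong[OF e, of pdT] by (simp add: bs w)
      (simp add: cst_def mult.commute flip: fps_const_neg)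
  from arg_cong[OF this, of "\<lambda>f. f $ q $ p $ 0 $ 0 $ 0" for q p]
  have "(cst \<i> * Zs \<rho> - cst \<i> * bar5 (Zs \<rho>)) $ q $ p $ 0 $ 0 $ 0 = 0" for q p by (simp only: fps_zero_nth)
  note eT = this[unfolded fps_sub_nth bar5_nth5 Zs_nth v_nth]
  have r: "\<rho> p = 0" if "0 < p" for p using eT[where q = "0" and p = "p"] that by (simp add: bar5_nth5 Zs_nth v_nth)
  have r0: "cnj (\<rho> 0) = \<rho> 0" using eT[where q = "0" and p = "0"] by (simp add: bar5_nth5 Zs_nth v_nth)
  define kb where "kb = bar5 (Zs \<kappa>)"
  define rb where "rb = bar5 (Zs \<rho>)"
  define ub where "ub = bar5 (Zs u)"
  define bb where "bb = bar5 (Zs b)"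
  have e': "Zs \<kappa> * (zz * zz) + Zs \<rho> * ww + (kb * (aa * aa) + rb * (cst (- \<i>) * vT + vX * vY - vA * (vY * vY)))
     = cst 2 * (vX * (Zs u * zz) + half * (vX * vX) * Zs b) + cst 2 * (vY * (ub * aa) + half * (vY * vY) * bb)"
    using e by (simp add: bar5_hom bar5_leaf bar5_vars kb_def rb_def ub_def bb_def)
  have pb: "pdX kb = 0" "pdX rb = 0" "pdX ub = 0" "pdX bb = 0" "pdY kb = 0" "pdY rb = 0" "pdY ub = 0" "pdY bb = 0"
    by (simp_all add: kb_def rb_def ub_def bb_def)
  have hX: "half * (vX + vX) = vX" by (simp only: distrib_left half_double)
  have eX: "- (Zs \<kappa> * (vZ * zz + vZ * zz)) + Zs \<rho> * (vY - vZ * (vX + vX)) + (kb * (aa + aa) + rb * vY)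
     = cst 2 * (Zs u * zz - vX * (Zs u * vZ) + vX * Zs b) + cst 2 * (vY * ub)"
  proof -
    have "pdX (half * (vX * vX) * Zs b) = half * (vX + vX) * Zs b" by (simp add: pd_rules)
    thus ?thesis using arg_cong[OF e', of pdX] by (simp only: pd_rules hX pd_leaf pd_vars pd_Zs pb w) (simp add: algebra_simps)
  qed
  have eXX: "Zs \<kappa> * (vZ * vZ + vZ * vZ) - Zs \<rho> * (vZ + vZ) + (kb + kb) = cst 2 * (Zs b - (Zs u * vZ + Zs u * vZ))"
    using arg_cong[OF eX, of pdX] by (simp only: pd_rules pd_leaf pd_vars pd_Zs pb) (simp add: algebra_simps)
  have eXY: "Zs \<rho> - Zs \<kappa> * (vZ + vZ) + (rb - kb * (vA + vA)) = cst 2 * Zs u + cst 2 * ub"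
    using arg_cong[OF eX, of pdY] by (simp only: pd_rules pd_leaf pd_vars pd_Zs pb) (simp add: algebra_simps)
  have "(vZ * (vZ * Zs \<kappa>) + vZ * (vZ * Zs \<kappa>) - (vZ * Zs \<rho> + vZ * Zs \<rho>) + (kb + kb)) $ q $ p $ 0 $ 0 $ 0 = (cst 2 * Zs b - (cst 2 * (vZ * Zs u) + cst 2 * (vZ * Zs u))) $ q $ p $ 0 $ 0 $ 0" for q p
  proof -
    have 1: "vZ * (vZ * Zs \<kappa>) + vZ * (vZ * Zs \<kappa>) - (vZ * Zs \<rho> + vZ * Zs \<rho>) + (kb + kb) = Zs \<kappa> * (vZ * vZ + vZ * vZ) - Zs \<rho> * (vZ + vZ) + (kb + kb)"
      by (simp add: algebra_simps)
    have 2: "cst 2 * Zs b - (cst 2 * (vZ * Zs u) + cst 2 * (vZ * Zs u)) = cst 2 * (Zs b - (Zs u * vZ + Zs u * vZ))"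
      by (simp add: algebra_simps)
    show ?thesis unfolding 1 2 eXX ..
  qed
  note xx = this[unfolded kb_def, unfolded fps_add_nth fps_sub_nth v_nth bar5_nth5 Zs_nth]
  have "(Zs \<rho> - (vZ * Zs \<kappa> + vZ * Zs \<kappa>) + (rb - (vA * kb + vA * kb))) $ q $ p $ 0 $ 0 $ 0 = (cst 2 * Zs u + cst 2 * ub) $ q $ p $ 0 $ 0 $ 0" for q p
  proof -
    have 1: "Zs \<rho> - (vZ * Zs \<kappa> + vZ * Zs \<kappa>) + (rb - (vA * kb + vA * kb)) = Zs \<rho> - Zs \<kappa> * (vZ + vZ) + (rb - kb * (vA + vA))"
      by (simp add: algebra_simps)
    show ?thesis unfolding 1 eXY ..
  qed
  note xy = this[unfolded kb_def rb_def ub_def, unfolded fps_add_nth fps_sub_nth v_nth bar5_nth5 Zs_nth]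
  have k0: "\<kappa> 0 = 1"
  proof -
    have "cnj (\<kappa> 0) = 1" using xx[where q = "0" and p = "0"] b0 by simp
    thus ?thesis by (metis complex_cnj_cnj complex_cnj_one)
  qed
  have k: "\<kappa> q = 0" if "0 < q" for q using xx[where q = "q" and p = "0"] that by simp
  have r00: "\<rho> 0 = u 0 + cnj (u 0)"
  proof -
    have "2 * \<rho> 0 = 2 * (u 0 + cnj (u 0))" using xy[where q = "0" and p = "0"] r0 by simp
    thus ?thesis by (simp only: mult_cancel_left) simp
  qed
  have u1: "u (Suc 0) = - 1"
  proof -
    have "2 * u (Suc 0) = - 2" using xy[where q = "0" and p = "Suc 0"] k0 r by simp
    thus ?thesis by simp
  qed
  have u2: "u (Suc (Suc p)) = 0" for p using xy[where q = "0" and p = "Suc (Suc p)"] k r by simp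
  have b1: "b (Suc 0) = u 0 - cnj (u 0)"
  proof -
    have "- (2 * \<rho> 0) = 2 * b (Suc 0) - 4 * u 0" using xx[where q = "0" and p = "Suc 0"] by simp
    hence "2 * b (Suc 0) = - (2 * \<rho> 0) + 4 * u 0" unfolding eq_diff_eq by (rule sym)
    also have "\<dots> = 2 * (u 0 - cnj (u 0))" unfolding r00 by simp
    finally show ?thesis by (simp only: mult_cancel_left) simp
  qed
  have b2: "b (Suc (Suc p)) = (if p = 0 then - 1 else 0)" for p
  proof (cases p)
    case 0
    have "2 + 2 * b (Suc (Suc 0)) = 0" using xx[where q = "0" and p = "Suc (Suc 0)"] k0 r u1 by simp
    hence "2 * (b (Suc (Suc 0)) + 1) = 0" by (simp only: distrib_left mult_1_right add.commute)
    hence "b (Suc (Suc 0)) + 1 = 0" by (simp only: mult_eq_0_iff) simp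
    hence "b (Suc (Suc 0)) = - 1" by (simp only: eq_neg_iff_add_eq_0)
    thus ?thesis using 0 by simp
  next
    case (Suc m)
    thus ?thesis using xx[where q = "0" and p = "Suc (Suc p)"] k r u2 by simp
  qed
  show "Zs \<rho> = cst (u 0 + cnj (u 0))" using Zs_const[of \<rho>] r r00 by simp
  have vZn: "vZ $ q $ p $ i $ j $ k = (if q = 0 \<and> p = 1 \<and> i = 0 \<and> j = 0 \<and> k = 0 then 1 else 0)" for q p i j k
    by (auto simp: vZ_def)
  show "Zs u = cst (u 0) - vZ"
  proof (rule ser5_eqI)
    fix q p i j k
    show "Zs u $ q $ p $ i $ j $ k = (cst (u 0) - vZ) $ q $ p $ i $ j $ k"
      by (rule nat_cases2[of _ p]) (auto simp: Zs_nth cst_nth vZn u1 u2)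
  qed
  show "Zs b = 1 + (cst (u 0) - cst (cnj (u 0))) * vZ - vZ * vZ"
  proof (rule ser5_eqI)
    fix q p i j k
    have c: "(1 + (cst (u 0) - cst (cnj (u 0))) * vZ - vZ * vZ) = cst 1 + (cst (u 0) * vZ - cst (cnj (u 0)) * vZ) - vZ * vZ"
      by (simp add: cst_1 algebra_simps)
    show "Zs b $ q $ p $ i $ j $ k = (1 + (cst (u 0) - cst (cnj (u 0))) * vZ - vZ * vZ) $ q $ p $ i $ j $ k"
      unfolding c by (rule nat_cases2[of _ p]) (auto simp: Zs_nth cst_nth v_nth vZn b0 b1 b2)
  qed
qed

lemma sum_pick:
  fixes x :: ser5 and N m :: nat
  shows "(\<Sum>i=0..N. (if i = m then x else 0) * g (N - i)) = (if m \<le> N then x * g (N - m) else 0)"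
proof -
  have "(\<Sum>i=0..N. (if i = m then x else 0) * g (N - i)) = (\<Sum>i=0..N. if i = m then x * g (N - m) else 0)"
    by (rule sum.cong) auto
  thus ?thesis unfolding sum.delta[OF finite_atLeastAtMost] by simp
qed

subsection \<open>Vanishing of the lowest weight part\<close>

lemma dc_ibox:
  assumes "\<And>h p j k l. c h p j k l \<noteq> 0 \<Longrightarrow> (h, j, l) \<in> ibox N"
  shows "dc1 c h p j k l \<noteq> 0 \<Longrightarrow> (h, j, l) \<in> ibox N" "dc2 c h p j k l \<noteq> 0 \<Longrightarrow> (h, j, l) \<in> ibox N" "dc5 c h p j k l \<noteq> 0 \<Longrightarrow> (h, j, l) \<in> ibox N"
  using assms[of "Suc h" p j k l] assms[of h "Suc p" j k l] assms[of h p j k "Suc l"] by (auto simp: dc1_def dc2_def dc5_def ibox_def)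

lemma sub_nth_00:
  assumes "\<And>h p j k l. c h p j k l \<noteq> 0 \<Longrightarrow> (h, j, l) \<in> ibox N"
  shows "sub N c $ 0 $ 0 $ i $ y $ k = c y 0 i 0 k"
  by (rule sub_nth_lowest) (use assms in auto)

lemma sub_nth_01:
  assumes bx: "\<And>h p j k l. c h p j k l \<noteq> 0 \<Longrightarrow> (h, j, l) \<in> ibox N"
  shows "sub N c $ 0 $ 1 $ i $ y $ k = c y 1 i 0 k - (if i = 0 then 0 else of_nat (Suc y) * c (Suc y) 0 (i - 1) 0 k)
    + (if i < 2 then 0 else \<i> / 2 * of_nat (Suc k) * c y 0 (i - 2) 0 (Suc k))"
proof -
  have "sub N c $ 0 $ 1 $ i $ y $ k = pdZ (sub N c) $ 0 $ 0 $ i $ y $ k" by (simp add: pd_nth)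
  also have "pdZ (sub N c) = sub N (dc2 c) - vX * sub N (dc1 c) + cst (\<i> / 2) * (vX * (vX * sub N (dc5 c)))"
  proof -
    have "pdZ (sub N c) = sub N (dc2 c) - vX * sub N (dc1 c) + cst (\<i> / 2) * (vX * vX) * sub N (dc5 c)"
      by (rule chain_rule) (rule bx)
    thus ?thesis by (simp only: mult.assoc)
  qed
  also have "\<dots> $ 0 $ 0 $ i $ y $ k = sub N (dc2 c) $ 0 $ 0 $ i $ y $ k - (if i = 0 then 0 else sub N (dc1 c) $ 0 $ 0 $ (i - 1) $ y $ k)
     + \<i> / 2 * (if i = 0 then 0 else if i - 1 = 0 then 0 else sub N (dc5 c) $ 0 $ 0 $ (i - 1 - 1) $ y $ k)"
    unfolding fps_add_nth fps_sub_nth v_nth ..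
  also have "\<dots> = c y 1 i 0 k - (if i = 0 then 0 else of_nat (Suc y) * c (Suc y) 0 (i - 1) 0 k)
    + (if i < 2 then 0 else \<i> / 2 * of_nat (Suc k) * c y 0 (i - 2) 0 (Suc k))"
  proof -
    have 1: "sub N (dc1 c) $ 0 $ 0 $ i $ y $ k = dc1 c y 0 i 0 k" for i by (rule sub_nth_00) (rule dc_ibox(1)[OF bx])
    have 2: "sub N (dc2 c) $ 0 $ 0 $ i $ y $ k = dc2 c y 0 i 0 k" for i by (rule sub_nth_00) (rule dc_ibox(2)[OF bx])
    have 5: "sub N (dc5 c) $ 0 $ 0 $ i $ y $ k = dc5 c y 0 i 0 k" for i by (rule sub_nth_00) (rule dc_ibox(3)[OF bx])
    show ?thesis unfolding 1 2 5
      by (rule nat_cases2[of _ i]) (simp_all add: dc1_def dc2_def dc5_def)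
  qed
  finally show ?thesis .
qed

lemma cst_2_half: "cst 2 * (half * f) = f"
  by (simp add: mult.assoc[symmetric] cst_mult cst_1)

context
  fixes F G :: coeffs and \<nu> :: nat
  assumes fg: "nst F = gm_ser + nst G" and cF: "convergent_series F"
    and nu: "3 \<le> \<nu>" and Gw: "\<And>h p j k l. G h p j k l \<noteq> 0 \<Longrightarrow> \<nu> \<le> h + j + 2 * l"
    and cG: "convergent_series G" and nG: "normalized G"
    and fields: "\<And>V1 V2 V3. Re V3 = 0 \<Longrightarrow> \<exists>a b c. tangent_series F a b c \<and> a 0 0 0 0 0 = V1 \<and> b 0 0 0 0 0 = V2 \<and> c 0 0 0 0 0 = V3"
begin

definition "Gm = wpart \<nu> G"
definition "H = sub \<nu> Gm"
definition "S1 = sub \<nu> (dc1 Gm)"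
definition "S2 = sub \<nu> (dc2 Gm)"
definition "S3 = sub \<nu> (dc3 Gm)"
definition "S5 = sub \<nu> (dc5 Gm)"

abbreviation "pn \<equiv> PN G \<nu>"

lemma pn: "n \<noteq> \<nu> \<Longrightarrow> pn n a = hf n a" "pn \<nu> a = hf \<nu> a + zs a 0 1 * H"
proof -
  have "pn n a = hf n a + (if n = \<nu> then zs a 0 1 * sub \<nu> (wpart \<nu> G) else 0)" for n
    by (rule PN_def[OF fg cF nu]) (rule Gw)
  thus "n \<noteq> \<nu> \<Longrightarrow> pn n a = hf n a" "pn \<nu> a = hf \<nu> a + zs a 0 1 * H" by (simp_all add: H_def Gm_def)
qed

lemma Gm_ibox: "Gm h p j k l \<noteq> 0 \<Longrightarrow> (h, j, l) \<in> ibox \<nu>"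
  unfolding Gm_def by (rule wpart_ibox[OF order_refl])

lemma chain_H:
  "pdX H = S3 - vZ * S1 + cst \<i> * vZ * vX * S5" "pdY H = S1 - vA * S3 - cst \<i> * vA * vY * S5" "pdT H = S5"
  "pdZ H = S2 - vX * S1 + cst (\<i> / 2) * (vX * vX) * S5"
  unfolding H_def S1_def S2_def S3_def S5_def by (rule chain_rule, erule Gm_ibox)+

lemma Gm_herm: "cnj (Gm h p j k l) = Gm j k h p l"
  using nG by (simp add: Gm_def wpart_def normalized_def add.commute)

lemma Gm_norm: "j \<le> 2 \<Longrightarrow> Gm h p j 0 l = 0" "h \<le> 2 \<Longrightarrow> Gm h 0 j k l = 0"
  "Gm 3 0 0 1 l = 0" "Gm 4 0 0 1 l = 0" "Gm 3 0 1 1 l = 0" "Gm 4 0 1 1 l = 0" "Gm 3 0 3 0 l = 0" "Gm 3 0 0 2 0 = 0" "Gm 5 0 0 1 0 = 0"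
proof -
  show 1: "Gm h p j 0 l = 0" if "j \<le> 2" for h p j l using nG that by (simp add: Gm_def wpart_def normalized_def)
  show "Gm h 0 j k l = 0" if "h \<le> 2" for h j k l using Gm_herm[of h 0 j k l] 1[OF that, of j k l] by simp
qed (use nG in \<open>simp_all add: Gm_def wpart_def normalized_def\<close>)

lemma bar_H: "bar5 H = H" "bar5 S1 = S3"
proof -
  have cGm: "convergent_series Gm" unfolding Gm_def by (rule convergent_wpart[OF cG])
  have h: "hermitian_coeffs Gm" using Gm_herm by (simp add: hermitian_coeffs_def)
  note e = hermitian_cnj_coeffs[OF h]
  have "bar5 (sub \<nu> Gm) = sub \<nu> (cnj_coeffs Gm)" by (rule bar5_sub) (use cGm e Gm_ibox in auto)
  thus "bar5 H = H" by (simp add: H_def e)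
  have "bar5 (sub \<nu> (dc1 Gm)) = sub \<nu> (cnj_coeffs (dc1 Gm))"
    by (rule bar5_sub) (use convergent_dc[OF cGm] e dc_ibox(1)[OF Gm_ibox] in auto)
  thus "bar5 S1 = S3" by (simp add: S1_def S3_def e)
qed

section \<open>The tangency condition at single orders\<close>

lemma L_vals:
  "i < \<nu> \<Longrightarrow> sub \<nu> (wpart i (dc1 F)) = (if i = 1 then vX else 0) + (if i = \<nu> - 1 then S1 else 0)"
  "i \<le> \<nu> \<Longrightarrow> sub \<nu> (wpart i (dc2 F)) = (if i = 2 then half * (vX * vX) else 0) + (if i = \<nu> then S2 else 0)"
  "i \<le> \<nu> - 2 \<Longrightarrow> sub \<nu> (wpart i (dc5 F)) = (if i = \<nu> - 2 then S5 else 0)"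
  unfolding S1_def S2_def S5_def Gm_def by (rule L_F[OF fg cF nu]; use Gw in blast)+

text \<open>Separates the contribution of the model, gathered in \<open>Kf\<close>, from that of the
  lowest part of \<open>G\<close>. At order \<open>\<nu>\<close> the \<open>z\<close>-derivative of
  \<open>F\<close> of weight \<open>\<nu>\<close> would involve the next part of \<open>G\<close>;
  it is multiplied by \<open>hf 0 a\<close>, which is why this is required to vanish.\<close>

lemma kf_identity:
  assumes T: "tangent_series F a b c" and N: "N \<le> \<nu>" and z: "N = \<nu> \<Longrightarrow> hf 0 a = 0"
  defines "rest \<equiv> (if \<nu> - 1 \<le> N then S1 * hf (N - (\<nu> - 1)) a else 0) + (if \<nu> \<le> N then S2 * hf 0 b else 0)"
    and "\<delta> \<equiv> (if N = \<nu> then zs c 0 1 * H else 0)"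
  shows "Kf N a b c + bar5 (Kf N a b c) + (\<delta> + bar5 \<delta>) = cst 2 * rest + bar5 (cst 2 * rest)
     - cst \<i> * (\<Sum>i=0..N. sub \<nu> (wpart i (dc5 F)) * (pn (N - i) c - bar5 (pn (N - i) c)))"
proof -
  let ?S = "\<Sum>i=0..N. sub \<nu> (wpart i (dc1 F)) * pn (N - i) a + sub \<nu> (wpart i (dc2 F)) * pn (N - i) b"
  have id: "pn N c + bar5 (pn N c) = cst 2 * ?S + bar5 (cst 2 * ?S)
     - cst \<i> * (\<Sum>i=0..N. sub \<nu> (wpart i (dc5 F)) * (pn (N - i) c - bar5 (pn (N - i) c)))"
    by (rule formal_identity[OF fg cF nu _ T N]) (use Gw in blast)
  have "?S = (\<Sum>i=0..N. (if i = 1 then vX else 0) * pn (N - i) a + (if i = \<nu> - 1 then S1 else 0) * pn (N - i) a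
     + (if i = 2 then half * (vX * vX) else 0) * pn (N - i) b + (if i = \<nu> then S2 else 0) * pn (N - i) b)"
  proof (rule sum.cong[OF refl])
    fix i assume i: "i \<in> {0..N}"
    have i': "i \<le> \<nu>" using i N by simp
    have "sub \<nu> (wpart i (dc1 F)) * pn (N - i) a = ((if i = 1 then vX else 0) + (if i = \<nu> - 1 then S1 else 0)) * pn (N - i) a"
    proof (cases "i < \<nu>")
      case True
      thus ?thesis by (simp only: L_vals(1))
    next
      case False
      hence "i = \<nu>" "N = \<nu>" using i N by auto
      thus ?thesis using z nu by (simp add: pn)
    qed
    thus "sub \<nu> (wpart i (dc1 F)) * pn (N - i) a + sub \<nu> (wpart i (dc2 F)) * pn (N - i) b = (if i = 1 then vX else 0) * pn (N - i) a + (if i = \<nu> - 1 then S1 else 0) * pn (N - i) a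
     + (if i = 2 then half * (vX * vX) else 0) * pn (N - i) b + (if i = \<nu> then S2 else 0) * pn (N - i) b"
      by (simp only: L_vals(2)[OF i'] distrib_right add.assoc)
  qed
  also have "\<dots> = (if 1 \<le> N then vX * pn (N - 1) a else 0) + (if \<nu> - 1 \<le> N then S1 * pn (N - (\<nu> - 1)) a else 0)
     + (if 2 \<le> N then half * (vX * vX) * pn (N - 2) b else 0) + (if \<nu> \<le> N then S2 * pn (N - \<nu>) b else 0)"
    by (simp only: sum.distrib sum_pick[where g = "\<lambda>m. pn m a"] sum_pick[where g = "\<lambda>m. pn m b"])
  also have "\<dots> = vX * (if N < 1 then 0 else hf (N - 1) a) + half * (vX * vX * (if N < 2 then 0 else hf (N - 2) b)) + rest"
  proof -
    have q1: "pn (N - 1) a = hf (N - 1) a" if "1 \<le> N" by (rule pn) (use that N nu in linarith)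
    have q2: "pn (N - (\<nu> - 1)) a = hf (N - (\<nu> - 1)) a" by (rule pn) (use N nu in linarith)
    have q3: "pn (N - 2) b = hf (N - 2) b" if "2 \<le> N" by (rule pn) (use that N nu in linarith)
    have q4: "pn (N - \<nu>) b = hf 0 b"
    proof -
      have "N - \<nu> = 0" using N by simp
      thus ?thesis using pn(1)[of 0 b] nu by simp
    qed
    have "(if 1 \<le> N then vX * pn (N - 1) a else 0) = vX * (if N < 1 then 0 else hf (N - 1) a)"
      using q1 by (cases "1 \<le> N") (auto simp: not_le)
    moreover have "(if 2 \<le> N then half * (vX * vX) * pn (N - 2) b else 0) = half * (vX * vX * (if N < 2 then 0 else hf (N - 2) b))"
      using q3 by (cases "2 \<le> N") (auto simp: not_le mult.assoc)
    ultimately show ?thesis unfolding rest_def q2 q4 by (simp only: add_ac)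
  qed
  finally have S: "?S = vX * (if N < 1 then 0 else hf (N - 1) a) + half * (vX * vX * (if N < 2 then 0 else hf (N - 2) b)) + rest" .
  have S2: "cst 2 * ?S = cst 2 * (vX * (if N < 1 then 0 else hf (N - 1) a)) + vX * vX * (if N < 2 then 0 else hf (N - 2) b) + cst 2 * rest"
    unfolding S distrib_left cst_2_half ..
  have P: "pn N c = Kf N a b c + cst 2 * (vX * (if N < 1 then 0 else hf (N - 1) a)) + vX * vX * (if N < 2 then 0 else hf (N - 2) b) + \<delta>"
    using pn(1)[of N c] pn(2)[of c] by (cases "N = \<nu>") (simp_all add: Kf_def \<delta>_def)
  show ?thesis using id unfolding S2 P bar5_hom by (simp add: algebra_simps)
qed

text \<open>Up to weight \<open>\<nu> - 2\<close> the \<open>v\<close>-derivative of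
  \<open>F\<close> vanishes by \<open>S5 = 0\<close>; at larger weights its cofactor is of order 0
  or 1 in \<open>c\<close>, where nothing is left.\<close>

lemma dsum_0:
  assumes "S5 = 0" "hf 0 c = 0" "N \<le> \<nu>" "N = \<nu> \<Longrightarrow> hf 1 c = 0"
  shows "(\<Sum>i=0..N. sub \<nu> (wpart i (dc5 F)) * (pn (N - i) c - bar5 (pn (N - i) c))) = 0"
proof (rule sum.neutral, rule ballI)
  fix i assume i: "i \<in> {0..N}"
  consider "i \<le> \<nu> - 2" | "N - i = 0" | "N - i = 1" "N = \<nu>" using i assms(3) by fastforce
  thus "sub \<nu> (wpart i (dc5 F)) * (pn (N - i) c - bar5 (pn (N - i) c)) = 0"
  proof cases
    case 1
    thus ?thesis using L_vals(3)[OF 1] assms(1) by simp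
  next
    case 2
    have "pn 0 c = 0" using pn(1)[of 0 c] nu assms(2) by simp
    thus ?thesis unfolding 2 by (simp add: bar5_vars)
  next
    case 3
    have "pn 1 c = 0" using pn(1)[of 1 c] nu assms(4)[OF 3(2)] by simp
    thus ?thesis unfolding 3(1) by (simp add: bar5_vars)
  qed
qed

lemma C0: assumes T: "tangent_series F a b c" shows "hf 0 c = cst (c 0 0 0 0 0)"
proof -
  have "sub \<nu> (wpart 0 (dc5 F)) = 0" using L_vals(3)[of 0] nu by simp
  hence "Kf 0 a b c + bar5 (Kf 0 a b c) = 0"
    using kf_identity[OF T, of 0] nu by (simp add: bar5_vars)
  hence "Zs (\<lambda>p. c 0 p 0 0 0) + bar5 (Zs (\<lambda>p. c 0 p 0 0 0)) = 0"
    by (simp add: Kf_def hf_low zs_def)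
  from order0[OF this] show ?thesis by (simp add: hf_low zs_def)
qed

text \<open>The field with value i in the direction of \<open>w\<close>, taken at order
  \<open>\<nu> - 2\<close>: there the lowest part of \<open>G\<close> enters for the first time, and
  only through its \<open>v\<close>-derivative.\<close>

lemma field_T: "\<exists>K. polyK K \<and> S5 = K + bar5 K"
proof -
  obtain a b c where T: "tangent_series F a b c" and c0: "c 0 0 0 0 0 = \<i>" using fields[of \<i> 0 0] by auto
  have D: "(\<Sum>i=0..\<nu>-2. sub \<nu> (wpart i (dc5 F)) * (pn (\<nu> - 2 - i) c - bar5 (pn (\<nu> - 2 - i) c))) = S5 * cst (2 * \<i>)"
  proof -
    have "(\<Sum>i=0..\<nu>-2. sub \<nu> (wpart i (dc5 F)) * (pn (\<nu> - 2 - i) c - bar5 (pn (\<nu> - 2 - i) c))) = (\<Sum>i=0..\<nu>-2. (if i = \<nu> - 2 then S5 else 0) * (pn (\<nu> - 2 - i) c - bar5 (pn (\<nu> - 2 - i) c)))"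
      by (rule sum.cong) (simp_all add: L_vals(3))
    also have "\<dots> = S5 * (pn 0 c - bar5 (pn 0 c))"
      using sum_pick[of "\<nu> - 2" S5 "\<lambda>m. pn m c - bar5 (pn m c)" "\<nu> - 2"] by simp
    also have "pn 0 c = cst \<i>" using pn(1)[of 0 c] nu C0[OF T] c0 by simp
    also have "cst \<i> - bar5 (cst \<i>) = cst (2 * \<i>)" by (simp add: bar5_vars) (simp add: cst_def)
    finally show ?thesis .
  qed
  define K where "K = Kf (\<nu> - 2) a b c"
  have "K + bar5 K = - (cst \<i> * (S5 * cst (2 * \<i>)))"
  proof -
    have n: "\<nu> - 2 \<noteq> \<nu>" "\<not> \<nu> - 1 \<le> \<nu> - 2" "\<not> \<nu> \<le> \<nu> - 2" "\<nu> - 2 \<le> \<nu>" using nu by linarith+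
    show ?thesis using kf_identity[OF T n(4)] n unfolding D K_def by (simp only: if_False bar5_vars) (simp add: bar5_vars)
  qed
  \<comment> \<open>The factor 2 i is the difference of the value of \<open>c\<close> at the origin
    and its conjugate.\<close>
  also have "cst \<i> * (S5 * cst (2 * \<i>)) = - (cst 2 * S5)"
  proof -
    have "cst \<i> * (S5 * cst (2 * \<i>)) = cst (\<i> * (2 * \<i>)) * S5" by (simp only: cst_mult[symmetric] mult_ac)
    also have "\<i> * (2 * \<i>) = - 2" by simp
    finally show ?thesis by (simp only: cst_minus mult_minus_left)
  qed
  finally have e: "K + bar5 K = cst 2 * S5" by simp
  have "half * K + bar5 (half * K) = half * (K + bar5 K)" by (simp add: bar5_hom bar5_vars distrib_left)
  also have "\<dots> = S5" unfolding e by (simp add: mult.assoc[symmetric] cst_mult cst_1)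
  finally show ?thesis using polyK_lin(3)[OF polyK_Kf] unfolding K_def by metis
qed

lemma A0:
  assumes T: "tangent_series F a b c" and S5: "S5 = 0" and c0: "c 0 0 0 0 0 = 0"
  shows "hf 0 c = 0" "hf 1 c = cst (2 * cnj (a 0 0 0 0 0)) * zz" "hf 0 a = cst (a 0 0 0 0 0) - cst (cnj (a 0 0 0 0 0)) * vZ"
proof -
  show z: "hf 0 c = 0" using C0[OF T] c0 by (simp add: cst_0)
  have "Kf 1 a b c + bar5 (Kf 1 a b c) = 0"
    using kf_identity[OF T, of 1] dsum_0[OF S5 z, of 1] nu by (simp add: bar5_vars)
  hence "Zs (\<lambda>p. c 1 p 0 0 0) * zz + bar5 (Zs (\<lambda>p. c 1 p 0 0 0) * zz) = cst 2 * (vX * Zs (\<lambda>p. a 0 p 0 0 0)) + bar5 (cst 2 * (vX * Zs (\<lambda>p. a 0 p 0 0 0)))"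
    by (simp add: Kf_def hf_low zs_def bar5_hom algebra_simps)
  from order1[OF this] show "hf 1 c = cst (2 * cnj (a 0 0 0 0 0)) * zz" "hf 0 a = cst (a 0 0 0 0 0) - cst (cnj (a 0 0 0 0 0)) * vZ"
    by (simp_all add: hf_low zs_def)
qed

text \<open>The field with value \<open>s\<close> in the direction of \<open>z\<close>, at order
  \<open>\<nu> - 1\<close>. Its leading part is that of a model translation, by which the first
  derivatives of the lowest part are multiplied.\<close>

lemma field_S:
  assumes S5: "S5 = 0"
  shows "\<exists>K. polyK K \<and> K + bar5 K = cst 2 * ((cst s - cst (cnj s) * vZ) * S1) + cst 2 * ((cst (cnj s) - cst s * vA) * S3)"
proof -
  obtain a b c where T: "tangent_series F a b c" and a0: "a 0 0 0 0 0 = s" and c0: "c 0 0 0 0 0 = 0" using fields[of 0 s 0] by auto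
  note A = A0[OF T S5 c0, unfolded a0]
  have "Kf (\<nu> - 1) a b c + bar5 (Kf (\<nu> - 1) a b c) = cst 2 * (S1 * hf 0 a) + bar5 (cst 2 * (S1 * hf 0 a))"
  proof -
    have n: "\<nu> - 1 \<noteq> \<nu>" "\<not> \<nu> \<le> \<nu> - 1" "\<nu> - 1 \<le> \<nu>" using nu by linarith+
    have D: "(\<Sum>i=0..\<nu> - 1. sub \<nu> (wpart i (dc5 F)) * (pn (\<nu> - 1 - i) c - bar5 (pn (\<nu> - 1 - i) c))) = 0"
      by (rule dsum_0[OF S5 A(1) n(3)]) (use n in simp)
    have "\<nu> - 1 = \<nu> \<Longrightarrow> hf 0 a = 0" using n by simp
    from kf_identity[OF T n(3) this, unfolded D] n show ?thesis
      by (simp only: if_False if_True order_refl diff_self_eq_0 bar5_vars add_0 add_0_right mult_zero_right diff_zero)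
  qed
  also have "\<dots> = cst 2 * ((cst s - cst (cnj s) * vZ) * S1) + cst 2 * ((cst (cnj s) - cst s * vA) * S3)"
    unfolding A by (simp add: bar5_hom bar5_vars bar_H mult_ac)
  finally show ?thesis using polyK_Kf by blast
qed

text \<open>The field with value 1 in the direction of \<open>\<zeta>\<close>, at order
  \<open>\<nu>\<close>. The parameter \<open>u\<close> is the isotropy component that the value at
  the origin leaves undetermined; the last term comes from the correction of \<open>w\<close> by
  \<open>H\<close> in the component \<open>c\<close>.\<close>

lemma field_Z:
  assumes S5: "S5 = 0"
  shows "\<exists>K u. polyK K \<and> K + bar5 K =
    (1 + (cst u - cst (cnj u)) * vZ - vZ * vZ) * pdZ H + (1 + (cst (cnj u) - cst u) * vA - vA * vA) * pdA H
     + (cst u * vY + vX) * pdY H + (cst (cnj u) * vX + vY) * pdX H - cst (u + cnj u) * H"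
proof -
  obtain a b c where T: "tangent_series F a b c" and a0: "a 0 0 0 0 0 = 0" and b0: "b 0 0 0 0 0 = 1" and c0: "c 0 0 0 0 0 = 0"
    using fields[of 0 0 1] by auto
  note A = A0[OF T S5 c0, unfolded a0, simplified, unfolded cst_0, simplified]
  have A0: "hf 0 a = 0" "hf 0 c = 0" "hf (Suc 0) c = 0" using A by (simp_all add: cst_0)
  have "Kf 2 a b c + bar5 (Kf 2 a b c) = 0"
  proof -
    have "hf (2 - (\<nu> - 1)) a = 0 \<or> \<not> \<nu> - 1 \<le> 2" using nu A0(1) by (cases "\<nu> = 3") auto
    thus ?thesis using kf_identity[OF T, of 2] dsum_0[OF S5 A0(2), of 2] nu A0 by (auto simp: bar5_vars)
  qed
  hence "hf 2 c + bar5 (hf 2 c) = cst 2 * (vX * (hf 1 a) + half * (vX * vX) * hf 0 b) + bar5 (cst 2 * (vX * (hf 1 a) + half * (vX * vX) * hf 0 b))"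
    by (simp add: Kf_def bar5_hom distrib_left mult.assoc cst_2_half) (simp add: algebra_simps)
  hence "Zs (\<lambda>p. c 2 p 0 0 0) * (zz * zz) + Zs (\<lambda>p. c 0 p 0 0 1) * ww + bar5 (Zs (\<lambda>p. c 2 p 0 0 0) * (zz * zz) + Zs (\<lambda>p. c 0 p 0 0 1) * ww)
     = cst 2 * (vX * (Zs (\<lambda>p. a 1 p 0 0 0) * zz) + half * (vX * vX) * Zs (\<lambda>p. b 0 p 0 0 0))
      + bar5 (cst 2 * (vX * (Zs (\<lambda>p. a 1 p 0 0 0) * zz) + half * (vX * vX) * Zs (\<lambda>p. b 0 p 0 0 0)))"
    by (simp only: hf_low One_nat_def zs_def)
  note O = order2[OF this b0]
  define u where "u = a 1 0 0 0 0"
  have vals: "zs c 0 1 = cst (u + cnj u)" "hf 1 a = (cst u - vZ) * zz" "hf 0 b = 1 + (cst u - cst (cnj u)) * vZ - vZ * vZ"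
    using O by (simp_all add: hf_low zs_def u_def)
  define B where "B = 1 + (cst u - cst (cnj u)) * vZ - vZ * vZ"
  define Bb where "Bb = 1 + (cst (cnj u) - cst u) * vA - vA * vA"
  have Bb: "bar5 B = Bb" by (simp add: B_def Bb_def bar5_hom bar5_vars)
  define R where "R = S1 * ((cst u - vZ) * zz) + S2 * B"
  define K where "K = Kf \<nu> a b c"
  have h1: "\<nu> - (\<nu> - 1) = Suc 0" using nu by simp
  have "K + bar5 K + (cst (u + cnj u) * H + bar5 (cst (u + cnj u) * H)) = cst 2 * R + bar5 (cst 2 * R)"
    using kf_identity[OF T, of \<nu>] dsum_0[OF S5 A0(2), of \<nu>] nu A0 vals unfolding h1 by (simp add: K_def R_def B_def)
  moreover have "bar5 (cst (u + cnj u) * H) = cst (u + cnj u) * H" by (simp add: bar5_hom bar5_vars bar_H add.commute)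
  moreover have "cst 2 * R + bar5 (cst 2 * R) = cst 2 * (R + bar5 R)" by (simp add: bar5_hom bar5_vars distrib_left)
  ultimately have KR: "K + bar5 K = cst 2 * (R + bar5 R) - (cst (u + cnj u) * H + cst (u + cnj u) * H)"
    by (simp only: eq_diff_eq)
  have zH: "S2 = pdZ H + vX * S1" "pdX H = S3 - vZ * S1" "pdY H = S1 - vA * S3" using chain_H S5 by simp_all
  have "bar5 R = S3 * ((cst (cnj u) - vA) * aa) + (pdA H + vY * S3) * Bb"
    unfolding R_def zH(1) by (simp add: bar5_hom bar5_vars bar5_leaf bar_H bar5_pdZ Bb)
  hence "R + bar5 R = B * pdZ H + Bb * pdA H + (cst u * vY + vX) * pdY H + (cst (cnj u) * vX + vY) * pdX H"
    unfolding R_def zH by (simp add: B_def Bb_def zz_def aa_def algebra_simps)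
  hence "half * (K + bar5 K) = half * (cst 2 * (B * pdZ H + Bb * pdA H + (cst u * vY + vX) * pdY H + (cst (cnj u) * vX + vY) * pdX H)) - (half * (cst (u + cnj u) * H) + half * (cst (u + cnj u) * H))"
    unfolding KR by (simp add: right_diff_distrib distrib_left)
  also have "\<dots> = B * pdZ H + Bb * pdA H + (cst u * vY + vX) * pdY H + (cst (cnj u) * vX + vY) * pdX H - cst (u + cnj u) * H"
    unfolding half_double by (simp add: mult.assoc[symmetric] cst_mult cst_1)
  finally have "half * K + bar5 (half * K) = B * pdZ H + Bb * pdA H + (cst u * vY + vX) * pdY H + (cst (cnj u) * vX + vY) * pdX H - cst (u + cnj u) * H"
    by (simp add: bar5_hom bar5_vars distrib_left)
  thus ?thesis unfolding B_def Bb_def using polyK_lin(3)[OF polyK_Kf[of \<nu> a b c]] unfolding K_def by blast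
qed

section \<open>The conditions on the leaves for the lowest part\<close>

lemma pd_H_nth: "dT (H $ q $ p) = pdT H $ q $ p" "dX (H $ q $ p) = pdX H $ q $ p" "dY (H $ q $ p) = pdY H $ q $ p"
  by (simp_all add: pdT_def pdX_def pdY_def)

lemma H_T: "\<exists>P. Ptype P \<and> (\<forall>q p. dT (H $ q $ p) = (if q = 0 then P $ p else 0) + (if p = 0 then bar3 (P $ q) else 0))"
proof -
  obtain K where K: "polyK K" "S5 = K + bar5 K" using field_T by blast
  note p = polyK_Ptype[OF K(1)]
  show ?thesis unfolding pd_H_nth chain_H(3) K(2) fps_add_nth
    by (rule exI[of _ "K $ 0"], rule conjI[OF p(1)], intro allI, subst p(2), subst p(3), rule refl)
qed

lemma S5_0: "(\<And>q p. dT (H $ q $ p) = 0) \<Longrightarrow> S5 = 0"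
  unfolding pd_H_nth chain_H(3) by (intro fps_ext) simp

text \<open>The fields for s = 1 and s = i are combined with complex coefficients to isolate the
  derivatives by \<open>Y\<close> and by \<open>X\<close>. After this the two cubic solutions are no
  longer related by conjugation, hence the pair \<open>P\<close>, \<open>Q\<close>.\<close>

lemma H_S:
  assumes "\<And>q p. dT (H $ q $ p) = 0"
  shows "\<exists>P Q. Ptype P \<and> Ptype Q \<and>
        (\<forall>q p. dY (H $ q $ p) = (if q = 0 then P $ p else 0) + (if p = 0 then bar3 (Q $ q) else 0)) \<and>
        (\<forall>q p. dX (H $ q $ p) = (if q = 0 then Q $ p else 0) + (if p = 0 then bar3 (P $ q) else 0))"
proof -
  note S5 = S5_0[OF assms]
  obtain K1 where K1: "polyK K1" "K1 + bar5 K1 = cst 2 * ((cst 1 - cst (cnj 1) * vZ) * S1) + cst 2 * ((cst (cnj 1) - cst 1 * vA) * S3)"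
    using field_S[OF S5, of 1] by blast
  obtain K2 where K2: "polyK K2" "K2 + bar5 K2 = cst 2 * ((cst \<i> - cst (cnj \<i>) * vZ) * S1) + cst 2 * ((cst (cnj \<i>) - cst \<i> * vA) * S3)"
    using field_S[OF S5, of \<i>] by blast
  define I where "I = cst \<i>"
  have I: "I * I = - 1" "cst (- \<i>) = - I" by (simp_all add: I_def cst_mult cst_minus cst_1)
  \<comment> \<open>In \<open>A + bar5 B\<close> the translation terms combine to the
    \<open>Y\<close>-derivative of \<open>H\<close>, in \<open>B + bar5 A\<close> to its
    \<open>X\<close>-derivative, each with the factor 4 removed by \<open>q4\<close>.\<close>
  define A where "A = K1 - I * K2"
  define B where "B = K1 + I * K2"
  have bI: "bar5 I = - I" by (simp add: I_def bar5_vars cst_minus)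
  have pY: "pdY H = S1 - vA * S3" and pX: "pdX H = S3 - vZ * S1" using chain_H S5 by simp_all
  have k1: "K1 + bar5 K1 = cst 2 * ((1 - vZ) * S1 + (1 - vA) * S3)" using K1(2) by (simp add: cst_1 distrib_left)
  have k2: "K2 + bar5 K2 = cst 2 * (I * ((1 + vZ) * S1) - I * ((1 + vA) * S3))"
    using K2(2) by (simp add: I_def[symmetric] I algebra_simps)
  have "A + bar5 B = (K1 + bar5 K1) - I * (K2 + bar5 K2)"
    by (simp add: A_def B_def bar5_hom bI algebra_simps)
  also have "\<dots> = cst 2 * ((1 - vZ) * S1 + (1 - vA) * S3 - (I * I) * ((1 + vZ) * S1 - (1 + vA) * S3))"
    unfolding k1 k2 by (simp add: algebra_simps)
  also have "\<dots> = cst 2 * (pdY H + pdY H)" unfolding I pY by (simp add: algebra_simps)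
  finally have AB: "A + bar5 B = cst 2 * (pdY H + pdY H)" .
  have "B + bar5 A = (K1 + bar5 K1) + I * (K2 + bar5 K2)"
    by (simp add: A_def B_def bar5_hom bI algebra_simps)
  also have "\<dots> = cst 2 * ((1 - vZ) * S1 + (1 - vA) * S3 + (I * I) * ((1 + vZ) * S1 - (1 + vA) * S3))"
    unfolding k1 k2 by (simp add: algebra_simps)
  also have "\<dots> = cst 2 * (pdX H + pdX H)" unfolding I pX by (simp add: algebra_simps)
  finally have BA: "B + bar5 A = cst 2 * (pdX H + pdX H)" .
  define q4 where "q4 = cst (1/4)"
  have q4: "q4 * (cst 2 * (f + f)) = f" for f
  proof -
    have "q4 * (cst 2 * (f + f)) = half * f + half * f" by (simp add: q4_def distrib_left mult.assoc[symmetric] cst_mult)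
    thus ?thesis by (simp only: half_double)
  qed
  have bq: "bar5 q4 = q4" by (simp add: q4_def bar5_vars)
  have eY: "pdY H = q4 * A + bar5 (q4 * B)" using q4[of "pdY H"] AB by (simp add: bar5_hom bq flip: distrib_left)
  have eX: "pdX H = q4 * B + bar5 (q4 * A)" using q4[of "pdX H"] BA by (simp add: bar5_hom bq flip: distrib_left)
  have pA: "polyK (q4 * A)" "polyK (q4 * B)"
    unfolding A_def B_def q4_def I_def by (intro polyK_lin K1 K2)+
  note p = polyK_Ptype[OF pA(1)] polyK_Ptype[OF pA(2)]
  show ?thesis
  proof (intro exI conjI allI)
    show "Ptype ((q4 * A) $ 0)" "Ptype ((q4 * B) $ 0)" by (rule p)+
    show "dY (H $ q $ p) = (if q = 0 then (q4 * A) $ 0 $ p else 0) + (if p = 0 then bar3 ((q4 * B) $ 0 $ q) else 0)" for q p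
      unfolding pd_H_nth eY fps_add_nth by (subst p(2), subst p(6), rule refl)
    show "dX (H $ q $ p) = (if q = 0 then (q4 * B) $ 0 $ p else 0) + (if p = 0 then bar3 ((q4 * A) $ 0 $ q) else 0)" for q p
      unfolding pd_H_nth eX fps_add_nth by (subst p(5), subst p(3), rule refl)
  qed
qed

lemma H_Z:
  assumes "\<And>q p. dT (H $ q $ p) = 0"
  shows "\<exists>R a r b. Ptype R \<and>
        (\<forall>p i j k. of_nat (Suc p) * xyt_coeff (H $ 0 $ Suc p) i j k + b * of_nat p * xyt_coeff (H $ 0 $ p) i j k
            - of_nat (p - 1) * xyt_coeff (H $ 0 $ (p - 1)) i j k + xyt_coeff (H $ 1 $ p) i j k + rot_coeff a r (H $ 0 $ p) i j k
            = xyt_coeff (R $ p) i j k + (if p = 0 then xyt_coeff (bar3 (R $ 0)) i j k else 0))"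
proof -
  obtain K u where K: "polyK K" "K + bar5 K =
    (1 + (cst u - cst (cnj u)) * vZ - vZ * vZ) * pdZ H + (1 + (cst (cnj u) - cst u) * vA - vA * vA) * pdA H
     + (cst u * vY + vX) * pdY H + (cst (cnj u) * vX + vY) * pdX H - cst (u + cnj u) * H"
    using field_Z[OF S5_0[OF assms]] by blast
  note p = polyK_Ptype[OF K(1)]
  \<comment> \<open>Grouped so that every term with a factor \<open>vA\<close> is visible as such;
    these drop out of the row \<open>q = 0\<close>.\<close>
  have e: "K + bar5 K = (pdZ H + cst (u - cnj u) * (vZ * pdZ H) - vZ * (vZ * pdZ H)) + (pdA H + vA * ((cst (cnj u) - cst u - vA) * pdA H))
     + (cst u * (vY * pdY H) + vX * pdY H) + (cst (cnj u) * (vX * pdX H) + vY * pdX H) - cst (u + cnj u) * H"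
  proof -
    have "cst (u - cnj u) = cst u - cst (cnj u)" by (simp add: cst_def)
    note c = this
    show ?thesis unfolding K(2) c by (simp add: algebra_simps)
  qed
  have "of_nat (Suc p) * xyt_coeff (H $ 0 $ Suc p) i j k + (u - cnj u) * of_nat p * xyt_coeff (H $ 0 $ p) i j k
            - of_nat (p - 1) * xyt_coeff (H $ 0 $ (p - 1)) i j k + xyt_coeff (H $ 1 $ p) i j k + rot_coeff u (u + cnj u) (H $ 0 $ p) i j k
            = xyt_coeff (K $ 0 $ p) i j k + (if p = 0 then xyt_coeff (bar3 (K $ 0 $ 0)) i j k else 0)" for p i j k
  proof -
    have "K $ 0 $ p $ i $ j $ k + bar5 K $ 0 $ p $ i $ j $ k = (K + bar5 K) $ 0 $ p $ i $ j $ k" by simp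
    also have "\<dots> = pdZ H $ 0 $ p $ i $ j $ k + (u - cnj u) * (if p = 0 then 0 else pdZ H $ 0 $ (p - 1) $ i $ j $ k)
        - (if p = 0 then 0 else if p - 1 = 0 then 0 else pdZ H $ 0 $ (p - 1 - 1) $ i $ j $ k) + (pdA H $ 0 $ p $ i $ j $ k + 0)
        + (u * (if j = 0 then 0 else pdY H $ 0 $ p $ i $ (j - 1) $ k) + (if i = 0 then 0 else pdY H $ 0 $ p $ (i - 1) $ j $ k))
        + (cnj u * (if i = 0 then 0 else pdX H $ 0 $ p $ (i - 1) $ j $ k) + (if j = 0 then 0 else pdX H $ 0 $ p $ i $ (j - 1) $ k))
        - (u + cnj u) * H $ 0 $ p $ i $ j $ k"
      unfolding e fps_add_nth fps_sub_nth v_nth by simp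
    also have "\<dots> = of_nat (Suc p) * xyt_coeff (H $ 0 $ Suc p) i j k + (u - cnj u) * of_nat p * xyt_coeff (H $ 0 $ p) i j k
            - of_nat (p - 1) * xyt_coeff (H $ 0 $ (p - 1)) i j k + xyt_coeff (H $ 1 $ p) i j k + rot_coeff u (u + cnj u) (H $ 0 $ p) i j k"
    proof -
      have z: "pdZ H $ 0 $ p $ i $ j $ k + (u - cnj u) * (if p = 0 then 0 else pdZ H $ 0 $ (p - 1) $ i $ j $ k)
        - (if p = 0 then 0 else if p - 1 = 0 then 0 else pdZ H $ 0 $ (p - 1 - 1) $ i $ j $ k) + (pdA H $ 0 $ p $ i $ j $ k + 0)
        = of_nat (Suc p) * xyt_coeff (H $ 0 $ Suc p) i j k + (u - cnj u) * of_nat p * xyt_coeff (H $ 0 $ p) i j k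
            - of_nat (p - 1) * xyt_coeff (H $ 0 $ (p - 1)) i j k + xyt_coeff (H $ 1 $ p) i j k"
        by (rule nat_cases2[of _ p]) (simp_all add: pd_nth xyt_coeff_def del: of_nat_Suc)
      have rt: "(u * (if j = 0 then 0 else pdY H $ 0 $ p $ i $ (j - 1) $ k) + (if i = 0 then 0 else pdY H $ 0 $ p $ (i - 1) $ j $ k))
        + (cnj u * (if i = 0 then 0 else pdX H $ 0 $ p $ (i - 1) $ j $ k) + (if j = 0 then 0 else pdX H $ 0 $ p $ i $ (j - 1) $ k))
        - (u + cnj u) * H $ 0 $ p $ i $ j $ k = rot_coeff u (u + cnj u) (H $ 0 $ p) i j k"
        by (cases i; cases j) (simp_all add: rot_coeff_def pd_nth xyt_coeff_def algebra_simps)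
      show ?thesis unfolding z[symmetric] rt[symmetric] by (simp only: add.assoc add_diff_eq)
    qed
    finally show ?thesis by (subst (asm) p(3)) (auto simp: xyt_coeff_def)
  qed
  thus ?thesis using p(1) by blast
qed

text \<open>By the chain rule in \<open>\<zeta>\<close> the coefficient of \<zeta>^2 X^3 is, up to
  contributions with fewer than three factors conj z, the coefficient \<open>Gm 0 2 3 0 0\<close>,
  conjugate to the one assumed to be zero.\<close>

lemma H_02: "H $ 0 $ 2 $ 3 $ 0 $ 0 = 0"
proof -
  have z: "sub \<nu> c $ 0 $ q $ i $ y $ k = 0" if "\<And>h p j l. j < 3 \<Longrightarrow> c h p j 0 l = 0" "i < 3" for c q i y k
  proof -
    have "xdiv 3 (sub \<nu> c $ 0 $ q)" by (rule xdiv_sub) (rule that(1))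
    thus ?thesis using that(2) by (simp add: xdiv_def xyt_coeff_def)
  qed
  have G0: "Gm h p j 0 l = 0" if "j < 3" for h p j l using that by (intro Gm_norm) simp
  have "pdZ H = S2 - vX * S1 + cst (\<i> / 2) * (vX * (vX * S5))" using chain_H(4) by (simp only: mult.assoc)
  hence "pdZ H $ 0 $ 1 $ 3 $ 0 $ 0 = S2 $ 0 $ 1 $ 3 $ 0 $ 0 - S1 $ 0 $ 1 $ 2 $ 0 $ 0 + \<i> / 2 * S5 $ 0 $ 1 $ 1 $ 0 $ 0"
    by (simp only: fps_add_nth fps_sub_nth v_nth) simp
  moreover have "S1 $ 0 $ 1 $ 2 $ 0 $ 0 = 0" unfolding S1_def by (rule z) (simp_all add: dc1_def G0)
  moreover have "S5 $ 0 $ 1 $ 1 $ 0 $ 0 = 0" unfolding S5_def by (rule z) (simp_all add: dc5_def G0)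
  moreover have "S2 $ 0 $ 1 $ 3 $ 0 $ 0 = 0"
  proof -
    have "S2 $ 0 $ 1 $ 3 $ 0 $ 0 = dc2 Gm 0 1 3 0 0 - of_nat (Suc 0) * dc2 Gm (Suc 0) 0 2 0 0 + \<i> / 2 * of_nat (Suc 0) * dc2 Gm 0 0 1 0 (Suc 0)"
      unfolding S2_def by (subst sub_nth_01, rule dc_ibox(2), rule Gm_ibox, assumption, assumption) simp
    moreover have "Gm 0 2 3 0 0 = 0" using Gm_herm[of 3 0 0 2 0] Gm_norm by simp
    ultimately show ?thesis by (simp add: dc2_def Gm_norm numeral_2_eq_2)
  qed
  ultimately have "pdZ H $ 0 $ 1 $ 3 $ 0 $ 0 = 0" by simp
  thus ?thesis by (simp add: pd_nth numeral_2_eq_2)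
qed

lemma H_01: "y \<le> 1 \<Longrightarrow> H $ 0 $ 1 $ i $ y $ k = Gm y 1 i 0 k"
  unfolding H_def by (subst sub_nth_01, erule Gm_ibox) (simp add: Gm_norm)

text \<open>It remains to see that the normalization of \<open>G\<close> is what the formal
  vanishing argument requires of \<open>H\<close>, and that passing to leaf coordinates loses
  nothing.\<close>

lemma lowest_part_vanishes: "h + j + 2 * l = \<nu> \<Longrightarrow> G h p j k l = 0"
proof -
  have "H = 0"
  proof (rule leaf_vanish[OF nu _ _ _ _ _ _ _ H_T H_S H_Z])
    show "xdiv 3 (H $ 0 $ p)" for p unfolding H_def by (rule xdiv_sub) (simp add: Gm_norm)
    show "H $ q $ p = bar3 (H $ p $ q)" for q p using arg_cong[OF bar_H(1), of "\<lambda>f. f $ q $ p"] by (simp add: bar5_nth)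
    have "supp_in H (\<lambda>a b. b = \<nu>)" unfolding H_def by (rule supp_in_sub) (simp add: Gm_def wpart_def split: if_splits)
    thus "i + j + 2 * k = \<nu>" if "xyt_coeff (H $ q $ p) i j k \<noteq> 0" for q p i j k
      using that by (auto simp: supp_in_def xyt_coeff_def)
    show "xyt_coeff (H $ 0 $ 0) 3 3 k = 0" for k
      unfolding xyt_coeff_def H_def by (subst sub_nth_00, erule Gm_ibox) (rule Gm_norm)
    have g: "Gm y 1 i 0 k = cnj (Gm i 0 y 1 k)" for y i k by (simp add: Gm_herm)
    show "xyt_coeff (H $ 0 $ 1) i j k = 0" if "i \<in> {3, 4}" "j \<in> {0, 1}" for i j k
    proof -
      have "j \<le> 1" using that by auto
      show ?thesis unfolding xyt_coeff_def H_01[OF \<open>j \<le> 1\<close>] g using that Gm_norm by auto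
    qed
    show "xyt_coeff (H $ 0 $ 1) 5 0 0 = 0" unfolding xyt_coeff_def H_01[OF zero_le] g by (simp add: Gm_norm del: One_nat_def)
    show "xyt_coeff (H $ 0 $ 2) 3 0 0 = 0" using H_02 by (simp add: xyt_coeff_def)
  qed auto
  hence z: "Gm h p j k l = 0" for h p j k l
    by (intro sub_inj[of Gm \<nu>]) (use Gm_ibox in \<open>auto simp: H_def\<close>)
  show "G h p j k l = 0" if "h + j + 2 * l = \<nu>"
    using z[of h p j k l] that by (simp add: Gm_def wpart_def)
qed

end

unbundle no fps_syntax
unbundle vec_syntax

theorem theorem3p2:
  fixes M :: "(complex ^ 3) set" and F G :: coeffs
  assumes "0 \<in> M"
    and "convergent_series F" and "hermitian_coeffs F" and "F 0 0 0 0 0 = 0"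
    and "is_graph_of M (graph_value F)"
    and "convergent_series G"
    and "\<forall>\<^sub>F p in nhds 0. graph_value F p = gaussier_merker_value p + graph_value G p"
    and "C21_hypersurface M (graph_defining_function F)"
    and "poincare_moser_normal_form F"
    and "F 3 0 0 2 0 = 0" and "F 5 0 0 1 0 = 0"
    and "locally_homogeneous M (graph_defining_function F)"
  shows "(\<forall>h p j k l. G h p j k l = 0) \<and> is_graph_of M gaussier_merker_value"
proof -
  note cF = assms(2) and herm = assms(3) and F0 = assms(4) and M = assms(5) and cG = assms(6) and eq = assms(7)
  have fg: "nst F = gm_ser + nst G" by (rule gm_formal[OF cF cG F0 eq])
  have nG: "normalized G" by (rule normalized_if_normal_form[OF fg herm assms(9-11)])
  have w3: "3 \<le> h + j + 2 * l" if "G h p j k l \<noteq> 0" for h p j k l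
    by (rule weight_ge_3[OF fg nG _ that]) (use levi_det_formal[OF herm cF F0 M assms(8)] in \<open>simp only: Let_def\<close>)
  have F_eq: "F h p j k l = gmc h p j k l + G h p j k l" for h p j k l
    using arg_cong[OF fg, of "\<lambda>f. fps_nth (fps_nth (fps_nth (fps_nth (fps_nth f k) p) h) j) l"] by (simp add: gmc_def)
  have G1: "G 0 0 0 1 0 = 0" using nG unfolding normalized_def by (metis complex_cnj_zero_iff zero_le)
  have F1: "F 1 0 0 0 0 = 0" "F 0 1 0 0 0 = 0" "F 0 0 1 0 0 = 0" "F 0 0 0 1 0 = 0" "F 0 0 0 0 1 = 0"
    using nG G1 by (simp_all add: F_eq gmc_def gm_ser_nth normalized_def)
  note fields = tangent_series_exists[OF herm cF F0 F1 M assms(12)]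
  have G0: "G h p j k l = 0" for h p j k l
  proof (rule ccontr)
    assume nz: "G h p j k l \<noteq> 0"
    \<comment> \<open>The weights occurring in \<open>G\<close>: at the least one every coefficient
      of \<open>G\<close> vanishes, a contradiction.\<close>
    define W where "W = (\<lambda>n. \<exists>h p j k l. G h p j k l \<noteq> 0 \<and> h + j + 2 * l = n)"
    define \<nu> where "\<nu> = (LEAST n. W n)"
    have "W (h + j + 2 * l)" using nz unfolding W_def by blast
    hence "W \<nu>" unfolding \<nu>_def by (rule LeastI)
    then obtain h' p' j' k' l' where g: "G h' p' j' k' l' \<noteq> 0" "h' + j' + 2 * l' = \<nu>" unfolding W_def by blast
    have nu: "3 \<le> \<nu>" using w3[OF g(1)] g(2) by simp
    have Gw: "\<nu> \<le> h + j + 2 * l" if "G h p j k l \<noteq> 0" for h p j k l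
      unfolding \<nu>_def by (rule Least_le) (use that in \<open>unfold W_def, blast\<close>)
    have "G h' p' j' k' l' = 0"
      by (rule lowest_part_vanishes[OF fg cF nu _ cG nG _ g(2)]) (rule Gw, assumption, rule fields)
    thus False using g(1) by contradiction
  qed
  hence "G = (\<lambda>_ _ _ _ _. 0)" by blast
  hence "graph_value G p = 0" for p by (simp add: graph_value_def eval_series_zero)
  hence "\<forall>\<^sub>F p in nhds 0. graph_value F p = gaussier_merker_value p" using eq by simp
  with M have "is_graph_of M gaussier_merker_value"
    unfolding is_graph_of_def by eventually_elim simp
  thus ?thesis using G0 by blast
qed

end
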